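(* Let $k$ be a commutative artinian ring, let $n\ge 1$, and let $(\mathscr{C},\mathbb{E},\mathfrak{s})$ be an $\mathrm{Ext}$-finite, Krull-Schmidt and $k$-linear $n$-exangulated category. Then $\mathscr{C}$ has Serre duality if and only if $\mathscr{C}$ has right determined deflations and left determined inflations.
   Context: **$n$-exangulated categories.** Let $\mathscr{C}$ be an additive category and $\mathbb{E}\colon\mathscr{C}^{\mathrm{op}}\times\mathscr{C}\to\mathrm{Ab}$ an additive bifunctor. Elements $\delta\in\mathbb{E}(C,A)$ are called extensions. For $a\in\mathscr{C}(A,A')$, $c\in\mathscr{C}(C',C)$ put $a_*\delta=\mathbb{E}(C,a)(\delta)$ and $c^*\delta=\mathbb{E}(c,A)(\delta)$. A morphism of extensions from $\delta\in\mathbb{E}(C,A)$ to $\rho\in\mathbb{E}(D,B)$ is a pair $(a,c)$, $a\in\mathscr{C}(A,B)$, $c\in\mathscr{C}(C,D)$, with $a_*\delta=c^*\rho$. Let $\mathbf{C}^{n+2}_{\mathscr{C}}$ be the category of complexes $X_\bullet\colon X_0\xrightarrow{d_0^X}X_1\to\cdots\to X_n\xrightarrow{d_n^X}X_{n+1}$ in $\mathscr{C}$. For $\delta\in\mathbb{E}(C,A)$ define $\delta_\sharp\colon\mathscr{C}(-,C)\to\mathbb{E}(-,A)$, $f\mapsto f^*\delta$, and $\delta^\sharp\colon\mathscr{C}(A,-)\to\mathbb{E}(C,-)$, $g\mapsto g_*\delta$. A pair $\langle X_\bullet,\delta\rangle$ with $\delta\in\mathbb{E}(X_{n+1},X_0)$,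 $(d_0^X)_*\delta=0$, $(d_n^X)^*\delta=0$ is an $n$-exangle if the sequences of functors $\mathscr{C}(-,X_0)\to\cdots\to\mathscr{C}(-,X_{n+1})\xrightarrow{\delta_\sharp}\mathbb{E}(-,X_0)$ and $\mathscr{C}(X_{n+1},-)\to\cdots\to\mathscr{C}(X_0,-)\xrightarrow{\delta^\sharp}\mathbb{E}(X_{n+1},-)$ are exact. For fixed $A,C$, consider complexes with $X_0=A$, $X_{n+1}=C$ and morphisms $f_\bullet$ with $f_0=\mathrm{id}_A$, $f_{n+1}=\mathrm{id}_C$; two such are homotopic if they differ by a chain homotopy $(\varphi_i\colon X_i\to Y_{i-1})_{1\le i\le n+1}$, and $[X_\bullet]$ denotes the resulting homotopy equivalence class. An exact realization $\mathfrak{s}$ of $\mathbb{E}$ assigns to each $\delta\in\mathbb{E}(C,A)$ such a class $\mathfrak{s}(\delta)=[X_\bullet]$ with $X_0=A$, $X_{n+1}=C$, such that: (R0) for $\mathfrak{s}(\delta)=[X_\bullet]$, $\mathfrak{s}(\rho)=[Y_\bullet]$, every morphism of extensions $(a,c)\colon\delta\to\rho$ has a lift $f_\bullet=(a,f_1,\dots,f_n,c)\colon X_\bullet\to Y_\bullet$; (R1) $\langle X_\bullet,\delta\rangle$ is an $n$-exangle whenever $\mathfrak{s}(\delta)=[X_\bullet]$; (R2) $0\in\mathbb{E}(0,A)$ is realized by $A\xrightarrow{\mathrm{id}}A\to0\to\cdots\to0$ and $0\in\mathbb{E}(A,0)$ is realized by $0\to\cdots\to0\to A\xrightarrow{\mathrm{id}}A$.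 If $\mathfrak{s}(\delta)=[X_\bullet]$, then $\langle X_\bullet,\delta\rangle$ is called a distinguished $n$-exangle, written $X_0\xrightarrow{d_0}X_1\to\cdots\to X_n\xrightarrow{d_n}X_{n+1}\overset{\delta}{\dashrightarrow}$; then $d_0$ is called an inflation and $d_n$ a deflation. The triple $(\mathscr{C},\mathbb{E},\mathfrak{s})$ is an $n$-exangulated category if: (EA1) inflations are closed under composition and deflations are closed under composition; (EA2) for $\rho\in\mathbb{E}(D,A)$, $c\in\mathscr{C}(C,D)$ and distinguished $\langle X_\bullet,c^*\rho\rangle$, $\langle Y_\bullet,\rho\rangle$, the pair $(\mathrm{id}_A,c)$ has a lift $f_\bullet\colon X_\bullet\to Y_\bullet$ whose mapping cone $X_1\to X_2\oplus Y_1\to\cdots\to X_{n+1}\oplus Y_n\to Y_{n+1}$, with differentials $\begin{bmatrix}-d_1^X\\ f_1\end{bmatrix}$, $\begin{bmatrix}-d_{i+1}^X&0\\ f_{i+1}&d_i^Y\end{bmatrix}$ ($1\le i\le n-1$), $\begin{bmatrix}f_{n+1}&d_n^Y\end{bmatrix}$, together with $(d_0^X)_*\rho$ is a distinguished $n$-exangle; (EA2$^{\mathrm{op}}$) the dual of (EA2). **Linearity and finiteness.** $\mathscr{C}$ is $k$-linear if all $\mathscr{C}(A,B)$ and $\mathbb{E}(A,B)$ are $k$-modules and the compositions $\mathscr{C}(A,B)\times\mathscr{C}(B,C)\to\mathscr{C}(A,C)$ and $\mathscr{C}(A,B)\times\mathbb{E}(B,C)\times\mathscr{C}(C,D)\to\mathbb{E}(A,D)$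 are $k$-linear in each variable; $\mathrm{Ext}$-finite if each $\mathbb{E}(A,B)$ is a finitely generated $k$-module; Krull-Schmidt if each object is a finite direct sum of objects with local endomorphism rings. $D=\mathrm{Hom}_k(-,J)$, where $J$ is the minimal injective cogenerator of $k$. **Serre duality.** $\mathscr{C}$ has Serre duality if there is a $k$-linear auto-equivalence $\tau_n\colon\mathscr{C}\to\mathscr{C}$ with an isomorphism $\varphi_{X,Y}\colon D\mathbb{E}(X,Y)\to\mathscr{C}(Y,\tau_nX)$, natural in $X,Y\in\mathscr{C}$. **Determined morphisms.** A morphism $f\in\mathscr{C}(X,Y)$ is right $C$-determined ($C\in\mathscr{C}$) if every $g\in\mathscr{C}(L,Y)$ (for any $L$) such that $g\circ h$ factors through $f$ for each $h\in\mathscr{C}(C,L)$ itself factors through $f$. Dually, $f\in\mathscr{C}(X,Y)$ is left $C$-determined if every $g\in\mathscr{C}(X,L)$ such that $h\circ g$ factors through $f$ for each $h\in\mathscr{C}(L,C)$ itself factors through $f$. An object $Y$ is right deflation-classified if: (RDC1) each deflation $\alpha\colon X\to Y$ ending at $Y$ is right $C$-determined for some $C\in\mathscr{C}$; (RDC2) for any $C\in\mathscr{C}$ and any $\mathrm{End}_{\mathscr{C}}(C)^{\mathrm{op}}$-submodule $H$ of $\mathscr{C}(C,Y)$ there is a deflation $\alpha\colon X\to Y$ that is right $C$-determined and satisfies $\mathrm{Im}\,\mathscr{C}(C,\alpha)=H$. $\mathscr{C}$ has right determined deflations if every object is right deflation-classified. Dually, an object $X$ is left inflation-classified if each inflation $\alpha\colon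 X\to Y$ starting at $X$ is left $C$-determined for some $C\in\mathscr{C}$, and for any $C\in\mathscr{C}$ and any $\mathrm{End}_{\mathscr{C}}(C)$-submodule $H$ of $\mathscr{C}(X,C)$ there is an inflation $\alpha\colon X\to Y$ that is left $C$-determined and satisfies $\mathrm{Im}\,\mathscr{C}(\alpha,C)=H$. $\mathscr{C}$ has left determined inflations if every object is left inflation-classified. *)

theory Defs
  imports "HOL-Algebra.Module" "HOL-Algebra.Ideal"
begin

section \<open>Modules over a commutative ring\<close>

definition linear_map ::
    "('k, 'r) ring_scheme \<Rightarrow> ('k, 'a, 'x) module_scheme \<Rightarrow> ('k, 'b, 'y) module_scheme \<Rightarrow> ('a \<Rightarrow> 'b) \<Rightarrow> bool"
  where "linear_map k M N f \<longleftrightarrow>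
    f \<in> carrier M \<rightarrow> carrier N \<and>
    (\<forall>x\<in>carrier M. \<forall>y\<in>carrier M. f (x \<oplus>\<^bsub>M\<^esub> y) = f x \<oplus>\<^bsub>N\<^esub> f y) \<and>
    (\<forall>r\<in>carrier k. \<forall>x\<in>carrier M. f (r \<odot>\<^bsub>M\<^esub> x) = r \<odot>\<^bsub>N\<^esub> f x)"

definition linear_iso ::
    "('k, 'r) ring_scheme \<Rightarrow> ('k, 'a, 'x) module_scheme \<Rightarrow> ('k, 'b, 'y) module_scheme \<Rightarrow> ('a \<Rightarrow> 'b) \<Rightarrow> bool"
  where "linear_iso k M N f \<longleftrightarrow> linear_map k M N f \<and> bij_betw f (carrier M) (carrier N)"

definition finitely_generated_module :: "('k, 'r) ring_scheme \<Rightarrow> ('k, 'a, 'x) module_scheme \<Rightarrow> bool"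
  where "finitely_generated_module k M \<longleftrightarrow>
    (\<exists>S. finite S \<and> S \<subseteq> carrier M \<and>
      (\<forall>x\<in>carrier M. \<exists>c \<in> S \<rightarrow> carrier k. x = (\<Oplus>\<^bsub>M\<^esub>s\<in>S. c s \<odot>\<^bsub>M\<^esub> s)))"

definition artinian_ring :: "('k, 'r) ring_scheme \<Rightarrow> bool"
  where "artinian_ring k \<longleftrightarrow>
    (\<forall>I :: nat \<Rightarrow> 'k set. (\<forall>i. ideal (I i) k \<and> I (Suc i) \<subseteq> I i) \<longrightarrow> (\<exists>m. \<forall>i\<ge>m. I i = I m))"

text \<open>
  A definition cannot quantify over all types, so the test modules below are those with elements
  in \<^typ>\<open>'k set\<close>. These include isomorphic copies of all ideals of \<open>k\<close> (via singletons) and all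
  cyclic modules \<open>k / I\<close> (with cosets as elements). By Baer's criterion nothing is lost for
  injectivity; and an injective module is a cogenerator as soon as it detects the nonzero elements
  of cyclic modules.
\<close>

definition injective_module :: "('k, 'r) ring_scheme \<Rightarrow> ('k, 'j) module \<Rightarrow> bool"
  where "injective_module k J \<longleftrightarrow> module k J \<and>
    (\<forall>(M :: ('k, 'k set) module) (N :: ('k, 'k set) module) f g.
      module k M \<and> module k N \<and> linear_map k M N f \<and> inj_on f (carrier M) \<and> linear_map k M J g \<longrightarrow>
      (\<exists>h. linear_map k N J h \<and> (\<forall>x\<in>carrier M. h (f x) = g x)))"

definition cogenerator_module :: "('k, 'r) ring_scheme \<Rightarrow> ('k, 'j) module \<Rightarrow> bool"
  where "cogenerator_module k J \<longleftrightarrow> module k J \<and>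
    (\<forall>(M :: ('k, 'k set) module) x.
      module k M \<and> x \<in> carrier M \<and> x \<noteq> \<zero>\<^bsub>M\<^esub> \<longrightarrow> (\<exists>h. linear_map k M J h \<and> h x \<noteq> \<zero>\<^bsub>J\<^esub>))"

definition minimal_injective_cogenerator :: "('k, 'r) ring_scheme \<Rightarrow> ('k, 'j) module \<Rightarrow> bool"
  where "minimal_injective_cogenerator k J \<longleftrightarrow>
    injective_module k J \<and> cogenerator_module k J \<and>
    (\<forall>N. submodule N k J \<and> injective_module k (J\<lparr>carrier := N\<rparr>) \<and>
         cogenerator_module k (J\<lparr>carrier := N\<rparr>) \<longrightarrow> N = carrier J)"

text \<open>
  The module \<open>Hom\<^sub>k(M, J)\<close>, with functions made extensional so that equality of elements is equality
  on \<open>M\<close>. The multiplicative fields that a module record inherits from rings carry no meaning, here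
  and throughout.
\<close>

definition dual_module ::
    "('k, 'r) ring_scheme \<Rightarrow> ('k, 'j) module \<Rightarrow> ('k, 'a) module \<Rightarrow> ('k, 'a \<Rightarrow> 'j) module"
  where "dual_module k J M =
    \<lparr> carrier = {f \<in> extensional (carrier M). linear_map k M J f},
      mult = undefined, one = undefined,
      zero = (\<lambda>x\<in>carrier M. \<zero>\<^bsub>J\<^esub>),
      add = (\<lambda>f g. \<lambda>x\<in>carrier M. f x \<oplus>\<^bsub>J\<^esub> g x),
      smult = (\<lambda>r f. \<lambda>x\<in>carrier M. r \<odot>\<^bsub>J\<^esub> f x) \<rparr>"

text \<open>A not necessarily commutative ring is local if it is nonzero and its non-units are closed
  under addition.\<close>

definition local_ring :: "('a, 'r) ring_scheme \<Rightarrow> bool"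
  where "local_ring R \<longleftrightarrow> ring R \<and> \<one>\<^bsub>R\<^esub> \<noteq> \<zero>\<^bsub>R\<^esub> \<and>
    (\<forall>x\<in>carrier R. \<forall>y\<in>carrier R. x \<notin> Units R \<and> y \<notin> Units R \<longrightarrow> x \<oplus>\<^bsub>R\<^esub> y \<notin> Units R)"


section \<open>Additive categories\<close>

text \<open>
  \<open>Hom \<C> A B\<close> is the group (or module, depending on the record extension) of morphisms from
  \<open>A\<close> to \<open>B\<close>, and \<open>g \<cdot> f\<close> is \<open>g\<close> after \<open>f\<close>.
\<close>

record ('o, 'm, 'x) cat =
  Ob :: "'o set"
  Hom :: "'o \<Rightarrow> 'o \<Rightarrow> ('m, 'x) ring_scheme"
  comp_mor :: "'m \<Rightarrow> 'm \<Rightarrow> 'm"  (infixl \<open>\<cdot>\<index>\<close> 75)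
  ident :: "'o \<Rightarrow> 'm"

text \<open>Complexes \<open>X\<^sub>0 \<rightarrow> \<dots> \<rightarrow> X\<^sub>n\<^sub>+\<^sub>1\<close>; values outside the index range are ignored throughout.\<close>

record ('o, 'm) cpx =
  obj :: "nat \<Rightarrow> 'o"
  diff :: "nat \<Rightarrow> 'm"

locale category =
  fixes \<C> :: "('o, 'm, 'x) cat" (structure)
  assumes hom_disjoint:
      "\<lbrakk>A \<in> Ob \<C>; B \<in> Ob \<C>; A' \<in> Ob \<C>; B' \<in> Ob \<C>;
        f \<in> carrier (Hom \<C> A B); f \<in> carrier (Hom \<C> A' B')\<rbrakk> \<Longrightarrow> A = A' \<and> B = B'"
    and ident_closed: "A \<in> Ob \<C> \<Longrightarrow> ident \<C> A \<in> carrier (Hom \<C> A A)"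
    and comp_closed:
      "\<lbrakk>A \<in> Ob \<C>; B \<in> Ob \<C>; D \<in> Ob \<C>; f \<in> carrier (Hom \<C> A B); g \<in> carrier (Hom \<C> B D)\<rbrakk>
        \<Longrightarrow> g \<cdot> f \<in> carrier (Hom \<C> A D)"
    and ident_left:
      "\<lbrakk>A \<in> Ob \<C>; B \<in> Ob \<C>; f \<in> carrier (Hom \<C> A B)\<rbrakk> \<Longrightarrow> ident \<C> B \<cdot> f = f"
    and ident_right:
      "\<lbrakk>A \<in> Ob \<C>; B \<in> Ob \<C>; f \<in> carrier (Hom \<C> A B)\<rbrakk> \<Longrightarrow> f \<cdot> ident \<C> A = f"
    and comp_assoc:
      "\<lbrakk>A \<in> Ob \<C>; B \<in> Ob \<C>; D \<in> Ob \<C>; F \<in> Ob \<C>;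
        f \<in> carrier (Hom \<C> A B); g \<in> carrier (Hom \<C> B D); h \<in> carrier (Hom \<C> D F)\<rbrakk>
        \<Longrightarrow> h \<cdot> (g \<cdot> f) = (h \<cdot> g) \<cdot> f"
begin

abbreviation mor :: "'o \<Rightarrow> 'o \<Rightarrow> 'm set"
  where "mor A B \<equiv> carrier (Hom \<C> A B)"

definition iso_mor :: "'o \<Rightarrow> 'o \<Rightarrow> 'm \<Rightarrow> bool"
  where "iso_mor A B f \<longleftrightarrow> f \<in> mor A B \<and> (\<exists>g\<in>mor B A. g \<cdot> f = ident \<C> A \<and> f \<cdot> g = ident \<C> B)"

definition endofunctor :: "('o \<Rightarrow> 'o) \<Rightarrow> ('m \<Rightarrow> 'm) \<Rightarrow> bool"
  where "endofunctor Fo Fm \<longleftrightarrow>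
    (\<forall>A\<in>Ob \<C>. Fo A \<in> Ob \<C> \<and> Fm (ident \<C> A) = ident \<C> (Fo A)) \<and>
    (\<forall>A\<in>Ob \<C>. \<forall>B\<in>Ob \<C>. \<forall>f\<in>mor A B. Fm f \<in> mor (Fo A) (Fo B)) \<and>
    (\<forall>A\<in>Ob \<C>. \<forall>B\<in>Ob \<C>. \<forall>D\<in>Ob \<C>. \<forall>f\<in>mor A B. \<forall>g\<in>mor B D. Fm (g \<cdot> f) = Fm g \<cdot> Fm f)"

definition naturally_isomorphic ::
    "('o \<Rightarrow> 'o) \<Rightarrow> ('m \<Rightarrow> 'm) \<Rightarrow> ('o \<Rightarrow> 'o) \<Rightarrow> ('m \<Rightarrow> 'm) \<Rightarrow> bool"
  where "naturally_isomorphic Fo Fm Go Gm \<longleftrightarrow>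
    (\<exists>\<eta>. (\<forall>A\<in>Ob \<C>. iso_mor (Fo A) (Go A) (\<eta> A)) \<and>
         (\<forall>A\<in>Ob \<C>. \<forall>B\<in>Ob \<C>. \<forall>f\<in>mor A B. \<eta> B \<cdot> Fm f = Gm f \<cdot> \<eta> A))"

definition auto_equivalence :: "('o \<Rightarrow> 'o) \<Rightarrow> ('m \<Rightarrow> 'm) \<Rightarrow> bool"
  where "auto_equivalence Fo Fm \<longleftrightarrow> endofunctor Fo Fm \<and>
    (\<exists>Go Gm. endofunctor Go Gm \<and>
      naturally_isomorphic (Go \<circ> Fo) (Gm \<circ> Fm) id id \<and>
      naturally_isomorphic (Fo \<circ> Go) (Fm \<circ> Gm) id id)"

definition right_determined :: "'o \<Rightarrow> 'o \<Rightarrow> 'o \<Rightarrow> 'm \<Rightarrow> bool"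
  where "right_determined C X Y f \<longleftrightarrow>
    (\<forall>L\<in>Ob \<C>. \<forall>g\<in>mor L Y.
      (\<forall>h\<in>mor C L. \<exists>t\<in>mor C X. g \<cdot> h = f \<cdot> t) \<longrightarrow> (\<exists>t\<in>mor L X. g = f \<cdot> t))"

definition left_determined :: "'o \<Rightarrow> 'o \<Rightarrow> 'o \<Rightarrow> 'm \<Rightarrow> bool"
  where "left_determined C X Y f \<longleftrightarrow>
    (\<forall>L\<in>Ob \<C>. \<forall>g\<in>mor X L.
      (\<forall>h\<in>mor L C. \<exists>t\<in>mor Y C. h \<cdot> g = t \<cdot> f) \<longrightarrow> (\<exists>t\<in>mor Y L. g = t \<cdot> f))"

end

locale preadditive_category = category \<C>
  for \<C> :: "('o, 'm, 'x) cat" (structure) +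
  assumes hom_group: "\<lbrakk>A \<in> Ob \<C>; B \<in> Ob \<C>\<rbrakk> \<Longrightarrow> abelian_group (Hom \<C> A B)"
    and comp_add_right:
      "\<lbrakk>A \<in> Ob \<C>; B \<in> Ob \<C>; D \<in> Ob \<C>; f \<in> mor A B; f' \<in> mor A B; g \<in> mor B D\<rbrakk>
        \<Longrightarrow> g \<cdot> (f \<oplus>\<^bsub>Hom \<C> A B\<^esub> f') = g \<cdot> f \<oplus>\<^bsub>Hom \<C> A D\<^esub> g \<cdot> f'"
    and comp_add_left:
      "\<lbrakk>A \<in> Ob \<C>; B \<in> Ob \<C>; D \<in> Ob \<C>; f \<in> mor A B; g \<in> mor B D; g' \<in> mor B D\<rbrakk>
        \<Longrightarrow> (g \<oplus>\<^bsub>Hom \<C> B D\<^esub> g') \<cdot> f = g \<cdot> f \<oplus>\<^bsub>Hom \<C> A D\<^esub> g' \<cdot> f"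
begin

definition zero_object :: "'o \<Rightarrow> bool"
  where "zero_object Z \<longleftrightarrow> Z \<in> Ob \<C> \<and> (\<forall>A\<in>Ob \<C>. (\<exists>!f. f \<in> mor Z A) \<and> (\<exists>!f. f \<in> mor A Z))"

definition biproduct :: "'o \<Rightarrow> 'o \<Rightarrow> 'o \<Rightarrow> 'm \<Rightarrow> 'm \<Rightarrow> 'm \<Rightarrow> 'm \<Rightarrow> bool"
  where "biproduct A B S i\<^sub>1 i\<^sub>2 p\<^sub>1 p\<^sub>2 \<longleftrightarrow>
    S \<in> Ob \<C> \<and> i\<^sub>1 \<in> mor A S \<and> i\<^sub>2 \<in> mor B S \<and> p\<^sub>1 \<in> mor S A \<and> p\<^sub>2 \<in> mor S B \<and>
    p\<^sub>1 \<cdot> i\<^sub>1 = ident \<C> A \<and> p\<^sub>2 \<cdot> i\<^sub>2 = ident \<C> B \<and>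
    p\<^sub>1 \<cdot> i\<^sub>2 = \<zero>\<^bsub>Hom \<C> B A\<^esub> \<and> p\<^sub>2 \<cdot> i\<^sub>1 = \<zero>\<^bsub>Hom \<C> A B\<^esub> \<and>
    i\<^sub>1 \<cdot> p\<^sub>1 \<oplus>\<^bsub>Hom \<C> S S\<^esub> i\<^sub>2 \<cdot> p\<^sub>2 = ident \<C> S"

definition direct_sum :: "nat \<Rightarrow> (nat \<Rightarrow> 'o) \<Rightarrow> 'o \<Rightarrow> (nat \<Rightarrow> 'm) \<Rightarrow> (nat \<Rightarrow> 'm) \<Rightarrow> bool"
  where "direct_sum m A S i p \<longleftrightarrow>
    S \<in> Ob \<C> \<and> (\<forall>j<m. A j \<in> Ob \<C> \<and> i j \<in> mor (A j) S \<and> p j \<in> mor S (A j)) \<and>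
    (\<forall>j<m. \<forall>l<m. p j \<cdot> i l = (if j = l then ident \<C> (A j) else \<zero>\<^bsub>Hom \<C> (A l) (A j)\<^esub>)) \<and>
    (\<Oplus>\<^bsub>Hom \<C> S S\<^esub>j\<in>{..<m}. i j \<cdot> p j) = ident \<C> S"

definition End_ring :: "'o \<Rightarrow> 'm ring"
  where "End_ring A =
    \<lparr> carrier = mor A A, mult = (\<lambda>g f. g \<cdot> f), one = ident \<C> A,
      zero = \<zero>\<^bsub>Hom \<C> A A\<^esub>, add = add (Hom \<C> A A) \<rparr>"

definition krull_schmidt :: bool
  where "krull_schmidt \<longleftrightarrow>
    (\<forall>X\<in>Ob \<C>. \<exists>m A i p. direct_sum m A X i p \<and> (\<forall>j<m. local_ring (End_ring (A j))))"

definition complex :: "nat \<Rightarrow> ('o, 'm) cpx \<Rightarrow> bool"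
  where "complex n X \<longleftrightarrow>
    (\<forall>i\<le>n+1. obj X i \<in> Ob \<C>) \<and>
    (\<forall>i\<le>n. diff X i \<in> mor (obj X i) (obj X (i+1))) \<and>
    (\<forall>i<n. diff X (i+1) \<cdot> diff X i = \<zero>\<^bsub>Hom \<C> (obj X i) (obj X (i+2))\<^esub>)"

definition chain_map :: "nat \<Rightarrow> ('o, 'm) cpx \<Rightarrow> ('o, 'm) cpx \<Rightarrow> (nat \<Rightarrow> 'm) \<Rightarrow> bool"
  where "chain_map n X Y f \<longleftrightarrow>
    (\<forall>i\<le>n+1. f i \<in> mor (obj X i) (obj Y i)) \<and>
    (\<forall>i\<le>n. f (i+1) \<cdot> diff X i = diff Y i \<cdot> f i)"

definition homotopic :: "nat \<Rightarrow> ('o, 'm) cpx \<Rightarrow> ('o, 'm) cpx \<Rightarrow> (nat \<Rightarrow> 'm) \<Rightarrow> (nat \<Rightarrow> 'm) \<Rightarrow> bool"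
  where "homotopic n X Y f g \<longleftrightarrow>
    (\<exists>\<phi>. (\<forall>i\<in>{1..n+1}. \<phi> i \<in> mor (obj X i) (obj Y (i-1))) \<and>
      f 0 \<ominus>\<^bsub>Hom \<C> (obj X 0) (obj Y 0)\<^esub> g 0 = \<phi> 1 \<cdot> diff X 0 \<and>
      (\<forall>i\<in>{1..n}. f i \<ominus>\<^bsub>Hom \<C> (obj X i) (obj Y i)\<^esub> g i
         = diff Y (i-1) \<cdot> \<phi> i \<oplus>\<^bsub>Hom \<C> (obj X i) (obj Y i)\<^esub> \<phi> (i+1) \<cdot> diff X i) \<and>
      f (n+1) \<ominus>\<^bsub>Hom \<C> (obj X (n+1)) (obj Y (n+1))\<^esub> g (n+1) = diff Y n \<cdot> \<phi> (n+1))"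

definition complex_between :: "nat \<Rightarrow> 'o \<Rightarrow> 'o \<Rightarrow> ('o, 'm) cpx \<Rightarrow> bool"
  where "complex_between n A C X \<longleftrightarrow> complex n X \<and> obj X 0 = A \<and> obj X (n+1) = C"

definition fixed_ends_map :: "nat \<Rightarrow> 'o \<Rightarrow> 'o \<Rightarrow> ('o, 'm) cpx \<Rightarrow> ('o, 'm) cpx \<Rightarrow> (nat \<Rightarrow> 'm) \<Rightarrow> bool"
  where "fixed_ends_map n A C X Y f \<longleftrightarrow>
    chain_map n X Y f \<and> f 0 = ident \<C> A \<and> f (n+1) = ident \<C> C"

definition homotopy_equivalent :: "nat \<Rightarrow> 'o \<Rightarrow> 'o \<Rightarrow> ('o, 'm) cpx \<Rightarrow> ('o, 'm) cpx \<Rightarrow> bool"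
  where "homotopy_equivalent n A C X Y \<longleftrightarrow>
    (\<exists>f g. fixed_ends_map n A C X Y f \<and> fixed_ends_map n A C Y X g \<and>
      homotopic n X X (\<lambda>i. g i \<cdot> f i) (\<lambda>i. ident \<C> (obj X i)) \<and>
      homotopic n Y Y (\<lambda>i. f i \<cdot> g i) (\<lambda>i. ident \<C> (obj Y i)))"

definition homotopy_class :: "nat \<Rightarrow> 'o \<Rightarrow> 'o \<Rightarrow> ('o, 'm) cpx \<Rightarrow> ('o, 'm) cpx set"
  where "homotopy_class n A C X = {Y. complex_between n A C Y \<and> homotopy_equivalent n A C X Y}"

text \<open>
  \<open>M\<close> is the mapping cone
  \<open>X\<^sub>1 \<rightarrow> X\<^sub>2 \<oplus> Y\<^sub>1 \<rightarrow> \<dots> \<rightarrow> X\<^sub>n\<^sub>+\<^sub>1 \<oplus> Y\<^sub>n \<rightarrow> Y\<^sub>n\<^sub>+\<^sub>1\<close> of a chain map with \<open>f\<^sub>0 = id\<close>, formed with some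
  choice of biproducts; the matrices are expanded through injections and projections.
\<close>

definition mapping_cone ::
    "nat \<Rightarrow> ('o, 'm) cpx \<Rightarrow> ('o, 'm) cpx \<Rightarrow> (nat \<Rightarrow> 'm) \<Rightarrow> ('o, 'm) cpx \<Rightarrow> bool"
  where "mapping_cone n X Y f M \<longleftrightarrow>
    obj M 0 = obj X 1 \<and> obj M (n+1) = obj Y (n+1) \<and>
    (\<exists>i\<^sub>1 i\<^sub>2 p\<^sub>1 p\<^sub>2.
      (\<forall>j\<in>{1..n}. biproduct (obj X (j+1)) (obj Y j) (obj M j) (i\<^sub>1 j) (i\<^sub>2 j) (p\<^sub>1 j) (p\<^sub>2 j)) \<and>
      diff M 0 =
        i\<^sub>1 1 \<cdot> (\<ominus>\<^bsub>Hom \<C> (obj X 1) (obj X 2)\<^esub> diff X 1)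
          \<oplus>\<^bsub>Hom \<C> (obj M 0) (obj M 1)\<^esub> i\<^sub>2 1 \<cdot> f 1 \<and>
      (\<forall>j\<in>{1..<n}. diff M j =
        i\<^sub>1 (j+1) \<cdot> (\<ominus>\<^bsub>Hom \<C> (obj X (j+1)) (obj X (j+2))\<^esub> diff X (j+1)) \<cdot> p\<^sub>1 j
          \<oplus>\<^bsub>Hom \<C> (obj M j) (obj M (j+1))\<^esub> i\<^sub>2 (j+1) \<cdot> f (j+1) \<cdot> p\<^sub>1 j
          \<oplus>\<^bsub>Hom \<C> (obj M j) (obj M (j+1))\<^esub> i\<^sub>2 (j+1) \<cdot> diff Y j \<cdot> p\<^sub>2 j) \<and>
      diff M n = f (n+1) \<cdot> p\<^sub>1 n \<oplus>\<^bsub>Hom \<C> (obj M n) (obj M (n+1))\<^esub> diff Y n \<cdot> p\<^sub>2 n)"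

text \<open>
  The mapping cocone of a chain map \<open>f : X \<rightarrow> Y\<close> with \<open>f\<^sub>n\<^sub>+\<^sub>1 = id\<close> is the mapping cone of
  \<open>f : Y \<rightarrow> X\<close> in the opposite category, read backwards:
  \<open>X\<^sub>0 \<rightarrow> Y\<^sub>0 \<oplus> X\<^sub>1 \<rightarrow> \<dots> \<rightarrow> Y\<^sub>n\<^sub>-\<^sub>1 \<oplus> X\<^sub>n \<rightarrow> Y\<^sub>n\<close>, where the first differential has entries \<open>f\<^sub>0\<close>, \<open>d\<^sub>0\<close>,
  the last one has entries \<open>- d\<^sub>n\<^sub>-\<^sub>1\<close>, \<open>f\<^sub>n\<close>, and the intermediate ones are given by
  \<open>- d\<^sub>j\<^sub>-\<^sub>1 : Y\<^sub>j\<^sub>-\<^sub>1 \<rightarrow> Y\<^sub>j\<close>, \<open>f\<^sub>j : X\<^sub>j \<rightarrow> Y\<^sub>j\<close> and \<open>d\<^sub>j : X\<^sub>j \<rightarrow> X\<^sub>j\<^sub>+\<^sub>1\<close>. Putting the minus sign on the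
  differentials of \<open>X\<close> instead would change the cocone, for odd \<open>n\<close>, by a sign at one end.
\<close>

definition mapping_cocone ::
    "nat \<Rightarrow> ('o, 'm) cpx \<Rightarrow> ('o, 'm) cpx \<Rightarrow> (nat \<Rightarrow> 'm) \<Rightarrow> ('o, 'm) cpx \<Rightarrow> bool"
  where "mapping_cocone n X Y f N \<longleftrightarrow>
    obj N 0 = obj X 0 \<and> obj N (n+1) = obj Y n \<and>
    (\<exists>i\<^sub>1 i\<^sub>2 p\<^sub>1 p\<^sub>2.
      (\<forall>j\<in>{1..n}. biproduct (obj Y (j-1)) (obj X j) (obj N j) (i\<^sub>1 j) (i\<^sub>2 j) (p\<^sub>1 j) (p\<^sub>2 j)) \<and>
      diff N 0 = i\<^sub>1 1 \<cdot> f 0 \<oplus>\<^bsub>Hom \<C> (obj N 0) (obj N 1)\<^esub> i\<^sub>2 1 \<cdot> diff X 0 \<and>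
      (\<forall>j\<in>{1..<n}. diff N j =
        i\<^sub>1 (j+1) \<cdot> (\<ominus>\<^bsub>Hom \<C> (obj Y (j-1)) (obj Y j)\<^esub> diff Y (j-1)) \<cdot> p\<^sub>1 j
          \<oplus>\<^bsub>Hom \<C> (obj N j) (obj N (j+1))\<^esub> i\<^sub>1 (j+1) \<cdot> f j \<cdot> p\<^sub>2 j
          \<oplus>\<^bsub>Hom \<C> (obj N j) (obj N (j+1))\<^esub> i\<^sub>2 (j+1) \<cdot> diff X j \<cdot> p\<^sub>2 j) \<and>
      diff N n =
        (\<ominus>\<^bsub>Hom \<C> (obj Y (n-1)) (obj Y n)\<^esub> diff Y (n-1)) \<cdot> p\<^sub>1 n
          \<oplus>\<^bsub>Hom \<C> (obj N n) (obj N (n+1))\<^esub> f n \<cdot> p\<^sub>2 n)"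

end

locale additive_category = preadditive_category \<C>
  for \<C> :: "('o, 'm, 'x) cat" (structure) +
  assumes zero_object_exists: "\<exists>Z. zero_object Z"
    and biproduct_exists:
      "\<lbrakk>A \<in> Ob \<C>; B \<in> Ob \<C>\<rbrakk> \<Longrightarrow> \<exists>S i\<^sub>1 i\<^sub>2 p\<^sub>1 p\<^sub>2. biproduct A B S i\<^sub>1 i\<^sub>2 p\<^sub>1 p\<^sub>2"


section \<open>n-exangulated categories\<close>

text \<open>
  An additive bifunctor \<open>\<E> : \<C>\<^sup>o\<^sup>p \<times> \<C> \<rightarrow> Ab\<close>: for \<open>c : C' \<rightarrow> C\<close> and \<open>a : A \<rightarrow> A'\<close>, \<open>Emap \<E> c a\<close> is
  the map \<open>\<E>(c, a) : \<E>(C, A) \<rightarrow> \<E>(C', A')\<close>.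
\<close>

record ('o, 'm, 'e, 'x) bifunctor =
  Ext :: "'o \<Rightarrow> 'o \<Rightarrow> ('e, 'x) ring_scheme"
  Emap :: "'m \<Rightarrow> 'm \<Rightarrow> 'e \<Rightarrow> 'e"

locale additive_bifunctor = additive_category \<C>
  for \<C> :: "('o, 'm, 'x) cat" (structure) +
  fixes \<E> :: "('o, 'm, 'e, 'y) bifunctor"
  assumes Ext_group: "\<lbrakk>C \<in> Ob \<C>; A \<in> Ob \<C>\<rbrakk> \<Longrightarrow> abelian_group (Ext \<E> C A)"
    and Emap_closed:
      "\<lbrakk>C \<in> Ob \<C>; C' \<in> Ob \<C>; A \<in> Ob \<C>; A' \<in> Ob \<C>; c \<in> mor C' C; a \<in> mor A A';
        \<delta> \<in> carrier (Ext \<E> C A)\<rbrakk> \<Longrightarrow> Emap \<E> c a \<delta> \<in> carrier (Ext \<E> C' A')"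
    and Emap_add:
      "\<lbrakk>C \<in> Ob \<C>; C' \<in> Ob \<C>; A \<in> Ob \<C>; A' \<in> Ob \<C>; c \<in> mor C' C; a \<in> mor A A';
        \<delta> \<in> carrier (Ext \<E> C A); \<epsilon> \<in> carrier (Ext \<E> C A)\<rbrakk>
        \<Longrightarrow> Emap \<E> c a (\<delta> \<oplus>\<^bsub>Ext \<E> C A\<^esub> \<epsilon>) = Emap \<E> c a \<delta> \<oplus>\<^bsub>Ext \<E> C' A'\<^esub> Emap \<E> c a \<epsilon>"
    and Emap_ident:
      "\<lbrakk>C \<in> Ob \<C>; A \<in> Ob \<C>; \<delta> \<in> carrier (Ext \<E> C A)\<rbrakk>
        \<Longrightarrow> Emap \<E> (ident \<C> C) (ident \<C> A) \<delta> = \<delta>"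
    and Emap_comp:
      "\<lbrakk>C \<in> Ob \<C>; C' \<in> Ob \<C>; C'' \<in> Ob \<C>; A \<in> Ob \<C>; A' \<in> Ob \<C>; A'' \<in> Ob \<C>;
        c \<in> mor C' C; c' \<in> mor C'' C'; a \<in> mor A A'; a' \<in> mor A' A'';
        \<delta> \<in> carrier (Ext \<E> C A)\<rbrakk>
        \<Longrightarrow> Emap \<E> (c \<cdot> c') (a' \<cdot> a) \<delta> = Emap \<E> c' a' (Emap \<E> c a \<delta>)"
    and Emap_add_first:
      "\<lbrakk>C \<in> Ob \<C>; C' \<in> Ob \<C>; A \<in> Ob \<C>; A' \<in> Ob \<C>; c \<in> mor C' C; c' \<in> mor C' C; a \<in> mor A A';
        \<delta> \<in> carrier (Ext \<E> C A)\<rbrakk>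
        \<Longrightarrow> Emap \<E> (c \<oplus>\<^bsub>Hom \<C> C' C\<^esub> c') a \<delta> = Emap \<E> c a \<delta> \<oplus>\<^bsub>Ext \<E> C' A'\<^esub> Emap \<E> c' a \<delta>"
    and Emap_add_second:
      "\<lbrakk>C \<in> Ob \<C>; C' \<in> Ob \<C>; A \<in> Ob \<C>; A' \<in> Ob \<C>; c \<in> mor C' C; a \<in> mor A A'; a' \<in> mor A A';
        \<delta> \<in> carrier (Ext \<E> C A)\<rbrakk>
        \<Longrightarrow> Emap \<E> c (a \<oplus>\<^bsub>Hom \<C> A A'\<^esub> a') \<delta> = Emap \<E> c a \<delta> \<oplus>\<^bsub>Ext \<E> C' A'\<^esub> Emap \<E> c a' \<delta>"
begin

text \<open>\<open>push C a \<delta>\<close> is \<open>a\<^sub>* \<delta> = \<E>(C, a)(\<delta>)\<close> and \<open>pull c A \<delta>\<close> is \<open>c\<^sup>* \<delta> = \<E>(c, A)(\<delta>)\<close>,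
  for \<open>\<delta> \<in> \<E>(C, A)\<close>.\<close>

definition push :: "'o \<Rightarrow> 'm \<Rightarrow> 'e \<Rightarrow> 'e"
  where "push C a \<delta> = Emap \<E> (ident \<C> C) a \<delta>"

definition pull :: "'m \<Rightarrow> 'o \<Rightarrow> 'e \<Rightarrow> 'e"
  where "pull c A \<delta> = Emap \<E> c (ident \<C> A) \<delta>"

definition extension_morphism ::
    "'o \<Rightarrow> 'o \<Rightarrow> 'e \<Rightarrow> 'o \<Rightarrow> 'o \<Rightarrow> 'e \<Rightarrow> 'm \<Rightarrow> 'm \<Rightarrow> bool"
  where "extension_morphism C A \<delta> D B \<rho> a c \<longleftrightarrow>
    a \<in> mor A B \<and> c \<in> mor C D \<and> push C a \<delta> = pull c B \<rho>"

definition exangle :: "nat \<Rightarrow> ('o, 'm) cpx \<Rightarrow> 'e \<Rightarrow> bool"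
  where "exangle n X \<delta> \<longleftrightarrow>
    complex n X \<and>
    \<delta> \<in> carrier (Ext \<E> (obj X (n+1)) (obj X 0)) \<and>
    push (obj X (n+1)) (diff X 0) \<delta> = \<zero>\<^bsub>Ext \<E> (obj X (n+1)) (obj X 1)\<^esub> \<and>
    pull (diff X n) (obj X 0) \<delta> = \<zero>\<^bsub>Ext \<E> (obj X n) (obj X 0)\<^esub> \<and>
    (\<forall>T\<in>Ob \<C>.
      (\<forall>i\<in>{1..n}. {f \<in> mor T (obj X i). diff X i \<cdot> f = \<zero>\<^bsub>Hom \<C> T (obj X (i+1))\<^esub>}
         = (\<lambda>g. diff X (i-1) \<cdot> g) ` mor T (obj X (i-1))) \<and>
      {f \<in> mor T (obj X (n+1)). pull f (obj X 0) \<delta> = \<zero>\<^bsub>Ext \<E> T (obj X 0)\<^esub>}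
         = (\<lambda>g. diff X n \<cdot> g) ` mor T (obj X n)) \<and>
    (\<forall>T\<in>Ob \<C>.
      (\<forall>i\<in>{1..n}. {f \<in> mor (obj X i) T. f \<cdot> diff X (i-1) = \<zero>\<^bsub>Hom \<C> (obj X (i-1)) T\<^esub>}
         = (\<lambda>g. g \<cdot> diff X i) ` mor (obj X (i+1)) T) \<and>
      {f \<in> mor (obj X 0) T. push (obj X (n+1)) f \<delta> = \<zero>\<^bsub>Ext \<E> (obj X (n+1)) T\<^esub>}
         = (\<lambda>g. g \<cdot> diff X 0) ` mor (obj X 1) T)"

end

text \<open>\<open>\<ss> C A \<delta>\<close> is the class \<open>\<ss>(\<delta>)\<close> for \<open>\<delta> \<in> \<E>(C, A)\<close>.\<close>

locale exact_realization = additive_bifunctor \<C> \<E>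
  for \<C> :: "('o, 'm, 'x) cat" (structure) and \<E> :: "('o, 'm, 'e, 'y) bifunctor" +
  fixes \<ss> :: "'o \<Rightarrow> 'o \<Rightarrow> 'e \<Rightarrow> ('o, 'm) cpx set" and n :: nat
  assumes realization_class:
      "\<lbrakk>C \<in> Ob \<C>; A \<in> Ob \<C>; \<delta> \<in> carrier (Ext \<E> C A)\<rbrakk>
        \<Longrightarrow> \<exists>X. complex_between n A C X \<and> \<ss> C A \<delta> = homotopy_class n A C X"
    and R0:
      "\<lbrakk>C \<in> Ob \<C>; A \<in> Ob \<C>; D \<in> Ob \<C>; B \<in> Ob \<C>;
        \<delta> \<in> carrier (Ext \<E> C A); \<rho> \<in> carrier (Ext \<E> D B); X \<in> \<ss> C A \<delta>; Y \<in> \<ss> D B \<rho>;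
        extension_morphism C A \<delta> D B \<rho> a c\<rbrakk>
        \<Longrightarrow> \<exists>f. chain_map n X Y f \<and> f 0 = a \<and> f (n+1) = c"
    and R1:
      "\<lbrakk>C \<in> Ob \<C>; A \<in> Ob \<C>; \<delta> \<in> carrier (Ext \<E> C A); X \<in> \<ss> C A \<delta>\<rbrakk> \<Longrightarrow> exangle n X \<delta>"
    and R2_left:
      "\<lbrakk>A \<in> Ob \<C>; zero_object Z; Q = (\<lambda>i. if i \<le> 1 then A else Z)\<rbrakk>
        \<Longrightarrow> \<lparr>obj = Q, diff = (\<lambda>i. if i = 0 then ident \<C> A else \<zero>\<^bsub>Hom \<C> (Q i) (Q (i+1))\<^esub>)\<rparr>
              \<in> \<ss> Z A \<zero>\<^bsub>Ext \<E> Z A\<^esub>"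
    and R2_right:
      "\<lbrakk>A \<in> Ob \<C>; zero_object Z; Q = (\<lambda>i. if i < n then Z else A)\<rbrakk>
        \<Longrightarrow> \<lparr>obj = Q, diff = (\<lambda>i. if i = n then ident \<C> A else \<zero>\<^bsub>Hom \<C> (Q i) (Q (i+1))\<^esub>)\<rparr>
              \<in> \<ss> A Z \<zero>\<^bsub>Ext \<E> A Z\<^esub>"
begin

definition distinguished :: "('o, 'm) cpx \<Rightarrow> 'e \<Rightarrow> bool"
  where "distinguished X \<delta> \<longleftrightarrow>
    obj X 0 \<in> Ob \<C> \<and> obj X (n+1) \<in> Ob \<C> \<and>
    \<delta> \<in> carrier (Ext \<E> (obj X (n+1)) (obj X 0)) \<and> X \<in> \<ss> (obj X (n+1)) (obj X 0) \<delta>"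

definition inflation :: "'o \<Rightarrow> 'o \<Rightarrow> 'm \<Rightarrow> bool"
  where "inflation A B f \<longleftrightarrow>
    (\<exists>X \<delta>. distinguished X \<delta> \<and> obj X 0 = A \<and> obj X 1 = B \<and> diff X 0 = f)"

definition deflation :: "'o \<Rightarrow> 'o \<Rightarrow> 'm \<Rightarrow> bool"
  where "deflation A B f \<longleftrightarrow>
    (\<exists>X \<delta>. distinguished X \<delta> \<and> obj X n = A \<and> obj X (n+1) = B \<and> diff X n = f)"

definition right_deflation_classified :: "'o \<Rightarrow> bool"
  where "right_deflation_classified Y \<longleftrightarrow>
    (\<forall>X\<in>Ob \<C>. \<forall>\<alpha>. deflation X Y \<alpha> \<longrightarrow> (\<exists>C\<in>Ob \<C>. right_determined C X Y \<alpha>)) \<and>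
    (\<forall>C\<in>Ob \<C>. \<forall>H. subgroup H (add_monoid (Hom \<C> C Y)) \<and>
        (\<forall>h\<in>H. \<forall>e\<in>mor C C. h \<cdot> e \<in> H) \<longrightarrow>
      (\<exists>X\<in>Ob \<C>. \<exists>\<alpha>. deflation X Y \<alpha> \<and> right_determined C X Y \<alpha> \<and>
        (\<lambda>t. \<alpha> \<cdot> t) ` mor C X = H))"

definition left_inflation_classified :: "'o \<Rightarrow> bool"
  where "left_inflation_classified X \<longleftrightarrow>
    (\<forall>Y\<in>Ob \<C>. \<forall>\<alpha>. inflation X Y \<alpha> \<longrightarrow> (\<exists>C\<in>Ob \<C>. left_determined C X Y \<alpha>)) \<and>
    (\<forall>C\<in>Ob \<C>. \<forall>H. subgroup H (add_monoid (Hom \<C> X C)) \<and>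
        (\<forall>h\<in>H. \<forall>e\<in>mor C C. e \<cdot> h \<in> H) \<longrightarrow>
      (\<exists>Y\<in>Ob \<C>. \<exists>\<alpha>. inflation X Y \<alpha> \<and> left_determined C X Y \<alpha> \<and>
        (\<lambda>t. t \<cdot> \<alpha>) ` mor Y C = H))"

definition has_right_determined_deflations :: bool
  where "has_right_determined_deflations \<longleftrightarrow> (\<forall>Y\<in>Ob \<C>. right_deflation_classified Y)"

definition has_left_determined_inflations :: bool
  where "has_left_determined_inflations \<longleftrightarrow> (\<forall>X\<in>Ob \<C>. left_inflation_classified X)"

end

locale n_exangulated = exact_realization \<C> \<E> \<ss> n
  for \<C> :: "('o, 'm, 'x) cat" (structure) and \<E> :: "('o, 'm, 'e, 'y) bifunctor"
    and \<ss> :: "'o \<Rightarrow> 'o \<Rightarrow> 'e \<Rightarrow> ('o, 'm) cpx set" and n :: nat +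
  assumes EA1_inflation: "\<lbrakk>inflation A B f; inflation B D g\<rbrakk> \<Longrightarrow> inflation A D (g \<cdot> f)"
    and EA1_deflation: "\<lbrakk>deflation A B f; deflation B D g\<rbrakk> \<Longrightarrow> deflation A D (g \<cdot> f)"
    and EA2:
      "\<lbrakk>A \<in> Ob \<C>; C \<in> Ob \<C>; D \<in> Ob \<C>; \<rho> \<in> carrier (Ext \<E> D A); c \<in> mor C D;
        X \<in> \<ss> C A (pull c A \<rho>); Y \<in> \<ss> D A \<rho>\<rbrakk>
        \<Longrightarrow> \<exists>f M. chain_map n X Y f \<and> f 0 = ident \<C> A \<and> f (n+1) = c \<and>
              mapping_cone n X Y f M \<and> distinguished M (push D (diff X 0) \<rho>)"
    and EA2_op:
      "\<lbrakk>A \<in> Ob \<C>; B \<in> Ob \<C>; C \<in> Ob \<C>; \<rho> \<in> carrier (Ext \<E> C A); a \<in> mor A B;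
        X \<in> \<ss> C A \<rho>; Y \<in> \<ss> C B (push C a \<rho>)\<rbrakk>
        \<Longrightarrow> \<exists>f N. chain_map n X Y f \<and> f 0 = a \<and> f (n+1) = ident \<C> C \<and>
              mapping_cocone n X Y f N \<and> distinguished N (pull (diff Y n) A \<rho>)"


section \<open>Linearity, finiteness and Serre duality\<close>

type_synonym ('o, 'm, 'k) module_cat = "('o, 'm, ('k, 'm, unit) module_ext) cat"

type_synonym ('o, 'm, 'e, 'k) module_bifunctor = "('o, 'm, 'e, ('k, 'e, unit) module_ext) bifunctor"

definition k_linear ::
    "('k, 'r) ring_scheme \<Rightarrow> ('o, 'm, 'k) module_cat \<Rightarrow> ('o, 'm, 'e, 'k) module_bifunctor \<Rightarrow> bool"
  where "k_linear k \<C> \<E> \<longleftrightarrow>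
    (\<forall>A\<in>Ob \<C>. \<forall>B\<in>Ob \<C>. module k (Hom \<C> A B) \<and> module k (Ext \<E> A B)) \<and>
    (\<forall>A\<in>Ob \<C>. \<forall>B\<in>Ob \<C>. \<forall>C\<in>Ob \<C>.
      (\<forall>g\<in>carrier (Hom \<C> B C). linear_map k (Hom \<C> A B) (Hom \<C> A C) (\<lambda>f. g \<cdot>\<^bsub>\<C>\<^esub> f)) \<and>
      (\<forall>f\<in>carrier (Hom \<C> A B). linear_map k (Hom \<C> B C) (Hom \<C> A C) (\<lambda>g. g \<cdot>\<^bsub>\<C>\<^esub> f))) \<and>
    (\<forall>A\<in>Ob \<C>. \<forall>B\<in>Ob \<C>. \<forall>C\<in>Ob \<C>. \<forall>D\<in>Ob \<C>.
      (\<forall>\<delta>\<in>carrier (Ext \<E> B C). \<forall>g\<in>carrier (Hom \<C> C D).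
        linear_map k (Hom \<C> A B) (Ext \<E> A D) (\<lambda>f. Emap \<E> f g \<delta>)) \<and>
      (\<forall>f\<in>carrier (Hom \<C> A B). \<forall>g\<in>carrier (Hom \<C> C D).
        linear_map k (Ext \<E> B C) (Ext \<E> A D) (\<lambda>\<delta>. Emap \<E> f g \<delta>)) \<and>
      (\<forall>f\<in>carrier (Hom \<C> A B). \<forall>\<delta>\<in>carrier (Ext \<E> B C).
        linear_map k (Hom \<C> C D) (Ext \<E> A D) (\<lambda>g. Emap \<E> f g \<delta>)))"

definition ext_finite ::
    "('k, 'r) ring_scheme \<Rightarrow> ('o, 'm, 'k) module_cat \<Rightarrow> ('o, 'm, 'e, 'k) module_bifunctor \<Rightarrow> bool"
  where "ext_finite k \<C> \<E> \<longleftrightarrow>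
    (\<forall>A\<in>Ob \<C>. \<forall>B\<in>Ob \<C>. finitely_generated_module k (Ext \<E> A B))"

text \<open>
  \<open>\<tau>o\<close> and \<open>\<tau>m\<close> are the object and morphism parts of \<open>\<tau>\<^sub>n\<close>. With \<open>D = Hom\<^sub>k(-, J)\<close>, the functor
  \<open>D \<E>(X, Y)\<close> is covariant in \<open>X\<close> and contravariant in \<open>Y\<close>: along \<open>x : X \<rightarrow> X'\<close> and \<open>y : Y' \<rightarrow> Y\<close>
  it sends \<open>\<psi>\<close> to \<open>\<psi> \<circ> \<E>(x, y)\<close>.
\<close>

definition has_serre_duality ::
    "('k, 'r) ring_scheme \<Rightarrow> ('k, 'j) module \<Rightarrow> ('o, 'm, 'k) module_cat \<Rightarrow>
      ('o, 'm, 'e, 'k) module_bifunctor \<Rightarrow> bool"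
  where "has_serre_duality k J \<C> \<E> \<longleftrightarrow>
    (\<exists>\<tau>o \<tau>m \<phi>.
      category.auto_equivalence \<C> \<tau>o \<tau>m \<and>
      (\<forall>A\<in>Ob \<C>. \<forall>B\<in>Ob \<C>. linear_map k (Hom \<C> A B) (Hom \<C> (\<tau>o A) (\<tau>o B)) \<tau>m) \<and>
      (\<forall>X\<in>Ob \<C>. \<forall>Y\<in>Ob \<C>.
        linear_iso k (dual_module k J (Ext \<E> X Y)) (Hom \<C> Y (\<tau>o X)) (\<phi> X Y)) \<and>
      (\<forall>X\<in>Ob \<C>. \<forall>X'\<in>Ob \<C>. \<forall>Y\<in>Ob \<C>. \<forall>Y'\<in>Ob \<C>.
        \<forall>x\<in>carrier (Hom \<C> X X'). \<forall>y\<in>carrier (Hom \<C> Y' Y).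
        \<forall>\<psi>\<in>carrier (dual_module k J (Ext \<E> X Y)).
          \<phi> X' Y' (\<lambda>\<delta>\<in>carrier (Ext \<E> X' Y'). \<psi> (Emap \<E> x y \<delta>))
            = \<tau>m x \<cdot>\<^bsub>\<C>\<^esub> \<phi> X Y \<psi> \<cdot>\<^bsub>\<C>\<^esub> y))"

end

theory Submission
  imports Defs "HOL-Algebra.QuotRing"
begin

text \<open>Serre duality amounts to the existence of enough perfect pairings. Call \<open>(C, A, \<gamma>)\<close> a Serre pair if
  \<open>\<gamma>\<close> is a form in \<open>D \<E>(C, A)\<close> for which the pairings \<open>(f, \<theta>) \<mapsto> \<gamma>(f\<^sub>* \<theta>)\<close> of \<open>\<C>(B, A)\<close> with \<open>\<E>(C, B)\<close>
  and \<open>(g, \<rho>) \<mapsto> \<gamma>(g\<^sup>* \<rho>)\<close> of \<open>\<C>(C, D)\<close> with \<open>\<E>(D, A)\<close> are nondegenerate for all \<open>B\<close> and \<open>D\<close>. As the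
  groups \<open>\<E>(X, Y)\<close> have finite length, Matlis duality turns nondegeneracy into isomorphisms
  \<open>\<C>(-, A) \<cong> D \<E>(C, -)\<close> and \<open>\<C>(C, -) \<cong> D \<E>(-, A)\<close>. The category has Serre duality if and only if every
  object occurs both as the first and as the second member of a Serre pair (\<open>serre_duality_has_serre_pairs\<close>,
  \<open>has_serre_pairs_serre_duality\<close>): given Serre duality, an isomorphism \<open>A \<cong> \<tau> C\<close> corresponds to a form
  \<open>\<gamma>\<close>; given Serre pairs \<open>(C, \<tau> C, \<gamma>\<^sub>C)\<close>, the first family of isomorphisms defines \<open>\<tau>\<close> on morphisms by
  transposition, the second makes \<open>\<tau>\<close> fully faithful, and the pairs with second member \<open>A\<close>
  make it essentially surjective.

  Determined deflations and inflations are translated into statements about \<open>\<E>\<close>. A deflation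
  \<open>Z\<^sub>n \<rightarrow> Y\<close> with extension \<open>\<delta> \<in> \<E>(Y, A)\<close> factors exactly those \<open>g\<close> with \<open>g\<^sup>* \<delta> = 0\<close>, so both
  conditions on deflations concern the subfunctors \<open>{g. g\<^sup>* \<delta> = 0}\<close>; dually for inflations. From the
  \<open>n\<close>-exangles only one more property enters: if \<open>g\<^sup>* \<delta> = 0\<close> implies \<open>g\<^sup>* \<theta> = 0\<close> for all \<open>g\<close>, then
  \<open>\<theta> = f\<^sub>* \<delta>\<close> for some \<open>f\<close>, and dually (\<open>push_exactness\<close>, \<open>pull_exactness\<close>). It holds because a
  suitable mapping cone or cocone has the zero extension and therefore splits. The resulting setting is
  symmetric under passage to the opposite category, which gives one half of each dual pair of
  statements.

  Serre pairs give classification: \<open>\<gamma>\<close> detects elements of \<open>\<E>(L, A)\<close> by morphisms \<open>C \<rightarrow> L\<close>, so every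
  \<open>\<delta> \<in> \<E>(Y, A)\<close> is determined by \<open>C\<close>; and a submodule \<open>H\<close> of \<open>\<C>(C, Y)\<close> is the annihilator of its
  orthogonal complement in \<open>\<E>(Y, A)\<close>, finitely many elements of which combine into one extension
  (\<open>serre_pair_right_classifies\<close>).

  Conversely, let \<open>C\<close> have a local endomorphism ring. An extension of \<open>C\<close> that classifies the
  non-isomorphisms in \<open>\<C>(C, C)\<close> has a component \<open>\<delta> \<in> \<E>(C, A)\<close> that is almost split. By exactness,
  every nonzero element of \<open>\<E>(C, B)\<close> can be pushed to \<open>\<delta>\<close> and every nonzero element of \<open>\<E>(D, A)\<close> can be
  pulled back to \<open>\<delta>\<close>; classification of the zero submodule extends this to nonzero morphisms. Hence
  any form \<open>\<gamma>\<close> with \<open>\<gamma>(\<delta>) \<noteq> 0\<close> yields a Serre pair (\<open>almost_split_serre_pair\<close>), and direct sums of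
  Serre pairs reach all objects of a Krull-Schmidt category.

  The module theory behind this is the double annihilator theorem over \<open>k\<close> (\<open>double_annihilator\<close>). It
  rests on a composition series of \<open>k\<close> (\<open>artinian_simple_filtration\<close>) and on the fact that, by
  minimality of \<open>J\<close>, the elements of \<open>J\<close> killed by a maximal ideal form a single line
  (\<open>socle_of_minimal_injective_cogenerator\<close>).\<close>

section \<open>Submodules and Zorn's lemma\<close>

definition self_module :: "('k, 'r) ring_scheme \<Rightarrow> ('k, 'k) module"
  where "self_module k = \<lparr>carrier = carrier k, mult = mult k, one = one k, zero = zero k,
    add = add k, smult = mult k\<rparr>"

definition adjoin :: "('k, 'r) ring_scheme \<Rightarrow> ('k, 'a, 'x) module_scheme \<Rightarrow> 'a set \<Rightarrow> 'a \<Rightarrow> 'a set"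
  where "adjoin k M A b = {a \<oplus>\<^bsub>M\<^esub> r \<odot>\<^bsub>M\<^esub> b | a r. a \<in> A \<and> r \<in> carrier k}"

lemma self_module_simps [simp]:
  "carrier (self_module k) = carrier k" "zero (self_module k) = zero k"
  "add (self_module k) = add k" "smult (self_module k) = mult k"
  by (simp_all add: self_module_def)

lemma self_module_minus [simp]: "a_inv (self_module k) = a_inv k"
  by (rule ext) (simp add: self_module_def a_inv_def m_inv_def)

lemma module_self_module:
  fixes k (structure)
  assumes "cring k"
  shows "module k (self_module k)"
proof -
  interpret cring k by fact
  have "abelian_group (self_module k)"
    by (rule abelian_groupI) (auto simp: a_ac intro: l_neg a_inv_closed)
  then show ?thesis
    by (intro moduleI) (auto simp: assms l_distr r_distr m_assoc)
qed

context module
begin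

lemma submodule_iff:
  "submodule H R M \<longleftrightarrow> H \<subseteq> carrier M \<and> \<zero>\<^bsub>M\<^esub> \<in> H \<and> (\<forall>a\<in>H. \<forall>b\<in>H. a \<oplus>\<^bsub>M\<^esub> b \<in> H) \<and>
    (\<forall>r\<in>carrier R. \<forall>a\<in>H. r \<odot>\<^bsub>M\<^esub> a \<in> H)" (is "?L \<longleftrightarrow> ?R")
proof
  assume ?L
  then show ?R
    using submodule.axioms(1) subgroup.one_closed submoduleE(1,4,5) by fastforce
next
  assume r: ?R
  have "\<ominus>\<^bsub>M\<^esub> a \<in> H" if "a \<in> H" for a
  proof -
    have "(\<ominus> \<one>) \<odot>\<^bsub>M\<^esub> a \<in> H" using r that by auto
    moreover have "a \<in> carrier M" using r that by auto
    ultimately show ?thesis by (simp add: smult_l_minus)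
  qed
  then show ?L using r by (intro submoduleI) auto
qed

lemma zero_submodule: "submodule {\<zero>\<^bsub>M\<^esub>} R M"
  by (auto simp: submodule_iff)

lemma adjoinI: "a \<in> A \<Longrightarrow> r \<in> carrier R \<Longrightarrow> a \<oplus>\<^bsub>M\<^esub> r \<odot>\<^bsub>M\<^esub> b \<in> adjoin R M A b"
  by (auto simp: adjoin_def)

lemma subset_adjoin:
  assumes "submodule A R M" "b \<in> carrier M"
  shows "A \<subseteq> adjoin R M A b"
proof
  fix a assume "a \<in> A"
  then have "a \<oplus>\<^bsub>M\<^esub> \<zero> \<odot>\<^bsub>M\<^esub> b \<in> adjoin R M A b" by (intro adjoinI) auto
  moreover have "a \<in> carrier M" using \<open>a \<in> A\<close> assms by (auto simp: submodule_iff)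
  ultimately show "a \<in> adjoin R M A b" using assms by simp
qed

lemma in_adjoin:
  assumes "submodule A R M" "b \<in> carrier M"
  shows "b \<in> adjoin R M A b"
proof -
  have "\<zero>\<^bsub>M\<^esub> \<oplus>\<^bsub>M\<^esub> \<one> \<odot>\<^bsub>M\<^esub> b \<in> adjoin R M A b"
    using assms by (intro adjoinI) (auto simp: submodule_iff)
  then show ?thesis using assms by simp
qed

lemma adjoin_submodule:
  assumes A: "submodule A R M" and b: "b \<in> carrier M"
  shows "submodule (adjoin R M A b) R M"
  unfolding submodule_iff
proof (intro conjI ballI)
  have sub: "A \<subseteq> carrier M" using A by (auto simp: submodule_iff)
  show "adjoin R M A b \<subseteq> carrier M"
    using sub b by (auto simp: adjoin_def)
  show "\<zero>\<^bsub>M\<^esub> \<in> adjoin R M A b"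
    using subset_adjoin[OF A b] A by (auto simp: submodule_iff)
  fix x assume "x \<in> adjoin R M A b"
  then obtain a r where x: "x = a \<oplus>\<^bsub>M\<^esub> r \<odot>\<^bsub>M\<^esub> b" "a \<in> A" "r \<in> carrier R"
    by (auto simp: adjoin_def)
  have aM: "a \<in> carrier M" using x sub by auto
  { fix y assume "y \<in> adjoin R M A b"
    then obtain a' r' where y: "y = a' \<oplus>\<^bsub>M\<^esub> r' \<odot>\<^bsub>M\<^esub> b" "a' \<in> A" "r' \<in> carrier R"
      by (auto simp: adjoin_def)
    have aM': "a' \<in> carrier M" using y sub by auto
    have "x \<oplus>\<^bsub>M\<^esub> y = (a \<oplus>\<^bsub>M\<^esub> a') \<oplus>\<^bsub>M\<^esub> (r \<oplus> r') \<odot>\<^bsub>M\<^esub> b"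
      using x y aM aM' b by (simp add: smult_l_distr M.a_ac)
    moreover have "a \<oplus>\<^bsub>M\<^esub> a' \<in> A" using A x y by (auto simp: submodule_iff)
    ultimately show "x \<oplus>\<^bsub>M\<^esub> y \<in> adjoin R M A b"
      using x y by (auto intro: adjoinI) }
  fix s assume s: "s \<in> carrier R"
  have "s \<odot>\<^bsub>M\<^esub> x = s \<odot>\<^bsub>M\<^esub> a \<oplus>\<^bsub>M\<^esub> (s \<otimes> r) \<odot>\<^bsub>M\<^esub> b"
    using x aM b s by (simp add: smult_r_distr smult_assoc1)
  moreover have "s \<odot>\<^bsub>M\<^esub> a \<in> A" using A x s by (auto simp: submodule_iff)
  ultimately show "s \<odot>\<^bsub>M\<^esub> x \<in> adjoin R M A b"
    using x s by (auto intro: adjoinI)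
qed

lemma adjoin_least:
  assumes "submodule V R M" "A \<subseteq> V" "b \<in> V"
  shows "adjoin R M A b \<subseteq> V"
  using assms by (auto simp: adjoin_def submodule_iff subset_iff)

lemma chain_Union_submodule:
  assumes "\<C> \<noteq> {}" "subset.chain \<A> \<C>" "\<And>H. H \<in> \<A> \<Longrightarrow> submodule H R M"
  shows "submodule (\<Union>\<C>) R M"
proof -
  have c: "submodule H R M" if "H \<in> \<C>" for H
    using that assms by (auto simp: subset.chain_def)
  show ?thesis
    unfolding submodule_iff
  proof (intro conjI ballI)
    show "\<Union> \<C> \<subseteq> carrier M" using c by (meson Sup_least submodule_iff)
    show "\<zero>\<^bsub>M\<^esub> \<in> \<Union> \<C>" using c assms(1) by (auto simp: submodule_iff)
    show "r \<odot>\<^bsub>M\<^esub> a \<in> \<Union> \<C>" if "r \<in> carrier R" "a \<in> \<Union> \<C>" for r a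
      using that c by (fastforce simp: submodule_iff)
    fix a b assume "a \<in> \<Union> \<C>" "b \<in> \<Union> \<C>"
    then obtain A B where AB: "A \<in> \<C>" "B \<in> \<C>" "a \<in> A" "b \<in> B" by auto
    then have "A \<subseteq> B \<or> B \<subseteq> A" using assms(2) by (auto simp: subset.chain_def)
    then obtain H where "H \<in> \<C>" "a \<in> H" "b \<in> H" using AB by blast
    then show "a \<oplus>\<^bsub>M\<^esub> b \<in> \<Union> \<C>" using submoduleE(5)[OF c] by blast
  qed
qed

lemma maximal_submodule_avoiding:
  assumes A: "submodule A R M" and b: "b \<notin> A"
  shows "\<exists>U. submodule U R M \<and> A \<subseteq> U \<and> b \<notin> U \<and>
    (\<forall>V. submodule V R M \<longrightarrow> U \<subseteq> V \<longrightarrow> b \<notin> V \<longrightarrow> V = U)"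
proof -
  let ?A = "{U. submodule U R M \<and> A \<subseteq> U \<and> b \<notin> U}"
  have "\<exists>U\<in>?A. \<forall>X\<in>?A. U \<subseteq> X \<longrightarrow> X = U"
  proof (rule subset_Zorn_nonempty)
    show "?A \<noteq> {}" using assms by auto
    fix \<C> assume c: "\<C> \<noteq> {}" "subset.chain ?A \<C>"
    have "submodule (\<Union>\<C>) R M" by (rule chain_Union_submodule[OF c]) auto
    moreover have "A \<subseteq> \<Union>\<C>" "b \<notin> \<Union>\<C>" using c by (fastforce simp: subset.chain_def)+
    ultimately show "\<Union>\<C> \<in> ?A" by auto
  qed
  then obtain U where "U \<in> ?A" "\<forall>X\<in>?A. U \<subseteq> X \<longrightarrow> X = U" by blast
  then show ?thesis
    by (intro exI[of _ U]) (auto dest: subset_trans)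
qed

lemma submodule_conductor_ideal:
  assumes U: "submodule U R M" and b: "b \<in> carrier M"
  shows "ideal {r \<in> carrier R. r \<odot>\<^bsub>M\<^esub> b \<in> U} R" (is "ideal ?I R")
proof (rule idealI)
  show "ring R" by (rule R.ring_axioms)
  show "subgroup ?I (add_monoid R)"
    using U b submoduleE(3)[OF U]
    by (intro R.add.subgroupI)
       (auto simp: submodule_iff smult_l_distr smult_l_minus
         simp flip: a_inv_def)
  fix a x assume "a \<in> ?I" and x: "x \<in> carrier R"
  then show "x \<otimes> a \<in> ?I" using U b by (auto simp: smult_assoc1 submodule_iff)
  then show "a \<otimes> x \<in> ?I" using \<open>a \<in> ?I\<close> x by (simp add: R.m_comm)
qed

text \<open>The class of \<open>b\<close> lies in every nonzero submodule of \<open>M / U\<close>: for \<open>r\<close> with \<open>r b \<notin> U\<close>, maximality puts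
  \<open>b\<close> into \<open>U + k r b\<close>, which makes \<open>r\<close> invertible modulo the conductor.\<close>

lemma maximal_conductor:
  assumes U: "submodule U R M" and b: "b \<in> carrier M" "b \<notin> U"
    and max: "\<And>V. submodule V R M \<Longrightarrow> U \<subseteq> V \<Longrightarrow> b \<notin> V \<Longrightarrow> V = U"
  shows "maximalideal {r \<in> carrier R. r \<odot>\<^bsub>M\<^esub> b \<in> U} R" (is "maximalideal ?m R")
proof (rule maximalidealI)
  show "ideal ?m R" by (rule submodule_conductor_ideal[OF U b(1)])
  show "carrier R \<noteq> ?m" using b by (metis (mono_tags, lifting) R.one_closed mem_Collect_eq smult_one)
  fix I assume I: "ideal I R" "?m \<subseteq> I" "I \<subseteq> carrier R"
  interpret I: ideal I R by fact
  show "I = ?m \<or> I = carrier R"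
  proof (cases "I = ?m")
    case False
    then obtain r where r: "r \<in> I" "r \<notin> ?m" using I by blast
    then have rc: "r \<in> carrier R" "r \<odot>\<^bsub>M\<^esub> b \<notin> U" using I by auto
    have rb: "r \<odot>\<^bsub>M\<^esub> b \<in> carrier M" using rc b by auto
    have "b \<in> adjoin R M U (r \<odot>\<^bsub>M\<^esub> b)"
      using max[OF adjoin_submodule[OF U rb] subset_adjoin[OF U rb]] in_adjoin[OF U rb] rc by auto
    then obtain u s where us: "b = u \<oplus>\<^bsub>M\<^esub> s \<odot>\<^bsub>M\<^esub> (r \<odot>\<^bsub>M\<^esub> b)" "u \<in> U" "s \<in> carrier R"
      by (auto simp: adjoin_def)
    have uM: "u \<in> carrier M" using us U by (auto simp: submodule_iff)
    have "(\<one> \<ominus> s \<otimes> r) \<odot>\<^bsub>M\<^esub> b = b \<ominus>\<^bsub>M\<^esub> s \<odot>\<^bsub>M\<^esub> (r \<odot>\<^bsub>M\<^esub> b)"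
      using us(3) rc b by (simp add: a_minus_def smult_l_distr smult_l_minus smult_assoc1)
    also have "\<dots> = u"
      using uM us(3) rb by (subst us(1)) (simp add: a_minus_def M.a_assoc M.r_neg)
    finally have "\<one> \<ominus> s \<otimes> r \<in> ?m" using us rc by auto
    then have "\<one> \<ominus> s \<otimes> r \<in> I" using I by auto
    moreover have "s \<otimes> r \<in> I" using r us I.I_l_closed by auto
    ultimately have "(\<one> \<ominus> s \<otimes> r) \<oplus> s \<otimes> r \<in> I" by (rule I.a_closed)
    also have "(\<one> \<ominus> s \<otimes> r) \<oplus> s \<otimes> r = \<one>" using us(3) rc by algebra
    finally show ?thesis using I.one_imp_carrier by auto
  qed blast
qed

end

lemma submodule_self_module_iff:
  fixes k (structure)
  assumes "cring k"
  shows "submodule I k (self_module k) \<longleftrightarrow> ideal I k"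
proof -
  interpret cring k by fact
  interpret S: module k "self_module k" by (rule module_self_module[OF assms])
  show ?thesis
  proof
    assume "submodule I k (self_module k)"
    then have i: "I \<subseteq> carrier k" "\<zero> \<in> I" "\<And>a b. a \<in> I \<Longrightarrow> b \<in> I \<Longrightarrow> a \<oplus> b \<in> I"
      "\<And>r a. r \<in> carrier k \<Longrightarrow> a \<in> I \<Longrightarrow> r \<otimes> a \<in> I"
      "\<And>a. a \<in> I \<Longrightarrow> \<ominus> a \<in> I"
      using S.submoduleE(3)[of I] by (auto simp: S.submodule_iff)
    show "ideal I k"
    proof (rule idealI)
      show "ring k" by (rule ring_axioms)
      show "subgroup I (add_monoid k)"
        using i by (intro add.subgroupI) (auto simp flip: a_inv_def)
      show "x \<otimes> a \<in> I" if "a \<in> I" "x \<in> carrier k" for a x using i that by auto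
      then show "a \<otimes> x \<in> I" if "a \<in> I" "x \<in> carrier k" for a x
        using i(1) that m_comm[of a x] by auto
    qed
  next
    assume "ideal I k"
    then interpret I: ideal I k .
    show "submodule I k (self_module k)"
      by (auto simp: S.submodule_iff I.a_closed I.I_l_closed)
  qed
qed

lemma proper_ideal_in_maximalideal:
  fixes k (structure)
  assumes "cring k" "ideal I k" "\<one> \<notin> I"
  shows "\<exists>m. maximalideal m k \<and> I \<subseteq> m"
proof -
  interpret cring k by fact
  interpret S: module k "self_module k" by (rule module_self_module[OF assms(1)])
  have "submodule I k (self_module k)" using assms by (simp add: submodule_self_module_iff)
  from S.maximal_submodule_avoiding[OF this assms(3)]
  obtain U where U: "submodule U k (self_module k)" "I \<subseteq> U" "\<one> \<notin> U"
    "\<And>V. submodule V k (self_module k) \<Longrightarrow> U \<subseteq> V \<Longrightarrow> \<one> \<notin> V \<Longrightarrow> V = U" by blast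
  have "maximalideal {r \<in> carrier k. r \<odot>\<^bsub>self_module k\<^esub> \<one> \<in> U} k"
    by (rule S.maximal_conductor[OF U(1) _ U(3,4)]) auto
  moreover have "{r \<in> carrier k. r \<odot>\<^bsub>self_module k\<^esub> \<one> \<in> U} = U"
    using U(1) by (auto simp: S.submodule_iff)
  ultimately show ?thesis using U(2) by auto
qed

section \<open>Modules of finite length\<close>

text \<open>A certificate that \<open>B / A\<close> has finite length: the class of each adjoined element is killed by a
  maximal ideal, so that every step is trivial or has a simple quotient.\<close>

inductive simple_filtration ::
    "('k, 'r) ring_scheme \<Rightarrow> ('k, 'a, 'x) module_scheme \<Rightarrow> 'a set \<Rightarrow> 'a set \<Rightarrow> bool"
  for k M A where
  base: "submodule A k M \<Longrightarrow> simple_filtration k M A A"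
| step: "\<lbrakk>simple_filtration k M A B; maximalideal m k; b \<in> carrier M;
          \<And>a. a \<in> m \<Longrightarrow> a \<odot>\<^bsub>M\<^esub> b \<in> B\<rbrakk> \<Longrightarrow> simple_filtration k M A (adjoin k M B b)"

lemma maximalideal_inverse_mod:
  fixes k (structure)
  assumes "cring k" "maximalideal m k" "r \<in> carrier k" "r \<notin> m"
  shows "\<exists>s\<in>carrier k. \<one> \<ominus> s \<otimes> r \<in> m"
proof -
  interpret cring k by fact
  interpret S: module k "self_module k" by (rule module_self_module[OF assms(1)])
  interpret m: maximalideal m k by fact
  have sm: "submodule m k (self_module k)"
    using assms(1) m.is_ideal by (simp add: submodule_self_module_iff)
  let ?N = "adjoin k (self_module k) m r"
  have "ideal ?N k"
    using S.adjoin_submodule[OF sm] assms by (simp add: submodule_self_module_iff)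
  then have "?N = m \<or> ?N = carrier k"
    using S.subset_adjoin[OF sm] assms S.adjoin_submodule[OF sm]
    by (intro m.I_maximal) (auto simp: S.submodule_iff)
  then have "\<one> \<in> ?N" using S.in_adjoin[OF sm, of r] assms by auto
  then obtain a s where as: "\<one> = a \<oplus> s \<otimes> r" "a \<in> m" "s \<in> carrier k"
    by (auto simp: adjoin_def)
  have "a \<in> carrier k" using as m.a_subset by auto
  then have "\<one> \<ominus> s \<otimes> r = a" using as assms by (simp only: as(1)) algebra
  then show ?thesis using as by blast
qed

context module
begin

lemma simple_filtration_submodules:
  assumes "simple_filtration R M A B"
  shows "submodule A R M" "submodule B R M" "A \<subseteq> B"
proof -
  from assms have "submodule A R M \<and> submodule B R M \<and> A \<subseteq> B"
  proof induct
    case (step B m b)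
    then show ?case using adjoin_submodule subset_adjoin by blast
  qed auto
  then show "submodule A R M" "submodule B R M" "A \<subseteq> B" by auto
qed

lemma simple_filtration_trans:
  assumes "simple_filtration R M B C" "simple_filtration R M A B"
  shows "simple_filtration R M A C"
  using assms by induct (auto intro: simple_filtration.step)

end

lemma artinian_minimal_ideal:
  assumes art: "artinian_ring k" and ne: "I0 \<in> F" and id: "\<And>I. I \<in> F \<Longrightarrow> ideal I k"
  shows "\<exists>I\<in>F. \<forall>I'\<in>F. I' \<subseteq> I \<longrightarrow> I' = I"
proof (rule ccontr)
  assume "\<not> ?thesis"
  then have s: "\<exists>I'\<in>F. I' \<subset> I" if "I \<in> F" for I using that by blast
  have "\<exists>f. \<forall>i. f i \<in> F \<and> f (Suc i) \<subset> f i"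
    by (rule dependent_nat_choice) (use ne s in auto)
  then obtain f where f: "\<And>i::nat. f i \<in> F" "\<And>i. f (Suc i) \<subset> f i" by blast
  then obtain m where "\<forall>i\<ge>m. f i = f m"
    using art id unfolding artinian_ring_def by (metis psubset_imp_subset)
  then have "f (Suc m) = f m" using le_SucI by blast
  then show False using f(2)[of m] by (metis less_irrefl)
qed

text \<open>Choose \<open>b \<in> I\<close> outside \<open>m I\<close> and a submodule \<open>U \<supseteq> m I\<close> that is maximal among those missing \<open>b\<close>. It
  may leave \<open>I\<close>, but \<open>U \<inter> I\<close> and \<open>b\<close> still generate \<open>I\<close>.\<close>

lemma artinian_simple_filtration_step:
  fixes k (structure)
  assumes k: "cring k" and I: "ideal I k" and m: "maximalideal m k"
    and ne: "Idl {a \<otimes> i | a i. a \<in> m \<and> i \<in> I} \<noteq> I" (is "?A \<noteq> I")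
  shows "\<exists>I'. I' \<subset> I \<and> simple_filtration k (self_module k) I' I"
proof -
  interpret cring k by fact
  interpret S: module k "self_module k" by (rule module_self_module[OF k])
  interpret m: maximalideal m k by fact
  interpret I: ideal I k by fact
  have mc: "m \<subseteq> carrier k" and Ic: "I \<subseteq> carrier k" using m.a_subset I.a_subset by auto
  have gen: "{a \<otimes> i | a i. a \<in> m \<and> i \<in> I} \<subseteq> carrier k"
    using mc Ic by auto
  have A: "ideal ?A k" by (rule genideal_ideal[OF gen])
  have "?A \<subseteq> I" using mc by (intro genideal_minimal[OF I]) (auto intro: I.I_l_closed)
  then obtain b where b: "b \<in> I" "b \<notin> ?A" using ne by blast
  have mI: "a \<otimes> i \<in> ?A" if "a \<in> m" "i \<in> I" for a i
    using genideal_self[OF gen] that by blast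
  have "submodule ?A k (self_module k)" using A k by (simp add: submodule_self_module_iff)
  from S.maximal_submodule_avoiding[OF this b(2)]
  obtain U where U: "submodule U k (self_module k)" "?A \<subseteq> U" "b \<notin> U"
    and max: "\<And>V. submodule V k (self_module k) \<Longrightarrow> U \<subseteq> V \<Longrightarrow> b \<notin> V \<Longrightarrow> V = U" by blast
  have Ui: "ideal U k" using U k by (simp add: submodule_self_module_iff)
  interpret U: ideal U k by fact
  have UIs: "submodule (U \<inter> I) k (self_module k)"
    using i_intersect[OF Ui I] k by (simp add: submodule_self_module_iff)
  have bc: "b \<in> carrier k" using b Ic by auto
  have "adjoin k (self_module k) (U \<inter> I) b = I"
  proof
    show "adjoin k (self_module k) (U \<inter> I) b \<subseteq> I"
      using I k b by (intro S.adjoin_least) (auto simp: submodule_self_module_iff)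
    show "I \<subseteq> adjoin k (self_module k) (U \<inter> I) b"
    proof
      fix c assume c: "c \<in> I"
      then have cc: "c \<in> carrier k" using Ic by auto
      show "c \<in> adjoin k (self_module k) (U \<inter> I) b"
      proof (cases "c \<in> U")
        case True
        then show ?thesis using S.subset_adjoin[OF UIs, of b] c bc by auto
      next
        case False
        have "b \<in> adjoin k (self_module k) U c"
          using max[OF S.adjoin_submodule[OF U(1)] S.subset_adjoin[OF U(1)]]
            S.in_adjoin[OF U(1)] False cc by (metis self_module_simps(1))
        then obtain u r where ur: "b = u \<oplus> r \<otimes> c" "u \<in> U" "r \<in> carrier k"
          by (auto simp: adjoin_def)
        have uc: "u \<in> carrier k" using ur U.a_subset by auto
        have "u = b \<oplus> \<ominus> r \<otimes> c" using ur uc cc by algebra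
        then have uI: "u \<in> I"
          using b c ur I.I_l_closed I.a_closed by (metis a_inv_closed)
        have "r \<notin> m"
        proof
          assume "r \<in> m"
          then have "r \<otimes> c \<in> U" using mI c U by blast
          then show False using ur U.a_closed U(3) by auto
        qed
        then obtain s where s: "s \<in> carrier k" "\<one> \<ominus> s \<otimes> r \<in> m"
          using maximalideal_inverse_mod[OF k m] ur by blast
        \<comment> \<open>Solve \<open>b = u + r c\<close> for \<open>c\<close> modulo \<open>m c\<close>, with \<open>s\<close> an inverse of \<open>r\<close> modulo \<open>m\<close>.\<close>
        define w where "w = \<ominus> s \<otimes> u \<oplus> (\<one> \<ominus> s \<otimes> r) \<otimes> c"
        have "(\<one> \<ominus> s \<otimes> r) \<otimes> c \<in> U" using mI[OF s(2) c] U(2) by blast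
        moreover have "(\<ominus> s) \<otimes> u \<in> U" using U.I_l_closed[OF ur(2)] s(1) by simp
        ultimately have "w \<in> U" unfolding w_def by (simp add: U.a_closed)
        moreover have "(\<one> \<ominus> s \<otimes> r) \<otimes> c \<in> I"
          using I.I_l_closed[OF c] s(1) ur(3) by simp
        then have "w \<in> I" unfolding w_def
          using I.I_l_closed[OF uI] s(1) by (simp add: I.a_closed)
        moreover have "c = w \<oplus> s \<otimes> b"
          unfolding w_def ur(1) using s(1) ur(3) uc cc by (algebra; simp)
        ultimately show ?thesis using s by (auto simp: adjoin_def)
      qed
    qed
  qed
  moreover have "simple_filtration k (self_module k) (U \<inter> I) (adjoin k (self_module k) (U \<inter> I) b)"
    using UIs m bc mI b U I.I_l_closed mc
    by (intro simple_filtration.step[OF simple_filtration.base[OF UIs] m]) auto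
  ultimately show ?thesis using b U by (intro exI[of _ "U \<inter> I"]) auto
qed

text \<open>Since \<open>m I = I\<close>, an element that annihilates \<open>m I\<close> annihilates \<open>I\<close>. Removing the simple factors
  of the filtration one after the other, from \<open>k\<close> down to \<open>I\<close>, shows that an element annihilating
  \<open>I\<^sup>2\<close> annihilates \<open>I\<close>. If \<open>I \<noteq> 0\<close>, take a minimal ideal among those that do not annihilate \<open>I\<close>; it is
  generated by an \<open>x\<close> with \<open>x = p x\<close> for some \<open>p \<in> I\<close>. But \<open>p\<close> lies in all maximal ideals, so \<open>1 - p\<close>
  is a unit and \<open>x = 0\<close>.\<close>

lemma artinian_nakayama:
  fixes k (structure)
  assumes k: "cring k" and art: "artinian_ring k"
    and f: "simple_filtration k (self_module k) I (carrier k)"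
    and eq: "\<And>m. maximalideal m k \<Longrightarrow> Idl {a \<otimes> i | a i. a \<in> m \<and> i \<in> I} = I"
  shows "I = {\<zero>}"
proof (rule ccontr)
  assume nz: "I \<noteq> {\<zero>}"
  interpret cring k by fact
  interpret S: module k "self_module k" by (rule module_self_module[OF k])
  have I: "ideal I k"
    using S.simple_filtration_submodules(1)[OF f] k by (simp add: submodule_self_module_iff)
  interpret I: ideal I k by fact
  have Ic: "I \<subseteq> carrier k" using I.a_subset by auto
  have ann_ideal: "ideal {r \<in> carrier k. c \<otimes> r = \<zero>} k" if c: "c \<in> carrier k" for c
    using S.submodule_conductor_ideal[OF S.zero_submodule, of c] c
    by (simp add: m_comm cong: conj_cong)
  have annm: "c \<otimes> i = \<zero>"
    if m: "maximalideal m k" and c: "c \<in> carrier k" "\<And>a i. a \<in> m \<Longrightarrow> i \<in> I \<Longrightarrow> c \<otimes> (a \<otimes> i) = \<zero>"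
      and i: "i \<in> I" for m c i
  proof -
    interpret m: maximalideal m k by fact
    have "Idl {a \<otimes> i | a i. a \<in> m \<and> i \<in> I} \<subseteq> {r \<in> carrier k. c \<otimes> r = \<zero>}"
      using c m.a_subset Ic by (intro genideal_minimal[OF ann_ideal]) auto
    then show ?thesis using eq[OF m] i by auto
  qed
  have "(\<forall>z\<in>carrier k. (\<forall>i\<in>I. \<forall>b\<in>B. z \<otimes> i \<otimes> b = \<zero>) \<longrightarrow> (\<forall>i\<in>I. z \<otimes> i = \<zero>)) \<Longrightarrow>
    (\<forall>z\<in>carrier k. (\<forall>i\<in>I. \<forall>b\<in>A. z \<otimes> i \<otimes> b = \<zero>) \<longrightarrow> (\<forall>i\<in>I. z \<otimes> i = \<zero>))"
    if "simple_filtration k (self_module k) A B" for A B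
    using that
  proof induct
    case (step B m b)
    have Bc: "B \<subseteq> carrier k"
      using S.simple_filtration_submodules(2)[OF step(1)] by (auto simp: S.submodule_iff)
    interpret m: maximalideal m k by fact
    have bc: "b \<in> carrier k" using step(4) by simp
    have "\<forall>z\<in>carrier k. (\<forall>i\<in>I. \<forall>b\<in>B. z \<otimes> i \<otimes> b = \<zero>) \<longrightarrow> (\<forall>i\<in>I. z \<otimes> i = \<zero>)"
    proof (intro ballI impI)
      fix z i assume z: "z \<in> carrier k" and h: "\<forall>i\<in>I. \<forall>b\<in>B. z \<otimes> i \<otimes> b = \<zero>" and i: "i \<in> I"
      have zb: "z \<otimes> b \<otimes> i' = \<zero>" if i': "i' \<in> I" for i'
      proof (rule annm[OF step(3) _ _ i'])
        show "z \<otimes> b \<in> carrier k" using z bc by auto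
        fix a j assume aj: "a \<in> m" "j \<in> I"
        have "z \<otimes> b \<otimes> (a \<otimes> j) = z \<otimes> j \<otimes> (a \<otimes> b)"
          using z bc aj m.a_subset Ic by (simp add: subset_iff m_ac)
        also have "\<dots> = \<zero>" using h aj(2) step(5)[OF aj(1)] by simp
        finally show "z \<otimes> b \<otimes> (a \<otimes> j) = \<zero>" .
      qed
      have "z \<otimes> i' \<otimes> b' = \<zero>" if b': "b' \<in> adjoin k (self_module k) B b" and i': "i' \<in> I" for i' b'
      proof -
        obtain c r where cr: "b' = c \<oplus> r \<otimes> b" "c \<in> B" "r \<in> carrier k"
          using b' by (auto simp: adjoin_def)
        have ic: "i' \<in> carrier k" "c \<in> carrier k" using i' Ic cr Bc by auto
        have "z \<otimes> i' \<otimes> b' = z \<otimes> i' \<otimes> c \<oplus> r \<otimes> (z \<otimes> b \<otimes> i')"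
          unfolding cr(1) using z ic bc cr(3) by algebra
        then show ?thesis using h zb i' cr by auto
      qed
      then show "z \<otimes> i = \<zero>" using step(6) z i by blast
    qed
    then show ?case using step(2) by blast
  qed blast
  note Q = this[OF f]
  have Q: "\<exists>i\<in>I. \<exists>i'\<in>I. z \<otimes> i \<otimes> i' \<noteq> \<zero>" if "z \<in> carrier k" "j \<in> I" "z \<otimes> j \<noteq> \<zero>" for z j
  proof -
    have "\<forall>z\<in>carrier k. (\<forall>i\<in>I. \<forall>b\<in>I. z \<otimes> i \<otimes> b = \<zero>) \<longrightarrow> (\<forall>i\<in>I. z \<otimes> i = \<zero>)"
      by (rule Q) (use Ic in \<open>metis m_closed one_closed r_one subsetD\<close>)
    then show ?thesis using that by blast
  qed
  define F where "F = {K. ideal K k \<and> (\<exists>x\<in>K. \<exists>i\<in>I. x \<otimes> i \<noteq> \<zero>)}"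
  obtain i0 where i0: "i0 \<in> I" "i0 \<noteq> \<zero>" using nz I.additive_subgroup_axioms
    by (metis additive_subgroup.zero_closed insertI1 singletonD subsetI subset_antisym subset_singleton_iff)
  have "\<one> \<otimes> i0 \<noteq> \<zero>" using i0 Ic by auto
  then have "carrier k \<in> F" unfolding F_def using i0(1) oneideal by blast
  then have "\<exists>K\<in>F. \<forall>K'\<in>F. K' \<subseteq> K \<longrightarrow> K' = K"
    by (rule artinian_minimal_ideal[OF art]) (simp add: F_def)
  then obtain K where K: "K \<in> F" "\<And>K'. K' \<in> F \<Longrightarrow> K' \<subseteq> K \<Longrightarrow> K' = K"
    by blast
  then obtain x j where xj: "x \<in> K" "j \<in> I" "x \<otimes> j \<noteq> \<zero>" unfolding F_def by blast
  interpret K: ideal K k using K(1) by (simp add: F_def)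
  have xc: "x \<in> carrier k" using xj K.a_subset by auto
  obtain i i' where ii: "i \<in> I" "i' \<in> I" "x \<otimes> i \<otimes> i' \<noteq> \<zero>" using Q[OF xc xj(2,3)] by blast
  have iic: "i \<in> carrier k" "i' \<in> carrier k" using ii Ic by auto
  have xi: "x \<otimes> i \<in> K" using K.I_r_closed xj iic by auto
  have "PIdl (x \<otimes> i) = K"
  proof (rule K(2))
    show "PIdl (x \<otimes> i) \<in> F"
      unfolding F_def using cgenideal_ideal[of "x \<otimes> i"] cgenideal_self[of "x \<otimes> i"] xc iic ii by blast
    show "PIdl (x \<otimes> i) \<subseteq> K" by (rule cgenideal_minimal[OF K.is_ideal xi])
  qed
  then obtain r where r: "r \<in> carrier k" "x = r \<otimes> (x \<otimes> i)" using xj by (auto simp: cgenideal_def)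
  define p where "p = r \<otimes> i"
  have p: "p \<in> I" "p \<in> carrier k" using r ii iic I.I_l_closed by (auto simp: p_def)
  have px: "(\<one> \<ominus> p) \<otimes> x = \<zero>"
  proof -
    have "(\<one> \<ominus> p) \<otimes> x = x \<ominus> r \<otimes> (x \<otimes> i)" unfolding p_def using r(1) xc iic by (algebra; simp)
    also have "\<dots> = \<zero>" using r xc by (metis r_neg a_minus_def)
    finally show ?thesis .
  qed
  have "\<one> \<in> PIdl (\<one> \<ominus> p)"
  proof (rule ccontr)
    assume "\<one> \<notin> PIdl (\<one> \<ominus> p)"
    then obtain m where m: "maximalideal m k" "PIdl (\<one> \<ominus> p) \<subseteq> m"
      using proper_ideal_in_maximalideal[OF k cgenideal_ideal] p by (meson minus_closed one_closed)
    interpret m: maximalideal m k by fact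
    have "Idl {a \<otimes> i | a i. a \<in> m \<and> i \<in> I} \<subseteq> m"
      using Ic by (intro genideal_minimal[OF m.is_ideal]) (auto intro: m.I_r_closed)
    then have "I \<subseteq> m" using eq[OF m(1)] by simp
    then have "p \<in> m" using p by auto
    moreover have "\<one> \<ominus> p \<in> m" using m cgenideal_self[of "\<one> \<ominus> p"] p by auto
    ultimately have "(\<one> \<ominus> p) \<oplus> p \<in> m" by (metis m.a_closed)
    moreover have "(\<one> \<ominus> p) \<oplus> p = \<one>" using p by algebra
    ultimately show False using m.one_imp_carrier m.I_notcarr by auto
  qed
  then obtain s where s: "s \<in> carrier k" "\<one> = s \<otimes> (\<one> \<ominus> p)" by (auto simp: cgenideal_def)
  have "x = s \<otimes> (\<one> \<ominus> p) \<otimes> x" using s xc by (metis l_one)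
  also have "\<dots> = s \<otimes> ((\<one> \<ominus> p) \<otimes> x)" using s(1) xc p by (simp add: m_assoc)
  also have "\<dots> = \<zero>" using px s by simp
  finally show False using xj Ic by (auto simp: subset_iff)
qed

text \<open>Hopkins' theorem: take a minimal ideal among those that are joined to \<open>k\<close> by a filtration. No
  further step leads below it, so it satisfies the hypotheses of the Nakayama argument.\<close>

lemma artinian_simple_filtration:
  assumes k: "cring k" and art: "artinian_ring k"
  shows "simple_filtration k (self_module k) {\<zero>\<^bsub>k\<^esub>} (carrier k)"
proof -
  interpret cring k by fact
  interpret S: module k "self_module k" by (rule module_self_module[OF k])
  let ?F = "{I. simple_filtration k (self_module k) I (carrier k)}"
  have "carrier k \<in> ?F"
    using S.carrier_is_submodule by (auto intro: simple_filtration.base)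
  moreover have "ideal I k" if "I \<in> ?F" for I
    using that S.simple_filtration_submodules(1) k submodule_self_module_iff by blast
  ultimately have "\<exists>I\<in>?F. \<forall>I'\<in>?F. I' \<subseteq> I \<longrightarrow> I' = I"
    by (rule artinian_minimal_ideal[OF art])
  then obtain I where I: "I \<in> ?F" "\<And>I'. I' \<in> ?F \<Longrightarrow> I' \<subseteq> I \<Longrightarrow> I' = I"
    by blast
  have Ii: "ideal I k"
    using I S.simple_filtration_submodules(1) k submodule_self_module_iff by blast
  have "I = {\<zero>\<^bsub>k\<^esub>}"
  proof (rule artinian_nakayama[OF k art])
    show "simple_filtration k (self_module k) I (carrier k)" using I by auto
    fix m assume m: "maximalideal m k"
    show "Idl\<^bsub>k\<^esub> {a \<otimes>\<^bsub>k\<^esub> i |a i. a \<in> m \<and> i \<in> I} = I"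
    proof (rule ccontr)
      assume "Idl\<^bsub>k\<^esub> {a \<otimes>\<^bsub>k\<^esub> i |a i. a \<in> m \<and> i \<in> I} \<noteq> I"
      from artinian_simple_filtration_step[OF k Ii m this] obtain I'
        where I': "I' \<subset> I" "simple_filtration k (self_module k) I' I" by blast
      then have "I' \<in> ?F" using S.simple_filtration_trans I by auto
      then show False using I(2)[of I'] I' by blast
    qed
  qed
  then show ?thesis using I by auto
qed

context module
begin

text \<open>Multiply a filtration of \<open>k\<close> by \<open>s\<close>.\<close>

lemma adjoin_simple_filtration:
  assumes f: "simple_filtration R (self_module R) {\<zero>} (carrier R)"
    and B: "submodule B R M" and s: "s \<in> carrier M"
  shows "simple_filtration R M B (adjoin R M B s)"
proof -
  interpret S: module R "self_module R" by (rule module_self_module) (rule R.is_cring)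
  have Bc: "B \<subseteq> carrier M" using B by (auto simp: submodule_iff)
  have "simple_filtration R M B {b \<oplus>\<^bsub>M\<^esub> r \<odot>\<^bsub>M\<^esub> s | b r. b \<in> B \<and> r \<in> I}"
    if "simple_filtration R (self_module R) {\<zero>} I" for I
    using that
  proof induct
    case base
    have "b \<oplus>\<^bsub>M\<^esub> \<zero> \<odot>\<^bsub>M\<^esub> s = b" if "b \<in> B" for b
      using that Bc s by auto
    then have "{b \<oplus>\<^bsub>M\<^esub> r \<odot>\<^bsub>M\<^esub> s |b r. b \<in> B \<and> r \<in> {\<zero>}} = B"
      by force
    then show ?case using B by (simp add: simple_filtration.base)
  next
    case (step I m c)
    interpret m: maximalideal m R by fact
    have Ic: "I \<subseteq> carrier R"
      using S.simple_filtration_submodules(2)[OF step(1)] by (auto simp: S.submodule_iff)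
    have cc: "c \<in> carrier R" using step(4) by simp
    let ?B = "{b \<oplus>\<^bsub>M\<^esub> r \<odot>\<^bsub>M\<^esub> s |b r. b \<in> B \<and> r \<in> I}"
    have assoc: "b \<oplus>\<^bsub>M\<^esub> (i \<oplus> t \<otimes> c) \<odot>\<^bsub>M\<^esub> s = (b \<oplus>\<^bsub>M\<^esub> i \<odot>\<^bsub>M\<^esub> s) \<oplus>\<^bsub>M\<^esub> t \<odot>\<^bsub>M\<^esub> (c \<odot>\<^bsub>M\<^esub> s)"
      if "b \<in> B" "i \<in> I" "t \<in> carrier R" for b i t
      using that Bc Ic cc s by (simp add: subset_iff smult_l_distr smult_assoc1 M.a_assoc)
    have "{b \<oplus>\<^bsub>M\<^esub> r \<odot>\<^bsub>M\<^esub> s |b r. b \<in> B \<and> r \<in> adjoin R (self_module R) I c}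
        = adjoin R M ?B (c \<odot>\<^bsub>M\<^esub> s)"
    proof (intro equalityI subsetI)
      fix x assume "x \<in> {b \<oplus>\<^bsub>M\<^esub> r \<odot>\<^bsub>M\<^esub> s |b r. b \<in> B \<and> r \<in> adjoin R (self_module R) I c}"
      then obtain b i t where "x = b \<oplus>\<^bsub>M\<^esub> (i \<oplus> t \<otimes> c) \<odot>\<^bsub>M\<^esub> s" "b \<in> B" "i \<in> I" "t \<in> carrier R"
        by (auto simp: adjoin_def)
      then show "x \<in> adjoin R M ?B (c \<odot>\<^bsub>M\<^esub> s)"
        unfolding adjoin_def using assoc by blast
    next
      fix x assume "x \<in> adjoin R M ?B (c \<odot>\<^bsub>M\<^esub> s)"
      then obtain b i t where "x = (b \<oplus>\<^bsub>M\<^esub> i \<odot>\<^bsub>M\<^esub> s) \<oplus>\<^bsub>M\<^esub> t \<odot>\<^bsub>M\<^esub> (c \<odot>\<^bsub>M\<^esub> s)"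
        "b \<in> B" "i \<in> I" "t \<in> carrier R"
        by (auto simp: adjoin_def)
      then show "x \<in> {b \<oplus>\<^bsub>M\<^esub> r \<odot>\<^bsub>M\<^esub> s |b r. b \<in> B \<and> r \<in> adjoin R (self_module R) I c}"
        using assoc by (auto simp: adjoin_def) metis
    qed
    moreover have "simple_filtration R M B (adjoin R M ?B (c \<odot>\<^bsub>M\<^esub> s))"
    proof (rule simple_filtration.step[OF step(2,3)])
      show "c \<odot>\<^bsub>M\<^esub> s \<in> carrier M" using cc s by auto
      fix a assume a: "a \<in> m"
      then have ac: "a \<in> carrier R" using m.a_subset by auto
      have "a \<odot>\<^bsub>M\<^esub> (c \<odot>\<^bsub>M\<^esub> s) = \<zero>\<^bsub>M\<^esub> \<oplus>\<^bsub>M\<^esub> (a \<otimes> c) \<odot>\<^bsub>M\<^esub> s"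
        using ac cc s by (simp add: smult_assoc1)
      moreover have "a \<otimes> c \<in> I" using step(5)[OF a] by simp
      moreover have "\<zero>\<^bsub>M\<^esub> \<in> B" using B by (auto simp: submodule_iff)
      ultimately show "a \<odot>\<^bsub>M\<^esub> (c \<odot>\<^bsub>M\<^esub> s) \<in> ?B" by blast
    qed
    ultimately show ?case by simp
  qed
  from this[OF f] show ?thesis by (simp add: adjoin_def)
qed

lemma finite_generation_simple_filtration:
  assumes f: "simple_filtration R (self_module R) {\<zero>} (carrier R)"
    and S: "finite S" "S \<subseteq> carrier M"
    and gen: "\<And>V. submodule V R M \<Longrightarrow> S \<subseteq> V \<Longrightarrow> V = carrier M"
  shows "simple_filtration R M {\<zero>\<^bsub>M\<^esub>} (carrier M)"
proof -
  have "\<exists>B. simple_filtration R M {\<zero>\<^bsub>M\<^esub>} B \<and> S \<subseteq> B"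
    using S
  proof (induct rule: finite_induct)
    case empty
    then show ?case using zero_submodule simple_filtration.base by blast
  next
    case (insert s S)
    then obtain B where B: "simple_filtration R M {\<zero>\<^bsub>M\<^esub>} B" "S \<subseteq> B" by auto
    note sub = simple_filtration_submodules(2)[OF B(1)]
    have sc: "s \<in> carrier M" using insert by auto
    have "simple_filtration R M {\<zero>\<^bsub>M\<^esub>} (adjoin R M B s)"
      by (rule simple_filtration_trans[OF adjoin_simple_filtration[OF f sub sc] B(1)])
    moreover have "insert s S \<subseteq> adjoin R M B s"
      using subset_adjoin[OF sub sc] in_adjoin[OF sub sc] B(2) by blast
    ultimately show ?case by blast
  qed
  then show ?thesis using gen simple_filtration_submodules(2) by metis
qed

text \<open>Finite generation is expressed through the submodules that contain the generators, which is the
  form in which annihilators are compared. Each step of the filtration needs at most one new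
  generator: if \<open>w \<in> U\<close> lies in the new module but not in \<open>B\<close>, then its coefficient at \<open>b\<close> is invertible
  modulo \<open>m\<close>, and subtracting multiples of \<open>w\<close> moves the other elements of \<open>U\<close> into \<open>B\<close>.\<close>

lemma submodule_finitely_generated:
  assumes f: "simple_filtration R M {\<zero>\<^bsub>M\<^esub>} B" and U: "submodule U R M"
  shows "\<exists>S. finite S \<and> S \<subseteq> U \<inter> B \<and> (\<forall>V. submodule V R M \<longrightarrow> S \<subseteq> V \<longrightarrow> U \<inter> B \<subseteq> V)"
  using f
proof induct
  case base
  show ?case by (intro exI[of _ "{}"]) (auto simp: submodule_iff)
next
  case (step B m b)
  then obtain S where S: "finite S" "S \<subseteq> U \<inter> B" "\<And>V. submodule V R M \<Longrightarrow> S \<subseteq> V \<Longrightarrow> U \<inter> B \<subseteq> V"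
    by auto
  note sub = simple_filtration_submodules(2)[OF step(1)]
  interpret m: maximalideal m R by fact
  have Bc: "B \<subseteq> carrier M" using sub by (auto simp: submodule_iff)
  have BB: "B \<subseteq> adjoin R M B b" by (rule subset_adjoin[OF sub step(4)])
  show ?case
  proof (cases "U \<inter> adjoin R M B b \<subseteq> B")
    case True
    then have "U \<inter> adjoin R M B b = U \<inter> B" using BB by auto
    then show ?thesis using S by (intro exI[of _ S]) auto
  next
    case False
    then obtain w where w: "w \<in> U" "w \<in> adjoin R M B b" "w \<notin> B" by auto
    then obtain b' r where br: "w = b' \<oplus>\<^bsub>M\<^esub> r \<odot>\<^bsub>M\<^esub> b" "b' \<in> B" "r \<in> carrier R"
      by (auto simp: adjoin_def)
    have "r \<notin> m" using step(5) br w sub by (auto simp: submodule_iff)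
    then obtain p where p: "p \<in> carrier R" "\<one> \<ominus> p \<otimes> r \<in> m"
      using maximalideal_inverse_mod[OF _ step(3)] br R.is_cring by blast
    have wc: "w \<in> carrier M" using w U by (auto simp: submodule_iff)
    have b'c: "b' \<in> carrier M" using br Bc by auto
    have "v \<in> V" if V: "submodule V R M" "insert w S \<subseteq> V" and v: "v \<in> U" "v \<in> adjoin R M B b" for V v
    proof -
      obtain c t where ct: "v = c \<oplus>\<^bsub>M\<^esub> t \<odot>\<^bsub>M\<^esub> b" "c \<in> B" "t \<in> carrier R"
        using v by (auto simp: adjoin_def)
      have cM: "c \<in> carrier M" using ct Bc by auto
      define d where "d = v \<oplus>\<^bsub>M\<^esub> (\<ominus> (t \<otimes> p)) \<odot>\<^bsub>M\<^esub> w"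
      have e1: "(t \<otimes> (\<one> \<ominus> p \<otimes> r)) \<odot>\<^bsub>M\<^esub> b = t \<odot>\<^bsub>M\<^esub> b \<oplus>\<^bsub>M\<^esub> (\<ominus> (t \<otimes> p)) \<odot>\<^bsub>M\<^esub> (r \<odot>\<^bsub>M\<^esub> b)"
      proof -
        have "t \<otimes> (\<one> \<ominus> p \<otimes> r) = t \<oplus> (\<ominus> (t \<otimes> p)) \<otimes> r" using ct(3) p(1) br(3) by algebra
        then show ?thesis using ct(3) p(1) br(3) step(4) by (simp add: smult_l_distr smult_assoc1)
      qed
      have "d = (c \<oplus>\<^bsub>M\<^esub> (\<ominus> (t \<otimes> p)) \<odot>\<^bsub>M\<^esub> b') \<oplus>\<^bsub>M\<^esub> t \<odot>\<^bsub>M\<^esub> ((\<one> \<ominus> p \<otimes> r) \<odot>\<^bsub>M\<^esub> b)"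
        unfolding d_def ct(1) br(1) using cM b'c ct(3) p(1) br(3) step(4) e1
        by (simp add: smult_r_distr M.a_ac smult_assoc1)
      moreover have "(\<one> \<ominus> p \<otimes> r) \<odot>\<^bsub>M\<^esub> b \<in> B" using step(5) p by auto
      ultimately have "d \<in> B" using sub ct br p by (simp add: submodule_iff)
      moreover have "d \<in> U" unfolding d_def using U v w ct p by (simp add: submodule_iff)
      ultimately have "d \<in> V" using S(3)[OF V(1)] V(2) by auto
      moreover have "v = d \<oplus>\<^bsub>M\<^esub> (t \<otimes> p) \<odot>\<^bsub>M\<^esub> w"
        unfolding d_def using ct p wc v U
        by (simp add: submodule_iff subset_iff smult_l_minus M.a_assoc M.l_neg)
      ultimately show ?thesis using V ct p by (simp add: submodule_iff)
    qed
    then show ?thesis using S w BB by (intro exI[of _ "insert w S"]) auto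
  qed
qed

end

lemma finitely_generated_module_simple_filtration:
  assumes M: "module k M" and art: "artinian_ring k" and fg: "finitely_generated_module k M"
  shows "simple_filtration k M {\<zero>\<^bsub>M\<^esub>} (carrier M)"
proof -
  interpret module k M by fact
  obtain S where S: "finite S" "S \<subseteq> carrier M"
    "\<And>x. x \<in> carrier M \<Longrightarrow> \<exists>c \<in> S \<rightarrow> carrier k. x = (\<Oplus>\<^bsub>M\<^esub>s\<in>S. c s \<odot>\<^bsub>M\<^esub> s)"
    using fg unfolding finitely_generated_module_def by blast
  show ?thesis
  proof (rule finite_generation_simple_filtration[OF _ S(1,2)])
    show "simple_filtration k (self_module k) {\<zero>\<^bsub>k\<^esub>} (carrier k)"
      by (rule artinian_simple_filtration[OF _ art]) (rule R.is_cring)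
    fix V assume V: "submodule V k M" "S \<subseteq> V"
    have sum: "(\<Oplus>\<^bsub>M\<^esub>s\<in>T. c s \<odot>\<^bsub>M\<^esub> s) \<in> V" if "finite T" "T \<subseteq> S" "c \<in> S \<rightarrow> carrier k" for c T
      using that
    proof (induct rule: finite_induct)
      case empty
      then show ?case using V by (simp add: submodule_iff)
    next
      case (insert t T)
      have "(\<Oplus>\<^bsub>M\<^esub>s\<in>insert t T. c s \<odot>\<^bsub>M\<^esub> s) = c t \<odot>\<^bsub>M\<^esub> t \<oplus>\<^bsub>M\<^esub> (\<Oplus>\<^bsub>M\<^esub>s\<in>T. c s \<odot>\<^bsub>M\<^esub> s)"
        using insert S(2) by (intro M.finsum_insert) (auto simp: Pi_iff subset_iff)
      moreover have "c t \<odot>\<^bsub>M\<^esub> t \<in> V" using V insert by (auto simp: submodule_iff Pi_iff)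
      ultimately show ?case using insert V by (simp add: submodule_iff)
    qed
    show "V = carrier M"
      using V S(3) sum[OF S(1)] by (auto simp: submodule_iff)
  qed
qed

section \<open>Extension of linear maps\<close>

lemma linear_mapD:
  assumes "linear_map k M N f"
  shows "x \<in> carrier M \<Longrightarrow> f x \<in> carrier N"
    and "x \<in> carrier M \<Longrightarrow> y \<in> carrier M \<Longrightarrow> f (x \<oplus>\<^bsub>M\<^esub> y) = f x \<oplus>\<^bsub>N\<^esub> f y"
    and "r \<in> carrier k \<Longrightarrow> x \<in> carrier M \<Longrightarrow> f (r \<odot>\<^bsub>M\<^esub> x) = r \<odot>\<^bsub>N\<^esub> f x"
  using assms by (auto simp: linear_map_def)

lemma linear_map_zero:
  assumes "module k M" "module k N" "linear_map k M N f"
  shows "f \<zero>\<^bsub>M\<^esub> = \<zero>\<^bsub>N\<^esub>"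
proof -
  interpret M: module k M by fact
  interpret N: module k N by fact
  have "f (\<zero>\<^bsub>k\<^esub> \<odot>\<^bsub>M\<^esub> \<zero>\<^bsub>M\<^esub>) = \<zero>\<^bsub>k\<^esub> \<odot>\<^bsub>N\<^esub> f \<zero>\<^bsub>M\<^esub>"
    by (rule linear_mapD(3)[OF assms(3)]) auto
  then show ?thesis using linear_mapD(1)[OF assms(3)] by simp
qed

lemma linear_map_minus:
  assumes "module k M" "module k N" "linear_map k M N f" "x \<in> carrier M" "y \<in> carrier M"
  shows "f (x \<ominus>\<^bsub>M\<^esub> y) = f x \<ominus>\<^bsub>N\<^esub> f y"
proof -
  interpret M: module k M by fact
  interpret N: module k N by fact
  note l = linear_mapD[OF assms(3)]
  have "f (\<ominus>\<^bsub>M\<^esub> y) = \<ominus>\<^bsub>N\<^esub> f y"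
    using l(3)[of "\<ominus>\<^bsub>k\<^esub> \<one>\<^bsub>k\<^esub>" y] assms l(1) by (simp add: M.smult_l_minus N.smult_l_minus)
  then show ?thesis using l(2) assms by (simp add: a_minus_def)
qed

lemma linear_map_comp:
  "linear_map k M N f \<Longrightarrow> linear_map k N P g \<Longrightarrow> linear_map k M P (\<lambda>x. g (f x))"
  by (auto simp: linear_map_def Pi_iff)

text \<open>Graphs of linear maps from submodules of \<open>M\<close> to \<open>J\<close>. Graphs are ordered by inclusion, as Zorn's
  lemma requires, and carry no junk values outside their domains.\<close>

definition lin_graph ::
    "('k, 'r) ring_scheme \<Rightarrow> ('k, 'a, 'x) module_scheme \<Rightarrow> ('k, 'b, 'y) module_scheme \<Rightarrow> ('a \<times> 'b) set \<Rightarrow> bool"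
  where "lin_graph k M J G \<longleftrightarrow> G \<subseteq> carrier M \<times> carrier J \<and> (\<zero>\<^bsub>M\<^esub>, \<zero>\<^bsub>J\<^esub>) \<in> G \<and>
    (\<forall>x y x' y'. (x, y) \<in> G \<longrightarrow> (x', y') \<in> G \<longrightarrow> (x \<oplus>\<^bsub>M\<^esub> x', y \<oplus>\<^bsub>J\<^esub> y') \<in> G) \<and>
    (\<forall>r x y. r \<in> carrier k \<longrightarrow> (x, y) \<in> G \<longrightarrow> (r \<odot>\<^bsub>M\<^esub> x, r \<odot>\<^bsub>J\<^esub> y) \<in> G) \<and>
    (\<forall>y. (\<zero>\<^bsub>M\<^esub>, y) \<in> G \<longrightarrow> y = \<zero>\<^bsub>J\<^esub>)"

locale two_modules = M: module k M + J: module k J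
  for k :: "('k, 'r) ring_scheme" (structure)
    and M :: "('k, 'a, 'x) module_scheme" and J :: "('k, 'b, 'y) module_scheme"
begin

lemma lin_graph_unique:
  assumes G: "lin_graph k M J G" and xy: "(x, y) \<in> G" "(x, z) \<in> G"
  shows "y = z"
proof -
  have c: "x \<in> carrier M" "y \<in> carrier J" "z \<in> carrier J" using assms by (auto simp: lin_graph_def)
  have "((\<ominus> \<one>) \<odot>\<^bsub>M\<^esub> x, (\<ominus> \<one>) \<odot>\<^bsub>J\<^esub> z) \<in> G" using G xy by (auto simp: lin_graph_def)
  then have "(\<ominus>\<^bsub>M\<^esub> x, \<ominus>\<^bsub>J\<^esub> z) \<in> G" using c by (simp add: M.smult_l_minus J.smult_l_minus)
  then have "(x \<oplus>\<^bsub>M\<^esub> \<ominus>\<^bsub>M\<^esub> x, y \<oplus>\<^bsub>J\<^esub> \<ominus>\<^bsub>J\<^esub> z) \<in> G" using G xy(1) unfolding lin_graph_def by blast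
  then have "y \<oplus>\<^bsub>J\<^esub> \<ominus>\<^bsub>J\<^esub> z = \<zero>\<^bsub>J\<^esub>" using G c by (auto simp: lin_graph_def M.M.r_neg)
  then show ?thesis using c by (metis J.M.minus_equality J.M.minus_minus J.M.a_inv_closed J.M.a_comm)
qed

lemma lin_graph_extend:
  assumes G: "lin_graph k M J G" and xy: "x \<in> carrier M" "y \<in> carrier J"
    and comp: "\<And>r z. r \<in> carrier k \<Longrightarrow> (r \<odot>\<^bsub>M\<^esub> x, z) \<in> G \<Longrightarrow> z = r \<odot>\<^bsub>J\<^esub> y"
  shows "\<exists>G'. lin_graph k M J G' \<and> G \<subseteq> G' \<and> (x, y) \<in> G'"
proof (intro exI conjI)
  let ?G = "{(a \<oplus>\<^bsub>M\<^esub> r \<odot>\<^bsub>M\<^esub> x, b \<oplus>\<^bsub>J\<^esub> r \<odot>\<^bsub>J\<^esub> y) | a b r. (a, b) \<in> G \<and> r \<in> carrier k}"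
  have Gc: "a \<in> carrier M" "b \<in> carrier J" if "(a, b) \<in> G" for a b
    using that G by (auto simp: lin_graph_def)
  have Ga: "(a \<oplus>\<^bsub>M\<^esub> a', b \<oplus>\<^bsub>J\<^esub> b') \<in> G" if "(a, b) \<in> G" "(a', b') \<in> G" for a b a' b'
    using that G by (auto simp: lin_graph_def)
  have Gm: "(r \<odot>\<^bsub>M\<^esub> a, r \<odot>\<^bsub>J\<^esub> b) \<in> G" if "(a, b) \<in> G" "r \<in> carrier k" for a b r
    using that G by (auto simp: lin_graph_def)
  have G0: "(\<zero>\<^bsub>M\<^esub>, \<zero>\<^bsub>J\<^esub>) \<in> G" using G by (auto simp: lin_graph_def)
  have memI: "(a \<oplus>\<^bsub>M\<^esub> r \<odot>\<^bsub>M\<^esub> x, b \<oplus>\<^bsub>J\<^esub> r \<odot>\<^bsub>J\<^esub> y) \<in> ?G" if "(a, b) \<in> G" "r \<in> carrier k" for a b r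
    using that by blast
  show sub: "G \<subseteq> ?G"
  proof safe
    fix a b assume ab: "(a, b) \<in> G"
    from memI[OF ab, of \<zero>] Gc[OF ab] xy
    show "\<exists>a' b' r. (a, b) = (a' \<oplus>\<^bsub>M\<^esub> r \<odot>\<^bsub>M\<^esub> x, b' \<oplus>\<^bsub>J\<^esub> r \<odot>\<^bsub>J\<^esub> y) \<and> (a', b') \<in> G \<and> r \<in> carrier k"
      by simp
  qed
  show "(x, y) \<in> ?G" using memI[OF G0, of \<one>] xy by simp
  show "lin_graph k M J ?G"
    unfolding lin_graph_def
  proof (intro conjI allI impI)
    show "?G \<subseteq> carrier M \<times> carrier J" using Gc xy by auto
    show "(\<zero>\<^bsub>M\<^esub>, \<zero>\<^bsub>J\<^esub>) \<in> ?G" using sub G0 by blast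
  next
    fix p q p' q' assume "(p, q) \<in> ?G" "(p', q') \<in> ?G"
    then obtain a b r a' b' r' where
      e: "p = a \<oplus>\<^bsub>M\<^esub> r \<odot>\<^bsub>M\<^esub> x" "q = b \<oplus>\<^bsub>J\<^esub> r \<odot>\<^bsub>J\<^esub> y" "(a, b) \<in> G" "r \<in> carrier k"
        "p' = a' \<oplus>\<^bsub>M\<^esub> r' \<odot>\<^bsub>M\<^esub> x" "q' = b' \<oplus>\<^bsub>J\<^esub> r' \<odot>\<^bsub>J\<^esub> y" "(a', b') \<in> G" "r' \<in> carrier k"
      by blast
    note c = Gc[OF e(3)] Gc[OF e(7)]
    have "p \<oplus>\<^bsub>M\<^esub> p' = (a \<oplus>\<^bsub>M\<^esub> a') \<oplus>\<^bsub>M\<^esub> (r \<oplus> r') \<odot>\<^bsub>M\<^esub> x"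
      using e(1,4,5,8) c xy by (simp add: M.smult_l_distr M.M.a_ac)
    moreover have "q \<oplus>\<^bsub>J\<^esub> q' = (b \<oplus>\<^bsub>J\<^esub> b') \<oplus>\<^bsub>J\<^esub> (r \<oplus> r') \<odot>\<^bsub>J\<^esub> y"
      using e(2,4,6,8) c xy by (simp add: J.smult_l_distr J.M.a_ac)
    ultimately show "(p \<oplus>\<^bsub>M\<^esub> p', q \<oplus>\<^bsub>J\<^esub> q') \<in> ?G"
      using memI[OF Ga[OF e(3,7)], of "r \<oplus> r'"] e(4,8) by simp
  next
    fix s p q assume s: "s \<in> carrier k" and "(p, q) \<in> ?G"
    then obtain a b r where
      e: "p = a \<oplus>\<^bsub>M\<^esub> r \<odot>\<^bsub>M\<^esub> x" "q = b \<oplus>\<^bsub>J\<^esub> r \<odot>\<^bsub>J\<^esub> y" "(a, b) \<in> G" "r \<in> carrier k"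
      by blast
    note c = Gc[OF e(3)]
    have "s \<odot>\<^bsub>M\<^esub> p = s \<odot>\<^bsub>M\<^esub> a \<oplus>\<^bsub>M\<^esub> (s \<otimes> r) \<odot>\<^bsub>M\<^esub> x"
      using e(1,4) c s xy by (simp add: M.smult_r_distr M.smult_assoc1)
    moreover have "s \<odot>\<^bsub>J\<^esub> q = s \<odot>\<^bsub>J\<^esub> b \<oplus>\<^bsub>J\<^esub> (s \<otimes> r) \<odot>\<^bsub>J\<^esub> y"
      using e(2,4) c s xy by (simp add: J.smult_r_distr J.smult_assoc1)
    ultimately show "(s \<odot>\<^bsub>M\<^esub> p, s \<odot>\<^bsub>J\<^esub> q) \<in> ?G"
      using memI[OF Gm[OF e(3) s], of "s \<otimes> r"] e(4) s by simp
  next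
    fix q assume "(\<zero>\<^bsub>M\<^esub>, q) \<in> ?G"
    then obtain a b r where
      e: "\<zero>\<^bsub>M\<^esub> = a \<oplus>\<^bsub>M\<^esub> r \<odot>\<^bsub>M\<^esub> x" "q = b \<oplus>\<^bsub>J\<^esub> r \<odot>\<^bsub>J\<^esub> y" "(a, b) \<in> G" "r \<in> carrier k"
      by blast
    note c = Gc[OF e(3)]
    have "a = (\<ominus> r) \<odot>\<^bsub>M\<^esub> x"
      using e(1,4) c(1) xy(1) by (simp add: M.smult_l_minus) (metis M.M.minus_equality M.smult_closed)
    then have "b = (\<ominus> r) \<odot>\<^bsub>J\<^esub> y" using comp[of "\<ominus> r" b] e by auto
    then show "q = \<zero>\<^bsub>J\<^esub>" using e(2,4) xy by (simp add: J.smult_l_minus J.M.l_neg)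
  qed
qed

lemma lin_graph_maximal:
  assumes "lin_graph k M J G0"
  shows "\<exists>G. lin_graph k M J G \<and> G0 \<subseteq> G \<and> (\<forall>G'. lin_graph k M J G' \<longrightarrow> G \<subseteq> G' \<longrightarrow> G' = G)"
proof -
  define A where "A = {G. lin_graph k M J G \<and> G0 \<subseteq> G}"
  have "\<exists>G\<in>A. \<forall>X\<in>A. G \<subseteq> X \<longrightarrow> X = G"
  proof (rule subset_Zorn_nonempty)
    show "A \<noteq> {}" using assms by (auto simp: A_def)
    fix \<C> assume ne: "\<C> \<noteq> {}" and ch: "subset.chain A \<C>"
    then have g: "lin_graph k M J G" "G0 \<subseteq> G" if "G \<in> \<C>" for G
      using that by (auto simp: subset.chain_def A_def)
    have "lin_graph k M J (\<Union>\<C>)"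
      unfolding lin_graph_def
    proof (intro conjI allI impI)
      show "\<Union>\<C> \<subseteq> carrier M \<times> carrier J" using g(1) unfolding lin_graph_def by (meson Sup_least)
      show "(\<zero>\<^bsub>M\<^esub>, \<zero>\<^bsub>J\<^esub>) \<in> \<Union>\<C>" using g(1) ne by (auto simp: lin_graph_def)
      show "(r \<odot>\<^bsub>M\<^esub> x, r \<odot>\<^bsub>J\<^esub> y) \<in> \<Union>\<C>" if "r \<in> carrier k" "(x, y) \<in> \<Union>\<C>" for r x y
        using that g(1) unfolding lin_graph_def by (meson UnionE UnionI)
      show "y = \<zero>\<^bsub>J\<^esub>" if "(\<zero>\<^bsub>M\<^esub>, y) \<in> \<Union>\<C>" for y
        using that g(1) unfolding lin_graph_def by (meson UnionE)
      fix x y x' y' assume "(x, y) \<in> \<Union>\<C>" "(x', y') \<in> \<Union>\<C>"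
      then obtain P Q where PQ: "P \<in> \<C>" "Q \<in> \<C>" "(x, y) \<in> P" "(x', y') \<in> Q" by auto
      then have "P \<subseteq> Q \<or> Q \<subseteq> P" using ch by (auto simp: subset.chain_def)
      then obtain H where H: "H \<in> \<C>" "(x, y) \<in> H" "(x', y') \<in> H" using PQ by blast
      then have "(x \<oplus>\<^bsub>M\<^esub> x', y \<oplus>\<^bsub>J\<^esub> y') \<in> H" using g(1)[OF H(1)] unfolding lin_graph_def by blast
      then show "(x \<oplus>\<^bsub>M\<^esub> x', y \<oplus>\<^bsub>J\<^esub> y') \<in> \<Union>\<C>" using H by blast
    qed
    moreover have "G0 \<subseteq> \<Union>\<C>" using g(2) ne by blast
    ultimately show "\<Union>\<C> \<in> A" by (simp add: A_def)
  qed
  then obtain G where G: "G \<in> A" "\<forall>X\<in>A. G \<subseteq> X \<longrightarrow> X = G" by blast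
  then have "\<forall>G'. lin_graph k M J G' \<longrightarrow> G \<subseteq> G' \<longrightarrow> G' = G" by (auto simp: A_def)
  then show ?thesis using G(1) unfolding A_def by blast
qed

lemma lin_graph_total_map:
  assumes G: "lin_graph k M J G" and tot: "\<And>x. x \<in> carrier M \<Longrightarrow> \<exists>y. (x, y) \<in> G"
  shows "\<exists>h. linear_map k M J h \<and> (\<forall>x y. (x, y) \<in> G \<longrightarrow> h x = y)"
proof -
  define h where "h x = (THE y. (x, y) \<in> G)" for x
  have h: "h x = y" if "(x, y) \<in> G" for x y
    unfolding h_def using that lin_graph_unique[OF G] by blast
  have hG: "(x, h x) \<in> G" if "x \<in> carrier M" for x using tot[OF that] h by blast
  have "linear_map k M J h"
    unfolding linear_map_def
  proof (intro conjI ballI)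
    show "h \<in> carrier M \<rightarrow> carrier J" using hG G by (auto simp: lin_graph_def)
    show "h (x \<oplus>\<^bsub>M\<^esub> y) = h x \<oplus>\<^bsub>J\<^esub> h y" if "x \<in> carrier M" "y \<in> carrier M" for x y
      using hG[OF that(1)] hG[OF that(2)] G by (intro h) (auto simp: lin_graph_def)
    show "h (r \<odot>\<^bsub>M\<^esub> x) = r \<odot>\<^bsub>J\<^esub> h x" if "r \<in> carrier k" "x \<in> carrier M" for r x
      using hG[OF that(2)] that G by (intro h) (auto simp: lin_graph_def)
  qed
  then show ?thesis using h by blast
qed

end

text \<open>Baer's criterion for injectivity: a linear map from an ideal to \<open>J\<close> extends to \<open>k\<close> if and only if it
  is multiplication of some \<open>y \<in> J\<close> by scalars.\<close>

definition baer :: "('k, 'r) ring_scheme \<Rightarrow> ('k, 'j, 'y) module_scheme \<Rightarrow> bool"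
  where "baer k J \<longleftrightarrow> (\<forall>I g. ideal I k \<longrightarrow> (\<forall>r\<in>I. g r \<in> carrier J) \<longrightarrow>
    (\<forall>r\<in>I. \<forall>s\<in>I. g (r \<oplus>\<^bsub>k\<^esub> s) = g r \<oplus>\<^bsub>J\<^esub> g s) \<longrightarrow>
    (\<forall>r\<in>carrier k. \<forall>s\<in>I. g (r \<otimes>\<^bsub>k\<^esub> s) = r \<odot>\<^bsub>J\<^esub> g s) \<longrightarrow>
    (\<exists>y\<in>carrier J. \<forall>r\<in>I. g r = r \<odot>\<^bsub>J\<^esub> y))"

context two_modules
begin

text \<open>Such a \<open>y\<close> is a consistent value at \<open>x\<close> for an extension of the map with graph \<open>G\<close>; Baer's condition
  is applied to \<open>r \<mapsto> G(r x)\<close>, which is defined on an ideal.\<close>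

lemma baer_value:
  assumes b: "baer k J" and G: "lin_graph k M J G" and x: "x \<in> carrier M"
  shows "\<exists>y\<in>carrier J. \<forall>r z. r \<in> carrier k \<longrightarrow> (r \<odot>\<^bsub>M\<^esub> x, z) \<in> G \<longrightarrow> z = r \<odot>\<^bsub>J\<^esub> y"
proof -
  let ?D = "{a. \<exists>z. (a, z) \<in> G}"
  define I where "I = {r \<in> carrier k. r \<odot>\<^bsub>M\<^esub> x \<in> ?D}"
  define g where "g r = (THE z. (r \<odot>\<^bsub>M\<^esub> x, z) \<in> G)" for r
  have D: "submodule ?D k M"
    using G unfolding M.submodule_iff lin_graph_def by blast
  have I: "ideal I k" unfolding I_def by (rule M.submodule_conductor_ideal[OF D x])
  have g: "g r = z" if "(r \<odot>\<^bsub>M\<^esub> x, z) \<in> G" for r z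
    unfolding g_def using that lin_graph_unique[OF G] by blast
  have gG: "(r \<odot>\<^bsub>M\<^esub> x, g r) \<in> G" if "r \<in> I" for r using that g by (auto simp: I_def)
  have "\<exists>y\<in>carrier J. \<forall>r\<in>I. g r = r \<odot>\<^bsub>J\<^esub> y"
  proof (rule b[unfolded baer_def, rule_format, OF I])
    show "g r \<in> carrier J" if "r \<in> I" for r using gG[OF that] G by (auto simp: lin_graph_def)
    fix r s assume r: "r \<in> I" and s: "s \<in> I"
    then have rs: "r \<in> carrier k" "s \<in> carrier k" by (auto simp: I_def)
    have "(r \<odot>\<^bsub>M\<^esub> x \<oplus>\<^bsub>M\<^esub> s \<odot>\<^bsub>M\<^esub> x, g r \<oplus>\<^bsub>J\<^esub> g s) \<in> G"
      using gG[OF r] gG[OF s] G unfolding lin_graph_def by blast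
    then show "g (r \<oplus> s) = g r \<oplus>\<^bsub>J\<^esub> g s" using rs x by (intro g) (simp add: M.smult_l_distr)
  next
    fix r s assume r: "r \<in> carrier k" and s: "s \<in> I"
    then have rs: "s \<in> carrier k" by (auto simp: I_def)
    have "(r \<odot>\<^bsub>M\<^esub> (s \<odot>\<^bsub>M\<^esub> x), r \<odot>\<^bsub>J\<^esub> g s) \<in> G"
      using gG[OF s] r G unfolding lin_graph_def by blast
    then show "g (r \<otimes> s) = r \<odot>\<^bsub>J\<^esub> g s" using r rs x by (intro g) (simp add: M.smult_assoc1)
  qed
  then obtain y where y: "y \<in> carrier J" "\<And>r. r \<in> I \<Longrightarrow> g r = r \<odot>\<^bsub>J\<^esub> y" by blast
  have "z = r \<odot>\<^bsub>J\<^esub> y" if "r \<in> carrier k" "(r \<odot>\<^bsub>M\<^esub> x, z) \<in> G" for r z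
  proof -
    have "r \<in> I" using that by (auto simp: I_def)
    then show ?thesis using g[OF that(2)] y(2) by simp
  qed
  then show ?thesis using y(1) by blast
qed

lemma baer_extension:
  assumes b: "baer k J" and G0: "lin_graph k M J G0"
  shows "\<exists>h. linear_map k M J h \<and> (\<forall>x y. (x, y) \<in> G0 \<longrightarrow> h x = y)"
proof -
  obtain G where G: "lin_graph k M J G" "G0 \<subseteq> G"
    "\<And>G'. lin_graph k M J G' \<Longrightarrow> G \<subseteq> G' \<Longrightarrow> G' = G"
    using lin_graph_maximal[OF G0] by blast
  have "\<exists>y. (x, y) \<in> G" if x: "x \<in> carrier M" for x
  proof -
    obtain y where y: "y \<in> carrier J" "\<And>r z. r \<in> carrier k \<Longrightarrow> (r \<odot>\<^bsub>M\<^esub> x, z) \<in> G \<Longrightarrow> z = r \<odot>\<^bsub>J\<^esub> y"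
      using baer_value[OF b G(1) x] by blast
    from lin_graph_extend[OF G(1) x y] G(3) show ?thesis by blast
  qed
  from lin_graph_total_map[OF G(1) this] G(2) show ?thesis by blast
qed

end

section \<open>The minimal injective cogenerator\<close>

text \<open>Replacing every \<open>a\<close> by the singleton \<open>{a}\<close> turns an ideal and \<open>k\<close> itself into modules with elements
  in \<^typ>\<open>'k set\<close>, which are among the test modules.\<close>

lemma injective_module_baer:
  fixes k (structure) and J :: "('k, 'j) module"
  assumes k: "cring k" and inj: "injective_module k J"
  shows "baer k J"
  unfolding baer_def
proof (intro allI impI)
  interpret cring k by fact
  fix I g
  assume I: "ideal I k" and g: "\<forall>r\<in>I. g r \<in> carrier J"
    "\<forall>r\<in>I. \<forall>s\<in>I. g (r \<oplus> s) = g r \<oplus>\<^bsub>J\<^esub> g s" "\<forall>r\<in>carrier k. \<forall>s\<in>I. g (r \<otimes> s) = r \<odot>\<^bsub>J\<^esub> g s"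
  define sing :: "'k set \<Rightarrow> ('k, 'k set) module" where
    "sing S = \<lparr>carrier = (\<lambda>a. {a}) ` S, mult = undefined, one = undefined, zero = {\<zero>},
      add = (\<lambda>X Y. {the_elem X \<oplus> the_elem Y}), smult = (\<lambda>r X. {r \<otimes> the_elem X})\<rparr>" for S
  have sing_simps: "carrier (sing S) = (\<lambda>a. {a}) ` S" "zero (sing S) = {\<zero>}"
    "X \<oplus>\<^bsub>sing S\<^esub> Y = {the_elem X \<oplus> the_elem Y}" "r \<odot>\<^bsub>sing S\<^esub> X = {r \<otimes> the_elem X}" for S X Y r
    by (simp_all add: sing_def)
  have sing: "module k (sing S)" if "ideal S k" for S
  proof -
    interpret S: ideal S k by fact
    have c: "a \<in> carrier k" if "a \<in> S" for a using that S.a_subset by auto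
    have "abelian_group (sing S)"
    proof (rule abelian_groupI, goal_cases)
      case (6 X)
      then obtain a where a: "X = {a}" "a \<in> S" by (auto simp: sing_simps)
      then show ?case using c
        by (intro bexI[of _ "{\<ominus> a}"]) (auto simp: sing_simps l_neg)
    qed (auto simp: sing_simps c a_ac S.a_closed)
    then show ?thesis
      by (intro moduleI k) (auto simp: sing_simps c l_distr r_distr m_assoc S.I_l_closed)
  qed
  interpret I: ideal I k by fact
  have "linear_map k (sing I) (sing (carrier k)) (\<lambda>X. X)"
    using I.a_subset by (auto simp: linear_map_def sing_simps)
  moreover have "linear_map k (sing I) J (\<lambda>X. g (the_elem X))"
    using g by (auto simp: linear_map_def sing_simps)
  moreover have "module k (sing I)" "module k (sing (carrier k))" using sing I oneideal by auto
  ultimately obtain h where h: "linear_map k (sing (carrier k)) J h"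
    "\<forall>X\<in>carrier (sing I). h X = g (the_elem X)"
    using inj unfolding injective_module_def by (metis inj_on_id2)
  show "\<exists>y\<in>carrier J. \<forall>r\<in>I. g r = r \<odot>\<^bsub>J\<^esub> y"
  proof (intro bexI ballI)
    show "h {\<one>} \<in> carrier J" using linear_mapD(1)[OF h(1)] by (auto simp: sing_simps)
    fix r assume r: "r \<in> I"
    then have rc: "r \<in> carrier k" using I.a_subset by auto
    have "g r = h {r}" using h(2) r by (auto simp: sing_simps)
    also have "{r} = r \<odot>\<^bsub>sing (carrier k)\<^esub> {\<one>}" using rc by (simp add: sing_simps)
    also have "h \<dots> = r \<odot>\<^bsub>J\<^esub> h {\<one>}"
      using linear_mapD(3)[OF h(1) rc, of "{\<one>}"] by (simp add: sing_simps)
    finally show "g r = r \<odot>\<^bsub>J\<^esub> h {\<one>}" .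
  qed
qed

text \<open>The image of \<open>Hom\<^sub>k(k / m, J)\<close> under evaluation at \<open>1\<close>, written \<open>J[m]\<close> below.\<close>

definition killed_by :: "'k set \<Rightarrow> ('k, 'j, 'y) module_scheme \<Rightarrow> 'j set"
  where "killed_by m J = {x \<in> carrier J. \<forall>a\<in>m. a \<odot>\<^bsub>J\<^esub> x = \<zero>\<^bsub>J\<^esub>}"

text \<open>Test with the field \<open>k / m\<close>, whose elements are cosets.\<close>

lemma cogenerator_killed_by:
  fixes k (structure) and J :: "('k, 'j) module"
  assumes k: "cring k" and cog: "cogenerator_module k J" and m: "maximalideal m k"
  shows "\<exists>u\<in>killed_by m J. u \<noteq> \<zero>\<^bsub>J\<^esub>"
proof -
  interpret cring k by fact
  interpret m: maximalideal m k by fact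
  interpret J: module k J using cog by (simp add: cogenerator_module_def)
  interpret Q: cring "k Quot m" by (rule m.quotient_is_cring[OF k])
  define M :: "('k, 'k set) module" where
    "M = \<lparr>carrier = carrier (k Quot m), mult = undefined, one = undefined, zero = zero (k Quot m),
      add = add (k Quot m), smult = (\<lambda>r X. (m +> r) \<otimes>\<^bsub>k Quot m\<^esub> X)\<rparr>"
  note hom = m.rcos_ring_hom
  have M_simps: "carrier M = carrier (k Quot m)" "zero M = zero (k Quot m)"
    "X \<oplus>\<^bsub>M\<^esub> Y = X \<oplus>\<^bsub>k Quot m\<^esub> Y" "r \<odot>\<^bsub>M\<^esub> X = (m +> r) \<otimes>\<^bsub>k Quot m\<^esub> X" for X Y r
    by (simp_all add: M_def)
  have cl: "m +> r \<in> carrier (k Quot m)" if "r \<in> carrier k" for r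
    using ring_hom_closed[OF hom that] .
  have zero: "\<zero>\<^bsub>k Quot m\<^esub> = m" by (simp add: FactRing_def)
  have one: "m +> \<one> = \<one>\<^bsub>k Quot m\<^esub>" using ring_hom_one[OF hom] .
  have "abelian_group M"
    by (rule abelian_groupI) (auto simp: M_simps Q.a_ac intro: Q.l_neg Q.a_inv_closed)
  then have M: "module k M"
    by (intro moduleI k) (auto simp: M_simps cl one ring_hom_add[OF hom] ring_hom_mult[OF hom]
      Q.l_distr Q.r_distr Q.m_assoc)
  have "\<one>\<^bsub>k Quot m\<^esub> \<noteq> \<zero>\<^bsub>k Quot m\<^esub>"
  proof
    assume "\<one>\<^bsub>k Quot m\<^esub> = \<zero>\<^bsub>k Quot m\<^esub>"
    then have "m +> \<one> = m" by (simp only: one zero)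
    then have "\<one> \<in> m" using m.a_rcos_self[OF one_closed] by simp
    then show False using m.one_imp_carrier m.I_notcarr by auto
  qed
  then obtain h where h: "linear_map k M J h" "h \<one>\<^bsub>k Quot m\<^esub> \<noteq> \<zero>\<^bsub>J\<^esub>"
    using cog M Q.one_closed unfolding cogenerator_module_def M_simps(1,2)[symmetric]
    by blast
  have "h \<one>\<^bsub>k Quot m\<^esub> \<in> killed_by m J"
    unfolding killed_by_def
  proof (intro CollectI conjI ballI)
    show "h \<one>\<^bsub>k Quot m\<^esub> \<in> carrier J" using linear_mapD(1)[OF h(1)] by (simp add: M_simps)
    fix a assume a: "a \<in> m"
    then have ac: "a \<in> carrier k" using m.a_subset by auto
    have "m +> a = \<zero>\<^bsub>k Quot m\<^esub>"
      using m.a_rcos_const[OF a] by (simp only: zero)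
    then have "a \<odot>\<^bsub>M\<^esub> \<one>\<^bsub>k Quot m\<^esub> = \<zero>\<^bsub>M\<^esub>" by (simp add: M_simps)
    then have "a \<odot>\<^bsub>J\<^esub> h \<one>\<^bsub>k Quot m\<^esub> = h \<zero>\<^bsub>M\<^esub>"
      using linear_mapD(3)[OF h(1) ac, of "\<one>\<^bsub>k Quot m\<^esub>"] by (simp add: M_simps)
    then show "a \<odot>\<^bsub>J\<^esub> h \<one>\<^bsub>k Quot m\<^esub> = \<zero>\<^bsub>J\<^esub>"
      using linear_map_zero[OF M J.module_axioms h(1)] by simp
  qed
  then show ?thesis using h(2) by blast
qed

text \<open>Enlarge \<open>N\<close> to a submodule \<open>U\<close> that is maximal among those missing \<open>x\<close>. The class of \<open>x\<close> spans a copy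
  of \<open>k / m\<close> in \<open>M / U\<close>, which is mapped to \<open>J\<close> by sending \<open>x\<close> to a nonzero element \<open>u\<close> of \<open>J[m]\<close>; this
  map extends to \<open>M\<close>. The set \<open>V\<close> records a place where \<open>u\<close> is to be found.\<close>

lemma (in two_modules) separate_from_submodule:
  assumes b: "baer k J" and soc: "\<And>m. maximalideal m k \<Longrightarrow> \<exists>u\<in>V \<inter> killed_by m J. u \<noteq> \<zero>\<^bsub>J\<^esub>"
    and N: "submodule N k M" and x: "x \<in> carrier M" "x \<notin> N"
  shows "\<exists>h. linear_map k M J h \<and> (\<forall>y\<in>N. h y = \<zero>\<^bsub>J\<^esub>) \<and> h x \<noteq> \<zero>\<^bsub>J\<^esub> \<and> h x \<in> V"
proof -
  obtain U where U: "submodule U k M" "N \<subseteq> U" "x \<notin> U"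
    "\<And>V. submodule V k M \<Longrightarrow> U \<subseteq> V \<Longrightarrow> x \<notin> V \<Longrightarrow> V = U"
    using M.maximal_submodule_avoiding[OF N x(2)] by blast
  define m where "m = {r \<in> carrier k. r \<odot>\<^bsub>M\<^esub> x \<in> U}"
  have m: "maximalideal m k" unfolding m_def by (rule M.maximal_conductor[OF U(1) x(1) U(3,4)])
  then obtain u where u: "u \<in> V" "u \<in> carrier J" "\<And>a. a \<in> m \<Longrightarrow> a \<odot>\<^bsub>J\<^esub> u = \<zero>\<^bsub>J\<^esub>" "u \<noteq> \<zero>\<^bsub>J\<^esub>"
    using soc unfolding killed_by_def by blast
  let ?G = "U \<times> {\<zero>\<^bsub>J\<^esub>}"
  have "lin_graph k M J ?G"
    using U(1) by (auto simp: lin_graph_def M.submodule_iff)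
  moreover have "z = r \<odot>\<^bsub>J\<^esub> u" if "r \<in> carrier k" "(r \<odot>\<^bsub>M\<^esub> x, z) \<in> ?G" for r z
    using that u(3)[of r] by (auto simp: m_def)
  ultimately obtain G where G: "lin_graph k M J G" "?G \<subseteq> G" "(x, u) \<in> G"
    using lin_graph_extend[OF _ x(1) u(2)] by blast
  obtain h where h: "linear_map k M J h" "\<And>x y. (x, y) \<in> G \<Longrightarrow> h x = y"
    using baer_extension[OF b G(1)] by blast
  have "h y = \<zero>\<^bsub>J\<^esub>" if "y \<in> N" for y using h(2)[of y] G(2) that U(2) by blast
  then show ?thesis using h G(3) u by blast
qed

text \<open>This is the argument that \<open>J\<close> contains an injective hull of \<open>L\<close>. Let \<open>G\<close> be a maximal partial
  retraction of \<open>J\<close> onto \<open>N\<close> and suppose that it is not defined at \<open>y\<close>. By Baer's condition \<open>y\<close> has a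
  consistent value \<open>y'\<close> in \<open>J\<close>, which is not in \<open>N\<close>. Maximality of \<open>N\<close> provides \<open>z = a + r y'\<close> in \<open>J[m]\<close>
  outside \<open>N\<close>. If only scalars in \<open>m\<close> multiply \<open>r y\<close> into the domain of \<open>G\<close>, then \<open>-a\<close> is a consistent
  value at \<open>r y\<close>, and \<open>G\<close> was not maximal. Otherwise some \<open>s \<notin> m\<close> does, so that \<open>s z \<in> N\<close>, and \<open>z \<in> N\<close>
  because \<open>s\<close> is invertible modulo \<open>m\<close>.\<close>

lemma maximal_socle_retract:
  fixes k (structure)
  assumes J: "module k J" and b: "baer k J" and m: "maximalideal m k"
    and N: "submodule N k J" "N \<inter> killed_by m J = L"
    and max: "\<And>N'. submodule N' k J \<Longrightarrow> N \<subseteq> N' \<Longrightarrow> N' \<inter> killed_by m J = L \<Longrightarrow> N' = N"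
  shows "\<exists>p. linear_map k J (J\<lparr>carrier := N\<rparr>) p \<and> (\<forall>x\<in>N. p x = x)"
proof -
  interpret J: module k J by fact
  interpret m: maximalideal m k by fact
  have N': "module k (J\<lparr>carrier := N\<rparr>)" by (rule submodule.submodule_is_module[OF N(1) J])
  interpret P: two_modules k J "J\<lparr>carrier := N\<rparr>" using J N' by (simp add: two_modules_def)
  interpret JJ: two_modules k J J using J by (simp add: two_modules_def)
  have Nc: "N \<subseteq> carrier J" using N by (auto simp: J.submodule_iff)
  have "lin_graph k J (J\<lparr>carrier := N\<rparr>) (Id_on N)"
    using N(1) by (auto simp: lin_graph_def J.submodule_iff)
  then obtain G where G: "lin_graph k J (J\<lparr>carrier := N\<rparr>) G" "Id_on N \<subseteq> G"
    and Gmax: "\<And>G'. lin_graph k J (J\<lparr>carrier := N\<rparr>) G' \<Longrightarrow> G \<subseteq> G' \<Longrightarrow> G' = G"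
    using P.lin_graph_maximal by blast
  have GJ: "lin_graph k J J G" using G(1) Nc unfolding lin_graph_def by auto
  have GN: "c \<in> N" if "(a, c) \<in> G" for a c using that G(1) by (auto simp: lin_graph_def)
  have Gmul: "(r \<odot>\<^bsub>J\<^esub> a, r \<odot>\<^bsub>J\<^esub> c) \<in> G" if "(a, c) \<in> G" "r \<in> carrier k" for a c r
    using that G(1) by (auto simp: lin_graph_def)
  have ext: "\<exists>z. (w, z) \<in> G" if "w \<in> carrier J" "z \<in> N"
    "\<And>r v. r \<in> carrier k \<Longrightarrow> (r \<odot>\<^bsub>J\<^esub> w, v) \<in> G \<Longrightarrow> v = r \<odot>\<^bsub>J\<^esub> z" for w z
    using P.lin_graph_extend[OF G(1), of w z] that Gmax by auto
  have "\<exists>z. (y, z) \<in> G" if y: "y \<in> carrier J" for y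
  proof (rule ccontr)
    assume no: "\<not> ?thesis"
    obtain y' where y': "y' \<in> carrier J"
      and comp: "\<And>r z. r \<in> carrier k \<Longrightarrow> (r \<odot>\<^bsub>J\<^esub> y, z) \<in> G \<Longrightarrow> z = r \<odot>\<^bsub>J\<^esub> y'"
      using JJ.baer_value[OF b GJ y] by blast
    have "y' \<notin> N" using ext[OF y _ comp] no by blast
    then have "adjoin k J N y' \<noteq> N" using J.in_adjoin[OF N(1) y'] by auto
    then have "adjoin k J N y' \<inter> killed_by m J \<noteq> L"
      using max[OF J.adjoin_submodule[OF N(1) y'] J.subset_adjoin[OF N(1) y']] by blast
    then obtain z where z: "z \<in> adjoin k J N y'" "z \<in> killed_by m J" "z \<notin> N"
      using N(2) J.subset_adjoin[OF N(1) y'] by blast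
    then obtain a r where ar: "z = a \<oplus>\<^bsub>J\<^esub> r \<odot>\<^bsub>J\<^esub> y'" "a \<in> N" "r \<in> carrier k"
      by (auto simp: adjoin_def)
    have ac: "a \<in> carrier J" using ar Nc by auto
    have ry: "r \<odot>\<^bsub>J\<^esub> y \<in> carrier J" using ar y by auto
    have notU: "\<nexists>v. (r \<odot>\<^bsub>J\<^esub> y, v) \<in> G"
    proof
      assume "\<exists>v. (r \<odot>\<^bsub>J\<^esub> y, v) \<in> G"
      then have "r \<odot>\<^bsub>J\<^esub> y' \<in> N" using comp[OF ar(3)] GN by blast
      then show False using z(3) ar N(1) by (auto simp: J.submodule_iff)
    qed
    show False
    proof (cases "\<forall>s v. s \<in> carrier k \<longrightarrow> (s \<odot>\<^bsub>J\<^esub> (r \<odot>\<^bsub>J\<^esub> y), v) \<in> G \<longrightarrow> s \<in> m")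
      case True
      have "\<exists>v. (r \<odot>\<^bsub>J\<^esub> y, v) \<in> G"
      proof (rule ext[OF ry])
        show "\<ominus>\<^bsub>J\<^esub> a \<in> N" using J.submoduleE(3)[OF N(1) ar(2)] .
        fix s v assume s: "s \<in> carrier k" and v: "(s \<odot>\<^bsub>J\<^esub> (r \<odot>\<^bsub>J\<^esub> y), v) \<in> G"
        have sm: "s \<in> m" using True s v by blast
        have "s \<odot>\<^bsub>J\<^esub> (r \<odot>\<^bsub>J\<^esub> y) = (s \<otimes> r) \<odot>\<^bsub>J\<^esub> y" using s ar(3) y by (simp add: J.smult_assoc1)
        then have "v = (s \<otimes> r) \<odot>\<^bsub>J\<^esub> y'" using comp[of "s \<otimes> r" v] v s ar(3) by simp
        moreover have "s \<odot>\<^bsub>J\<^esub> a \<oplus>\<^bsub>J\<^esub> (s \<otimes> r) \<odot>\<^bsub>J\<^esub> y' = \<zero>\<^bsub>J\<^esub>"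
        proof -
          have "s \<odot>\<^bsub>J\<^esub> z = \<zero>\<^bsub>J\<^esub>" using z(2) sm by (auto simp: killed_by_def)
          then show ?thesis unfolding ar(1) using s ar(3) ac y' by (simp add: J.smult_r_distr J.smult_assoc1)
        qed
        ultimately have "s \<odot>\<^bsub>J\<^esub> a \<oplus>\<^bsub>J\<^esub> v = \<zero>\<^bsub>J\<^esub>" "v \<in> carrier J"
          using s ar(3) y' by simp_all
        then show "v = s \<odot>\<^bsub>J\<^esub> (\<ominus>\<^bsub>J\<^esub> a)"
          using s ac by (simp add: J.smult_r_minus)
            (metis J.M.a_comm J.M.minus_equality J.smult_closed)
      qed
      then show False using notU by blast
    next
      case False
      then obtain s v where s: "s \<in> carrier k" "s \<notin> m" and v: "(s \<odot>\<^bsub>J\<^esub> (r \<odot>\<^bsub>J\<^esub> y), v) \<in> G" by blast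
      obtain t where t: "t \<in> carrier k" "\<one> \<ominus> t \<otimes> s \<in> m"
        using maximalideal_inverse_mod[OF J.R.is_cring m s] by blast
      have "s \<odot>\<^bsub>J\<^esub> (r \<odot>\<^bsub>J\<^esub> y) = (s \<otimes> r) \<odot>\<^bsub>J\<^esub> y" using s ar(3) y by (simp add: J.smult_assoc1)
      then have v': "v = (s \<otimes> r) \<odot>\<^bsub>J\<^esub> y'" using comp[of "s \<otimes> r" v] v s(1) ar(3) by simp
      have zc: "z \<in> carrier J" using z by (auto simp: killed_by_def)
      have "s \<odot>\<^bsub>J\<^esub> z = s \<odot>\<^bsub>J\<^esub> a \<oplus>\<^bsub>J\<^esub> v"
        unfolding ar(1) v' using s(1) ar(3) ac y' by (simp add: J.smult_r_distr J.smult_assoc1)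
      also have "\<dots> \<in> N" using GN[OF v] ar(2) s(1) N(1) by (simp add: J.submodule_iff)
      finally have "t \<odot>\<^bsub>J\<^esub> (s \<odot>\<^bsub>J\<^esub> z) \<in> N" using t(1) N(1) by (simp add: J.submodule_iff)
      moreover have "(\<one> \<ominus> t \<otimes> s) \<odot>\<^bsub>J\<^esub> z = \<zero>\<^bsub>J\<^esub>" using z(2) t(2) by (auto simp: killed_by_def)
      then have "(\<one> \<ominus> t \<otimes> s) \<odot>\<^bsub>J\<^esub> z \<oplus>\<^bsub>J\<^esub> (t \<otimes> s) \<odot>\<^bsub>J\<^esub> z = (t \<otimes> s) \<odot>\<^bsub>J\<^esub> z"
        using t(1) s(1) zc by simp
      then have "((\<one> \<ominus> t \<otimes> s) \<oplus> t \<otimes> s) \<odot>\<^bsub>J\<^esub> z = t \<odot>\<^bsub>J\<^esub> (s \<odot>\<^bsub>J\<^esub> z)"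
        using t(1) s(1) zc by (simp add: J.smult_l_distr J.smult_assoc1)
      moreover have "(\<one> \<ominus> t \<otimes> s) \<oplus> t \<otimes> s = \<one>" using t(1) s(1) by algebra
      ultimately have "z \<in> N" using zc by simp
      then show False using z(3) by simp
    qed
  qed
  from P.lin_graph_total_map[OF G(1) this] obtain p where
    p: "linear_map k J (J\<lparr>carrier := N\<rparr>) p" "\<forall>x y. (x, y) \<in> G \<longrightarrow> p x = y" by blast
  have "\<forall>x\<in>N. p x = x" using p(2) G(2) by blast
  then show ?thesis using p(1) by blast
qed

text \<open>Let \<open>N\<close> be maximal among the submodules that meet \<open>J[m]\<close> in the line \<open>k x\<close>. As a retract of \<open>J\<close> it is
  injective. For a maximal ideal \<open>m' \<noteq> m\<close>, adjoining an element of \<open>J[m']\<close> does not change the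
  intersection with \<open>J[m]\<close>, so \<open>N\<close> contains \<open>J[m']\<close>; hence \<open>N\<close> is a cogenerator. Minimality of \<open>J\<close>
  gives \<open>N = J\<close>, and \<open>J[m] = k x\<close>.\<close>

lemma socle_of_minimal_injective_cogenerator:
  fixes k (structure) and J :: "('k, 'j) module"
  assumes k: "cring k" and J: "minimal_injective_cogenerator k J" and m: "maximalideal m k"
    and x: "x \<in> killed_by m J" "x \<noteq> \<zero>\<^bsub>J\<^esub>" and y: "y \<in> killed_by m J"
  shows "\<exists>a\<in>carrier k. y = a \<odot>\<^bsub>J\<^esub> x"
proof -
  have inj: "injective_module k J" and cog: "cogenerator_module k J"
    using J by (auto simp: minimal_injective_cogenerator_def)
  have b: "baer k J" by (rule injective_module_baer[OF k inj])
  interpret J: module k J using inj by (simp add: injective_module_def)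
  interpret m: maximalideal m k by fact
  have xc: "x \<in> carrier J" using x by (auto simp: killed_by_def)
  define L where "L = adjoin k J {\<zero>\<^bsub>J\<^esub>} x"
  have L: "submodule L k J" unfolding L_def by (rule J.adjoin_submodule[OF J.zero_submodule xc])
  have killed: "submodule (killed_by m J) k J"
    unfolding J.submodule_iff killed_by_def
    using m.a_subset by (auto simp: subset_iff J.smult_r_distr J.smult_assoc1[symmetric] J.R.m_comm)
      (auto simp: J.smult_assoc1)
  have Lk: "L \<subseteq> killed_by m J"
    unfolding L_def using killed x by (intro J.adjoin_least) (auto simp: J.submodule_iff)
  define A where "A = {N. submodule N k J \<and> L \<subseteq> N \<and> N \<inter> killed_by m J = L}"
  have "\<exists>N\<in>A. \<forall>N'\<in>A. N \<subseteq> N' \<longrightarrow> N' = N"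
  proof (rule subset_Zorn_nonempty)
    show "A \<noteq> {}" using L Lk by (auto simp: A_def)
    fix \<C> assume c: "\<C> \<noteq> {}" "subset.chain A \<C>"
    have "submodule (\<Union>\<C>) k J" by (rule J.chain_Union_submodule[OF c]) (auto simp: A_def)
    moreover have "H \<in> A" if "H \<in> \<C>" for H using c that by (auto simp: subset.chain_def)
    then have "L \<subseteq> \<Union>\<C>" "\<Union>\<C> \<inter> killed_by m J = L" using c(1) unfolding A_def by blast+
    ultimately show "\<Union>\<C> \<in> A" by (simp add: A_def)
  qed
  then obtain N where N: "N \<in> A" and max: "\<And>N'. N' \<in> A \<Longrightarrow> N \<subseteq> N' \<Longrightarrow> N' = N" by blast
  have Ns: "submodule N k J" and LN: "L \<subseteq> N" and NL: "N \<inter> killed_by m J = L"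
    using N by (auto simp: A_def)
  have Nc: "N \<subseteq> carrier J" using Ns by (auto simp: J.submodule_iff)
  have max': "N' = N" if "submodule N' k J" "N \<subseteq> N'" "N' \<inter> killed_by m J = L" for N'
    using that LN by (intro max) (auto simp: A_def)
  obtain p where p: "linear_map k J (J\<lparr>carrier := N\<rparr>) p" "\<And>x. x \<in> N \<Longrightarrow> p x = x"
    using maximal_socle_retract[OF J.module_axioms b m Ns NL max'] by blast
  have soc: "\<exists>u\<in>N \<inter> killed_by m' J. u \<noteq> \<zero>\<^bsub>J\<^esub>" if m': "maximalideal m' k" for m'
  proof (cases "m' = m")
    case True
    have "x \<in> L" unfolding L_def by (rule J.in_adjoin[OF J.zero_submodule xc])
    then show ?thesis using True x LN by auto
  next
    case False
    interpret m': maximalideal m' k by fact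
    have "\<not> m' \<subseteq> m"
      using m'.I_maximal[OF m.is_ideal] m.a_subset m.I_notcarr False by auto
    then obtain r where r: "r \<in> m'" "r \<notin> m" by auto
    then have rc: "r \<in> carrier k" using m'.a_subset by auto
    then obtain s where s: "s \<in> carrier k" "\<one> \<ominus> s \<otimes> r \<in> m"
      using maximalideal_inverse_mod[OF k m _ r(2)] by blast
    obtain u where u: "u \<in> killed_by m' J" "u \<noteq> \<zero>\<^bsub>J\<^esub>"
      using cogenerator_killed_by[OF k cog m'] by blast
    then have uc: "u \<in> carrier J" and um: "\<And>a. a \<in> m' \<Longrightarrow> a \<odot>\<^bsub>J\<^esub> u = \<zero>\<^bsub>J\<^esub>"
      by (auto simp: killed_by_def)
    have sr: "s \<otimes> r \<in> m'" "s \<otimes> r \<in> carrier k" using s r rc by (auto intro: m'.I_l_closed)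
    have "z \<in> N" if z: "z \<in> adjoin k J N u" "z \<in> killed_by m J" for z
    proof -
      obtain a t where at: "z = a \<oplus>\<^bsub>J\<^esub> t \<odot>\<^bsub>J\<^esub> u" "a \<in> N" "t \<in> carrier k"
        using z by (auto simp: adjoin_def)
      have ac: "a \<in> carrier J" using at Nc by auto
      have zc: "z \<in> carrier J" using z by (auto simp: killed_by_def)
      have "z = ((\<one> \<ominus> s \<otimes> r) \<oplus> s \<otimes> r) \<odot>\<^bsub>J\<^esub> z"
      proof -
        have "(\<one> \<ominus> s \<otimes> r) \<oplus> s \<otimes> r = \<one>" using s(1) rc by algebra
        then show ?thesis using zc by simp
      qed
      also have "\<dots> = (s \<otimes> r) \<odot>\<^bsub>J\<^esub> z"
        using z(2) s sr zc by (simp add: J.smult_l_distr killed_by_def)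
      also have "\<dots> = (s \<otimes> r) \<odot>\<^bsub>J\<^esub> a \<oplus>\<^bsub>J\<^esub> t \<odot>\<^bsub>J\<^esub> ((s \<otimes> r) \<odot>\<^bsub>J\<^esub> u)"
        unfolding at(1) using sr(2) at(3) ac uc
        by (simp add: J.smult_r_distr J.smult_assoc1[symmetric] J.R.m_comm)
      also have "\<dots> = (s \<otimes> r) \<odot>\<^bsub>J\<^esub> a" using um[OF sr(1)] at(3) sr(2) ac by simp
      also have "\<dots> \<in> N" using Ns at(2) sr(2) by (simp add: J.submodule_iff)
      finally show ?thesis .
    qed
    then have "adjoin k J N u \<inter> killed_by m J = L"
      using NL J.subset_adjoin[OF Ns uc] by blast
    then have "adjoin k J N u = N"
      by (intro max' J.adjoin_submodule[OF Ns uc] J.subset_adjoin[OF Ns uc])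
    then show ?thesis using J.in_adjoin[OF Ns uc] u by blast
  qed
  have Nm: "module k (J\<lparr>carrier := N\<rparr>)" by (rule submodule.submodule_is_module[OF Ns J.module_axioms])
  have "N = carrier J"
  proof (rule J[unfolded minimal_injective_cogenerator_def, THEN conjunct2, THEN conjunct2, rule_format],
      intro conjI)
    show "submodule N k J" by (rule Ns)
    show "injective_module k (J\<lparr>carrier := N\<rparr>)"
      unfolding injective_module_def
    proof (intro conjI allI impI)
      fix M M' :: "('k, 'k set) module" and f g
      assume a: "module k M \<and> module k M' \<and> linear_map k M M' f \<and> inj_on f (carrier M) \<and>
        linear_map k M (J\<lparr>carrier := N\<rparr>) g"
      have "linear_map k M J g" using a Nc by (auto simp: linear_map_def)
      then obtain h where h: "linear_map k M' J h" "\<forall>x\<in>carrier M. h (f x) = g x"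
        using a inj unfolding injective_module_def by meson
      have "linear_map k M' (J\<lparr>carrier := N\<rparr>) (\<lambda>x. p (h x))" by (rule linear_map_comp[OF h(1) p(1)])
      moreover have "p (h (f x)) = g x" if "x \<in> carrier M" for x
        using h(2) that a p(2)[of "g x"] by (auto simp: linear_map_def Pi_iff)
      ultimately show "\<exists>h. linear_map k M' (J\<lparr>carrier := N\<rparr>) h \<and> (\<forall>x\<in>carrier M. h (f x) = g x)"
        by blast
    qed (rule Nm)
    show "cogenerator_module k (J\<lparr>carrier := N\<rparr>)"
      unfolding cogenerator_module_def
    proof (intro conjI allI impI)
      fix M :: "('k, 'k set) module" and v
      assume a: "module k M \<and> v \<in> carrier M \<and> v \<noteq> \<zero>\<^bsub>M\<^esub>"
      then interpret M: module k M by simp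
      interpret MJ: two_modules k M J by (simp add: two_modules_def M.module_axioms J.module_axioms)
      obtain h where h: "linear_map k M J h" "h v \<noteq> \<zero>\<^bsub>J\<^esub>" "h v \<in> N"
        using MJ.separate_from_submodule[OF b soc M.zero_submodule] a by blast
      have "linear_map k M (J\<lparr>carrier := N\<rparr>) (\<lambda>x. p (h x))" by (rule linear_map_comp[OF h(1) p(1)])
      moreover have "p (h v) \<noteq> \<zero>\<^bsub>J\<lparr>carrier := N\<rparr>\<^esub>" using h p(2) by simp
      ultimately show "\<exists>h. linear_map k M (J\<lparr>carrier := N\<rparr>) h \<and> h v \<noteq> \<zero>\<^bsub>J\<lparr>carrier := N\<rparr>\<^esub>" by blast
    qed (rule Nm)
  qed
  then have "y \<in> L" using y NL by (auto simp: killed_by_def)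
  then show ?thesis using xc by (auto simp: L_def adjoin_def)
qed

section \<open>Matlis duality\<close>

locale artinian_duality =
  fixes k :: "'k ring" (structure) and J :: "('k, 'j) module"
  assumes cring: "cring k" and artinian: "artinian_ring k"
    and cogenerator: "minimal_injective_cogenerator k J"
begin

abbreviation dual where "dual M \<equiv> dual_module k J M"

lemma module_J: "module k J"
  using cogenerator by (simp add: minimal_injective_cogenerator_def injective_module_def)

lemma baer_J: "baer k J"
  using cogenerator cring by (simp add: minimal_injective_cogenerator_def injective_module_baer)

lemma socle_J: "maximalideal m k \<Longrightarrow> \<exists>u\<in>UNIV \<inter> killed_by m J. u \<noteq> \<zero>\<^bsub>J\<^esub>"
  using cogenerator cring cogenerator_killed_by by (auto simp: minimal_injective_cogenerator_def)

lemma dual_simps: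
  "carrier (dual M) = {f \<in> extensional (carrier M). linear_map k M J f}"
  "zero (dual M) = (\<lambda>x\<in>carrier M. \<zero>\<^bsub>J\<^esub>)"
  "f \<oplus>\<^bsub>dual M\<^esub> g = (\<lambda>x\<in>carrier M. f x \<oplus>\<^bsub>J\<^esub> g x)"
  "r \<odot>\<^bsub>dual M\<^esub> f = (\<lambda>x\<in>carrier M. r \<odot>\<^bsub>J\<^esub> f x)"
  by (simp_all add: dual_module_def)

lemma dual_restrict:
  assumes M: "module k M" and h: "linear_map k M J h"
  shows "restrict h (carrier M) \<in> carrier (dual M)"
proof -
  interpret M: module k M by fact
  show ?thesis using h by (auto simp: dual_simps linear_map_def)
qed

lemma dual_eqI:
  "f \<in> carrier (dual M) \<Longrightarrow> g \<in> carrier (dual M) \<Longrightarrow> (\<And>x. x \<in> carrier M \<Longrightarrow> f x = g x) \<Longrightarrow> f = g"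
  by (auto simp: dual_simps intro: extensionalityI)

lemma module_dual:
  assumes M: "module k M"
  shows "module k (dual M)"
proof -
  interpret M: module k M by fact
  interpret J: module k J by (rule module_J)
  note l = linear_mapD
  have "abelian_group (dual M)"
  proof (rule abelian_groupI, goal_cases)
    case (1 f g)
    then show ?case by (auto simp: dual_simps linear_map_def Pi_iff J.M.a_ac J.smult_r_distr)
  next
    case 2
    then show ?case by (auto simp: dual_simps linear_map_def)
  next
    case (3 f g h)
    then show ?case by (auto simp: dual_simps linear_map_def Pi_iff J.M.a_ac)
  next
    case (4 f g)
    then show ?case by (auto simp: dual_simps linear_map_def Pi_iff J.M.a_ac)
  next
    case (5 f)
    then show ?case
      by (auto simp: dual_simps linear_map_def Pi_iff restrict_def extensional_def fun_eq_iff)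
  next
    case (6 f)
    then have "(\<lambda>x\<in>carrier M. \<ominus>\<^bsub>J\<^esub> f x) \<in> carrier (dual M)"
      by (auto simp: dual_simps linear_map_def Pi_iff J.M.minus_add J.smult_r_minus)
    moreover have "(\<lambda>x\<in>carrier M. \<ominus>\<^bsub>J\<^esub> f x) \<oplus>\<^bsub>dual M\<^esub> f = \<zero>\<^bsub>dual M\<^esub>"
      using 6 by (auto simp: dual_simps linear_map_def Pi_iff J.M.l_neg)
    ultimately show ?case by blast
  qed
  then show ?thesis
  proof (intro moduleI cring, goal_cases)
    case (2 a f)
    then show ?case
      by (auto simp: dual_simps linear_map_def Pi_iff J.smult_r_distr J.smult_assoc1[symmetric] M.R.m_comm)
  qed (auto simp: dual_simps linear_map_def Pi_iff J.smult_l_distr J.smult_r_distr J.smult_assoc1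
      restrict_def extensional_def fun_eq_iff)
qed

text \<open>The hypothesis \<open>van\<close> says that \<open>F \<psi>\<close> depends only on the restriction of \<open>\<psi>\<close> to \<open>B\<close>. Induction along the
  filtration: forms that vanish on the previous step are determined on the next one by their value at
  the adjoined element \<open>s\<close>, which lies in the line \<open>J[m]\<close>. On these forms \<open>F\<close> is therefore evaluation at a
  multiple \<open>c s\<close>, and \<open>F\<close> minus this evaluation depends only on restrictions to the previous step.\<close>

lemma reflexive_step:
  assumes M: "module k M" and f: "simple_filtration k M {\<zero>\<^bsub>M\<^esub>} B"
    and F: "linear_map k (dual M) J F"
    and van: "\<And>\<psi>. \<psi> \<in> carrier (dual M) \<Longrightarrow> (\<And>x. x \<in> B \<Longrightarrow> \<psi> x = \<zero>\<^bsub>J\<^esub>) \<Longrightarrow> F \<psi> = \<zero>\<^bsub>J\<^esub>"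
  shows "\<exists>x\<in>B. \<forall>\<psi>\<in>carrier (dual M). F \<psi> = \<psi> x"
  using f F van
proof (induct arbitrary: F)
  case base
  interpret M: module k M by fact
  have "\<psi> \<zero>\<^bsub>M\<^esub> = \<zero>\<^bsub>J\<^esub>" if "\<psi> \<in> carrier (dual M)" for \<psi>
    using that linear_map_zero[OF M module_J] by (auto simp: dual_simps)
  then show ?case using base by auto
next
  case (step B m s F)
  interpret M: module k M by fact
  interpret J: module k J by (rule module_J)
  interpret D: module k "dual M" by (rule module_dual[OF M])
  interpret m: maximalideal m k by fact
  note F = step(6) and van = step(7) and sc = step(4)
  note sub = M.simple_filtration_submodules(2)[OF step(1)]
  have Bc: "B \<subseteq> carrier M" using sub by (auto simp: M.submodule_iff)
  have lin: "linear_map k M J \<psi>" if "\<psi> \<in> carrier (dual M)" for \<psi> using that by (simp add: dual_simps)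
  have van': "F \<psi> = \<zero>\<^bsub>J\<^esub>" if p: "\<psi> \<in> carrier (dual M)" "\<And>x. x \<in> B \<Longrightarrow> \<psi> x = \<zero>\<^bsub>J\<^esub>" "\<psi> s = \<zero>\<^bsub>J\<^esub>" for \<psi>
  proof (rule van[OF p(1)])
    fix x assume "x \<in> adjoin k M B s"
    then obtain b r where "x = b \<oplus>\<^bsub>M\<^esub> r \<odot>\<^bsub>M\<^esub> s" "b \<in> B" "r \<in> carrier k" by (auto simp: adjoin_def)
    then show "\<psi> x = \<zero>\<^bsub>J\<^esub>" using linear_mapD[OF lin[OF p(1)]] p(2,3) Bc sc by (auto simp: subset_iff)
  qed
  have smult_app: "(r \<odot>\<^bsub>dual M\<^esub> \<psi>) x = r \<odot>\<^bsub>J\<^esub> \<psi> x" if "x \<in> carrier M" for r \<psi> x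
    using that by (simp add: dual_simps)
  have add_app: "(\<phi> \<oplus>\<^bsub>dual M\<^esub> \<psi>) x = \<phi> x \<oplus>\<^bsub>J\<^esub> \<psi> x" if "x \<in> carrier M" for \<phi> \<psi> x
    using that by (simp add: dual_simps)
  have soc: "\<psi> s \<in> killed_by m J" if p: "\<psi> \<in> carrier (dual M)" "\<And>x. x \<in> B \<Longrightarrow> \<psi> x = \<zero>\<^bsub>J\<^esub>" for \<psi>
    unfolding killed_by_def
  proof (intro CollectI conjI ballI)
    show "\<psi> s \<in> carrier J" using linear_mapD(1)[OF lin[OF p(1)] sc] .
    fix a assume a: "a \<in> m"
    then have "a \<in> carrier k" using m.a_subset by auto
    then show "a \<odot>\<^bsub>J\<^esub> \<psi> s = \<zero>\<^bsub>J\<^esub>"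
      using linear_mapD(3)[OF lin[OF p(1)] _ sc] p(2)[OF step(5)[OF a]] by metis
  qed
  show ?case
  proof (cases "\<exists>\<psi>\<in>carrier (dual M). (\<forall>x\<in>B. \<psi> x = \<zero>\<^bsub>J\<^esub>) \<and> \<psi> s \<noteq> \<zero>\<^bsub>J\<^esub>")
    case False
    have "\<exists>x\<in>B. \<forall>\<psi>\<in>carrier (dual M). F \<psi> = \<psi> x"
      by (rule step(2)[OF F]) (use False van' in blast)
    then show ?thesis using M.subset_adjoin[OF sub sc] by blast
  next
    case True
    then obtain \<psi>0 where p0: "\<psi>0 \<in> carrier (dual M)" "\<And>x. x \<in> B \<Longrightarrow> \<psi>0 x = \<zero>\<^bsub>J\<^esub>" "\<psi>0 s \<noteq> \<zero>\<^bsub>J\<^esub>"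
      by blast
    have "F \<psi>0 \<in> killed_by m J"
      unfolding killed_by_def
    proof (intro CollectI conjI ballI)
      show "F \<psi>0 \<in> carrier J" using linear_mapD(1)[OF F p0(1)] .
      fix a assume a: "a \<in> m"
      then have ac: "a \<in> carrier k" using m.a_subset by auto
      have "F (a \<odot>\<^bsub>dual M\<^esub> \<psi>0) = \<zero>\<^bsub>J\<^esub>"
      proof (rule van')
        show "a \<odot>\<^bsub>dual M\<^esub> \<psi>0 \<in> carrier (dual M)" using ac p0 by auto
        show "(a \<odot>\<^bsub>dual M\<^esub> \<psi>0) x = \<zero>\<^bsub>J\<^esub>" if "x \<in> B" for x
          using that Bc ac p0(2)[OF that] by (subst smult_app) auto
        show "(a \<odot>\<^bsub>dual M\<^esub> \<psi>0) s = \<zero>\<^bsub>J\<^esub>"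
          using soc[OF p0(1,2)] a sc by (simp add: smult_app killed_by_def)
      qed
      then show "a \<odot>\<^bsub>J\<^esub> F \<psi>0 = \<zero>\<^bsub>J\<^esub>" using linear_mapD(3)[OF F ac p0(1)] by simp
    qed
    then obtain c where c: "c \<in> carrier k" "F \<psi>0 = c \<odot>\<^bsub>J\<^esub> \<psi>0 s"
      using socle_of_minimal_injective_cogenerator[OF cring cogenerator step(3) soc[OF p0(1,2)] p0(3)]
      by blast
    have csc: "c \<odot>\<^bsub>M\<^esub> s \<in> carrier M" using c sc by auto
    define F' where "F' \<psi> = F \<psi> \<ominus>\<^bsub>J\<^esub> \<psi> (c \<odot>\<^bsub>M\<^esub> s)" for \<psi>
    have Fc: "F \<psi> \<in> carrier J" "\<psi> (c \<odot>\<^bsub>M\<^esub> s) \<in> carrier J" if "\<psi> \<in> carrier (dual M)" for \<psi>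
      using linear_mapD(1)[OF F that] linear_mapD(1)[OF lin[OF that] csc] by auto
    have F': "linear_map k (dual M) J F'"
      unfolding linear_map_def
    proof (intro conjI ballI)
      show "F' \<in> carrier (dual M) \<rightarrow> carrier J" using Fc by (auto simp: F'_def)
      show "F' (\<phi> \<oplus>\<^bsub>dual M\<^esub> \<psi>) = F' \<phi> \<oplus>\<^bsub>J\<^esub> F' \<psi>"
        if "\<phi> \<in> carrier (dual M)" "\<psi> \<in> carrier (dual M)" for \<phi> \<psi>
        using Fc[OF that(1)] Fc[OF that(2)] linear_mapD(2)[OF F that] csc
        by (simp add: F'_def add_app a_minus_def J.M.minus_add J.M.a_ac)
      show "F' (r \<odot>\<^bsub>dual M\<^esub> \<psi>) = r \<odot>\<^bsub>J\<^esub> F' \<psi>" if "r \<in> carrier k" "\<psi> \<in> carrier (dual M)" for r \<psi>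
        using Fc[OF that(2)] linear_mapD(3)[OF F that] csc that(1)
        by (simp add: F'_def smult_app a_minus_def J.smult_r_minus J.smult_r_distr)
    qed
    have F'0: "F' \<psi>0 = \<zero>\<^bsub>J\<^esub>"
      using c linear_mapD(3)[OF lin[OF p0(1)] c(1) sc] linear_mapD(1)[OF lin[OF p0(1)] sc]
      by (simp add: F'_def a_minus_def J.M.r_neg)
    have "\<exists>x\<in>B. \<forall>\<psi>\<in>carrier (dual M). F' \<psi> = \<psi> x"
    proof (rule step(2)[OF F'])
      fix \<psi> assume p: "\<psi> \<in> carrier (dual M)" "\<And>x. x \<in> B \<Longrightarrow> \<psi> x = \<zero>\<^bsub>J\<^esub>"
      obtain d where d: "d \<in> carrier k" "\<psi> s = d \<odot>\<^bsub>J\<^esub> \<psi>0 s"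
        using socle_of_minimal_injective_cogenerator[OF cring cogenerator step(3) soc[OF p0(1,2)] p0(3)
          soc[OF p]] by blast
      define \<theta> where "\<theta> = \<psi> \<oplus>\<^bsub>dual M\<^esub> (\<ominus> d) \<odot>\<^bsub>dual M\<^esub> \<psi>0"
      have th: "\<theta> \<in> carrier (dual M)" unfolding \<theta>_def using d p0 p by auto
      have ths: "\<theta> x = \<psi> x \<ominus>\<^bsub>J\<^esub> d \<odot>\<^bsub>J\<^esub> \<psi>0 x" if "x \<in> carrier M" for x
        unfolding \<theta>_def using that d linear_mapD(1)[OF lin[OF p0(1)] that]
        by (simp add: add_app smult_app a_minus_def J.smult_l_minus)
      have thB: "\<theta> x = \<zero>\<^bsub>J\<^esub>" if "x \<in> B" for x
        using ths[of x] that Bc p(2)[OF that] p0(2)[OF that] d by (auto simp: a_minus_def)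
      have thS: "\<theta> s = \<zero>\<^bsub>J\<^esub>"
        using ths[OF sc] d linear_mapD(1)[OF lin[OF p0(1)] sc] by (simp add: a_minus_def J.M.r_neg)
      have "\<theta> (c \<odot>\<^bsub>M\<^esub> s) = \<zero>\<^bsub>J\<^esub>" using linear_mapD(3)[OF lin[OF th] c(1) sc] thS c by simp
      then have "F' \<theta> = \<zero>\<^bsub>J\<^esub>" using van'[OF th thB thS] by (simp add: F'_def a_minus_def)
      moreover have "F' \<theta> = F' \<psi> \<oplus>\<^bsub>J\<^esub> (\<ominus> d) \<odot>\<^bsub>J\<^esub> F' \<psi>0"
        unfolding \<theta>_def using linear_mapD(2)[OF F' p(1)] linear_mapD(3)[OF F' _ p0(1)] d p0(1) by simp
      ultimately show "F' \<psi> = \<zero>\<^bsub>J\<^esub>"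
        using F'0 d linear_mapD(1)[OF F' p(1)] by simp
    qed
    then obtain x where x: "x \<in> B" "\<And>\<psi>. \<psi> \<in> carrier (dual M) \<Longrightarrow> F' \<psi> = \<psi> x" by blast
    have xc: "x \<in> carrier M" using x Bc by auto
    have "F \<psi> = \<psi> (x \<oplus>\<^bsub>M\<^esub> c \<odot>\<^bsub>M\<^esub> s)" if p: "\<psi> \<in> carrier (dual M)" for \<psi>
    proof -
      have "F \<psi> = F' \<psi> \<oplus>\<^bsub>J\<^esub> \<psi> (c \<odot>\<^bsub>M\<^esub> s)"
        using Fc[OF p] by (simp add: F'_def a_minus_def J.M.a_assoc J.M.l_neg)
      then show ?thesis using x(2)[OF p] linear_mapD(2)[OF lin[OF p] xc csc] by simp
    qed
    then show ?thesis using x(1) c(1) by (auto simp: adjoin_def)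
  qed
qed

end

locale finite_length_module = artinian_duality k J + M: module k M
  for k :: "'k ring" (structure) and J :: "('k, 'j) module" and M :: "('k, 'a) module" +
  assumes finitely_generated: "finitely_generated_module k M"
begin

lemma filtration: "simple_filtration k M {\<zero>\<^bsub>M\<^esub>} (carrier M)"
  by (rule finitely_generated_module_simple_filtration[OF M.module_axioms artinian finitely_generated])

lemma reflexive:
  assumes "linear_map k (dual M) J F"
  shows "\<exists>x\<in>carrier M. \<forall>\<psi>\<in>carrier (dual M). F \<psi> = \<psi> x"
proof (rule reflexive_step[OF M.module_axioms filtration assms])
  fix \<psi> assume p: "\<psi> \<in> carrier (dual M)" "\<And>x. x \<in> carrier M \<Longrightarrow> \<psi> x = \<zero>\<^bsub>J\<^esub>"
  interpret D: module k "dual M" by (rule module_dual[OF M.module_axioms])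
  have "\<psi> = \<zero>\<^bsub>dual M\<^esub>" 
    by (rule dual_eqI[OF p(1) D.M.zero_closed]) (simp add: p(2) dual_simps(2))
  then show "F \<psi> = \<zero>\<^bsub>J\<^esub>"
    using linear_map_zero[OF module_dual[OF M.module_axioms] module_J assms] by simp
qed

lemma dual_separates:
  assumes "x \<in> carrier M" "x \<noteq> \<zero>\<^bsub>M\<^esub>"
  shows "\<exists>\<psi>\<in>carrier (dual M). \<psi> x \<noteq> \<zero>\<^bsub>J\<^esub>"
proof -
  interpret MJ: two_modules k M J by (simp add: two_modules_def M.module_axioms module_J)
  obtain h where h: "linear_map k M J h" "h x \<noteq> \<zero>\<^bsub>J\<^esub>"
    using MJ.separate_from_submodule[OF baer_J socle_J M.zero_submodule] assms by blast
  then show ?thesis 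
    using dual_restrict[OF M.module_axioms h(1)] assms(1)
    by (intro bexI[of _ "restrict h (carrier M)"]) auto
qed

text \<open>A form on the dual that separates \<open>\<psi>\<close> from \<open>N\<close> is evaluation at some \<open>x\<close> by reflexivity. This \<open>x\<close> is
  annihilated by \<open>N\<close> but not by \<open>\<psi>\<close>.\<close>

lemma double_annihilator:
  assumes N: "submodule N k (dual M)" and p: "\<psi> \<in> carrier (dual M)"
    and van: "\<And>x. x \<in> carrier M \<Longrightarrow> (\<And>\<phi>. \<phi> \<in> N \<Longrightarrow> \<phi> x = \<zero>\<^bsub>J\<^esub>) \<Longrightarrow> \<psi> x = \<zero>\<^bsub>J\<^esub>"
  shows "\<psi> \<in> N"
proof (rule ccontr)
  assume nN: "\<psi> \<notin> N"
  interpret D: module k "dual M" by (rule module_dual[OF M.module_axioms])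
  interpret DJ: two_modules k "dual M" J by (simp add: two_modules_def D.module_axioms module_J)
  obtain F where F: "linear_map k (dual M) J F" "\<forall>\<phi>\<in>N. F \<phi> = \<zero>\<^bsub>J\<^esub>" "F \<psi> \<noteq> \<zero>\<^bsub>J\<^esub>"
    using DJ.separate_from_submodule[OF baer_J socle_J N p nN] by blast
  then obtain x where x: "x \<in> carrier M" "\<And>\<phi>. \<phi> \<in> carrier (dual M) \<Longrightarrow> F \<phi> = \<phi> x"
    using reflexive by blast
  have "N \<subseteq> carrier (dual M)" using N by (auto simp: D.submodule_iff)
  then have "\<psi> x = \<zero>\<^bsub>J\<^esub>" using van[OF x(1)] F(2) x(2) by (metis subsetD)
  then show False using F(3) x(2)[OF p] by simp
qed

lemma submodule_finite_generators:
  assumes U: "submodule U k M"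
  shows "\<exists>S. finite S \<and> S \<subseteq> U \<and> (\<forall>V. submodule V k M \<longrightarrow> S \<subseteq> V \<longrightarrow> U \<subseteq> V)"
proof -
  have "U \<subseteq> carrier M" using U by (auto simp: M.submodule_iff)
  then show ?thesis using M.submodule_finitely_generated[OF filtration U] by (simp add: Int_absorb2)
qed

end

section \<open>Categories with an additive bifunctor\<close>

context preadditive_category
begin

text \<open>Finite direct sums. The last clause replaces the equation \<open>\<Sum>\<^sub>j i\<^sub>j p\<^sub>j = 1\<close> by the statement that \<open>1\<close>
  lies in the additive closure of the \<open>i\<^sub>j p\<^sub>j\<close>, which is how the equation is applied: a property of
  endomorphisms that is closed under addition passes from the \<open>i\<^sub>j p\<^sub>j\<close> to the identity.\<close>

definition decomposition :: "nat \<Rightarrow> (nat \<Rightarrow> 'o) \<Rightarrow> 'o \<Rightarrow> (nat \<Rightarrow> 'm) \<Rightarrow> (nat \<Rightarrow> 'm) \<Rightarrow> bool"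
  where "decomposition m A X i p \<longleftrightarrow>
    X \<in> Ob \<C> \<and> (\<forall>j<m. A j \<in> Ob \<C> \<and> i j \<in> mor (A j) X \<and> p j \<in> mor X (A j)) \<and>
    (\<forall>j<m. \<forall>l<m. p j \<cdot> i l = (if j = l then ident \<C> (A j) else \<zero>\<^bsub>Hom \<C> (A l) (A j)\<^esub>)) \<and>
    (\<forall>K \<subseteq> mor X X. \<zero>\<^bsub>Hom \<C> X X\<^esub> \<in> K \<longrightarrow> (\<forall>x\<in>K. \<forall>y\<in>K. x \<oplus>\<^bsub>Hom \<C> X X\<^esub> y \<in> K) \<longrightarrow>
      (\<forall>j<m. i j \<cdot> p j \<in> K) \<longrightarrow> ident \<C> X \<in> K)"

text \<open>An object with local endomorphism ring. Isomorphisms in place of units make it evident that the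
  notion is self-dual.\<close>

definition local_object :: "'o \<Rightarrow> bool"
  where "local_object A \<longleftrightarrow> A \<in> Ob \<C> \<and> ident \<C> A \<noteq> \<zero>\<^bsub>Hom \<C> A A\<^esub> \<and>
    (\<forall>f\<in>mor A A. \<forall>g\<in>mor A A. \<not> iso_mor A A f \<longrightarrow> \<not> iso_mor A A g \<longrightarrow>
      \<not> iso_mor A A (f \<oplus>\<^bsub>Hom \<C> A A\<^esub> g))"

lemma zero_mor: "A \<in> Ob \<C> \<Longrightarrow> B \<in> Ob \<C> \<Longrightarrow> \<zero>\<^bsub>Hom \<C> A B\<^esub> \<in> mor A B"
  by (simp add: abelian_monoid.zero_closed abelian_group.axioms(1) hom_group)

lemma add_mor: "\<lbrakk>A \<in> Ob \<C>; B \<in> Ob \<C>; f \<in> mor A B; g \<in> mor A B\<rbrakk> \<Longrightarrow> f \<oplus>\<^bsub>Hom \<C> A B\<^esub> g \<in> mor A B"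
  by (simp add: abelian_monoid.a_closed abelian_group.axioms(1) hom_group)

lemma comp_zero_right:
  assumes "A \<in> Ob \<C>" "B \<in> Ob \<C>" "D \<in> Ob \<C>" "g \<in> mor B D"
  shows "g \<cdot> \<zero>\<^bsub>Hom \<C> A B\<^esub> = \<zero>\<^bsub>Hom \<C> A D\<^esub>"
proof -
  interpret H: abelian_group "Hom \<C> A B" by (rule hom_group) (use assms in auto)
  interpret K: abelian_group "Hom \<C> A D" by (rule hom_group) (use assms in auto)
  have c: "g \<cdot> \<zero>\<^bsub>Hom \<C> A B\<^esub> \<in> mor A D" using assms by (intro comp_closed[of A B D]) auto
  have "g \<cdot> (\<zero>\<^bsub>Hom \<C> A B\<^esub> \<oplus>\<^bsub>Hom \<C> A B\<^esub> \<zero>\<^bsub>Hom \<C> A B\<^esub>) =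
      g \<cdot> \<zero>\<^bsub>Hom \<C> A B\<^esub> \<oplus>\<^bsub>Hom \<C> A D\<^esub> g \<cdot> \<zero>\<^bsub>Hom \<C> A B\<^esub>"
    using assms by (intro comp_add_right) auto
  then show ?thesis using c by (metis H.zero_closed H.l_zero K.add.r_cancel_one')
qed

lemma comp_zero_left:
  assumes "A \<in> Ob \<C>" "B \<in> Ob \<C>" "D \<in> Ob \<C>" "f \<in> mor A B"
  shows "\<zero>\<^bsub>Hom \<C> B D\<^esub> \<cdot> f = \<zero>\<^bsub>Hom \<C> A D\<^esub>"
proof -
  interpret H: abelian_group "Hom \<C> B D" by (rule hom_group) (use assms in auto)
  interpret K: abelian_group "Hom \<C> A D" by (rule hom_group) (use assms in auto)
  have c: "\<zero>\<^bsub>Hom \<C> B D\<^esub> \<cdot> f \<in> mor A D" using assms by (intro comp_closed[of A B D]) auto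
  have "(\<zero>\<^bsub>Hom \<C> B D\<^esub> \<oplus>\<^bsub>Hom \<C> B D\<^esub> \<zero>\<^bsub>Hom \<C> B D\<^esub>) \<cdot> f =
      \<zero>\<^bsub>Hom \<C> B D\<^esub> \<cdot> f \<oplus>\<^bsub>Hom \<C> A D\<^esub> \<zero>\<^bsub>Hom \<C> B D\<^esub> \<cdot> f"
    using assms by (intro comp_add_left) auto
  then show ?thesis using c by (metis H.zero_closed H.l_zero K.add.r_cancel_one')
qed

lemma local_object_iso_or:
  assumes A: "local_object A" and f: "f \<in> mor A A"
  shows "iso_mor A A f \<or> iso_mor A A (ident \<C> A \<ominus>\<^bsub>Hom \<C> A A\<^esub> f)"
proof (rule ccontr)
  assume n: "\<not> ?thesis"
  have AO: "A \<in> Ob \<C>" using A by (simp add: local_object_def)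
  interpret H: abelian_group "Hom \<C> A A" by (rule hom_group[OF AO AO])
  have i: "ident \<C> A \<in> mor A A" using AO by (rule ident_closed)
  have "\<not> iso_mor A A (f \<oplus>\<^bsub>Hom \<C> A A\<^esub> (ident \<C> A \<ominus>\<^bsub>Hom \<C> A A\<^esub> f))"
    using A n f i unfolding local_object_def by (metis H.minus_closed)
  moreover have "f \<oplus>\<^bsub>Hom \<C> A A\<^esub> (ident \<C> A \<ominus>\<^bsub>Hom \<C> A A\<^esub> f) = ident \<C> A"
    using f i by (simp add: a_minus_def H.a_lcomm[of f] H.r_neg)
  moreover have "iso_mor A A (ident \<C> A)"
    using i AO unfolding iso_mor_def by (metis ident_left)
  ultimately show False by simp
qed

text \<open>The idempotent \<open>e = x y\<close> or its complement \<open>1 - e\<close> is an isomorphism. In the first case \<open>e = 1\<close>. In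
  the second, \<open>(1 - e) x = 0\<close> gives \<open>x = 0\<close>, which is impossible.\<close>

lemma local_object_one_sided_inverse:
  assumes A: "local_object A" and xy: "x \<in> mor A A" "y \<in> mor A A" "y \<cdot> x = ident \<C> A"
  shows "iso_mor A A x" "iso_mor A A y"
proof -
  have AO: "A \<in> Ob \<C>" using A by (simp add: local_object_def)
  interpret H: abelian_group "Hom \<C> A A" by (rule hom_group[OF AO AO])
  have i: "ident \<C> A \<in> mor A A" using AO by (rule ident_closed)
  note asc = comp_assoc[OF AO AO AO AO] and cl = comp_closed[OF AO AO AO]
    and il = ident_left[OF AO AO] and ir = ident_right[OF AO AO]
  let ?e = "x \<cdot> y"
  have e: "?e \<in> mor A A" using cl xy by auto
  from local_object_iso_or[OF A e] have "?e = ident \<C> A"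
  proof
    assume "iso_mor A A ?e"
    then obtain g where g: "g \<in> mor A A" "g \<cdot> ?e = ident \<C> A" by (auto simp: iso_mor_def)
    have "?e \<cdot> ?e = ?e" by (metis asc xy cl ir)
    then have "g \<cdot> ?e \<cdot> ?e = g \<cdot> ?e" using g e asc by metis
    then show ?thesis using g e il by simp
  next
    let ?d = "ident \<C> A \<ominus>\<^bsub>Hom \<C> A A\<^esub> ?e"
    assume "iso_mor A A ?d"
    then obtain g where g: "g \<in> mor A A" "g \<cdot> ?d = ident \<C> A" by (auto simp: iso_mor_def)
    have d: "?d \<in> mor A A" using i e by auto
    have "?d \<cdot> x \<oplus>\<^bsub>Hom \<C> A A\<^esub> ?e \<cdot> x = (?d \<oplus>\<^bsub>Hom \<C> A A\<^esub> ?e) \<cdot> x"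
      by (rule comp_add_left[OF AO AO AO xy(1) d e, symmetric])
    also have "?d \<oplus>\<^bsub>Hom \<C> A A\<^esub> ?e = ident \<C> A"
      using e i by (simp add: a_minus_def H.a_assoc H.l_neg)
    also have "ident \<C> A \<cdot> x = x" using il xy by auto
    also have "?e \<cdot> x = x" by (metis asc xy ir)
    finally have "?d \<cdot> x = \<zero>\<^bsub>Hom \<C> A A\<^esub>"
      using cl[OF xy(1) d] xy(1) by (metis H.add.r_cancel_one')
    then have "x = \<zero>\<^bsub>Hom \<C> A A\<^esub>"
      using asc[OF xy(1) d g(1)] g comp_zero_right[OF AO AO AO g(1)] il xy by simp
    then have "ident \<C> A = \<zero>\<^bsub>Hom \<C> A A\<^esub>" using xy comp_zero_right[OF AO AO AO xy(2)] by simp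
    then show ?thesis using A by (simp add: local_object_def)
  qed
  then show "iso_mor A A x" "iso_mor A A y" using xy by (auto simp: iso_mor_def)
qed

end

definition op_cat :: "('o, 'm, 'x) cat \<Rightarrow> ('o, 'm, 'x) cat"
  where "op_cat \<C> = \<lparr>Ob = Ob \<C>, Hom = (\<lambda>A B. Hom \<C> B A), comp_mor = (\<lambda>g f. f \<cdot>\<^bsub>\<C>\<^esub> g), ident = ident \<C>\<rparr>"

definition op_bif :: "('o, 'm, 'e, 'x) bifunctor \<Rightarrow> ('o, 'm, 'e, 'x) bifunctor"
  where "op_bif \<E> = \<lparr>Ext = (\<lambda>C A. Ext \<E> A C), Emap = (\<lambda>c a. Emap \<E> a c)\<rparr>"

lemma op_simps [simp]:
  "Ob (op_cat \<C>) = Ob \<C>" "Hom (op_cat \<C>) A B = Hom \<C> B A" "g \<cdot>\<^bsub>op_cat \<C>\<^esub> f = f \<cdot>\<^bsub>\<C>\<^esub> g"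
  "ident (op_cat \<C>) = ident \<C>" "Ext (op_bif \<E>) X A = Ext \<E> A X" "Emap (op_bif \<E>) c a = Emap \<E> a c"
  by (simp_all add: op_cat_def op_bif_def)

lemma op_category:
  assumes "category \<C>"
  shows "category (op_cat \<C>)"
proof -
  interpret category \<C> by fact
  show ?thesis
  proof (unfold_locales, goal_cases)
    case (1 A B A' B' f) then show ?case using hom_disjoint[of B A B' A' f] by auto
  next
    case (3 A B D f g) then show ?case using comp_closed[of D B A g f] by simp
  next
    case (6 A B D F f g h) then show ?case using comp_assoc[of F D B A h g f] by simp
  qed (use ident_closed ident_left ident_right in auto)
qed

lemma op_preadditive_category:
  assumes "preadditive_category \<C>"
  shows "preadditive_category (op_cat \<C>)"
proof -
  interpret preadditive_category \<C> by fact
  interpret op: category "op_cat \<C>" by (rule op_category) (rule category_axioms)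
  show ?thesis
    by (rule preadditive_category.intro[OF op.category_axioms], unfold preadditive_category_axioms_def)
      (simp add: hom_group comp_add_left comp_add_right)
qed

lemma op_additive_category:
  assumes "additive_category \<C>"
  shows "additive_category (op_cat \<C>)"
proof -
  interpret additive_category \<C> by fact
  interpret op: preadditive_category "op_cat \<C>"
    by (rule op_preadditive_category) (rule preadditive_category_axioms)
  show ?thesis
  proof (unfold_locales, goal_cases)
    case 1
    then show ?case using zero_object_exists by (simp add: zero_object_def op.zero_object_def) metis
  next
    case (2 A B)
    then obtain S i1 i2 p1 p2 where "biproduct A B S i1 i2 p1 p2" using biproduct_exists[of A B] by auto
    then have "op.biproduct A B S p1 p2 i1 i2" by (simp add: biproduct_def op.biproduct_def)
    then show ?case by blast
  qed
qed

lemma op_additive_bifunctor: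
  assumes "additive_bifunctor \<C> \<E>"
  shows "additive_bifunctor (op_cat \<C>) (op_bif \<E>)"
proof -
  interpret additive_bifunctor \<C> \<E> by fact
  interpret op: additive_category "op_cat \<C>"
    by (rule op_additive_category) (rule additive_category_axioms)
  show ?thesis
    by (rule additive_bifunctor.intro[OF op.additive_category_axioms], unfold additive_bifunctor_axioms_def)
      (simp add: Ext_group Emap_closed Emap_add Emap_ident Emap_comp Emap_add_first Emap_add_second)
qed

lemma op_k_linear:
  assumes "k_linear k \<C> \<E>"
  shows "k_linear k (op_cat \<C>) (op_bif \<E>)"
  using assms unfolding k_linear_def op_simps by blast

lemma op_ext_finite: "ext_finite k \<C> \<E> \<Longrightarrow> ext_finite k (op_cat \<C>) (op_bif \<E>)"
  by (auto simp: ext_finite_def)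

lemma (in preadditive_category) op_iso_mor:
  "category.iso_mor (op_cat \<C>) A A f \<longleftrightarrow> iso_mor A A f"
proof -
  interpret op: category "op_cat \<C>" by (rule op_category) (rule category_axioms)
  show ?thesis by (auto simp: iso_mor_def op.iso_mor_def)
qed

lemma (in preadditive_category) op_local_object:
  "preadditive_category.local_object (op_cat \<C>) A \<longleftrightarrow> local_object A"
proof -
  interpret op: preadditive_category "op_cat \<C>"
    by (rule op_preadditive_category) (rule preadditive_category_axioms)
  show ?thesis by (simp add: local_object_def op.local_object_def op_iso_mor)
qed

lemma (in preadditive_category) op_decomposition:
  "preadditive_category.decomposition (op_cat \<C>) m A X i p \<longleftrightarrow> decomposition m A X p i"
proof -
  interpret op: preadditive_category "op_cat \<C>"
    by (rule op_preadditive_category) (rule preadditive_category_axioms)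
  have "(\<forall>j<m. \<forall>l<m. i l \<cdot> p j = (if j = l then ident \<C> (A j) else \<zero>\<^bsub>Hom \<C> (A j) (A l)\<^esub>)) \<longleftrightarrow>
    (\<forall>j<m. \<forall>l<m. i j \<cdot> p l = (if j = l then ident \<C> (A j) else \<zero>\<^bsub>Hom \<C> (A l) (A j)\<^esub>))"
    by metis
  then show ?thesis
    unfolding decomposition_def op.decomposition_def op_simps
    by (intro conj_cong refl) auto
qed

locale serre_setting = artinian_duality k J + additive_bifunctor \<C> \<E>
  for k :: "'k ring" and J :: "('k, 'j) module"
    and \<C> :: "('o, 'm, 'k) module_cat" (structure)
    and \<E> :: "('o, 'm, 'e, 'k) module_bifunctor" +
  assumes k_linear: "k_linear k \<C> \<E>" and ext_finite: "ext_finite k \<C> \<E>"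
    and local_decomposition:
      "X \<in> Ob \<C> \<Longrightarrow> \<exists>m A i p. decomposition m A X i p \<and> (\<forall>j<m. local_object (A j))"

lemma op_serre_setting:
  assumes "serre_setting k J \<C> \<E>"
  shows "serre_setting k J (op_cat \<C>) (op_bif \<E>)"
proof -
  interpret serre_setting k J \<C> \<E> by fact
  interpret op: additive_bifunctor "op_cat \<C>" "op_bif \<E>"
    by (rule op_additive_bifunctor) (rule additive_bifunctor_axioms)
  show ?thesis
  proof (unfold_locales, goal_cases)
    case 1 then show ?case by (rule op_k_linear[OF k_linear])
  next
    case 2 then show ?case by (rule op_ext_finite[OF ext_finite])
  next
    case (3 X)
    then show ?case using local_decomposition[of X] by (simp add: op_decomposition op_local_object) blast
  qed
qed

context serre_setting
begin

lemma hom_module: "A \<in> Ob \<C> \<Longrightarrow> B \<in> Ob \<C> \<Longrightarrow> module k (Hom \<C> A B)"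
  using k_linear by (simp add: k_linear_def)

lemma ext_module: "A \<in> Ob \<C> \<Longrightarrow> B \<in> Ob \<C> \<Longrightarrow> module k (Ext \<E> A B)"
  using k_linear by (simp add: k_linear_def)

lemma comp_linear:
  "\<lbrakk>A \<in> Ob \<C>; B \<in> Ob \<C>; D \<in> Ob \<C>; g \<in> mor B D\<rbrakk> \<Longrightarrow> linear_map k (Hom \<C> A B) (Hom \<C> A D) (\<lambda>f. g \<cdot> f)"
  "\<lbrakk>A \<in> Ob \<C>; B \<in> Ob \<C>; D \<in> Ob \<C>; f \<in> mor A B\<rbrakk> \<Longrightarrow> linear_map k (Hom \<C> B D) (Hom \<C> A D) (\<lambda>g. g \<cdot> f)"
  using k_linear unfolding k_linear_def by blast+

lemma Emap_linear:
  assumes "A \<in> Ob \<C>" "B \<in> Ob \<C>" "C \<in> Ob \<C>" "D \<in> Ob \<C>"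
  shows "\<lbrakk>\<delta> \<in> carrier (Ext \<E> B C); g \<in> mor C D\<rbrakk> \<Longrightarrow> linear_map k (Hom \<C> A B) (Ext \<E> A D) (\<lambda>f. Emap \<E> f g \<delta>)"
    and "\<lbrakk>f \<in> mor A B; g \<in> mor C D\<rbrakk> \<Longrightarrow> linear_map k (Ext \<E> B C) (Ext \<E> A D) (\<lambda>\<delta>. Emap \<E> f g \<delta>)"
    and "\<lbrakk>f \<in> mor A B; \<delta> \<in> carrier (Ext \<E> B C)\<rbrakk> \<Longrightarrow> linear_map k (Hom \<C> C D) (Ext \<E> A D) (\<lambda>g. Emap \<E> f g \<delta>)"
  using assms k_linear unfolding k_linear_def by blast+

lemma Emap_zero:
  assumes "A \<in> Ob \<C>" "B \<in> Ob \<C>" "C \<in> Ob \<C>" "D \<in> Ob \<C>"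
  shows "\<lbrakk>\<delta> \<in> carrier (Ext \<E> B C); g \<in> mor C D\<rbrakk> \<Longrightarrow> Emap \<E> \<zero>\<^bsub>Hom \<C> A B\<^esub> g \<delta> = \<zero>\<^bsub>Ext \<E> A D\<^esub>"
    and "\<lbrakk>f \<in> mor A B; g \<in> mor C D\<rbrakk> \<Longrightarrow> Emap \<E> f g \<zero>\<^bsub>Ext \<E> B C\<^esub> = \<zero>\<^bsub>Ext \<E> A D\<^esub>"
    and "\<lbrakk>f \<in> mor A B; \<delta> \<in> carrier (Ext \<E> B C)\<rbrakk> \<Longrightarrow> Emap \<E> f \<zero>\<^bsub>Hom \<C> C D\<^esub> \<delta> = \<zero>\<^bsub>Ext \<E> A D\<^esub>"
  using assms linear_map_zero[OF _ _ Emap_linear(1)] linear_map_zero[OF _ _ Emap_linear(2)]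
    linear_map_zero[OF _ _ Emap_linear(3)] hom_module ext_module by simp_all

lemma ext_finite_length: "A \<in> Ob \<C> \<Longrightarrow> B \<in> Ob \<C> \<Longrightarrow> finite_length_module k J (Ext \<E> A B)"
  using ext_finite ext_module
  by (simp add: finite_length_module_def finite_length_module_axioms_def ext_finite_def artinian_duality_axioms)

lemma Emap_pull_pull:
  assumes "A \<in> Ob \<C>" "X \<in> Ob \<C>" "Y \<in> Ob \<C>" "Z \<in> Ob \<C>" "g \<in> mor Y X" "h \<in> mor Z Y" "\<delta> \<in> carrier (Ext \<E> X A)"
  shows "Emap \<E> h (ident \<C> A) (Emap \<E> g (ident \<C> A) \<delta>) = Emap \<E> (g \<cdot> h) (ident \<C> A) \<delta>"
  using assms Emap_comp[of X Y Z A A A g h "ident \<C> A" "ident \<C> A" \<delta>]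
  by (simp add: ident_closed ident_left[of A A])

lemma Emap_push_push:
  assumes "X \<in> Ob \<C>" "A \<in> Ob \<C>" "B \<in> Ob \<C>" "D \<in> Ob \<C>" "f \<in> mor A B" "g \<in> mor B D" "\<delta> \<in> carrier (Ext \<E> X A)"
  shows "Emap \<E> (ident \<C> X) g (Emap \<E> (ident \<C> X) f \<delta>) = Emap \<E> (ident \<C> X) (g \<cdot> f) \<delta>"
  using assms Emap_comp[of X X X A B D "ident \<C> X" "ident \<C> X" f g \<delta>]
  by (simp add: ident_closed ident_left[of X X])

lemma Emap_push_pull:
  assumes "X \<in> Ob \<C>" "Y \<in> Ob \<C>" "A \<in> Ob \<C>" "B \<in> Ob \<C>" "f \<in> mor A B" "g \<in> mor Y X" "\<delta> \<in> carrier (Ext \<E> X A)"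
  shows "Emap \<E> (ident \<C> Y) f (Emap \<E> g (ident \<C> A) \<delta>) = Emap \<E> g f \<delta>"
    and "Emap \<E> g (ident \<C> B) (Emap \<E> (ident \<C> X) f \<delta>) = Emap \<E> g f \<delta>"
  using assms Emap_comp[of X Y Y A A B g "ident \<C> Y" "ident \<C> A" f \<delta>]
    Emap_comp[of X X Y A B B "ident \<C> X" g f "ident \<C> B" \<delta>]
  by (simp_all add: ident_closed ident_left[of Y X] ident_right[of Y X] ident_left[of A B] ident_right[of A B])

end

section \<open>Serre pairs\<close>

context serre_setting
begin

abbreviation "extn X A \<equiv> carrier (Ext \<E> X A)"
abbreviation "zero_ext X A \<equiv> \<zero>\<^bsub>Ext \<E> X A\<^esub>"
abbreviation "zero_hom A B \<equiv> \<zero>\<^bsub>Hom \<C> A B\<^esub>"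
abbreviation "pullback g A \<equiv> Emap \<E> g (ident \<C> A)"
abbreviation "pushforward X f \<equiv> Emap \<E> (ident \<C> X) f"

text \<open>The two halves are exchanged by passage to the opposite category. Requiring only nondegenerate
  pairings, on both sides, makes the notion easy to verify for almost split extensions and compatible
  with direct sums; bijectivity follows from Matlis duality.\<close>

definition serre_pair :: "'o \<Rightarrow> 'o \<Rightarrow> ('e \<Rightarrow> 'j) \<Rightarrow> bool"
  where "serre_pair C A \<gamma> \<longleftrightarrow> C \<in> Ob \<C> \<and> A \<in> Ob \<C> \<and> \<gamma> \<in> carrier (dual (Ext \<E> C A)) \<and>
    (\<forall>B\<in>Ob \<C>.
      (\<forall>f\<in>mor B A. f \<noteq> zero_hom B A \<longrightarrow>
        (\<exists>\<theta>\<in>extn C B. \<gamma> (pushforward C f \<theta>) \<noteq> \<zero>\<^bsub>J\<^esub>)) \<and>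
      (\<forall>\<theta>\<in>extn C B. \<theta> \<noteq> zero_ext C B \<longrightarrow>
        (\<exists>f\<in>mor B A. \<gamma> (pushforward C f \<theta>) \<noteq> \<zero>\<^bsub>J\<^esub>))) \<and>
    (\<forall>D\<in>Ob \<C>.
      (\<forall>g\<in>mor C D. g \<noteq> zero_hom C D \<longrightarrow>
        (\<exists>\<rho>\<in>extn D A. \<gamma> (pullback g A \<rho>) \<noteq> \<zero>\<^bsub>J\<^esub>)) \<and>
      (\<forall>\<rho>\<in>extn D A. \<rho> \<noteq> zero_ext D A \<longrightarrow>
        (\<exists>g\<in>mor C D. \<gamma> (pullback g A \<rho>) \<noteq> \<zero>\<^bsub>J\<^esub>)))"

lemma op_serre_pair: "serre_setting.serre_pair k J (op_cat \<C>) (op_bif \<E>) A C \<gamma> \<longleftrightarrow> serre_pair C A \<gamma>"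
proof -
  interpret op: serre_setting k J "op_cat \<C>" "op_bif \<E>"
    by (rule op_serre_setting) (rule serre_setting_axioms)
  show ?thesis unfolding serre_pair_def op.serre_pair_def op_simps by blast
qed

lemma dual_linear: "\<gamma> \<in> carrier (dual M) \<Longrightarrow> linear_map k M J \<gamma>"
  by (simp add: dual_simps)

definition pull_form :: "'o \<Rightarrow> ('e \<Rightarrow> 'j) \<Rightarrow> 'o \<Rightarrow> 'm \<Rightarrow> 'e \<Rightarrow> 'j"
  where "pull_form A \<gamma> D g = (\<lambda>\<rho>\<in>extn D A. \<gamma> (pullback g A \<rho>))"

lemma pull_form_dual:
  assumes "C \<in> Ob \<C>" "A \<in> Ob \<C>" "\<gamma> \<in> carrier (dual (Ext \<E> C A))" "D \<in> Ob \<C>" "g \<in> mor C D"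
  shows "pull_form A \<gamma> D g \<in> carrier (dual (Ext \<E> D A))"
  unfolding pull_form_def
  by (rule dual_restrict[OF ext_module linear_map_comp[OF Emap_linear(2) dual_linear]])
    (use assms ident_closed in auto)

lemma pull_form_linear:
  assumes o: "C \<in> Ob \<C>" "A \<in> Ob \<C>" "\<gamma> \<in> carrier (dual (Ext \<E> C A))" "D \<in> Ob \<C>"
  shows "linear_map k (Hom \<C> C D) (dual (Ext \<E> D A)) (pull_form A \<gamma> D)"
  unfolding linear_map_def
proof (intro conjI ballI)
  show "pull_form A \<gamma> D \<in> mor C D \<rightarrow> carrier (dual (Ext \<E> D A))"
    using pull_form_dual[OF o] by auto
  have id: "ident \<C> A \<in> mor A A" using o by (simp add: ident_closed)
  have lin: "linear_map k (Hom \<C> C D) J (\<lambda>g. \<gamma> (pullback g A \<rho>))"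
    if "\<rho> \<in> extn D A" for \<rho>
    by (rule linear_map_comp[OF Emap_linear(1) dual_linear[OF o(3)]]) (use o that id in auto)
  show "pull_form A \<gamma> D (x \<oplus>\<^bsub>Hom \<C> C D\<^esub> y) =
      pull_form A \<gamma> D x \<oplus>\<^bsub>dual (Ext \<E> D A)\<^esub> pull_form A \<gamma> D y" if "x \<in> mor C D" "y \<in> mor C D" for x y
    using linear_mapD(2)[OF lin that] unfolding pull_form_def dual_simps by (auto intro!: restrict_ext)
  show "pull_form A \<gamma> D (r \<odot>\<^bsub>Hom \<C> C D\<^esub> x) =
      r \<odot>\<^bsub>dual (Ext \<E> D A)\<^esub> pull_form A \<gamma> D x" if "r \<in> carrier k" "x \<in> mor C D" for r x
    using linear_mapD(3)[OF lin that] unfolding pull_form_def dual_simps by (auto intro!: restrict_ext)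
qed

lemma pull_form_image_submodule:
  assumes o: "C \<in> Ob \<C>" "A \<in> Ob \<C>" "\<gamma> \<in> carrier (dual (Ext \<E> C A))" "D \<in> Ob \<C>"
    and H: "submodule H k (Hom \<C> C D)"
  shows "submodule (pull_form A \<gamma> D ` H) k (dual (Ext \<E> D A))"
proof -
  interpret H: module k "Hom \<C> C D" by (rule hom_module) (use o in auto)
  interpret D: module k "dual (Ext \<E> D A)" by (rule module_dual[OF ext_module]) (use o in auto)
  note l = pull_form_linear[OF o]
  have Hs: "H \<subseteq> mor C D" "zero_hom C D \<in> H" "\<And>x y. x \<in> H \<Longrightarrow> y \<in> H \<Longrightarrow> x \<oplus>\<^bsub>Hom \<C> C D\<^esub> y \<in> H"
    "\<And>r x. r \<in> carrier k \<Longrightarrow> x \<in> H \<Longrightarrow> r \<odot>\<^bsub>Hom \<C> C D\<^esub> x \<in> H"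
    using H by (auto simp: H.submodule_iff)
  show ?thesis
    unfolding D.submodule_iff
  proof (intro conjI ballI)
    show "pull_form A \<gamma> D ` H \<subseteq> carrier (dual (Ext \<E> D A))" using Hs(1) linear_mapD(1)[OF l] by auto
    show "\<zero>\<^bsub>dual (Ext \<E> D A)\<^esub> \<in> pull_form A \<gamma> D ` H"
      using linear_map_zero[OF H.module_axioms D.module_axioms l] Hs(2) by (metis imageI)
    show "a \<oplus>\<^bsub>dual (Ext \<E> D A)\<^esub> b \<in> pull_form A \<gamma> D ` H"
      if "a \<in> pull_form A \<gamma> D ` H" "b \<in> pull_form A \<gamma> D ` H" for a b
      using that Hs linear_mapD(2)[OF l, symmetric] by (auto simp: subset_iff)
    show "r \<odot>\<^bsub>dual (Ext \<E> D A)\<^esub> a \<in> pull_form A \<gamma> D ` H"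
      if "r \<in> carrier k" "a \<in> pull_form A \<gamma> D ` H" for r a
      using that Hs linear_mapD(3)[OF l, symmetric] by (auto simp: subset_iff)
  qed
qed

text \<open>By nondegeneracy the forms that come from \<open>\<C>(C, D)\<close> have only \<open>0\<close> as a common zero, so their double
  annihilator is the whole dual.\<close>

lemma serre_pair_pull_surj:
  assumes p: "serre_pair C A \<gamma>" and D: "D \<in> Ob \<C>" and \<psi>: "\<psi> \<in> carrier (dual (Ext \<E> D A))"
  shows "\<exists>g\<in>mor C D. \<psi> = pull_form A \<gamma> D g"
proof -
  have o: "C \<in> Ob \<C>" "A \<in> Ob \<C>" "\<gamma> \<in> carrier (dual (Ext \<E> C A))" using p by (auto simp: serre_pair_def)
  interpret M: finite_length_module k J "Ext \<E> D A" by (rule ext_finite_length[OF D o(2)])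
  interpret H: module k "Hom \<C> C D" by (rule hom_module[OF o(1) D])
  have "\<psi> \<in> pull_form A \<gamma> D ` mor C D"
  proof (rule M.double_annihilator[OF pull_form_image_submodule[OF o D H.carrier_is_submodule] \<psi>])
    fix \<rho> assume r: "\<rho> \<in> extn D A"
      and v: "\<And>\<phi>. \<phi> \<in> pull_form A \<gamma> D ` mor C D \<Longrightarrow> \<phi> \<rho> = \<zero>\<^bsub>J\<^esub>"
    have "\<rho> = zero_ext D A"
    proof (rule ccontr)
      assume "\<rho> \<noteq> zero_ext D A"
      then obtain g where "g \<in> mor C D" "\<gamma> (pullback g A \<rho>) \<noteq> \<zero>\<^bsub>J\<^esub>"
        using p D r unfolding serre_pair_def by blast
      then show False using v[of "pull_form A \<gamma> D g"] r by (auto simp: pull_form_def)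
    qed
    then show "\<psi> \<rho> = \<zero>\<^bsub>J\<^esub>"
      using linear_map_zero[OF M.M.module_axioms module_J dual_linear[OF \<psi>]] by simp
  qed
  then show ?thesis by blast
qed

lemma serre_pair_pull_inj:
  assumes p: "serre_pair C A \<gamma>" and D: "D \<in> Ob \<C>" and g: "g \<in> mor C D" "h \<in> mor C D"
    and eq: "\<And>\<rho>. \<rho> \<in> extn D A \<Longrightarrow> \<gamma> (pullback g A \<rho>) = \<gamma> (pullback h A \<rho>)"
  shows "g = h"
proof -
  have o: "C \<in> Ob \<C>" "A \<in> Ob \<C>" "\<gamma> \<in> carrier (dual (Ext \<E> C A))" using p by (auto simp: serre_pair_def)
  interpret H: module k "Hom \<C> C D" by (rule hom_module[OF o(1) D])
  interpret J: module k J by (rule module_J)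
  have "g \<ominus>\<^bsub>Hom \<C> C D\<^esub> h = zero_hom C D"
  proof (rule ccontr)
    assume "g \<ominus>\<^bsub>Hom \<C> C D\<^esub> h \<noteq> zero_hom C D"
    moreover have "g \<ominus>\<^bsub>Hom \<C> C D\<^esub> h \<in> mor C D" using g by auto
    ultimately obtain \<rho> where r: "\<rho> \<in> extn D A"
      "\<gamma> (Emap \<E> (g \<ominus>\<^bsub>Hom \<C> C D\<^esub> h) (ident \<C> A) \<rho>) \<noteq> \<zero>\<^bsub>J\<^esub>"
      using p D unfolding serre_pair_def by blast
    have lin: "linear_map k (Hom \<C> C D) J (\<lambda>g. \<gamma> (pullback g A \<rho>))"
      by (rule linear_map_comp[OF Emap_linear(1) dual_linear[OF o(3)]])
        (use o D r ident_closed in auto)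
    have "\<gamma> (Emap \<E> (g \<ominus>\<^bsub>Hom \<C> C D\<^esub> h) (ident \<C> A) \<rho>) = \<zero>\<^bsub>J\<^esub>"
      using linear_map_minus[OF H.module_axioms module_J lin g] eq[OF r(1)] linear_mapD(1)[OF lin g(2)]
      by (simp add: a_minus_def J.M.r_neg)
    then show False using r by simp
  qed
  then show ?thesis using g
    by (metis H.M.minus_equality H.M.minus_minus H.M.a_inv_closed a_minus_def)
qed

lemma serre_pair_push_surj:
  assumes p: "serre_pair C A \<gamma>" and B: "B \<in> Ob \<C>" and \<psi>: "\<psi> \<in> carrier (dual (Ext \<E> C B))"
  shows "\<exists>f\<in>mor B A. \<psi> = (\<lambda>\<theta>\<in>extn C B. \<gamma> (pushforward C f \<theta>))"
proof -
  interpret op: serre_setting k J "op_cat \<C>" "op_bif \<E>"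
    by (rule op_serre_setting) (rule serre_setting_axioms)
  show ?thesis
    using op.serre_pair_pull_surj[of A C \<gamma> B \<psi>] p B \<psi> by (simp add: op_serre_pair op.pull_form_def)
qed

lemma serre_pair_push_inj:
  assumes p: "serre_pair C A \<gamma>" and B: "B \<in> Ob \<C>" and f: "f \<in> mor B A" "h \<in> mor B A"
    and eq: "\<And>\<theta>. \<theta> \<in> extn C B \<Longrightarrow> \<gamma> (pushforward C f \<theta>) = \<gamma> (pushforward C h \<theta>)"
  shows "f = h"
proof -
  interpret op: serre_setting k J "op_cat \<C>" "op_bif \<E>"
    by (rule op_serre_setting) (rule serre_setting_axioms)
  show ?thesis
    using op.serre_pair_pull_inj[of A C \<gamma> B f h] p B f eq by (simp add: op_serre_pair)
qed

section \<open>Extensions determined by an object\<close>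

text \<open>Right determination of a deflation with extension \<open>\<delta>\<close>, expressed by \<open>\<delta>\<close>: a morphism factors through
  the deflation if and only if it pulls \<open>\<delta>\<close> back to zero.\<close>

definition right_determined_ext :: "'o \<Rightarrow> 'o \<Rightarrow> 'o \<Rightarrow> 'e \<Rightarrow> bool"
  where "right_determined_ext C Y A \<delta> \<longleftrightarrow>
    (\<forall>L\<in>Ob \<C>. \<forall>g\<in>mor L Y. (\<forall>h\<in>mor C L. pullback (g \<cdot> h) A \<delta> = zero_ext C A) \<longrightarrow>
      pullback g A \<delta> = zero_ext L A)"

definition right_classified :: bool
  where "right_classified \<longleftrightarrow>
    (\<forall>Y\<in>Ob \<C>. \<forall>A\<in>Ob \<C>. \<forall>\<delta>\<in>extn Y A. \<exists>C\<in>Ob \<C>. right_determined_ext C Y A \<delta>) \<and>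
    (\<forall>Y\<in>Ob \<C>. \<forall>C\<in>Ob \<C>. \<forall>H. subgroup H (add_monoid (Hom \<C> C Y)) \<and>
        (\<forall>h\<in>H. \<forall>e\<in>mor C C. h \<cdot> e \<in> H) \<longrightarrow>
      (\<exists>A\<in>Ob \<C>. \<exists>\<delta>\<in>extn Y A. right_determined_ext C Y A \<delta> \<and>
        {h \<in> mor C Y. pullback h A \<delta> = zero_ext C A} = H))"

definition left_determined_ext :: "'o \<Rightarrow> 'o \<Rightarrow> 'o \<Rightarrow> 'e \<Rightarrow> bool"
  where "left_determined_ext C X D \<delta> \<longleftrightarrow>
    (\<forall>L\<in>Ob \<C>. \<forall>g\<in>mor X L. (\<forall>h\<in>mor L C. pushforward D (h \<cdot> g) \<delta> = zero_ext D C) \<longrightarrow>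
      pushforward D g \<delta> = zero_ext D L)"

definition left_classified :: bool
  where "left_classified \<longleftrightarrow>
    (\<forall>X\<in>Ob \<C>. \<forall>D\<in>Ob \<C>. \<forall>\<delta>\<in>extn D X. \<exists>C\<in>Ob \<C>. left_determined_ext C X D \<delta>) \<and>
    (\<forall>X\<in>Ob \<C>. \<forall>C\<in>Ob \<C>. \<forall>H. subgroup H (add_monoid (Hom \<C> X C)) \<and>
        (\<forall>h\<in>H. \<forall>e\<in>mor C C. e \<cdot> h \<in> H) \<longrightarrow>
      (\<exists>D\<in>Ob \<C>. \<exists>\<delta>\<in>extn D X. left_determined_ext C X D \<delta> \<and>
        {h \<in> mor X C. pushforward D h \<delta> = zero_ext D C} = H))"

lemma op_right_classified:
  "serre_setting.right_classified (op_cat \<C>) (op_bif \<E>) \<longleftrightarrow> left_classified"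
proof -
  interpret op: serre_setting k J "op_cat \<C>" "op_bif \<E>"
    by (rule op_serre_setting) (rule serre_setting_axioms)
  show ?thesis
    unfolding op.right_classified_def left_classified_def op.right_determined_ext_def
      left_determined_ext_def op_simps ..
qed

lemma op_left_classified:
  "serre_setting.left_classified (op_cat \<C>) (op_bif \<E>) \<longleftrightarrow> right_classified"
proof -
  interpret op: serre_setting k J "op_cat \<C>" "op_bif \<E>"
    by (rule op_serre_setting) (rule serre_setting_axioms)
  show ?thesis
    unfolding op.left_classified_def right_classified_def op.left_determined_ext_def
      right_determined_ext_def op_simps ..
qed

lemma Emap_annihilator_submodule:
  assumes "X \<in> Ob \<C>" "Y \<in> Ob \<C>" "A \<in> Ob \<C>" "g \<in> mor X Y"
  shows "submodule {\<delta> \<in> extn Y A. pullback g A \<delta> = zero_ext X A} k (Ext \<E> Y A)"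
proof -
  interpret Y: module k "Ext \<E> Y A" by (rule ext_module) (use assms in auto)
  interpret X: module k "Ext \<E> X A" by (rule ext_module) (use assms in auto)
  have l: "linear_map k (Ext \<E> Y A) (Ext \<E> X A) (pullback g A)"
    by (rule Emap_linear(2)) (use assms ident_closed in auto)
  show ?thesis
    unfolding Y.submodule_iff
    using linear_mapD[OF l] linear_map_zero[OF Y.module_axioms X.module_axioms l] by auto
qed

text \<open>The extension is \<open>(\<delta>, \<epsilon>) \<in> \<E>(Y, A \<oplus> B)\<close>.\<close>

lemma extension_sum:
  assumes o: "Y \<in> Ob \<C>" "A \<in> Ob \<C>" "B \<in> Ob \<C>" and d: "\<delta> \<in> extn Y A" "\<epsilon> \<in> extn Y B"
  shows "\<exists>S\<in>Ob \<C>. \<exists>\<omega>\<in>extn Y S. \<forall>L\<in>Ob \<C>. \<forall>g\<in>mor L Y.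
    pullback g S \<omega> = zero_ext L S \<longleftrightarrow>
    pullback g A \<delta> = zero_ext L A \<and> pullback g B \<epsilon> = zero_ext L B"
proof -
  obtain S i1 i2 p1 p2 where b: "biproduct A B S i1 i2 p1 p2" using biproduct_exists[OF o(2,3)] by auto
  have S: "S \<in> Ob \<C>" and i: "i1 \<in> mor A S" "i2 \<in> mor B S" and p: "p1 \<in> mor S A" "p2 \<in> mor S B"
    and e: "p1 \<cdot> i1 = ident \<C> A" "p2 \<cdot> i2 = ident \<C> B" "p1 \<cdot> i2 = zero_hom B A" "p2 \<cdot> i1 = zero_hom A B"
    using b by (auto simp: biproduct_def)
  have iY: "ident \<C> Y \<in> mor Y Y" "ident \<C> S \<in> mor S S" using o S by (auto simp: ident_closed)
  define \<omega>1 where "\<omega>1 = pushforward Y i1 \<delta>"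
  define \<omega>2 where "\<omega>2 = pushforward Y i2 \<epsilon>"
  have w: "\<omega>1 \<in> extn Y S" "\<omega>2 \<in> extn Y S"
    unfolding \<omega>1_def \<omega>2_def
    using o S i d iY Emap_closed[of Y Y A S "ident \<C> Y" i1 \<delta>] Emap_closed[of Y Y B S "ident \<C> Y" i2 \<epsilon>] by auto
  interpret YS: module k "Ext \<E> Y S" by (rule ext_module[OF o(1) S])
  show ?thesis
  proof (intro bexI[of _ S] bexI[of _ "\<omega>1 \<oplus>\<^bsub>Ext \<E> Y S\<^esub> \<omega>2"] ballI S)
    show "\<omega>1 \<oplus>\<^bsub>Ext \<E> Y S\<^esub> \<omega>2 \<in> extn Y S" using w by auto
    fix L g assume L: "L \<in> Ob \<C>" and g: "g \<in> mor L Y"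
    interpret LS: module k "Ext \<E> L S" by (rule ext_module[OF L S])
    interpret LA: module k "Ext \<E> L A" by (rule ext_module[OF L o(2)])
    interpret LB: module k "Ext \<E> L B" by (rule ext_module[OF L o(3)])
    have iL: "ident \<C> L \<in> mor L L" using L by (rule ident_closed)
    let ?\<omega> = "pullback g S (\<omega>1 \<oplus>\<^bsub>Ext \<E> Y S\<^esub> \<omega>2)"
    have w1: "pullback g S \<omega>1 = Emap \<E> g i1 \<delta>" "pullback g S \<omega>2 = Emap \<E> g i2 \<epsilon>"
      unfolding \<omega>1_def \<omega>2_def using Emap_push_pull(2) o S L g i d by auto
    have we: "?\<omega> = Emap \<E> g i1 \<delta> \<oplus>\<^bsub>Ext \<E> L S\<^esub> Emap \<E> g i2 \<epsilon>"
      using Emap_add[OF o(1) L S S g iY(2) w] w1 by simp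
    have c: "Emap \<E> g i1 \<delta> \<in> extn L S" "Emap \<E> g i2 \<epsilon> \<in> extn L S"
      using Emap_closed[OF o(1) L o(2) S g i(1) d(1)] Emap_closed[OF o(1) L o(3) S g i(2) d(2)] by auto
    have pp: "pushforward L q ?\<omega> =
        Emap \<E> g (q \<cdot> i1) \<delta> \<oplus>\<^bsub>Ext \<E> L Z\<^esub> Emap \<E> g (q \<cdot> i2) \<epsilon>" if q: "q \<in> mor S Z" "Z \<in> Ob \<C>" for q Z
    proof -
      have "pushforward L q (Emap \<E> g i1 \<delta>) = Emap \<E> g (q \<cdot> i1) \<delta>"
        using Emap_comp[OF o(1) L L o(2) S q(2) g iL i(1) q(1) d(1)] ident_right[OF L o(1) g] by simp
      moreover have "pushforward L q (Emap \<E> g i2 \<epsilon>) = Emap \<E> g (q \<cdot> i2) \<epsilon>"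
        using Emap_comp[OF o(1) L L o(3) S q(2) g iL i(2) q(1) d(2)] ident_right[OF L o(1) g] by simp
      ultimately show ?thesis
        unfolding we using Emap_add[OF L L S q(2) iL q(1) c] by simp
    qed
    have ca: "pullback g A \<delta> \<in> extn L A" "pullback g B \<epsilon> \<in> extn L B"
      using Emap_closed[OF o(1) L o(2,2) g ident_closed d(1)] Emap_closed[OF o(1) L o(3,3) g ident_closed d(2)] o
      by auto
    have P1: "pushforward L p1 ?\<omega> = pullback g A \<delta>"
      using pp[OF p(1) o(2)] e ca Emap_zero(3)[OF L o(1,3,2) g d(2)] by simp
    have P2: "pushforward L p2 ?\<omega> = pullback g B \<epsilon>"
      using pp[OF p(2) o(3)] e ca Emap_zero(3)[OF L o(1,2,3) g d(1)] by simp
    show "?\<omega> = zero_ext L S \<longleftrightarrow>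
      pullback g A \<delta> = zero_ext L A \<and> pullback g B \<epsilon> = zero_ext L B"
    proof
      assume "?\<omega> = zero_ext L S"
      then show "pullback g A \<delta> = zero_ext L A \<and> pullback g B \<epsilon> = zero_ext L B"
        using P1 P2 Emap_zero(2)[OF L L S o(2) iL p(1)] Emap_zero(2)[OF L L S o(3) iL p(2)] by simp
    next
      assume z: "pullback g A \<delta> = zero_ext L A \<and> pullback g B \<epsilon> = zero_ext L B"
      have "Emap \<E> g i1 \<delta> = zero_ext L S"
        using z Emap_push_pull(1)[OF o(1) L o(2) S i(1) g d(1)] Emap_zero(2)[OF L L o(2) S iL i(1)] by simp
      moreover have "Emap \<E> g i2 \<epsilon> = zero_ext L S"
        using z Emap_push_pull(1)[OF o(1) L o(3) S i(2) g d(2)] Emap_zero(2)[OF L L o(3) S iL i(2)] by simp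
      ultimately show "?\<omega> = zero_ext L S" unfolding we by simp
    qed
  qed
qed

lemma extension_family_sum:
  assumes o: "Y \<in> Ob \<C>" "A \<in> Ob \<C>" and S: "finite S" "S \<subseteq> extn Y A"
  shows "\<exists>B\<in>Ob \<C>. \<exists>\<omega>\<in>extn Y B. \<forall>L\<in>Ob \<C>. \<forall>g\<in>mor L Y.
    pullback g B \<omega> = zero_ext L B \<longleftrightarrow> (\<forall>\<delta>\<in>S. pullback g A \<delta> = zero_ext L A)"
  using S
proof (induct rule: finite_induct)
  case empty
  interpret M: module k "Ext \<E> Y A" by (rule ext_module[OF o])
  show ?case
    using o Emap_zero(2)[OF _ o(1) o(2) o(2) _ ident_closed[OF o(2)]]
    by (intro bexI[of _ A] bexI[of _ "(zero_ext Y A)"]) auto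
next
  case (insert \<epsilon> S)
  then obtain B \<omega> where B: "B \<in> Ob \<C>" "\<omega> \<in> extn Y B"
    "\<forall>L\<in>Ob \<C>. \<forall>g\<in>mor L Y. pullback g B \<omega> = zero_ext L B \<longleftrightarrow>
      (\<forall>\<delta>\<in>S. pullback g A \<delta> = zero_ext L A)" by auto
  have "\<epsilon> \<in> extn Y A" using insert by auto
  from extension_sum[OF o(1) B(1) o(2) B(2) this] obtain T \<omega>' where T: "T \<in> Ob \<C>" "\<omega>' \<in> extn Y T"
    "\<forall>L\<in>Ob \<C>. \<forall>g\<in>mor L Y. pullback g T \<omega>' = zero_ext L T \<longleftrightarrow>
      pullback g B \<omega> = zero_ext L B \<and> pullback g A \<epsilon> = zero_ext L A"
    by blast
  show ?case
    using T B(3) by (intro bexI[OF _ T(1)] bexI[OF _ T(2)]) auto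
qed

text \<open>A nonzero \<open>g\<^sup>* \<delta> \<in> \<E>(L, A)\<close> is detected by \<open>\<gamma>\<close> after pulling it back along some \<open>C \<rightarrow> L\<close>.\<close>

lemma serre_pair_right_determined:
  assumes p: "serre_pair C A \<gamma>" and Y: "Y \<in> Ob \<C>" and d: "\<delta> \<in> extn Y A"
  shows "right_determined_ext C Y A \<delta>"
  unfolding right_determined_ext_def
proof (intro ballI impI)
  have o: "C \<in> Ob \<C>" "A \<in> Ob \<C>" "\<gamma> \<in> carrier (dual (Ext \<E> C A))" using p by (auto simp: serre_pair_def)
  fix L g assume L: "L \<in> Ob \<C>" and g: "g \<in> mor L Y"
    and h: "\<forall>h\<in>mor C L. pullback (g \<cdot> h) A \<delta> = zero_ext C A"
  have c: "pullback g A \<delta> \<in> extn L A"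
    using Emap_closed[OF Y L o(2,2) g ident_closed[OF o(2)] d] .
  show "pullback g A \<delta> = zero_ext L A"
  proof (rule ccontr)
    assume "pullback g A \<delta> \<noteq> zero_ext L A"
    then obtain h where h': "h \<in> mor C L" "\<gamma> (pullback h A (pullback g A \<delta>)) \<noteq> \<zero>\<^bsub>J\<^esub>"
      using p L c unfolding serre_pair_def by blast
    have "\<gamma> (zero_ext C A) = \<zero>\<^bsub>J\<^esub>"
      using linear_map_zero[OF ext_module[OF o(1,2)] module_J dual_linear[OF o(3)]] .
    then show False using h' h Emap_pull_pull[OF o(2) Y L o(1) g h'(1) d] by simp
  qed
qed

text \<open>Let \<open>P \<subseteq> \<E>(Y, A)\<close> be the orthogonal complement of \<open>H\<close>, condensed into a single extension of \<open>Y\<close>. For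
  \<open>h \<in> H\<close> and \<open>\<delta> \<in> P\<close>, all \<open>\<gamma>(e\<^sup>* h\<^sup>* \<delta>) = \<gamma>((h e)\<^sup>* \<delta>)\<close> vanish because \<open>h e \<in> H\<close>, and so
  \<open>h\<^sup>* \<delta> = 0\<close>. Conversely, a morphism that annihilates \<open>P\<close> belongs to the double annihilator of \<open>H\<close>, which
  is \<open>H\<close>.\<close>

lemma serre_pair_right_classifies:
  assumes p: "serre_pair C A \<gamma>" and Y: "Y \<in> Ob \<C>"
    and Hg: "subgroup H (add_monoid (Hom \<C> C Y))" and He: "\<And>h e. h \<in> H \<Longrightarrow> e \<in> mor C C \<Longrightarrow> h \<cdot> e \<in> H"
  shows "\<exists>B\<in>Ob \<C>. \<exists>\<delta>\<in>extn Y B. right_determined_ext C Y B \<delta> \<and>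
    {h \<in> mor C Y. pullback h B \<delta> = zero_ext C B} = H"
proof -
  have o: "C \<in> Ob \<C>" "A \<in> Ob \<C>" "\<gamma> \<in> carrier (dual (Ext \<E> C A))" using p by (auto simp: serre_pair_def)
  interpret HM: module k "Hom \<C> C Y" by (rule hom_module[OF o(1) Y])
  interpret CC: module k "Hom \<C> C C" by (rule hom_module[OF o(1,1)])
  interpret M: finite_length_module k J "Ext \<E> Y A" by (rule ext_finite_length[OF Y o(2)])
  interpret J: module k J by (rule module_J)
  interpret CA: module k "Ext \<E> C A" by (rule ext_module[OF o(1,2)])
  have iC: "ident \<C> C \<in> mor C C" and iA: "ident \<C> A \<in> mor A A" using o by (auto simp: ident_closed)
  have Hc: "H \<subseteq> mor C Y" using subgroup.subset[OF Hg] by simp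
  have H: "submodule H k (Hom \<C> C Y)"
    unfolding HM.submodule_iff
  proof (intro conjI ballI Hc)
    show "zero_hom C Y \<in> H" using subgroup.one_closed[OF Hg] by simp
    show "a \<oplus>\<^bsub>Hom \<C> C Y\<^esub> b \<in> H" if "a \<in> H" "b \<in> H" for a b
      using subgroup.m_closed[OF Hg that] by simp
    show "r \<odot>\<^bsub>Hom \<C> C Y\<^esub> a \<in> H" if r: "r \<in> carrier k" and a: "a \<in> H" for r a
    proof -
      have ac: "a \<in> mor C Y" using a Hc by auto
      have "a \<cdot> (r \<odot>\<^bsub>Hom \<C> C C\<^esub> ident \<C> C) = r \<odot>\<^bsub>Hom \<C> C Y\<^esub> (a \<cdot> ident \<C> C)"
        by (rule linear_mapD(3)[OF comp_linear(1)[OF o(1,1) Y ac] r iC])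
      then show ?thesis
        using He[OF a, of "r \<odot>\<^bsub>Hom \<C> C C\<^esub> ident \<C> C"] r iC ident_right[OF o(1) Y ac] by auto
    qed
  qed
  have lin: "linear_map k (Ext \<E> Y A) J (\<lambda>\<delta>. \<gamma> (pullback h A \<delta>))" if "h \<in> mor C Y" for h
    by (rule linear_map_comp[OF Emap_linear(2) dual_linear[OF o(3)]]) (use o Y that iA in auto)
  define P where "P = {\<delta> \<in> extn Y A. \<forall>h\<in>H. \<gamma> (pullback h A \<delta>) = \<zero>\<^bsub>J\<^esub>}"
  have "submodule P k (Ext \<E> Y A)"
    unfolding M.M.submodule_iff P_def
    using linear_mapD(2,3)[OF lin] linear_map_zero[OF M.M.module_axioms module_J lin] Hc
    by (auto simp: subset_iff)
  from M.submodule_finite_generators[OF this]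
  obtain S where S: "finite S" "S \<subseteq> P" "\<And>V. submodule V k (Ext \<E> Y A) \<Longrightarrow> S \<subseteq> V \<Longrightarrow> P \<subseteq> V"
    by metis
  have Sc: "S \<subseteq> extn Y A" using S(2) by (auto simp: P_def)
  have S_iff: "(\<forall>\<delta>\<in>S. pullback g A \<delta> = zero_ext L A) \<longleftrightarrow> (\<forall>\<delta>\<in>P. pullback g A \<delta> = zero_ext L A)"
    if "L \<in> Ob \<C>" "g \<in> mor L Y" for L g
    using S(2) S(3)[OF Emap_annihilator_submodule[OF that(1) Y o(2) that(2)]] Sc by blast
  from extension_family_sum[OF Y o(2) S(1) Sc]
  obtain B \<omega> where B: "B \<in> Ob \<C>" "\<omega> \<in> extn Y B"
    and \<omega>S: "\<forall>L\<in>Ob \<C>. \<forall>g\<in>mor L Y. pullback g B \<omega> = zero_ext L B \<longleftrightarrow>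
      (\<forall>\<delta>\<in>S. pullback g A \<delta> = zero_ext L A)"
    by blast
  have \<omega>: "pullback g B \<omega> = zero_ext L B \<longleftrightarrow> (\<forall>\<delta>\<in>P. pullback g A \<delta> = zero_ext L A)"
    if "L \<in> Ob \<C>" "g \<in> mor L Y" for L g
    using \<omega>S S_iff[OF that] that by blast
  have "right_determined_ext C Y B \<omega>"
    unfolding right_determined_ext_def
  proof (intro ballI impI)
    fix L g assume L: "L \<in> Ob \<C>" and g: "g \<in> mor L Y"
      and z: "\<forall>h\<in>mor C L. pullback (g \<cdot> h) B \<omega> = zero_ext C B"
    have "pullback g A \<delta> = zero_ext L A" if d: "\<delta> \<in> P" for \<delta>
    proof -
      have "pullback (g \<cdot> h) A \<delta> = zero_ext C A" if "h \<in> mor C L" for h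
        using z \<omega>[OF o(1) comp_closed[OF o(1) L Y that g]] that d by auto
      then show ?thesis
        using serre_pair_right_determined[OF p Y, of \<delta>] d L g unfolding right_determined_ext_def P_def by blast
    qed
    then show "pullback g B \<omega> = zero_ext L B" using \<omega>[OF L g] by blast
  qed
  moreover have "{h \<in> mor C Y. pullback h B \<omega> = zero_ext C B} = H"
  proof (intro equalityI subsetI)
    fix h assume h: "h \<in> H"
    then have hc: "h \<in> mor C Y" using Hc by auto
    have "pullback h A \<delta> = zero_ext C A" if d: "\<delta> \<in> P" for \<delta>
    proof (rule ccontr)
      have dc: "\<delta> \<in> extn Y A" using d by (simp add: P_def)
      have hd: "pullback h A \<delta> \<in> extn C A"
        by (rule Emap_closed[OF Y o(1) o(2,2) hc iA dc])
      assume "pullback h A \<delta> \<noteq> zero_ext C A"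
      then obtain e where e: "e \<in> mor C C" "\<gamma> (pullback e A (pullback h A \<delta>)) \<noteq> \<zero>\<^bsub>J\<^esub>"
        using p o(1) hd unfolding serre_pair_def by blast
      have "\<gamma> (pullback (h \<cdot> e) A \<delta>) = \<zero>\<^bsub>J\<^esub>" using He[OF h e(1)] d by (simp add: P_def)
      then show False using e(2) Emap_pull_pull[OF o(2) Y o(1,1) hc e(1) dc] by simp
    qed
    then show "h \<in> {h \<in> mor C Y. pullback h B \<omega> = zero_ext C B}"
      using \<omega>[OF o(1) hc] hc by simp
  next
    fix h assume "h \<in> {h \<in> mor C Y. pullback h B \<omega> = zero_ext C B}"
    then have hc: "h \<in> mor C Y" and z: "\<And>\<delta>. \<delta> \<in> P \<Longrightarrow> pullback h A \<delta> = zero_ext C A"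
      using \<omega>[OF o(1)] by auto
    have "pull_form A \<gamma> Y h \<in> pull_form A \<gamma> Y ` H"
    proof (rule M.double_annihilator[OF pull_form_image_submodule[OF o Y H] pull_form_dual[OF o Y hc]])
      fix \<delta> assume d: "\<delta> \<in> extn Y A" and v: "\<And>\<phi>. \<phi> \<in> pull_form A \<gamma> Y ` H \<Longrightarrow> \<phi> \<delta> = \<zero>\<^bsub>J\<^esub>"
      have "\<gamma> (pullback h' A \<delta>) = \<zero>\<^bsub>J\<^esub>" if "h' \<in> H" for h'
        using v[of "pull_form A \<gamma> Y h'"] that d by (auto simp: pull_form_def)
      then have "\<delta> \<in> P" using d by (simp add: P_def)
      then show "pull_form A \<gamma> Y h \<delta> = \<zero>\<^bsub>J\<^esub>"
        using z[of \<delta>] d linear_map_zero[OF CA.module_axioms module_J dual_linear[OF o(3)]]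
        by (simp add: pull_form_def)
    qed
    then obtain h' where h': "h' \<in> H" "pull_form A \<gamma> Y h = pull_form A \<gamma> Y h'" by blast
    have "h = h'"
    proof (rule serre_pair_pull_inj[OF p Y hc])
      show "h' \<in> mor C Y" using h' Hc by auto
      fix \<rho> assume "\<rho> \<in> extn Y A"
      then show "\<gamma> (pullback h A \<rho>) = \<gamma> (pullback h' A \<rho>)"
        using fun_cong[OF h'(2), of \<rho>] by (simp add: pull_form_def)
    qed
    then show "h \<in> H" using h' by simp
  qed
  ultimately show ?thesis using B by blast
qed

definition has_serre_pairs :: bool
  where "has_serre_pairs \<longleftrightarrow> (\<forall>C\<in>Ob \<C>. \<exists>A \<gamma>. serre_pair C A \<gamma>) \<and> (\<forall>A\<in>Ob \<C>. \<exists>C \<gamma>. serre_pair C A \<gamma>)"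

lemma op_has_serre_pairs: "serre_setting.has_serre_pairs k J (op_cat \<C>) (op_bif \<E>) \<longleftrightarrow> has_serre_pairs"
proof -
  interpret op: serre_setting k J "op_cat \<C>" "op_bif \<E>"
    by (rule op_serre_setting) (rule serre_setting_axioms)
  show ?thesis unfolding op.has_serre_pairs_def has_serre_pairs_def op_serre_pair by auto
qed

lemma serre_pairs_right_classified:
  assumes "has_serre_pairs"
  shows "right_classified"
  unfolding right_classified_def
proof (intro conjI ballI allI impI, goal_cases)
  case (1 Y A \<delta>)
  then obtain C \<gamma> where p: "serre_pair C A \<gamma>" using assms by (auto simp: has_serre_pairs_def)
  then have "C \<in> Ob \<C>" by (simp add: serre_pair_def)
  then show ?case using serre_pair_right_determined[OF p 1(1,3)] by blast
next
  case (2 Y C H)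
  then obtain A \<gamma> where p: "serre_pair C A \<gamma>" using assms unfolding has_serre_pairs_def by blast
  show ?case by (rule serre_pair_right_classifies[OF p 2(1)]) (use 2 in auto)
qed

lemma serre_pairs_left_classified:
  assumes "has_serre_pairs"
  shows "left_classified"
proof -
  interpret op: serre_setting k J "op_cat \<C>" "op_bif \<E>"
    by (rule op_serre_setting) (rule serre_setting_axioms)
  show ?thesis
    using op.serre_pairs_right_classified assms by (simp add: op_has_serre_pairs op_right_classified)
qed

end

section \<open>Direct sums of Serre pairs\<close>

context additive_category
begin

lemma decomposition_exists:
  assumes "\<forall>j<m. A j \<in> Ob \<C>"
  shows "\<exists>S i p. decomposition m A S i p"
  using assms
proof (induct m)
  case 0
  obtain Z where Z: "zero_object Z" using zero_object_exists by blast
  then have ZO: "Z \<in> Ob \<C>" by (simp add: zero_object_def)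
  then have "ident \<C> Z = \<zero>\<^bsub>Hom \<C> Z Z\<^esub>"
    using Z zero_mor[OF ZO ZO] ident_closed[OF ZO] unfolding zero_object_def by blast
  then show ?case using ZO by (auto simp: decomposition_def)
next
  case (Suc m)
  then obtain S i p where d: "decomposition m A S i p" by auto
  have S: "S \<in> Ob \<C>" and Aj: "\<And>j. j < m \<Longrightarrow> A j \<in> Ob \<C>" and i: "\<And>j. j < m \<Longrightarrow> i j \<in> mor (A j) S"
    and p: "\<And>j. j < m \<Longrightarrow> p j \<in> mor S (A j)"
    and e: "\<And>j l. j < m \<Longrightarrow> l < m \<Longrightarrow> p j \<cdot> i l = (if j = l then ident \<C> (A j) else \<zero>\<^bsub>Hom \<C> (A l) (A j)\<^esub>)"
    using d unfolding decomposition_def by blast+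
  have Am: "A m \<in> Ob \<C>" using Suc by auto
  obtain S' i1 i2 p1 p2 where b: "biproduct S (A m) S' i1 i2 p1 p2" using biproduct_exists[OF S Am] by auto
  have S': "S' \<in> Ob \<C>" and i1: "i1 \<in> mor S S'" and i2: "i2 \<in> mor (A m) S'" and p1: "p1 \<in> mor S' S"
    and p2: "p2 \<in> mor S' (A m)" and be: "p1 \<cdot> i1 = ident \<C> S" "p2 \<cdot> i2 = ident \<C> (A m)"
    "p1 \<cdot> i2 = \<zero>\<^bsub>Hom \<C> (A m) S\<^esub>" "p2 \<cdot> i1 = \<zero>\<^bsub>Hom \<C> S (A m)\<^esub>"
    "i1 \<cdot> p1 \<oplus>\<^bsub>Hom \<C> S' S'\<^esub> i2 \<cdot> p2 = ident \<C> S'"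
    using b by (auto simp: biproduct_def)
  define i' where "i' j = (if j < m then i1 \<cdot> i j else i2)" for j
  define p' where "p' j = (if j < m then p j \<cdot> p1 else p2)" for j
  have "decomposition (Suc m) A S' i' p'"
    unfolding decomposition_def
  proof (intro conjI allI impI S')
    fix j assume j: "j < Suc m"
    show "A j \<in> Ob \<C>" using Suc j by auto
    show "i' j \<in> mor (A j) S'"
      using j comp_closed[OF Aj S S' i i1, of j] i2 by (auto simp: i'_def less_Suc_eq)
    show "p' j \<in> mor S' (A j)"
      using j comp_closed[OF S' S Aj p1 p, of j] p2 by (auto simp: p'_def less_Suc_eq)
    fix l assume l: "l < Suc m"
    consider "j < m" "l < m" | "j = m" "l < m" | "j < m" "l = m" | "j = m" "l = m"
      using j l by (auto simp: less_Suc_eq)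
    then show "p' j \<cdot> i' l = (if j = l then ident \<C> (A j) else \<zero>\<^bsub>Hom \<C> (A l) (A j)\<^esub>)"
    proof cases
      case 1
      have "p j \<cdot> p1 \<cdot> (i1 \<cdot> i l) = p j \<cdot> (p1 \<cdot> (i1 \<cdot> i l))"
        using comp_assoc[OF Aj[OF 1(2)] S' S Aj[OF 1(1)] comp_closed[OF Aj[OF 1(2)] S S' i[OF 1(2)] i1] p1 p[OF 1(1)]]
        by simp
      also have "p1 \<cdot> (i1 \<cdot> i l) = i l"
        using comp_assoc[OF Aj[OF 1(2)] S S' S i[OF 1(2)] i1 p1] be ident_left[OF Aj[OF 1(2)] S i[OF 1(2)]] by simp
      finally show ?thesis using 1 e by (simp add: i'_def p'_def)
    next
      case 2
      have "p2 \<cdot> (i1 \<cdot> i l) = \<zero>\<^bsub>Hom \<C> (A l) (A m)\<^esub>"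
        using comp_assoc[OF Aj[OF 2(2)] S S' Am i[OF 2(2)] i1 p2] be comp_zero_left[OF Aj[OF 2(2)] S Am i[OF 2(2)]]
        by simp
      then show ?thesis using 2 by (simp add: i'_def p'_def)
    next
      case 3
      have "p j \<cdot> p1 \<cdot> i2 = \<zero>\<^bsub>Hom \<C> (A m) (A j)\<^esub>"
        using comp_assoc[OF Am S' S Aj[OF 3(1)] i2 p1 p[OF 3(1)]] be comp_zero_right[OF Am S Aj[OF 3(1)] p[OF 3(1)]]
        by simp
      then show ?thesis using 3 by (simp add: i'_def p'_def)
    next
      case 4
      then show ?thesis using be by (simp add: i'_def p'_def)
    qed
  next
    fix K assume K: "K \<subseteq> mor S' S'" "\<zero>\<^bsub>Hom \<C> S' S'\<^esub> \<in> K" "\<forall>x\<in>K. \<forall>y\<in>K. x \<oplus>\<^bsub>Hom \<C> S' S'\<^esub> y \<in> K"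
      and ip: "\<forall>j<Suc m. i' j \<cdot> p' j \<in> K"
    define K' where "K' = {x \<in> mor S S. i1 \<cdot> (x \<cdot> p1) \<in> K}"
    have "ident \<C> S \<in> K'"
    proof (rule d[unfolded decomposition_def, THEN conjunct2, THEN conjunct2, THEN conjunct2, rule_format])
      show "K' \<subseteq> mor S S" by (auto simp: K'_def)
      show "\<zero>\<^bsub>Hom \<C> S S\<^esub> \<in> K'"
        using zero_mor[OF S S] comp_zero_left[OF S' S S p1] comp_zero_right[OF S' S S' i1] K(2) by (simp add: K'_def)
      show "x \<oplus>\<^bsub>Hom \<C> S S\<^esub> y \<in> K'" if "x \<in> K'" "y \<in> K'" for x y
      proof -
        have xy: "x \<in> mor S S" "y \<in> mor S S" using that by (auto simp: K'_def)
        have "i1 \<cdot> ((x \<oplus>\<^bsub>Hom \<C> S S\<^esub> y) \<cdot> p1) = i1 \<cdot> (x \<cdot> p1) \<oplus>\<^bsub>Hom \<C> S' S'\<^esub> i1 \<cdot> (y \<cdot> p1)"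
          using comp_add_left[OF S' S S p1 xy]
            comp_add_right[OF S' S S' comp_closed[OF S' S S p1 xy(1)] comp_closed[OF S' S S p1 xy(2)] i1] by simp
        then show ?thesis using that K(3) add_mor[OF S S xy] by (simp add: K'_def)
      qed
      fix j assume j: "j < m"
      have c: "p j \<cdot> p1 \<in> mor S' (A j)" by (rule comp_closed[OF S' S Aj p1 p]) (use j in auto)
      have "i1 \<cdot> ((i j \<cdot> p j) \<cdot> p1) = i1 \<cdot> (i j \<cdot> (p j \<cdot> p1))"
        using comp_assoc[OF S' S Aj[OF j] S p1 p[OF j] i[OF j]] by simp
      also have "\<dots> = i' j \<cdot> p' j"
        using comp_assoc[OF S' Aj[OF j] S S' c i[OF j] i1] j by (simp add: i'_def p'_def)
      finally have "i1 \<cdot> ((i j \<cdot> p j) \<cdot> p1) \<in> K" using ip j by auto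
      then show "i j \<cdot> p j \<in> K'"
        using comp_closed[OF S Aj[OF j] S p[OF j] i[OF j]] by (simp add: K'_def)
    qed
    then have "i1 \<cdot> p1 \<in> K" using ident_left[OF S' S p1] by (simp add: K'_def)
    moreover have "i2 \<cdot> p2 \<in> K" using ip by (auto simp: i'_def p'_def dest: spec[of _ m])
    ultimately show "ident \<C> S' \<in> K" using K(3) be(5) by metis
  qed
  then show ?case by blast
qed

lemma decomposition_jointly_monic:
  assumes d: "decomposition m A X i p" and B: "B \<in> Ob \<C>" and f: "f \<in> mor B X"
    and z: "\<And>j. j < m \<Longrightarrow> p j \<cdot> f = \<zero>\<^bsub>Hom \<C> B (A j)\<^esub>"
  shows "f = \<zero>\<^bsub>Hom \<C> B X\<^esub>"
proof -
  have X: "X \<in> Ob \<C>" using d by (simp add: decomposition_def)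
  interpret BX: abelian_group "Hom \<C> B X" by (rule hom_group[OF B X])
  have "ident \<C> X \<in> {x \<in> mor X X. x \<cdot> f = \<zero>\<^bsub>Hom \<C> B X\<^esub>}"
  proof (rule d[unfolded decomposition_def, THEN conjunct2, THEN conjunct2, THEN conjunct2, rule_format])
    show "\<zero>\<^bsub>Hom \<C> X X\<^esub> \<in> {x \<in> mor X X. x \<cdot> f = \<zero>\<^bsub>Hom \<C> B X\<^esub>}"
      using zero_mor[OF X X] comp_zero_left[OF B X X f] by simp
    show "x \<oplus>\<^bsub>Hom \<C> X X\<^esub> y \<in> {x \<in> mor X X. x \<cdot> f = \<zero>\<^bsub>Hom \<C> B X\<^esub>}"
      if "x \<in> {x \<in> mor X X. x \<cdot> f = \<zero>\<^bsub>Hom \<C> B X\<^esub>}" "y \<in> {x \<in> mor X X. x \<cdot> f = \<zero>\<^bsub>Hom \<C> B X\<^esub>}" for x y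
      using that comp_add_left[OF B X X f, of x y] add_mor[OF X X, of x y] by auto
    fix j assume j: "j < m"
    then have o: "A j \<in> Ob \<C>" "i j \<in> mor (A j) X" "p j \<in> mor X (A j)" using d by (auto simp: decomposition_def)
    show "i j \<cdot> p j \<in> {x \<in> mor X X. x \<cdot> f = \<zero>\<^bsub>Hom \<C> B X\<^esub>}"
      using comp_closed[OF X o(1) X o(3,2)] comp_assoc[OF B X o(1) X f o(3,2)] z[OF j]
        comp_zero_right[OF B o(1) X o(2)] by simp
  qed auto
  then show ?thesis using ident_left[OF B X f] by simp
qed

end

context serre_setting
begin

lemma decomposition_ext_zero:
  assumes d: "decomposition m A X i p" and B: "B \<in> Ob \<C>" and \<theta>: "\<theta> \<in> extn X B"
    and z: "\<And>j. j < m \<Longrightarrow> pullback (i j) B \<theta> = zero_ext (A j) B"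
  shows "\<theta> = zero_ext X B"
proof -
  have X: "X \<in> Ob \<C>" using d by (simp add: decomposition_def)
  interpret XB: module k "Ext \<E> X B" by (rule ext_module[OF X B])
  have iB: "ident \<C> B \<in> mor B B" by (rule ident_closed[OF B])
  let ?K = "{x \<in> mor X X. pullback x B \<theta> = zero_ext X B}"
  have "ident \<C> X \<in> ?K"
  proof (rule d[unfolded decomposition_def, THEN conjunct2, THEN conjunct2, THEN conjunct2, rule_format])
    show "zero_hom X X \<in> ?K"
      using zero_mor[OF X X] Emap_zero(1)[OF X X B B \<theta> iB] by simp
    show "x \<oplus>\<^bsub>Hom \<C> X X\<^esub> y \<in> ?K" if "x \<in> ?K" "y \<in> ?K" for x y
      using that Emap_add_first[OF X X B B _ _ iB \<theta>, of x y] add_mor[OF X X, of x y] by auto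
    fix j assume j: "j < m"
    then have o: "A j \<in> Ob \<C>" "i j \<in> mor (A j) X" "p j \<in> mor X (A j)" using d by (auto simp: decomposition_def)
    show "i j \<cdot> p j \<in> ?K"
      using comp_closed[OF X o(1) X o(3,2)] Emap_pull_pull[OF B X o(1) X o(2,3) \<theta>] z[OF j]
        Emap_zero(2)[OF X o(1) B B o(3) iB] by simp
  qed auto
  then show ?thesis using Emap_ident[OF X B \<theta>] by simp
qed

definition sum_form :: "nat \<Rightarrow> 'o \<Rightarrow> 'o \<Rightarrow> (nat \<Rightarrow> 'm) \<Rightarrow> (nat \<Rightarrow> 'm) \<Rightarrow> (nat \<Rightarrow> 'e \<Rightarrow> 'j) \<Rightarrow> 'e \<Rightarrow> 'j"
  where "sum_form m X A i q \<gamma> = (\<lambda>\<omega>\<in>extn X A. \<Oplus>\<^bsub>J\<^esub>j\<in>{..<m}. \<gamma> j (Emap \<E> (i j) (q j) \<omega>))"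

lemma sum_form_linear:
  assumes X: "X \<in> Ob \<C>" and A: "A \<in> Ob \<C>"
    and j: "\<And>j. j < m \<Longrightarrow> C j \<in> Ob \<C> \<and> T j \<in> Ob \<C> \<and> i j \<in> mor (C j) X \<and> q j \<in> mor A (T j) \<and>
      \<gamma> j \<in> carrier (dual (Ext \<E> (C j) (T j)))"
  shows "sum_form m X A i q \<gamma> \<in> carrier (dual (Ext \<E> X A))"
  unfolding sum_form_def
proof (rule dual_restrict[OF ext_module[OF X A]])
  interpret J: module k J by (rule module_J)
  interpret XA: module k "Ext \<E> X A" by (rule ext_module[OF X A])
  have lin: "linear_map k (Ext \<E> X A) J (\<lambda>\<omega>. \<gamma> l (Emap \<E> (i l) (q l) \<omega>))" if "l < m" for l
    by (rule linear_map_comp[OF Emap_linear(2)[of "C l" X A "T l"] dual_linear]) (use j[OF that] X A in blast)+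
  note l = linear_mapD[OF lin]
  show "linear_map k (Ext \<E> X A) J (\<lambda>\<omega>. \<Oplus>\<^bsub>J\<^esub>l\<in>{..<m}. \<gamma> l (Emap \<E> (i l) (q l) \<omega>))"
    unfolding linear_map_def
  proof (intro conjI ballI)
    show "(\<lambda>\<omega>. \<Oplus>\<^bsub>J\<^esub>l\<in>{..<m}. \<gamma> l (Emap \<E> (i l) (q l) \<omega>)) \<in> extn X A \<rightarrow> carrier J"
      using l(1) by (auto intro!: J.M.finsum_closed)
    fix x y assume xy: "x \<in> extn X A" "y \<in> extn X A"
    have "(\<Oplus>\<^bsub>J\<^esub>l\<in>{..<m}. \<gamma> l (Emap \<E> (i l) (q l) (x \<oplus>\<^bsub>Ext \<E> X A\<^esub> y))) =
      (\<Oplus>\<^bsub>J\<^esub>l\<in>{..<m}. \<gamma> l (Emap \<E> (i l) (q l) x) \<oplus>\<^bsub>J\<^esub> \<gamma> l (Emap \<E> (i l) (q l) y))"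
      using l(1,2) xy by (intro J.M.finsum_cong') auto
    also have "\<dots> = (\<Oplus>\<^bsub>J\<^esub>l\<in>{..<m}. \<gamma> l (Emap \<E> (i l) (q l) x)) \<oplus>\<^bsub>J\<^esub>
        (\<Oplus>\<^bsub>J\<^esub>l\<in>{..<m}. \<gamma> l (Emap \<E> (i l) (q l) y))"
      using l(1) xy by (intro J.M.finsum_addf) auto
    finally show "(\<Oplus>\<^bsub>J\<^esub>l\<in>{..<m}. \<gamma> l (Emap \<E> (i l) (q l) (x \<oplus>\<^bsub>Ext \<E> X A\<^esub> y))) =
      (\<Oplus>\<^bsub>J\<^esub>l\<in>{..<m}. \<gamma> l (Emap \<E> (i l) (q l) x)) \<oplus>\<^bsub>J\<^esub>
        (\<Oplus>\<^bsub>J\<^esub>l\<in>{..<m}. \<gamma> l (Emap \<E> (i l) (q l) y))" .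
  next
    fix r x assume r: "r \<in> carrier k" "x \<in> extn X A"
    show "(\<Oplus>\<^bsub>J\<^esub>l\<in>{..<m}. \<gamma> l (Emap \<E> (i l) (q l) (r \<odot>\<^bsub>Ext \<E> X A\<^esub> x))) =
      r \<odot>\<^bsub>J\<^esub> (\<Oplus>\<^bsub>J\<^esub>l\<in>{..<m}. \<gamma> l (Emap \<E> (i l) (q l) x))"
      using l(1,3) r by (subst J.finsum_smult_ldistr) (auto intro!: J.M.finsum_cong')
  qed
qed

lemma sum_form_single:
  assumes \<omega>: "\<omega> \<in> extn X A" and jm: "j < m"
    and p: "\<And>j. j < m \<Longrightarrow> serre_pair (C j) (T j) (\<gamma> j)"
    and c: "Emap \<E> (i j) (q j) \<omega> \<in> extn (C j) (T j)"
    and z: "\<And>l. l < m \<Longrightarrow> l \<noteq> j \<Longrightarrow> Emap \<E> (i l) (q l) \<omega> = zero_ext (C l) (T l)"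
  shows "sum_form m X A i q \<gamma> \<omega> = \<gamma> j (Emap \<E> (i j) (q j) \<omega>)"
proof -
  interpret J: module k J by (rule module_J)
  have lin: "linear_map k (Ext \<E> (C l) (T l)) J (\<gamma> l)" "module k (Ext \<E> (C l) (T l))" if "l < m" for l
    using p[OF that] by (auto simp: serre_pair_def dual_linear ext_module)
  have "sum_form m X A i q \<gamma> \<omega> = (\<Oplus>\<^bsub>J\<^esub>l\<in>{..<m}. \<gamma> l (Emap \<E> (i l) (q l) \<omega>))"
    using \<omega> by (simp add: sum_form_def)
  also have "\<dots> = (\<Oplus>\<^bsub>J\<^esub>l\<in>{..<m}. if j = l then \<gamma> j (Emap \<E> (i j) (q j) \<omega>) else \<zero>\<^bsub>J\<^esub>)"
    using linear_map_zero[OF lin(2) module_J lin(1)] z linear_mapD(1)[OF lin(1)[OF jm] c]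
    by (intro J.M.finsum_cong') auto
  also have "\<dots> = \<gamma> j (Emap \<E> (i j) (q j) \<omega>)"
    using linear_mapD(1)[OF lin(1)[OF jm] c] jm by (intro J.M.finsum_singleton) auto
  finally show ?thesis .
qed

text \<open>A component on which \<open>f\<close> or \<open>\<theta>\<close> is nonzero has a partner there. Extended by zero, this partner
  isolates one summand of the form.\<close>

lemma sum_form_push_nondegenerate:
  assumes dX: "decomposition m C X i p" and dA: "decomposition m T A t q"
    and pair: "\<And>j. j < m \<Longrightarrow> serre_pair (C j) (T j) (\<gamma> j)" and B: "B \<in> Ob \<C>"
  shows "\<lbrakk>f \<in> mor B A; f \<noteq> zero_hom B A\<rbrakk> \<Longrightarrow>
      \<exists>\<theta>\<in>extn X B. sum_form m X A i q \<gamma> (pushforward X f \<theta>) \<noteq> \<zero>\<^bsub>J\<^esub>"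
    and "\<lbrakk>\<theta> \<in> extn X B; \<theta> \<noteq> zero_ext X B\<rbrakk> \<Longrightarrow>
      \<exists>f\<in>mor B A. sum_form m X A i q \<gamma> (pushforward X f \<theta>) \<noteq> \<zero>\<^bsub>J\<^esub>"
proof -
  have X: "X \<in> Ob \<C>" and A: "A \<in> Ob \<C>" using dX dA by (auto simp: decomposition_def)
  have C: "C j \<in> Ob \<C>" and i: "i j \<in> mor (C j) X" and p: "p j \<in> mor X (C j)" if "j < m" for j
    using dX that by (auto simp: decomposition_def)
  have T: "T j \<in> Ob \<C>" and t: "t j \<in> mor (T j) A" and q: "q j \<in> mor A (T j)" if "j < m" for j
    using dA that by (auto simp: decomposition_def)
  have pi: "p j \<cdot> i l = (if j = l then ident \<C> (C j) else (zero_hom (C l) (C j)))" if "j < m" "l < m" for j l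
    using dX that unfolding decomposition_def by blast
  have qt: "q j \<cdot> t l = (if j = l then ident \<C> (T j) else (zero_hom (T l) (T j)))" if "j < m" "l < m" for j l
    using dA that unfolding decomposition_def by blast
  have iX: "ident \<C> X \<in> mor X X" and iB: "ident \<C> B \<in> mor B B" using X B by (auto simp: ident_closed)
  have el: "Emap \<E> (i l) (q l) (pushforward X f \<theta>) = Emap \<E> (i l) (q l \<cdot> f) \<theta>"
    if "l < m" "f \<in> mor B A" "\<theta> \<in> extn X B" for l f \<theta>
    using Emap_comp[OF X X C[OF that(1)] B A T[OF that(1)] iX i[OF that(1)] that(2) q[OF that(1)] that(3)]
      ident_left[OF C[OF that(1)] X i[OF that(1)]] by simp
  { fix f assume f: "f \<in> mor B A" "f \<noteq> zero_hom B A"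
    then obtain j where j: "j < m" "q j \<cdot> f \<noteq> zero_hom B (T j)"
      using decomposition_jointly_monic[OF dA B f(1)] by blast
    have qf: "q l \<cdot> f \<in> mor B (T l)" if "l < m" for l using comp_closed[OF B A T f(1) q] that by blast
    then obtain \<theta> where \<theta>: "\<theta> \<in> extn (C j) B" "\<gamma> j (pushforward (C j) (q j \<cdot> f) \<theta>) \<noteq> \<zero>\<^bsub>J\<^esub>"
      using pair[OF j(1)] B j unfolding serre_pair_def by blast
    define \<theta>' where "\<theta>' = pullback (p j) B \<theta>"
    have \<theta>': "\<theta>' \<in> extn X B"
      unfolding \<theta>'_def by (rule Emap_closed[OF C[OF j(1)] X B B p[OF j(1)] iB \<theta>(1)])
    have e: "Emap \<E> (i l) (q l) (pushforward X f \<theta>') = Emap \<E> (p j \<cdot> i l) (q l \<cdot> f) \<theta>" if "l < m" for l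
      using el[OF that f(1) \<theta>'] ident_right[OF B T[OF that] qf[OF that]]
        Emap_comp[OF C[OF j(1)] X C[OF that] B B T[OF that] p[OF j(1)] i[OF that] iB qf[OF that] \<theta>(1)]
      by (simp add: \<theta>'_def)
    have "sum_form m X A i q \<gamma> (pushforward X f \<theta>') = \<gamma> j (Emap \<E> (i j) (q j) (pushforward X f \<theta>'))"
    proof (rule sum_form_single[where C = C and T = T, OF _ j(1) pair])
      show c: "pushforward X f \<theta>' \<in> extn X A"
        by (rule Emap_closed[OF X X B A iX f(1) \<theta>'])
      show "Emap \<E> (i j) (q j) (pushforward X f \<theta>') \<in> extn (C j) (T j)"
        by (rule Emap_closed[OF X C A T i q c]) (use j in auto)
      show "Emap \<E> (i l) (q l) (pushforward X f \<theta>') = zero_ext (C l) (T l)" if "l < m" "l \<noteq> j" for l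
        using e[OF that(1)] pi[OF j(1) that(1)] that
          Emap_zero(1)[OF C[OF that(1)] C[OF j(1)] B T[OF that(1)] \<theta>(1) qf[OF that(1)]] by simp
    qed
    also have "\<dots> = \<gamma> j (pushforward (C j) (q j \<cdot> f) \<theta>)" using e[OF j(1)] pi[OF j(1,1)] by simp
    finally show "\<exists>\<theta>\<in>extn X B. sum_form m X A i q \<gamma> (pushforward X f \<theta>) \<noteq> \<zero>\<^bsub>J\<^esub>"
      using \<theta>(2) \<theta>' by (intro bexI[of _ \<theta>']) auto
  }
  { fix \<theta> assume \<theta>: "\<theta> \<in> extn X B" "\<theta> \<noteq> zero_ext X B"
    then obtain j where j: "j < m" "pullback (i j) B \<theta> \<noteq> zero_ext (C j) B"
      using decomposition_ext_zero[OF dX B \<theta>(1)] by blast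
    have ci: "pullback (i j) B \<theta> \<in> extn (C j) B"
      by (rule Emap_closed[OF X C B B i iB \<theta>(1)]) (use j in auto)
    then obtain f where f: "f \<in> mor B (T j)" "\<gamma> j (pushforward (C j) f (pullback (i j) B \<theta>)) \<noteq> \<zero>\<^bsub>J\<^esub>"
      using pair[OF j(1)] B j unfolding serre_pair_def by blast
    have tf: "t j \<cdot> f \<in> mor B A" by (rule comp_closed[OF B T A f(1) t]) (use j in auto)
    have qtf: "q l \<cdot> (t j \<cdot> f) = (if l = j then f else (zero_hom B (T l)))" if "l < m" for l
      using comp_assoc[OF B T[OF j(1)] A T[OF that] f(1) t[OF j(1)] q[OF that]] qt[OF that j(1)]
        ident_left[OF B T[OF j(1)] f(1)] comp_zero_left[OF B T[OF j(1)] T[OF that] f(1)] by auto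
    have "sum_form m X A i q \<gamma> (pushforward X (t j \<cdot> f) \<theta>) =
      \<gamma> j (Emap \<E> (i j) (q j) (pushforward X (t j \<cdot> f) \<theta>))"
    proof (rule sum_form_single[where C = C and T = T, OF _ j(1) pair])
      show c: "pushforward X (t j \<cdot> f) \<theta> \<in> extn X A"
        by (rule Emap_closed[OF X X B A iX tf \<theta>(1)])
      show "Emap \<E> (i j) (q j) (pushforward X (t j \<cdot> f) \<theta>) \<in> extn (C j) (T j)"
        by (rule Emap_closed[OF X C A T i q c]) (use j in auto)
      show "Emap \<E> (i l) (q l) (pushforward X (t j \<cdot> f) \<theta>) = zero_ext (C l) (T l)" if "l < m" "l \<noteq> j" for l
        using el[OF that(1) tf \<theta>(1)] qtf[OF that(1)] that(2)
          Emap_zero(3)[OF C[OF that(1)] X B T[OF that(1)] i[OF that(1)] \<theta>(1)] by simp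
    qed
    also have "\<dots> = \<gamma> j (Emap \<E> (i j) f \<theta>)" using el[OF j(1) tf \<theta>(1)] qtf[OF j(1)] by simp
    also have "\<dots> = \<gamma> j (pushforward (C j) f (pullback (i j) B \<theta>))"
      using Emap_push_pull(1)[OF X C[OF j(1)] B T[OF j(1)] f(1) i[OF j(1)] \<theta>(1)] by simp
    finally show "\<exists>f\<in>mor B A. sum_form m X A i q \<gamma> (pushforward X f \<theta>) \<noteq> \<zero>\<^bsub>J\<^esub>"
      using f(2) tf by (intro bexI[of _ "t j \<cdot> f"]) auto
  }
qed

lemma serre_pair_sum:
  assumes dX: "decomposition m C X i p" and dA: "decomposition m T A t q"
    and pair: "\<And>j. j < m \<Longrightarrow> serre_pair (C j) (T j) (\<gamma> j)"
  shows "serre_pair X A (sum_form m X A i q \<gamma>)"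
proof -
  interpret op: serre_setting k J "op_cat \<C>" "op_bif \<E>"
    by (rule op_serre_setting) (rule serre_setting_axioms)
  have X: "X \<in> Ob \<C>" and A: "A \<in> Ob \<C>" using dX dA by (auto simp: decomposition_def)
  have "sum_form m X A i q \<gamma> \<in> carrier (dual (Ext \<E> X A))"
    by (rule sum_form_linear[OF X A, where C = C and T = T])
      (use dX dA pair in \<open>auto simp: decomposition_def serre_pair_def\<close>)
  moreover have "op.sum_form m A X q i \<gamma> = sum_form m X A i q \<gamma>"
    by (simp add: op.sum_form_def sum_form_def)
  moreover note sum_form_push_nondegenerate[OF dX dA pair]
  moreover note op.sum_form_push_nondegenerate[of m T A q t C X p i \<gamma>, unfolded op_decomposition op_serre_pair op_simps,
      OF dA dX pair]
  ultimately show ?thesis unfolding serre_pair_def using X A by simp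
qed

end

section \<open>Almost split extensions\<close>

text \<open>If \<open>\<delta>\<close> is realized by a complex from \<open>A = Z\<^sub>0\<close> to \<open>Z\<^sub>n\<^sub>+\<^sub>1 = Y\<close>, the assumptions are exactness of
  \<open>\<C>(A, -) \<rightarrow> \<E>(Y, -) \<rightarrow> \<E>(Z\<^sub>n, -)\<close> and of \<open>\<C>(-, Y) \<rightarrow> \<E>(-, A) \<rightarrow> \<E>(-, Z\<^sub>1)\<close> at the middle terms, without
  reference to the complex.\<close>

locale exact_serre_setting = serre_setting k J \<C> \<E>
  for k :: "'k ring" and J :: "('k, 'j) module"
    and \<C> :: "('o, 'm, 'k) module_cat" (structure)
    and \<E> :: "('o, 'm, 'e, 'k) module_bifunctor" +
  assumes push_exact:
      "\<lbrakk>Y \<in> Ob \<C>; A \<in> Ob \<C>; B \<in> Ob \<C>; \<delta> \<in> extn Y A; \<theta> \<in> extn Y B;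
        \<forall>L\<in>Ob \<C>. \<forall>g\<in>mor L Y. pullback g A \<delta> = zero_ext L A \<longrightarrow>
          pullback g B \<theta> = zero_ext L B\<rbrakk>
        \<Longrightarrow> \<exists>f\<in>mor A B. \<theta> = pushforward Y f \<delta>"
    and pull_exact:
      "\<lbrakk>A \<in> Ob \<C>; Y \<in> Ob \<C>; X \<in> Ob \<C>; \<delta> \<in> extn Y A; \<theta> \<in> extn X A;
        \<forall>L\<in>Ob \<C>. \<forall>f\<in>mor A L. pushforward Y f \<delta> = zero_ext Y L \<longrightarrow>
          pushforward X f \<theta> = zero_ext X L\<rbrakk>
        \<Longrightarrow> \<exists>g\<in>mor X Y. \<theta> = pullback g A \<delta>"

lemma op_exact_serre_setting:
  assumes "exact_serre_setting k J \<C> \<E>"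
  shows "exact_serre_setting k J (op_cat \<C>) (op_bif \<E>)"
proof -
  interpret exact_serre_setting k J \<C> \<E> by fact
  interpret op: serre_setting k J "op_cat \<C>" "op_bif \<E>"
    by (rule op_serre_setting) (rule serre_setting_axioms)
  show ?thesis
    by (rule exact_serre_setting.intro[OF op.serre_setting_axioms],
        unfold exact_serre_setting_axioms_def op_simps)
      (intro conjI allI impI; (rule pull_exact push_exact; assumption))
qed

context exact_serre_setting
begin

text \<open>The almost split extensions of Auslander and Reiten.\<close>

definition almost_split :: "'o \<Rightarrow> 'o \<Rightarrow> 'e \<Rightarrow> bool"
  where "almost_split C A \<delta> \<longleftrightarrow> C \<in> Ob \<C> \<and> A \<in> Ob \<C> \<and> \<delta> \<in> extn C A \<and> \<delta> \<noteq> zero_ext C A \<and>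
    (\<forall>L\<in>Ob \<C>. \<forall>g\<in>mor L C. pullback g A \<delta> \<noteq> zero_ext L A \<longrightarrow> (\<exists>s\<in>mor C L. g \<cdot> s = ident \<C> C)) \<and>
    (\<forall>B\<in>Ob \<C>. \<forall>f\<in>mor A B. pushforward C f \<delta> \<noteq> zero_ext C B \<longrightarrow> (\<exists>r\<in>mor B A. r \<cdot> f = ident \<C> A))"

lemma nonisos_classified:
  assumes cl: "right_classified" and C: "local_object C"
  shows "\<exists>B\<in>Ob \<C>. \<exists>\<delta>\<in>extn C B. right_determined_ext C C B \<delta> \<and>
    {h \<in> mor C C. pullback h B \<delta> = zero_ext C B} = {h \<in> mor C C. \<not> iso_mor C C h}"
proof -
  have CO: "C \<in> Ob \<C>" using C by (simp add: local_object_def)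
  interpret M: module k "Hom \<C> C C" by (rule hom_module[OF CO CO])
  have iC: "ident \<C> C \<in> mor C C" by (rule ident_closed[OF CO])
  let ?H = "{h \<in> mor C C. \<not> iso_mor C C h}"
  have He: "h \<cdot> e \<in> ?H" if h: "h \<in> ?H" and e: "e \<in> mor C C" for h e
  proof -
    have hc: "h \<in> mor C C" using h by simp
    have "\<not> iso_mor C C (h \<cdot> e)"
    proof
      assume "iso_mor C C (h \<cdot> e)"
      then obtain g where g: "g \<in> mor C C" "h \<cdot> e \<cdot> g = ident \<C> C" by (auto simp: iso_mor_def)
      then have "h \<cdot> (e \<cdot> g) = ident \<C> C" using comp_assoc[OF CO CO CO CO g(1) e hc] by simp
      then have "iso_mor C C h"
        using local_object_one_sided_inverse(2)[OF C comp_closed[OF CO CO CO g(1) e] hc] by simp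
      then show False using h by simp
    qed
    then show ?thesis using comp_closed[OF CO CO CO e hc] by simp
  qed
  have z: "zero_hom C C \<in> ?H"
  proof -
    have "\<not> iso_mor C C (zero_hom C C)"
      using C comp_zero_right[OF CO CO CO] unfolding iso_mor_def local_object_def by metis
    then show ?thesis by simp
  qed
  have "subgroup ?H (add_monoid (Hom \<C> C C))"
  proof (rule M.M.add.subgroupI)
    show "?H \<subseteq> mor C C" by auto
    show "?H \<noteq> {}" using z by blast
    show "a \<oplus>\<^bsub>Hom \<C> C C\<^esub> b \<in> ?H" if "a \<in> ?H" "b \<in> ?H" for a b
      using that C unfolding local_object_def by auto
    fix a assume a: "a \<in> ?H"
    then have ac: "a \<in> mor C C" by simp
    \<comment> \<open>Negation is composition with \<open>-1\<close>, so that closure under composition suffices.\<close>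
    let ?e = "(\<ominus>\<^bsub>k\<^esub> \<one>\<^bsub>k\<^esub>) \<odot>\<^bsub>Hom \<C> C C\<^esub> ident \<C> C"
    have "a \<cdot> ?e = (\<ominus>\<^bsub>k\<^esub> \<one>\<^bsub>k\<^esub>) \<odot>\<^bsub>Hom \<C> C C\<^esub> (a \<cdot> ident \<C> C)"
      using linear_mapD(3)[OF comp_linear(1)[OF CO CO CO ac] _ iC, of "\<ominus>\<^bsub>k\<^esub> \<one>\<^bsub>k\<^esub>"] by simp
    also have "\<dots> = \<ominus>\<^bsub>Hom \<C> C C\<^esub> a" using ident_right[OF CO CO ac] ac by (simp add: M.smult_l_minus)
    finally show "\<ominus>\<^bsub>Hom \<C> C C\<^esub> a \<in> ?H" using He[OF a, of ?e] iC by auto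
  qed
  then show ?thesis using cl CO He unfolding right_classified_def by blast
qed

text \<open>The extension that classifies the non-isomorphisms of \<open>C\<close> is annihilated by all morphisms to \<open>C\<close>
  that are not retractions, and so is each of its components \<open>\<delta>\<close> along a decomposition of its target.
  Choose \<open>\<delta> \<noteq> 0\<close> with a target \<open>A\<close> whose endomorphism ring is local. If \<open>f\<^sub>* \<delta> \<noteq> 0\<close>, then every morphism
  annihilating \<open>f\<^sub>* \<delta>\<close> is not a retraction and annihilates \<open>\<delta>\<close>, so \<open>\<delta> = u\<^sub>* f\<^sub>* \<delta>\<close> for some \<open>u\<close> by
  exactness. Now \<open>1 - u f\<close> annihilates \<open>\<delta> \<noteq> 0\<close>; hence it is not an isomorphism, \<open>u f\<close> is one, and \<open>f\<close>
  is a section.\<close>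

lemma almost_split_exists:
  assumes cl: "right_classified" and C: "local_object C"
  shows "\<exists>A \<delta>. almost_split C A \<delta>"
proof -
  have CO: "C \<in> Ob \<C>" using C by (simp add: local_object_def)
  have iC: "ident \<C> C \<in> mor C C" by (rule ident_closed[OF CO])
  obtain B \<epsilon> where B: "B \<in> Ob \<C>" and \<epsilon>: "\<epsilon> \<in> extn C B" and det: "right_determined_ext C C B \<epsilon>"
    and ker: "{h \<in> mor C C. pullback h B \<epsilon> = zero_ext C B} = {h \<in> mor C C. \<not> iso_mor C C h}"
    using nonisos_classified[OF cl C] by blast
  have kill: "pullback g B \<epsilon> = zero_ext L B"
    if L: "L \<in> Ob \<C>" and g: "g \<in> mor L C" and ns: "\<nexists>s. s \<in> mor C L \<and> g \<cdot> s = ident \<C> C" for L g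
  proof -
    have "pullback (g \<cdot> h) B \<epsilon> = zero_ext C B" if h: "h \<in> mor C L" for h
    proof -
      have gh: "g \<cdot> h \<in> mor C C" by (rule comp_closed[OF CO L CO h g])
      have "\<not> iso_mor C C (g \<cdot> h)"
      proof
        assume "iso_mor C C (g \<cdot> h)"
        then obtain u where u: "u \<in> mor C C" "g \<cdot> h \<cdot> u = ident \<C> C" by (auto simp: iso_mor_def)
        then have "g \<cdot> (h \<cdot> u) = ident \<C> C" using comp_assoc[OF CO CO L CO u(1) h g] by simp
        then show False using ns comp_closed[OF CO CO L u(1) h] by blast
      qed
      then show ?thesis using ker gh by blast
    qed
    then show ?thesis using det L g unfolding right_determined_ext_def by blast
  qed
  have "iso_mor C C (ident \<C> C)" using iC CO unfolding iso_mor_def by (metis ident_left)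
  then have "pullback (ident \<C> C) B \<epsilon> \<noteq> zero_ext C B" using ker iC by blast
  then have \<epsilon>0: "\<epsilon> \<noteq> zero_ext C B" using Emap_ident[OF CO B \<epsilon>] by simp
  obtain m T i p where d: "decomposition m T B i p" and loc: "\<And>j. j < m \<Longrightarrow> local_object (T j)"
    using local_decomposition[OF B] by blast
  interpret op: serre_setting k J "op_cat \<C>" "op_bif \<E>"
    by (rule op_serre_setting) (rule serre_setting_axioms)
  obtain j where j: "j < m" "pushforward C (p j) \<epsilon> \<noteq> zero_ext C (T j)"
    using op.decomposition_ext_zero[of m T B p i C \<epsilon>, unfolded op_decomposition op_simps, OF d CO \<epsilon>] \<epsilon>0 by blast
  define A where "A = T j"
  define \<delta> where "\<delta> = pushforward C (p j) \<epsilon>"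
  have A: "local_object A" "A \<in> Ob \<C>" using loc[OF j(1)] by (auto simp: A_def local_object_def)
  have pj: "p j \<in> mor B A" using d j(1) by (auto simp: decomposition_def A_def)
  have \<delta>: "\<delta> \<in> extn C A" unfolding \<delta>_def by (rule Emap_closed[OF CO CO B A(2) iC pj \<epsilon>])
  have \<delta>0: "\<delta> \<noteq> zero_ext C A" using j(2) by (simp add: \<delta>_def A_def)
  have iA: "ident \<C> A \<in> mor A A" by (rule ident_closed[OF A(2)])
  have R: "\<exists>s\<in>mor C L. g \<cdot> s = ident \<C> C"
    if L: "L \<in> Ob \<C>" and g: "g \<in> mor L C" and nz: "pullback g A \<delta> \<noteq> zero_ext L A" for L g
  proof (rule ccontr)
    assume "\<not> ?thesis"
    then have "pullback g B \<epsilon> = zero_ext L B" using kill[OF L g] by blast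
    then have "pushforward L (p j) (pullback g B \<epsilon>) = zero_ext L A"
      using Emap_zero(2)[OF L L B A(2) ident_closed[OF L] pj] by simp
    then show False
      using nz Emap_push_pull[OF CO L B A(2) pj g \<epsilon>] by (simp add: \<delta>_def)
  qed
  have Lp: "\<exists>r\<in>mor D A. r \<cdot> f = ident \<C> A"
    if D: "D \<in> Ob \<C>" and f: "f \<in> mor A D" and nz: "pushforward C f \<delta> \<noteq> zero_ext C D" for D f
  proof -
    let ?\<eta> = "pushforward C f \<delta>"
    have \<eta>: "?\<eta> \<in> extn C D" by (rule Emap_closed[OF CO CO A(2) D iC f \<delta>])
    have "pullback g A \<delta> = zero_ext L A"
      if L: "L \<in> Ob \<C>" and g: "g \<in> mor L C" and z: "pullback g D ?\<eta> = zero_ext L D" for L g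
    proof (rule ccontr)
      assume "pullback g A \<delta> \<noteq> zero_ext L A"
      then obtain s where s: "s \<in> mor C L" "g \<cdot> s = ident \<C> C" using R[OF L g] by blast
      have "pullback s D (pullback g D ?\<eta>) = ?\<eta>"
        using Emap_pull_pull[OF D CO L CO g s(1) \<eta>] s(2) Emap_ident[OF CO D \<eta>] by simp
      then show False using z nz Emap_zero(2)[OF CO L D D s(1) ident_closed[OF D]] by simp
    qed
    then obtain u where u: "u \<in> mor D A" "\<delta> = pushforward C u ?\<eta>"
      using push_exact[OF CO D A(2) \<eta> \<delta>] by blast
    have uf: "u \<cdot> f \<in> mor A A" by (rule comp_closed[OF A(2) D A(2) f u(1)])
    have fix1: "pushforward C (u \<cdot> f) \<delta> = \<delta>"
      using Emap_push_push[OF CO A(2) D A(2) f u(1) \<delta>] u(2) by simp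
    have lin: "linear_map k (Hom \<C> A A) (Ext \<E> C A) (\<lambda>g. pushforward C g \<delta>)"
      by (rule Emap_linear(3)[OF CO CO A(2) A(2) iC \<delta>])
    interpret AA: module k "Hom \<C> A A" by (rule hom_module[OF A(2) A(2)])
    interpret CA: module k "Ext \<E> C A" by (rule ext_module[OF CO A(2)])
    have "iso_mor A A (u \<cdot> f)"
    proof (rule ccontr)
      assume "\<not> iso_mor A A (u \<cdot> f)"
      then have "iso_mor A A (ident \<C> A \<ominus>\<^bsub>Hom \<C> A A\<^esub> u \<cdot> f)" using local_object_iso_or[OF A(1) uf] by blast
      then obtain v where v: "v \<in> mor A A" "v \<cdot> (ident \<C> A \<ominus>\<^bsub>Hom \<C> A A\<^esub> u \<cdot> f) = ident \<C> A"
        by (auto simp: iso_mor_def)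
      have dc: "ident \<C> A \<ominus>\<^bsub>Hom \<C> A A\<^esub> u \<cdot> f \<in> mor A A" using iA uf by auto
      have "Emap \<E> (ident \<C> C) (ident \<C> A \<ominus>\<^bsub>Hom \<C> A A\<^esub> u \<cdot> f) \<delta> = zero_ext C A"
        using linear_map_minus[OF AA.module_axioms CA.module_axioms lin iA uf] fix1 Emap_ident[OF CO A(2) \<delta>] \<delta>
        by (simp add: a_minus_def CA.M.r_neg)
      then have "pullback (ident \<C> C) A \<delta> = zero_ext C A"
        using Emap_push_push[OF CO A(2) A(2) A(2) dc v(1) \<delta>] v(2) Emap_zero(2)[OF CO CO A(2) A(2) iC v(1)] by simp
      then show False using \<delta>0 Emap_ident[OF CO A(2) \<delta>] by simp
    qed
    then obtain v where v: "v \<in> mor A A" "v \<cdot> (u \<cdot> f) = ident \<C> A" by (auto simp: iso_mor_def)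
    then have "(v \<cdot> u) \<cdot> f = ident \<C> A" using comp_assoc[OF A(2) D A(2) A(2) f u(1) v(1)] by simp
    then show ?thesis using comp_closed[OF D A(2) A(2) u(1) v(1)] by blast
  qed
  have "almost_split C A \<delta>"
    unfolding almost_split_def using CO A(2) \<delta> \<delta>0 R Lp by blast
  then show ?thesis by blast
qed

lemma op_almost_split:
  "exact_serre_setting.almost_split (op_cat \<C>) (op_bif \<E>) A C \<delta> \<longleftrightarrow> almost_split C A \<delta>"
proof -
  interpret op: exact_serre_setting k J "op_cat \<C>" "op_bif \<E>"
    by (rule op_exact_serre_setting) (rule exact_serre_setting_axioms)
  show ?thesis unfolding op.almost_split_def almost_split_def op_simps by blast
qed

text \<open>A morphism that annihilates \<open>\<theta> \<noteq> 0\<close> is not a retraction, hence annihilates \<open>\<delta>\<close>.\<close>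

lemma almost_split_push:
  assumes as: "almost_split C A \<delta>" and B: "B \<in> Ob \<C>" and \<theta>: "\<theta> \<in> extn C B" "\<theta> \<noteq> zero_ext C B"
  shows "\<exists>f\<in>mor B A. \<delta> = pushforward C f \<theta>"
proof -
  have o: "C \<in> Ob \<C>" "A \<in> Ob \<C>" "\<delta> \<in> extn C A" using as by (auto simp: almost_split_def)
  have "pullback g A \<delta> = zero_ext L A"
    if L: "L \<in> Ob \<C>" and g: "g \<in> mor L C" and z: "pullback g B \<theta> = zero_ext L B" for L g
  proof (rule ccontr)
    assume "pullback g A \<delta> \<noteq> zero_ext L A"
    then obtain s where s: "s \<in> mor C L" "g \<cdot> s = ident \<C> C" using as L g unfolding almost_split_def by blast
    have "pullback s B (pullback g B \<theta>) = \<theta>"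
      using Emap_pull_pull[OF B o(1) L o(1) g s(1) \<theta>(1)] s(2) Emap_ident[OF o(1) B \<theta>(1)] by simp
    then show False using z \<theta>(2) Emap_zero(2)[OF o(1) L B B s(1) ident_closed[OF B]] by simp
  qed
  then show ?thesis using push_exact[OF o(1) B o(2) \<theta>(1) o(3)] by blast
qed

lemma almost_split_pull:
  assumes "almost_split C A \<delta>" "D \<in> Ob \<C>" "\<rho> \<in> extn D A" "\<rho> \<noteq> zero_ext D A"
  shows "\<exists>g\<in>mor C D. \<delta> = pullback g A \<rho>"
proof -
  interpret op: exact_serre_setting k J "op_cat \<C>" "op_bif \<E>"
    by (rule op_exact_serre_setting) (rule exact_serre_setting_axioms)
  show ?thesis using op.almost_split_push[of A C \<delta> D \<rho>] assms by (simp add: op_almost_split)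
qed

text \<open>The zero submodule of \<open>\<C>(C, D)\<close> is classified by some extension of \<open>D\<close>.\<close>

lemma right_classified_faithful:
  assumes cl: "right_classified" and o: "C \<in> Ob \<C>" "D \<in> Ob \<C>"
    and g: "g \<in> mor C D" "g \<noteq> zero_hom C D"
  shows "\<exists>B\<in>Ob \<C>. \<exists>\<rho>\<in>extn D B. pullback g B \<rho> \<noteq> zero_ext C B"
proof -
  interpret M: module k "Hom \<C> C D" by (rule hom_module[OF o])
  have "subgroup {(zero_hom C D)} (add_monoid (Hom \<C> C D))"
    using M.zero_submodule by (simp add: submodule_def)
  moreover have "\<forall>h\<in>{(zero_hom C D)}. \<forall>e\<in>mor C C. h \<cdot> e \<in> {(zero_hom C D)}"
    using comp_zero_left[OF o(1,1,2)] by simp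
  ultimately obtain B \<rho> where "B \<in> Ob \<C>" "\<rho> \<in> extn D B"
    "{h \<in> mor C D. pullback h B \<rho> = zero_ext C B} = {(zero_hom C D)}"
    using cl o unfolding right_classified_def by blast
  then show ?thesis using g by blast
qed

lemma almost_split_pull_nonzero:
  assumes cl: "right_classified" and as: "almost_split C A \<delta>" and D: "D \<in> Ob \<C>"
    and g: "g \<in> mor C D" "g \<noteq> zero_hom C D"
  shows "\<exists>\<rho>\<in>extn D A. \<delta> = pullback g A \<rho>"
proof -
  have o: "C \<in> Ob \<C>" "A \<in> Ob \<C>" using as by (auto simp: almost_split_def)
  obtain B \<rho> where B: "B \<in> Ob \<C>" and \<rho>: "\<rho> \<in> extn D B" "pullback g B \<rho> \<noteq> zero_ext C B"
    using right_classified_faithful[OF cl o(1) D g] by blast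
  have c: "pullback g B \<rho> \<in> extn C B"
    by (rule Emap_closed[OF D o(1) B B g(1) ident_closed[OF B] \<rho>(1)])
  obtain f where f: "f \<in> mor B A" "\<delta> = pushforward C f (pullback g B \<rho>)"
    using almost_split_push[OF as B c \<rho>(2)] by blast
  then have "\<delta> = pullback g A (pushforward D f \<rho>)"
    using Emap_push_pull[OF D o(1) B o(2) f(1) g(1) \<rho>(1)] by simp
  moreover have "pushforward D f \<rho> \<in> extn D A"
    by (rule Emap_closed[OF D D B o(2) ident_closed[OF D] f(1) \<rho>(1)])
  ultimately show ?thesis by blast
qed

lemma almost_split_push_nonzero:
  assumes "left_classified" "almost_split C A \<delta>" "B \<in> Ob \<C>" "f \<in> mor B A" "f \<noteq> zero_hom B A"
  shows "\<exists>\<theta>\<in>extn C B. \<delta> = pushforward C f \<theta>"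
proof -
  interpret op: exact_serre_setting k J "op_cat \<C>" "op_bif \<E>"
    by (rule op_exact_serre_setting) (rule exact_serre_setting_axioms)
  show ?thesis
    using op.almost_split_pull_nonzero[of A C \<delta> B f] assms by (simp add: op_almost_split op_right_classified)
qed

text \<open>Any nonzero morphism or extension can be completed to \<open>\<delta>\<close>, so it suffices that \<open>\<gamma>(\<delta>) \<noteq> 0\<close>.\<close>

lemma almost_split_serre_pair:
  assumes cl: "right_classified" "left_classified" and as: "almost_split C A \<delta>"
  shows "\<exists>\<gamma>. serre_pair C A \<gamma>"
proof -
  have o: "C \<in> Ob \<C>" "A \<in> Ob \<C>" and \<delta>: "\<delta> \<in> extn C A" "\<delta> \<noteq> zero_ext C A"
    using as by (auto simp: almost_split_def)
  interpret M: finite_length_module k J "Ext \<E> C A" by (rule ext_finite_length[OF o])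
  obtain \<gamma> where \<gamma>: "\<gamma> \<in> carrier (dual (Ext \<E> C A))" "\<gamma> \<delta> \<noteq> \<zero>\<^bsub>J\<^esub>"
    using M.dual_separates[OF \<delta>] by blast
  have "serre_pair C A \<gamma>"
    unfolding serre_pair_def
  proof (intro conjI ballI impI o \<gamma>)
    fix B f assume "B \<in> Ob \<C>" "f \<in> mor B A" "f \<noteq> zero_hom B A"
    then show "\<exists>\<theta>\<in>extn C B. \<gamma> (pushforward C f \<theta>) \<noteq> \<zero>\<^bsub>J\<^esub>"
      using almost_split_push_nonzero[OF cl(2) as] \<gamma>(2) by metis
  next
    fix B \<theta> assume "B \<in> Ob \<C>" "\<theta> \<in> extn C B" "\<theta> \<noteq> zero_ext C B"
    then show "\<exists>f\<in>mor B A. \<gamma> (pushforward C f \<theta>) \<noteq> \<zero>\<^bsub>J\<^esub>"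
      using almost_split_push[OF as] \<gamma>(2) by metis
  next
    fix D g assume "D \<in> Ob \<C>" "g \<in> mor C D" "g \<noteq> zero_hom C D"
    then show "\<exists>\<rho>\<in>extn D A. \<gamma> (pullback g A \<rho>) \<noteq> \<zero>\<^bsub>J\<^esub>"
      using almost_split_pull_nonzero[OF cl(1) as] \<gamma>(2) by metis
  next
    fix D \<rho> assume "D \<in> Ob \<C>" "\<rho> \<in> extn D A" "\<rho> \<noteq> zero_ext D A"
    then show "\<exists>g\<in>mor C D. \<gamma> (pullback g A \<rho>) \<noteq> \<zero>\<^bsub>J\<^esub>"
      using almost_split_pull[OF as] \<gamma>(2) by metis
  qed
  then show ?thesis by blast
qed

lemma classified_serre_pair_of_source:
  assumes cl: "right_classified" "left_classified" and X: "X \<in> Ob \<C>"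
  shows "\<exists>A \<gamma>. serre_pair X A \<gamma>"
proof -
  obtain m C i p where d: "decomposition m C X i p" and loc: "\<And>j. j < m \<Longrightarrow> local_object (C j)"
    using local_decomposition[OF X] by blast
  have "\<exists>T \<gamma>. serre_pair (C j) T \<gamma>" if "j < m" for j
    using almost_split_exists[OF cl(1) loc[OF that]] almost_split_serre_pair[OF cl] by blast
  then obtain T \<gamma> where pair: "\<And>j. j < m \<Longrightarrow> serre_pair (C j) (T j) (\<gamma> j)" by metis
  then have "\<forall>j<m. T j \<in> Ob \<C>" by (auto simp: serre_pair_def)
  then obtain A t q where dA: "decomposition m T A t q" using decomposition_exists by blast
  show ?thesis using serre_pair_sum[OF d dA pair] by blast
qed

lemma classified_has_serre_pairs:
  assumes cl: "right_classified" "left_classified"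
  shows "has_serre_pairs"
proof -
  interpret op: exact_serre_setting k J "op_cat \<C>" "op_bif \<E>"
    by (rule op_exact_serre_setting) (rule exact_serre_setting_axioms)
  show ?thesis
    unfolding has_serre_pairs_def
    using classified_serre_pair_of_source[OF cl] op.classified_serre_pair_of_source cl
    by (simp add: op_serre_pair op_right_classified op_left_classified)
qed

end

section \<open>Equivalences of categories\<close>

context category
begin

lemma iso_morE:
  assumes "iso_mor A B f"
  obtains g where "f \<in> mor A B" "g \<in> mor B A" "g \<cdot> f = ident \<C> A" "f \<cdot> g = ident \<C> B"
  using assms by (auto simp: iso_mor_def)

lemma iso_mor_cancel_left:
  assumes "iso_mor B D u" "A \<in> Ob \<C>" "B \<in> Ob \<C>" "D \<in> Ob \<C>" "f \<in> mor A B" "g \<in> mor A B" "u \<cdot> f = u \<cdot> g"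
  shows "f = g"
proof -
  obtain v where v: "u \<in> mor B D" "v \<in> mor D B" "v \<cdot> u = ident \<C> B" using assms(1) by (rule iso_morE)
  have "h = v \<cdot> (u \<cdot> h)" if "h \<in> mor A B" for h
    using comp_assoc[OF assms(2,3,4,3) that v(1,2)] v(3) ident_left[OF assms(2,3) that] by simp
  from this[OF assms(5)] this[OF assms(6)] show ?thesis using assms(7) by metis
qed

lemma iso_mor_cancel_right:
  assumes "iso_mor A B u" "A \<in> Ob \<C>" "B \<in> Ob \<C>" "D \<in> Ob \<C>" "f \<in> mor B D" "g \<in> mor B D" "f \<cdot> u = g \<cdot> u"
  shows "f = g"
proof -
  obtain v where v: "u \<in> mor A B" "v \<in> mor B A" "u \<cdot> v = ident \<C> B" using assms(1) by (rule iso_morE)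
  have "f \<cdot> u \<cdot> v = g \<cdot> u \<cdot> v" using assms by simp
  then show ?thesis
    using comp_assoc[of B A B D v u f] comp_assoc[of B A B D v u g] assms v ident_right[of B D] by simp
qed

lemma endofunctorD:
  assumes "endofunctor Fo Fm"
  shows "A \<in> Ob \<C> \<Longrightarrow> Fo A \<in> Ob \<C>" and "A \<in> Ob \<C> \<Longrightarrow> Fm (ident \<C> A) = ident \<C> (Fo A)"
    and "\<lbrakk>A \<in> Ob \<C>; B \<in> Ob \<C>; f \<in> mor A B\<rbrakk> \<Longrightarrow> Fm f \<in> mor (Fo A) (Fo B)"
    and "\<lbrakk>A \<in> Ob \<C>; B \<in> Ob \<C>; D \<in> Ob \<C>; f \<in> mor A B; g \<in> mor B D\<rbrakk> \<Longrightarrow> Fm (g \<cdot> f) = Fm g \<cdot> Fm f"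
  using assms unfolding endofunctor_def by blast+

lemma retract_functor_faithful:
  assumes F: "endofunctor Fo Fm" and G: "endofunctor Go Gm"
    and \<eta>: "naturally_isomorphic (Go \<circ> Fo) (Gm \<circ> Fm) id id"
    and o: "A \<in> Ob \<C>" "B \<in> Ob \<C>" "f \<in> mor A B" "g \<in> mor A B" and eq: "Fm f = Fm g"
  shows "f = g"
proof -
  obtain \<eta> where \<eta>: "\<And>A. A \<in> Ob \<C> \<Longrightarrow> iso_mor (Go (Fo A)) A (\<eta> A)"
    "\<And>A B f. A \<in> Ob \<C> \<Longrightarrow> B \<in> Ob \<C> \<Longrightarrow> f \<in> mor A B \<Longrightarrow> \<eta> B \<cdot> Gm (Fm f) = f \<cdot> \<eta> A"
    using \<eta> unfolding naturally_isomorphic_def o_apply id_apply by blast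
  have "f \<cdot> \<eta> A = g \<cdot> \<eta> A" using \<eta>(2)[OF o(1-3)] \<eta>(2)[OF o(1,2,4)] eq by simp
  then show ?thesis
    using iso_mor_cancel_right[OF \<eta>(1)[OF o(1)] _ o(1,2,3,4)] endofunctorD(1)[OF G] endofunctorD(1)[OF F] o by simp
qed

lemma auto_equivalence_faithful:
  assumes "auto_equivalence Fo Fm" "A \<in> Ob \<C>" "B \<in> Ob \<C>" "f \<in> mor A B" "g \<in> mor A B" "Fm f = Fm g"
  shows "f = g"
proof -
  obtain Go Gm where "endofunctor Go Gm" "naturally_isomorphic (Go \<circ> Fo) (Gm \<circ> Fm) id id"
    using assms(1) unfolding auto_equivalence_def by blast
  moreover have "endofunctor Fo Fm" using assms(1) by (simp add: auto_equivalence_def)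
  ultimately show ?thesis using retract_functor_faithful assms(2-6) by blast
qed

lemma auto_equivalence_full:
  assumes ae: "auto_equivalence Fo Fm" and o: "A \<in> Ob \<C>" "B \<in> Ob \<C>" and q: "q \<in> mor (Fo A) (Fo B)"
  shows "\<exists>f\<in>mor A B. Fm f = q"
proof -
  have F: "endofunctor Fo Fm" using ae by (simp add: auto_equivalence_def)
  obtain Go Gm where G: "endofunctor Go Gm" and n1: "naturally_isomorphic (Go \<circ> Fo) (Gm \<circ> Fm) id id"
    and n2: "naturally_isomorphic (Fo \<circ> Go) (Fm \<circ> Gm) id id"
    using ae unfolding auto_equivalence_def by blast
  obtain \<eta> where \<eta>: "\<And>A. A \<in> Ob \<C> \<Longrightarrow> iso_mor (Go (Fo A)) A (\<eta> A)"
    "\<And>A B f. A \<in> Ob \<C> \<Longrightarrow> B \<in> Ob \<C> \<Longrightarrow> f \<in> mor A B \<Longrightarrow> \<eta> B \<cdot> Gm (Fm f) = f \<cdot> \<eta> A"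
    using n1 unfolding naturally_isomorphic_def o_apply id_apply by blast
  have FA: "Fo A \<in> Ob \<C>" "Fo B \<in> Ob \<C>" and GF: "Go (Fo A) \<in> Ob \<C>" "Go (Fo B) \<in> Ob \<C>"
    using endofunctorD(1)[OF F] endofunctorD(1)[OF G] o by auto
  obtain v where v: "\<eta> A \<in> mor (Go (Fo A)) A" "v \<in> mor A (Go (Fo A))" "v \<cdot> \<eta> A = ident \<C> (Go (Fo A))"
    using \<eta>(1)[OF o(1)] by (rule iso_morE)
  have \<eta>B: "\<eta> B \<in> mor (Go (Fo B)) B" using \<eta>(1)[OF o(2)] by (simp add: iso_mor_def)
  have Gq: "Gm q \<in> mor (Go (Fo A)) (Go (Fo B))" by (rule endofunctorD(3)[OF G FA q])
  have \<eta>Gq: "\<eta> B \<cdot> Gm q \<in> mor (Go (Fo A)) B" by (rule comp_closed[OF GF o(2) Gq \<eta>B])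
  define f where "f = \<eta> B \<cdot> Gm q \<cdot> v"
  have f: "f \<in> mor A B" unfolding f_def by (rule comp_closed[OF o(1) GF(1) o(2) v(2) \<eta>Gq])
  have "\<eta> B \<cdot> Gm (Fm f) = \<eta> B \<cdot> Gm q \<cdot> (v \<cdot> \<eta> A)"
    unfolding \<eta>(2)[OF o f] using comp_assoc[OF GF(1) o(1) GF(1) o(2) v(1,2) \<eta>Gq] by (simp add: f_def)
  also have "\<dots> = \<eta> B \<cdot> Gm q" using v(3) ident_right[OF GF(1) o(2) \<eta>Gq] by simp
  finally have "Gm (Fm f) = Gm q"
    using iso_mor_cancel_left[OF \<eta>(1)[OF o(2)] GF(1,2) o(2) endofunctorD(3)[OF G FA endofunctorD(3)[OF F o f]] Gq]
    by simp
  then have "Fm f = q"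
    by (rule retract_functor_faithful[OF G F n2 FA endofunctorD(3)[OF F o f] q])
  then show ?thesis using f by blast
qed

lemma auto_equivalence_essentially_surjective:
  assumes ae: "auto_equivalence Fo Fm" and B: "B \<in> Ob \<C>"
  shows "\<exists>A\<in>Ob \<C>. \<exists>w. iso_mor B (Fo A) w"
proof -
  obtain Go Gm where G: "endofunctor Go Gm" and n2: "naturally_isomorphic (Fo \<circ> Go) (Fm \<circ> Gm) id id"
    using ae unfolding auto_equivalence_def by blast
  obtain u where "iso_mor (Fo (Go B)) B u" using n2 B unfolding naturally_isomorphic_def by auto
  then obtain w where "iso_mor B (Fo (Go B)) w" unfolding iso_mor_def by blast
  then show ?thesis using endofunctorD(1)[OF G B] by blast
qed

text \<open>Hom-sets are disjoint, so a functor can be described on a bare morphism, whose source and target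
  are recovered from it.\<close>

lemma fully_faithful_auto_equivalence:
  assumes F: "endofunctor Fo Fm"
    and faithful: "\<And>A B f g. \<lbrakk>A \<in> Ob \<C>; B \<in> Ob \<C>; f \<in> mor A B; g \<in> mor A B; Fm f = Fm g\<rbrakk> \<Longrightarrow> f = g"
    and full: "\<And>A B q. \<lbrakk>A \<in> Ob \<C>; B \<in> Ob \<C>; q \<in> mor (Fo A) (Fo B)\<rbrakk> \<Longrightarrow> \<exists>f\<in>mor A B. Fm f = q"
    and surj: "\<And>B. B \<in> Ob \<C> \<Longrightarrow> \<exists>A\<in>Ob \<C>. \<exists>w. iso_mor B (Fo A) w"
  shows "auto_equivalence Fo Fm"
proof -
  note FO = endofunctorD(1)[OF F] and Fid = endofunctorD(2)[OF F] and Fmor = endofunctorD(3)[OF F]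
    and Fcomp = endofunctorD(4)[OF F]
  have "\<forall>B\<in>Ob \<C>. \<exists>A v u. A \<in> Ob \<C> \<and> v \<in> mor B (Fo A) \<and> u \<in> mor (Fo A) B \<and>
      u \<cdot> v = ident \<C> B \<and> v \<cdot> u = ident \<C> (Fo A)"
    using surj unfolding iso_mor_def by meson
  then obtain Go v u where G: "\<And>B. B \<in> Ob \<C> \<Longrightarrow> Go B \<in> Ob \<C>"
    and v: "\<And>B. B \<in> Ob \<C> \<Longrightarrow> v B \<in> mor B (Fo (Go B))"
    and u: "\<And>B. B \<in> Ob \<C> \<Longrightarrow> u B \<in> mor (Fo (Go B)) B"
    and uv: "\<And>B. B \<in> Ob \<C> \<Longrightarrow> u B \<cdot> v B = ident \<C> B"
    and vu: "\<And>B. B \<in> Ob \<C> \<Longrightarrow> v B \<cdot> u B = ident \<C> (Fo (Go B))"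
    by metis
  \<comment> \<open>\<open>h\<close> is the conjugate of \<open>m\<close> under the isomorphisms \<open>u\<close>.\<close>
  define P where "P m h \<longleftrightarrow> (\<exists>A B. A \<in> Ob \<C> \<and> B \<in> Ob \<C> \<and> m \<in> mor A B \<and> h \<in> mor (Go A) (Go B) \<and>
      Fm h = v B \<cdot> (m \<cdot> u A))" for m h
  define Gm where "Gm m = (THE h. P m h)" for m
  have mu: "m \<cdot> u A \<in> mor (Fo (Go A)) B" if "A \<in> Ob \<C>" "B \<in> Ob \<C>" "m \<in> mor A B" for A B m
    using comp_closed[OF FO[OF G[OF that(1)]] that(1,2) u[OF that(1)] that(3)] .
  have Gex: "\<exists>h\<in>mor (Go A) (Go B). Fm h = v B \<cdot> (m \<cdot> u A)" if o: "A \<in> Ob \<C>" "B \<in> Ob \<C>" "m \<in> mor A B" for A B m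
    by (rule full[OF G[OF o(1)] G[OF o(2)] comp_closed[OF FO[OF G[OF o(1)]] o(2) FO[OF G[OF o(2)]] mu[OF o] v[OF o(2)]]])
  have Geq: "Gm m = h" if o: "A \<in> Ob \<C>" "B \<in> Ob \<C>" "m \<in> mor A B" and h: "h \<in> mor (Go A) (Go B)"
    "Fm h = v B \<cdot> (m \<cdot> u A)" for A B m h
    unfolding Gm_def
  proof (rule the_equality)
    show "P m h" using o h unfolding P_def by blast
    fix h' assume "P m h'"
    then obtain A' B' where h': "A' \<in> Ob \<C>" "B' \<in> Ob \<C>" "m \<in> mor A' B'" "h' \<in> mor (Go A') (Go B')"
      "Fm h' = v B' \<cdot> (m \<cdot> u A')" unfolding P_def by blast
    have "A' = A" "B' = B" using hom_disjoint[OF o(1,2) h'(1,2) o(3) h'(3)] by auto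
    then show "h' = h" using faithful[OF G[OF o(1)] G[OF o(2)]] h h' by auto
  qed
  have Gmor: "Gm m \<in> mor (Go A) (Go B)" and FG: "Fm (Gm m) = v B \<cdot> (m \<cdot> u A)"
    if o: "A \<in> Ob \<C>" "B \<in> Ob \<C>" "m \<in> mor A B" for A B m
    using Gex[OF o] Geq[OF o] by auto
  have uFG: "u B \<cdot> Fm (Gm m) = m \<cdot> u A" if o: "A \<in> Ob \<C>" "B \<in> Ob \<C>" "m \<in> mor A B" for A B m
    using comp_assoc[OF FO[OF G[OF o(1)]] o(2) FO[OF G[OF o(2)]] o(2) mu[OF o] v[OF o(2)] u[OF o(2)]]
      uv[OF o(2)] ident_left[OF FO[OF G[OF o(1)]] o(2) mu[OF o]] FG[OF o] by simp
  have uiso: "iso_mor (Fo (Go B)) B (u B)" if "B \<in> Ob \<C>" for B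
    using u v uv vu that unfolding iso_mor_def by blast
  have uinj: "h = h'"
    if o: "A \<in> Ob \<C>" "B \<in> Ob \<C>" "h \<in> mor A (Go B)" "h' \<in> mor A (Go B)" "u B \<cdot> Fm h = u B \<cdot> Fm h'" for A B h h'
  proof (rule faithful[OF o(1) G[OF o(2)] o(3,4)])
    show "Fm h = Fm h'"
      by (rule iso_mor_cancel_left[OF uiso[OF o(2)] FO[OF o(1)] FO[OF G[OF o(2)]] o(2) _ _ o(5)])
        (use Fmor[OF o(1) G[OF o(2)]] o in auto)
  qed
  have Gfun: "endofunctor Go Gm"
    unfolding endofunctor_def
  proof (intro conjI ballI)
    fix A assume A: "A \<in> Ob \<C>"
    show "Go A \<in> Ob \<C>" by (rule G[OF A])
    show "Gm (ident \<C> A) = ident \<C> (Go A)"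
      using Fid[OF G[OF A]] vu[OF A] ident_left[OF FO[OF G[OF A]] A u[OF A]]
      by (intro Geq[OF A A ident_closed[OF A] ident_closed[OF G[OF A]]]) simp
  next
    fix A B m assume "A \<in> Ob \<C>" "B \<in> Ob \<C>" "m \<in> mor A B"
    then show "Gm m \<in> mor (Go A) (Go B)" by (rule Gmor)
  next
    fix A B D f g assume A: "A \<in> Ob \<C>" and B: "B \<in> Ob \<C>" and D: "D \<in> Ob \<C>" and f: "f \<in> mor A B" and g: "g \<in> mor B D"
    have gf: "g \<cdot> f \<in> mor A D" by (rule comp_closed[OF A B D f g])
    have GG: "Gm g \<cdot> Gm f \<in> mor (Go A) (Go D)"
      by (rule comp_closed[OF G[OF A] G[OF B] G[OF D] Gmor[OF A B f] Gmor[OF B D g]])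
    show "Gm (g \<cdot> f) = Gm g \<cdot> Gm f"
    proof (rule uinj[OF G[OF A] D Gmor[OF A D gf] GG])
      note FGA = FO[OF G[OF A]] and FGB = FO[OF G[OF B]] and FGD = FO[OF G[OF D]]
      note Ff = Fmor[OF G[OF A] G[OF B] Gmor[OF A B f]] and Fg = Fmor[OF G[OF B] G[OF D] Gmor[OF B D g]]
      have "u D \<cdot> Fm (Gm g \<cdot> Gm f) = u D \<cdot> (Fm (Gm g) \<cdot> Fm (Gm f))"
        using Fcomp[OF G[OF A] G[OF B] G[OF D] Gmor[OF A B f] Gmor[OF B D g]] by simp
      also have "\<dots> = (g \<cdot> u B) \<cdot> Fm (Gm f)"
        using comp_assoc[OF FGA FGB FGD D Ff Fg u[OF D]] uFG[OF B D g] by simp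
      also have "\<dots> = g \<cdot> (f \<cdot> u A)"
        using comp_assoc[OF FGA FGB B D Ff u[OF B] g] uFG[OF A B f] by simp
      also have "\<dots> = u D \<cdot> Fm (Gm (g \<cdot> f))"
        using comp_assoc[OF FGA A B D u[OF A] f g] uFG[OF A D gf] by simp
      finally show "u D \<cdot> Fm (Gm (g \<cdot> f)) = u D \<cdot> Fm (Gm g \<cdot> Gm f)" by simp
    qed
  qed
  have n2: "naturally_isomorphic (Fo \<circ> Go) (Fm \<circ> Gm) id id"
    unfolding naturally_isomorphic_def by (rule exI[of _ u]) (use uiso uFG in auto)
  have n1: "naturally_isomorphic (Go \<circ> Fo) (Gm \<circ> Fm) id id"
  proof -
    have "\<forall>A\<in>Ob \<C>. \<exists>e\<in>mor (Go (Fo A)) A. Fm e = u (Fo A)"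
      using full[OF G[OF FO] _ u[OF FO]] by blast
    then obtain \<eta> where \<eta>: "\<And>A. A \<in> Ob \<C> \<Longrightarrow> \<eta> A \<in> mor (Go (Fo A)) A" "\<And>A. A \<in> Ob \<C> \<Longrightarrow> Fm (\<eta> A) = u (Fo A)"
      by metis
    have iso: "iso_mor (Go (Fo A)) A (\<eta> A)" if A: "A \<in> Ob \<C>" for A
    proof -
      note GF = G[OF FO[OF A]]
      obtain e where e: "e \<in> mor A (Go (Fo A))" "Fm e = v (Fo A)" using full[OF A GF v[OF FO[OF A]]] by blast
      have "e \<cdot> \<eta> A = ident \<C> (Go (Fo A))"
        using Fcomp[OF GF A GF \<eta>(1)[OF A] e(1)] \<eta>(2)[OF A] e(2) vu[OF FO[OF A]] Fid[OF GF]
        by (intro faithful[OF GF GF comp_closed[OF GF A GF \<eta>(1)[OF A] e(1)] ident_closed[OF GF]]) simp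
      moreover have "\<eta> A \<cdot> e = ident \<C> A"
        using Fcomp[OF A GF A e(1) \<eta>(1)[OF A]] \<eta>(2)[OF A] e(2) uv[OF FO[OF A]] Fid[OF A]
        by (intro faithful[OF A A comp_closed[OF A GF A e(1) \<eta>(1)[OF A]] ident_closed[OF A]]) simp
      ultimately show ?thesis using \<eta>(1)[OF A] e(1) unfolding iso_mor_def by blast
    qed
    have nat: "\<eta> B \<cdot> Gm (Fm f) = f \<cdot> \<eta> A" if A: "A \<in> Ob \<C>" and B: "B \<in> Ob \<C>" and f: "f \<in> mor A B" for A B f
    proof -
      note GA = G[OF FO[OF A]] and GB = G[OF FO[OF B]]
      note Gf = Gmor[OF FO[OF A] FO[OF B] Fmor[OF A B f]]
      show ?thesis
        using Fcomp[OF GA GB B Gf \<eta>(1)[OF B]] Fcomp[OF GA A B \<eta>(1)[OF A] f] \<eta>(2)[OF A] \<eta>(2)[OF B]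
          uFG[OF FO[OF A] FO[OF B] Fmor[OF A B f]]
        by (intro faithful[OF GA B comp_closed[OF GA GB B Gf \<eta>(1)[OF B]] comp_closed[OF GA A B \<eta>(1)[OF A] f]]) simp
    qed
    show ?thesis unfolding naturally_isomorphic_def by (rule exI[of _ \<eta>]) (use iso nat in auto)
  qed
  show ?thesis unfolding auto_equivalence_def using F Gfun n1 n2 by blast
qed

end

section \<open>Serre duality from Serre pairs\<close>

context serre_setting
begin

text \<open>Take the form \<open>\<gamma>\<close> that corresponds to \<open>w\<close>. By naturality, \<open>\<theta> \<mapsto> \<gamma>(f\<^sub>* \<theta>)\<close> corresponds to \<open>w f\<close> and
  \<open>\<rho> \<mapsto> \<gamma>(h\<^sup>* \<rho>)\<close> to \<open>\<tau>(h) w\<close>. Both assignments are bijective, as \<open>w\<close> is invertible and \<open>\<tau>\<close> fully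
  faithful.\<close>

lemma serre_duality_pair:
  assumes ae: "auto_equivalence \<tau>o \<tau>m"
    and \<tau>l: "\<And>A B. A \<in> Ob \<C> \<Longrightarrow> B \<in> Ob \<C> \<Longrightarrow> linear_map k (Hom \<C> A B) (Hom \<C> (\<tau>o A) (\<tau>o B)) \<tau>m"
    and \<phi>: "\<And>X Y. X \<in> Ob \<C> \<Longrightarrow> Y \<in> Ob \<C> \<Longrightarrow> linear_iso k (dual (Ext \<E> X Y)) (Hom \<C> Y (\<tau>o X)) (\<phi> X Y)"
    and nat: "\<And>X X' Y Y' x y \<psi>. \<lbrakk>X \<in> Ob \<C>; X' \<in> Ob \<C>; Y \<in> Ob \<C>; Y' \<in> Ob \<C>; x \<in> mor X X'; y \<in> mor Y' Y;
        \<psi> \<in> carrier (dual (Ext \<E> X Y))\<rbrakk> \<Longrightarrow>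
        \<phi> X' Y' (\<lambda>\<delta>\<in>extn X' Y'. \<psi> (Emap \<E> x y \<delta>)) = \<tau>m x \<cdot> \<phi> X Y \<psi> \<cdot> y"
    and C: "C \<in> Ob \<C>" and A: "A \<in> Ob \<C>" and w: "iso_mor A (\<tau>o C) w"
  shows "\<exists>\<gamma>. serre_pair C A \<gamma>"
proof -
  have F: "endofunctor \<tau>o \<tau>m" using ae by (simp add: auto_equivalence_def)
  note \<tau>O = endofunctorD(1)[OF F] and \<tau>id = endofunctorD(2)[OF F] and \<tau>mor = endofunctorD(3)[OF F]
  have TC: "\<tau>o C \<in> Ob \<C>" by (rule \<tau>O[OF C])
  obtain w' where wm: "w \<in> mor A (\<tau>o C)" and w': "w' \<in> mor (\<tau>o C) A" "w' \<cdot> w = ident \<C> A" "w \<cdot> w' = ident \<C> (\<tau>o C)"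
    using w by (rule iso_morE)
  have lin: "linear_map k (dual (Ext \<E> X Y)) (Hom \<C> Y (\<tau>o X)) (\<phi> X Y)"
    and bij: "bij_betw (\<phi> X Y) (carrier (dual (Ext \<E> X Y))) (mor Y (\<tau>o X))" if "X \<in> Ob \<C>" "Y \<in> Ob \<C>" for X Y
    using \<phi>[OF that] by (auto simp: linear_iso_def)
  have \<phi>0: "\<phi> X Y \<zero>\<^bsub>dual (Ext \<E> X Y)\<^esub> = zero_hom Y (\<tau>o X)" if "X \<in> Ob \<C>" "Y \<in> Ob \<C>" for X Y
    by (rule linear_map_zero[OF module_dual[OF ext_module[OF that]] hom_module[OF that(2) \<tau>O[OF that(1)]] lin[OF that]])
  have \<phi>inj: "\<psi> = \<psi>'" if "X \<in> Ob \<C>" "Y \<in> Ob \<C>" "\<psi> \<in> carrier (dual (Ext \<E> X Y))"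
    "\<psi>' \<in> carrier (dual (Ext \<E> X Y))" "\<phi> X Y \<psi> = \<phi> X Y \<psi>'" for X Y \<psi> \<psi>'
    using bij[OF that(1,2)] that(3-5) unfolding bij_betw_def by (meson inj_onD)
  have \<phi>c: "\<phi> X Y \<psi> \<in> mor Y (\<tau>o X)" if "X \<in> Ob \<C>" "Y \<in> Ob \<C>" "\<psi> \<in> carrier (dual (Ext \<E> X Y))" for X Y \<psi>
    using linear_mapD(1)[OF lin[OF that(1,2)] that(3)] .
  have "w \<in> \<phi> C A ` carrier (dual (Ext \<E> C A))" using bij[OF C A] wm by (simp add: bij_betw_def)
  then obtain \<gamma> where \<gamma>: "\<gamma> \<in> carrier (dual (Ext \<E> C A))" "\<phi> C A \<gamma> = w" by blast
  have iC: "ident \<C> C \<in> mor C C" and iA: "ident \<C> A \<in> mor A A" using C A by (auto simp: ident_closed)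
  define push where "push B f = (\<lambda>\<theta>\<in>extn C B. \<gamma> (pushforward C f \<theta>))" for B f
  have push: "\<phi> C B (push B f) = w \<cdot> f" if B: "B \<in> Ob \<C>" and f: "f \<in> mor B A" for B f
    using nat[OF C C A B iC f \<gamma>(1)] \<gamma>(2) \<tau>id[OF C] ident_left[OF A TC wm] by (simp add: push_def)
  have pushd: "push B f \<in> carrier (dual (Ext \<E> C B))" if B: "B \<in> Ob \<C>" and f: "f \<in> mor B A" for B f
    unfolding push_def
    by (rule dual_restrict[OF ext_module[OF C B] linear_map_comp[OF Emap_linear(2)[OF C C B A iC f] dual_linear[OF \<gamma>(1)]]])
  have pull: "\<phi> D A (pull_form A \<gamma> D h) = \<tau>m h \<cdot> w" if D: "D \<in> Ob \<C>" and h: "h \<in> mor C D" for D h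
    using nat[OF C D A A h iA \<gamma>(1)] \<gamma>(2) ident_right[OF A \<tau>O[OF D] comp_closed[OF A TC \<tau>O[OF D] wm \<tau>mor[OF C D h]]]
    by (simp add: pull_form_def)
  have "serre_pair C A \<gamma>"
    unfolding serre_pair_def
  proof (intro conjI ballI impI C A \<gamma>(1))
    fix B f assume B: "B \<in> Ob \<C>" and f: "f \<in> mor B A" and nz: "f \<noteq> zero_hom B A"
    show "\<exists>\<theta>\<in>extn C B. \<gamma> (pushforward C f \<theta>) \<noteq> \<zero>\<^bsub>J\<^esub>"
    proof (rule ccontr)
      assume "\<not> ?thesis"
      then have "push B f = \<zero>\<^bsub>dual (Ext \<E> C B)\<^esub>" by (auto simp: push_def dual_simps(2) intro!: restrict_ext)
      then have "w \<cdot> f = w \<cdot> (zero_hom B A)"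
        using push[OF B f] \<phi>0[OF C B] comp_zero_right[OF B A TC wm] by simp
      then show False using iso_mor_cancel_left[OF w B A TC f zero_mor[OF B A]] nz by simp
    qed
  next
    fix B \<theta> assume B: "B \<in> Ob \<C>" and \<theta>: "\<theta> \<in> extn C B" "\<theta> \<noteq> zero_ext C B"
    interpret M: finite_length_module k J "Ext \<E> C B" by (rule ext_finite_length[OF C B])
    obtain \<psi> where \<psi>: "\<psi> \<in> carrier (dual (Ext \<E> C B))" "\<psi> \<theta> \<noteq> \<zero>\<^bsub>J\<^esub>" using M.dual_separates[OF \<theta>] by blast
    define f where "f = w' \<cdot> \<phi> C B \<psi>"
    have f: "f \<in> mor B A" unfolding f_def by (rule comp_closed[OF B TC A \<phi>c[OF C B \<psi>(1)] w'(1)])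
    have "w \<cdot> f = \<phi> C B \<psi>"
      unfolding f_def using comp_assoc[OF B TC A TC \<phi>c[OF C B \<psi>(1)] w'(1) wm] w'(3)
        ident_left[OF B TC \<phi>c[OF C B \<psi>(1)]] by simp
    then have "push B f = \<psi>" using \<phi>inj[OF C B pushd[OF B f] \<psi>(1)] push[OF B f] by simp
    then have "\<gamma> (pushforward C f \<theta>) \<noteq> \<zero>\<^bsub>J\<^esub>" using \<psi>(2) \<theta>(1) by (auto simp: push_def)
    then show "\<exists>f\<in>mor B A. \<gamma> (pushforward C f \<theta>) \<noteq> \<zero>\<^bsub>J\<^esub>" using f by blast
  next
    fix D h assume D: "D \<in> Ob \<C>" and h: "h \<in> mor C D" and nz: "h \<noteq> zero_hom C D"
    show "\<exists>\<rho>\<in>extn D A. \<gamma> (pullback h A \<rho>) \<noteq> \<zero>\<^bsub>J\<^esub>"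
    proof (rule ccontr)
      assume "\<not> ?thesis"
      then have "pull_form A \<gamma> D h = \<zero>\<^bsub>dual (Ext \<E> D A)\<^esub>"
        by (auto simp: pull_form_def dual_simps(2) intro!: restrict_ext)
      then have "\<tau>m h \<cdot> w = zero_hom (\<tau>o C) (\<tau>o D) \<cdot> w"
        using pull[OF D h] \<phi>0[OF D A] comp_zero_left[OF A TC \<tau>O[OF D] wm] by simp
      then have "\<tau>m h = zero_hom (\<tau>o C) (\<tau>o D)"
        using iso_mor_cancel_right[OF w A TC \<tau>O[OF D] \<tau>mor[OF C D h] zero_mor[OF TC \<tau>O[OF D]]] by simp
      also have "\<dots> = \<tau>m (zero_hom C D)"
        using linear_map_zero[OF hom_module[OF C D] hom_module[OF TC \<tau>O[OF D]] \<tau>l[OF C D]] by simp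
      finally show False using auto_equivalence_faithful[OF ae C D h zero_mor[OF C D]] nz by simp
    qed
  next
    fix D \<rho> assume D: "D \<in> Ob \<C>" and \<rho>: "\<rho> \<in> extn D A" "\<rho> \<noteq> zero_ext D A"
    interpret M: finite_length_module k J "Ext \<E> D A" by (rule ext_finite_length[OF D A])
    obtain \<psi> where \<psi>: "\<psi> \<in> carrier (dual (Ext \<E> D A))" "\<psi> \<rho> \<noteq> \<zero>\<^bsub>J\<^esub>" using M.dual_separates[OF \<rho>] by blast
    obtain h where h: "h \<in> mor C D" "\<tau>m h = \<phi> D A \<psi> \<cdot> w'"
      using auto_equivalence_full[OF ae C D comp_closed[OF TC A \<tau>O[OF D] w'(1) \<phi>c[OF D A \<psi>(1)]]] by blast
    have "\<tau>m h \<cdot> w = \<phi> D A \<psi>"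
      unfolding h(2) using comp_assoc[OF A TC A \<tau>O[OF D] wm w'(1) \<phi>c[OF D A \<psi>(1)]] w'(2)
        ident_right[OF A \<tau>O[OF D] \<phi>c[OF D A \<psi>(1)]] by simp
    then have "pull_form A \<gamma> D h = \<psi>"
      using \<phi>inj[OF D A pull_form_dual[OF C A \<gamma>(1) D h(1)] \<psi>(1)] pull[OF D h(1)] by simp
    then have "\<gamma> (pullback h A \<rho>) \<noteq> \<zero>\<^bsub>J\<^esub>" using \<psi>(2) \<rho>(1) by (auto simp: pull_form_def)
    then show "\<exists>g\<in>mor C D. \<gamma> (pullback g A \<rho>) \<noteq> \<zero>\<^bsub>J\<^esub>" using h(1) by blast
  qed
  then show ?thesis by blast
qed

lemma serre_duality_has_serre_pairs:
  assumes "has_serre_duality k J \<C> \<E>"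
  shows "has_serre_pairs"
proof -
  obtain \<tau>o \<tau>m \<phi> where ae: "auto_equivalence \<tau>o \<tau>m"
    and rest: "\<forall>A\<in>Ob \<C>. \<forall>B\<in>Ob \<C>. linear_map k (Hom \<C> A B) (Hom \<C> (\<tau>o A) (\<tau>o B)) \<tau>m"
      "\<forall>X\<in>Ob \<C>. \<forall>Y\<in>Ob \<C>. linear_iso k (dual (Ext \<E> X Y)) (Hom \<C> Y (\<tau>o X)) (\<phi> X Y)"
      "\<forall>X\<in>Ob \<C>. \<forall>X'\<in>Ob \<C>. \<forall>Y\<in>Ob \<C>. \<forall>Y'\<in>Ob \<C>. \<forall>x\<in>mor X X'. \<forall>y\<in>mor Y' Y.
        \<forall>\<psi>\<in>carrier (dual (Ext \<E> X Y)).
          \<phi> X' Y' (\<lambda>\<delta>\<in>extn X' Y'. \<psi> (Emap \<E> x y \<delta>)) = \<tau>m x \<cdot> \<phi> X Y \<psi> \<cdot> y"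
    using assms unfolding has_serre_duality_def by blast
  have pair: "\<exists>\<gamma>. serre_pair C A \<gamma>" if "C \<in> Ob \<C>" "A \<in> Ob \<C>" "iso_mor A (\<tau>o C) w" for C A w
    by (rule serre_duality_pair[OF ae _ _ _ that, where \<phi> = \<phi>]) (use rest in blast)+
  have F: "endofunctor \<tau>o \<tau>m" using ae by (simp add: auto_equivalence_def)
  show ?thesis
    unfolding has_serre_pairs_def
  proof (intro conjI ballI)
    fix C assume C: "C \<in> Ob \<C>"
    have T: "\<tau>o C \<in> Ob \<C>" by (rule endofunctorD(1)[OF F C])
    have "iso_mor (\<tau>o C) (\<tau>o C) (ident \<C> (\<tau>o C))"
      unfolding iso_mor_def using ident_closed[OF T] ident_left[OF T T ident_closed[OF T]] by blast
    then show "\<exists>A \<gamma>. serre_pair C A \<gamma>" using pair[OF C T] by blast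
  next
    fix A assume A: "A \<in> Ob \<C>"
    then show "\<exists>C \<gamma>. serre_pair C A \<gamma>"
      using auto_equivalence_essentially_surjective[OF ae A] pair by blast
  qed
qed

text \<open>With \<open>\<tau> C\<close> and \<open>\<gamma>\<^sub>C\<close> chosen for each \<open>C\<close>, let \<open>\<tau> f\<close> be the morphism with
  \<open>\<gamma>\<^sub>B((\<tau> f)\<^sub>* \<omega>) = \<gamma>\<^sub>A(f\<^sup>* \<omega>)\<close>. Every form on \<open>\<E>(B, \<tau> A)\<close> is of either shape for a unique morphism, so \<open>\<tau>\<close>
  is well defined and fully faithful. It is essentially surjective since two objects that form Serre
  pairs with the same \<open>C\<close> are isomorphic.\<close>

lemma has_serre_pairs_serre_duality:
  assumes sp: "has_serre_pairs"
  shows "has_serre_duality k J \<C> \<E>"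
proof -
  have "\<forall>C\<in>Ob \<C>. \<exists>A \<gamma>. serre_pair C A \<gamma>" using sp by (simp add: has_serre_pairs_def)
  then obtain T \<gamma> where pair: "\<And>C. C \<in> Ob \<C> \<Longrightarrow> serre_pair C (T C) (\<gamma> C)" by metis
  have TO: "T C \<in> Ob \<C>" and \<gamma>d: "\<gamma> C \<in> carrier (dual (Ext \<E> C (T C)))" if "C \<in> Ob \<C>" for C
    using pair[OF that] by (auto simp: serre_pair_def)
  have \<gamma>l: "linear_map k (Ext \<E> C (T C)) J (\<gamma> C)" if "C \<in> Ob \<C>" for C
    by (rule dual_linear[OF \<gamma>d[OF that]])
  note id = ident_closed
  \<comment> \<open>\<open>t\<close> is the transpose of \<open>f\<close> under the pairings \<open>\<gamma> A\<close> and \<open>\<gamma> B\<close>.\<close>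
  define tr where "tr A B f t \<longleftrightarrow> A \<in> Ob \<C> \<and> B \<in> Ob \<C> \<and> f \<in> mor A B \<and> t \<in> mor (T A) (T B) \<and>
    (\<forall>\<omega>\<in>extn B (T A). \<gamma> B (pushforward B t \<omega>) = \<gamma> A (pullback f (T A) \<omega>))" for A B f t
  define \<tau>m where "\<tau>m f = (THE t. \<exists>A B. tr A B f t)" for f
  have tr_unique: "t = t'" if "tr A B f t" "tr A' B' f t'" for A B A' B' f t t'
  proof -
    have o: "A \<in> Ob \<C>" "B \<in> Ob \<C>" using that by (auto simp: tr_def)
    have "A = A'" "B = B'" using that hom_disjoint[of A B A' B' f] by (auto simp: tr_def)
    then show ?thesis
      using that by (intro serre_pair_push_inj[OF pair[OF o(2)] TO[OF o(1)]]) (auto simp: tr_def)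
  qed
  have tr_ex: "\<exists>t. tr A B f t" if o: "A \<in> Ob \<C>" "B \<in> Ob \<C>" and f: "f \<in> mor A B" for A B f
  proof -
    have "pull_form (T A) (\<gamma> A) B f \<in> carrier (dual (Ext \<E> B (T A)))"
      by (rule pull_form_dual[OF o(1) TO[OF o(1)] \<gamma>d[OF o(1)] o(2) f])
    then obtain t where t: "t \<in> mor (T A) (T B)" and
      e: "pull_form (T A) (\<gamma> A) B f = (\<lambda>\<omega>\<in>extn B (T A). \<gamma> B (pushforward B t \<omega>))"
      using serre_pair_push_surj[OF pair[OF o(2)] TO[OF o(1)]] by blast
    have "\<gamma> B (pushforward B t \<omega>) = \<gamma> A (pullback f (T A) \<omega>)" if "\<omega> \<in> extn B (T A)" for \<omega>
      using fun_cong[OF e, of \<omega>] that by (simp add: pull_form_def)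
    then show ?thesis using o f t unfolding tr_def by blast
  qed
  have \<tau>eq: "\<tau>m f = t" if "tr A B f t" for A B f t
    unfolding \<tau>m_def using that tr_unique by blast
  have \<tau>tr: "tr A B f (\<tau>m f)" if "A \<in> Ob \<C>" "B \<in> Ob \<C>" "f \<in> mor A B" for A B f
    using tr_ex[OF that] \<tau>eq by auto
  have \<tau>mor: "\<tau>m f \<in> mor (T A) (T B)" if "A \<in> Ob \<C>" "B \<in> Ob \<C>" "f \<in> mor A B" for A B f
    using \<tau>tr[OF that] by (simp add: tr_def)
  have \<tau>val: "\<gamma> B (pushforward B (\<tau>m f) \<omega>) = \<gamma> A (pullback f (T A) \<omega>)"
    if "A \<in> Ob \<C>" "B \<in> Ob \<C>" "f \<in> mor A B" "\<omega> \<in> extn B (T A)" for A B f \<omega>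
    using \<tau>tr[OF that(1-3)] that(4) by (simp add: tr_def)
  have F: "endofunctor T \<tau>m"
    unfolding endofunctor_def
  proof (intro conjI ballI)
    fix A assume A: "A \<in> Ob \<C>"
    show "T A \<in> Ob \<C>" by (rule TO[OF A])
    show "\<tau>m (ident \<C> A) = ident \<C> (T A)"
      by (rule \<tau>eq[of A A]) (use A id TO[OF A] in \<open>auto simp: tr_def\<close>)
  next
    fix A B f assume "A \<in> Ob \<C>" "B \<in> Ob \<C>" "f \<in> mor A B"
    then show "\<tau>m f \<in> mor (T A) (T B)" by (rule \<tau>mor)
  next
    fix A B D f g assume A: "A \<in> Ob \<C>" and B: "B \<in> Ob \<C>" and D: "D \<in> Ob \<C>" and f: "f \<in> mor A B" and g: "g \<in> mor B D"
    note tf = \<tau>mor[OF A B f] and tg = \<tau>mor[OF B D g] and TA = TO[OF A] and TB = TO[OF B] and TD = TO[OF D]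
    have "tr A D (g \<cdot> f) (\<tau>m g \<cdot> \<tau>m f)"
      unfolding tr_def
    proof (intro conjI ballI A D comp_closed[OF A B D f g] comp_closed[OF TA TB TD tf tg])
      fix \<omega> assume w: "\<omega> \<in> extn D (T A)"
      have c: "pushforward D (\<tau>m f) \<omega> \<in> extn D (T B)"
        by (rule Emap_closed[OF D D TA TB id[OF D] tf w])
      have c': "pullback g (T A) \<omega> \<in> extn B (T A)"
        by (rule Emap_closed[OF D B TA TA g id[OF TA] w])
      have "\<gamma> D (pushforward D (\<tau>m g \<cdot> \<tau>m f) \<omega>) = \<gamma> D (pushforward D (\<tau>m g) (pushforward D (\<tau>m f) \<omega>))"
        using Emap_push_push[OF D TA TB TD tf tg w] by simp
      also have "\<dots> = \<gamma> B (pullback g (T B) (pushforward D (\<tau>m f) \<omega>))"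
        by (rule \<tau>val[OF B D g c])
      also have "\<dots> = \<gamma> B (pushforward B (\<tau>m f) (pullback g (T A) \<omega>))"
        using Emap_push_pull[OF D B TA TB tf g w] by simp
      also have "\<dots> = \<gamma> A (pullback f (T A) (pullback g (T A) \<omega>))"
        by (rule \<tau>val[OF A B f c'])
      also have "\<dots> = \<gamma> A (pullback (g \<cdot> f) (T A) \<omega>)"
        using Emap_pull_pull[OF TA D B A g f w] by simp
      finally show "\<gamma> D (pushforward D (\<tau>m g \<cdot> \<tau>m f) \<omega>) = \<gamma> A (pullback (g \<cdot> f) (T A) \<omega>)" .
    qed
    then show "\<tau>m (g \<cdot> f) = \<tau>m g \<cdot> \<tau>m f" by (rule \<tau>eq)
  qed
  have \<tau>lin: "linear_map k (Hom \<C> A B) (Hom \<C> (T A) (T B)) \<tau>m" if A: "A \<in> Ob \<C>" and B: "B \<in> Ob \<C>" for A B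
  proof -
    note TA = TO[OF A] and TB = TO[OF B]
    interpret H: module k "Hom \<C> A B" by (rule hom_module[OF A B])
    interpret TH: module k "Hom \<C> (T A) (T B)" by (rule hom_module[OF TA TB])
    have l1: "linear_map k (Hom \<C> (T A) (T B)) J (\<lambda>t. \<gamma> B (pushforward B t \<omega>))"
      if "\<omega> \<in> extn B (T A)" for \<omega>
      by (rule linear_map_comp[OF Emap_linear(3)[OF B B TA TB id[OF B] that] \<gamma>l[OF B]])
    have l2: "linear_map k (Hom \<C> A B) J (\<lambda>f. \<gamma> A (pullback f (T A) \<omega>))"
      if "\<omega> \<in> extn B (T A)" for \<omega>
      by (rule linear_map_comp[OF Emap_linear(1)[OF A B TA TA that id[OF TA]] \<gamma>l[OF A]])
    show ?thesis
      unfolding linear_map_def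
    proof (intro conjI ballI)
      show "\<tau>m \<in> mor A B \<rightarrow> mor (T A) (T B)" using \<tau>mor[OF A B] by auto
      fix f g assume fg: "f \<in> mor A B" "g \<in> mor A B"
      show "\<tau>m (f \<oplus>\<^bsub>Hom \<C> A B\<^esub> g) = \<tau>m f \<oplus>\<^bsub>Hom \<C> (T A) (T B)\<^esub> \<tau>m g"
        by (rule \<tau>eq[of A B])
          (use A B fg \<tau>mor[OF A B] \<tau>val[OF A B] linear_mapD(2)[OF l1] linear_mapD(2)[OF l2] in \<open>simp add: tr_def\<close>)
    next
      fix r f assume r: "r \<in> carrier k" "f \<in> mor A B"
      show "\<tau>m (r \<odot>\<^bsub>Hom \<C> A B\<^esub> f) = r \<odot>\<^bsub>Hom \<C> (T A) (T B)\<^esub> \<tau>m f"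
        by (rule \<tau>eq[of A B])
          (use A B r \<tau>mor[OF A B] \<tau>val[OF A B] linear_mapD(3)[OF l1] linear_mapD(3)[OF l2] in \<open>simp add: tr_def\<close>)
    qed
  qed
  have ae: "auto_equivalence T \<tau>m"
  proof (rule fully_faithful_auto_equivalence[OF F])
    fix A B f g assume A: "A \<in> Ob \<C>" and B: "B \<in> Ob \<C>" and f: "f \<in> mor A B" and g: "g \<in> mor A B" and e: "\<tau>m f = \<tau>m g"
    show "f = g"
      by (rule serre_pair_pull_inj[OF pair[OF A] B f g]) (use \<tau>val[OF A B f] \<tau>val[OF A B g] e in simp)
  next
    fix A B q assume A: "A \<in> Ob \<C>" and B: "B \<in> Ob \<C>" and q: "q \<in> mor (T A) (T B)"
    note TA = TO[OF A] and TB = TO[OF B]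
    define \<psi> where "\<psi> = (\<lambda>\<omega>\<in>extn B (T A). \<gamma> B (pushforward B q \<omega>))"
    have "\<psi> \<in> carrier (dual (Ext \<E> B (T A)))"
      unfolding \<psi>_def
      by (rule dual_restrict[OF ext_module[OF B TA] linear_map_comp[OF Emap_linear(2)[OF B B TA TB id[OF B] q] \<gamma>l[OF B]]])
    then obtain f where f: "f \<in> mor A B" "\<psi> = pull_form (T A) (\<gamma> A) B f"
      using serre_pair_pull_surj[OF pair[OF A] B] by blast
    have "\<gamma> B (pushforward B q \<omega>) = \<gamma> A (pullback f (T A) \<omega>)" if "\<omega> \<in> extn B (T A)" for \<omega>
      using fun_cong[OF f(2), of \<omega>] that by (simp add: pull_form_def \<psi>_def)
    then have "\<tau>m f = q" using A B f(1) q by (intro \<tau>eq[of A B]) (simp add: tr_def)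
    then show "\<exists>f\<in>mor A B. \<tau>m f = q" using f(1) by blast
  next
    fix A assume A: "A \<in> Ob \<C>"
    then obtain C \<gamma>' where p: "serre_pair C A \<gamma>'" using sp by (auto simp: has_serre_pairs_def)
    then have C: "C \<in> Ob \<C>" and \<gamma>': "\<gamma>' \<in> carrier (dual (Ext \<E> C A))" by (auto simp: serre_pair_def)
    note TC = TO[OF C]
    obtain u where u: "u \<in> mor A (T C)" "\<gamma>' = (\<lambda>\<theta>\<in>extn C A. \<gamma> C (pushforward C u \<theta>))"
      using serre_pair_push_surj[OF pair[OF C] A \<gamma>'] by blast
    obtain v where v: "v \<in> mor (T C) A" "\<gamma> C = (\<lambda>\<theta>\<in>extn C (T C). \<gamma>' (pushforward C v \<theta>))"
      using serre_pair_push_surj[OF p TC \<gamma>d[OF C]] by blast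
    have uval: "\<gamma>' \<theta> = \<gamma> C (pushforward C u \<theta>)" if "\<theta> \<in> extn C A" for \<theta>
      using fun_cong[OF u(2), of \<theta>] that by simp
    have vval: "\<gamma> C \<theta> = \<gamma>' (pushforward C v \<theta>)" if "\<theta> \<in> extn C (T C)" for \<theta>
      using fun_cong[OF v(2), of \<theta>] that by simp
    have "u \<cdot> v = ident \<C> (T C)"
    proof (rule serre_pair_push_inj[OF pair[OF C] TC comp_closed[OF TC A TC v(1) u(1)] id[OF TC]])
      fix \<theta> assume t: "\<theta> \<in> extn C (T C)"
      have "pushforward C v \<theta> \<in> extn C A" by (rule Emap_closed[OF C C TC A id[OF C] v(1) t])
      then show "\<gamma> C (pushforward C (u \<cdot> v) \<theta>) = \<gamma> C (pullback (ident \<C> C) (T C) \<theta>)"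
        using Emap_push_push[OF C TC A TC v(1) u(1) t] uval vval[OF t] Emap_ident[OF C TC t] by simp
    qed
    moreover have "v \<cdot> u = ident \<C> A"
    proof (rule serre_pair_push_inj[OF p A comp_closed[OF A TC A u(1) v(1)] id[OF A]])
      fix \<theta> assume t: "\<theta> \<in> extn C A"
      have "pushforward C u \<theta> \<in> extn C (T C)" by (rule Emap_closed[OF C C A TC id[OF C] u(1) t])
      then show "\<gamma>' (pushforward C (v \<cdot> u) \<theta>) = \<gamma>' (pullback (ident \<C> C) A \<theta>)"
        using Emap_push_push[OF C A TC A u(1) v(1) t] vval uval[OF t] Emap_ident[OF C A t] by simp
    qed
    ultimately have "iso_mor A (T C) u" using u(1) v(1) unfolding iso_mor_def by blast
    then show "\<exists>C\<in>Ob \<C>. \<exists>w. iso_mor A (T C) w" using C by blast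
  qed
  define \<phi> where "\<phi> X Y \<psi> = (THE f. f \<in> mor Y (T X) \<and>
    (\<forall>\<theta>\<in>extn X Y. \<psi> \<theta> = \<gamma> X (pushforward X f \<theta>)))" for X Y \<psi>
  have \<phi>eq: "\<phi> X Y \<psi> = f" if "X \<in> Ob \<C>" "Y \<in> Ob \<C>" "f \<in> mor Y (T X)"
    "\<And>\<theta>. \<theta> \<in> extn X Y \<Longrightarrow> \<psi> \<theta> = \<gamma> X (pushforward X f \<theta>)" for X Y \<psi> f
    unfolding \<phi>_def
  proof (rule the_equality)
    fix f' assume f': "f' \<in> mor Y (T X) \<and> (\<forall>\<theta>\<in>extn X Y. \<psi> \<theta> = \<gamma> X (pushforward X f' \<theta>))"
    show "f' = f"
    proof (rule serre_pair_push_inj[OF pair[OF that(1)] that(2) _ that(3)])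
      show "f' \<in> mor Y (T X)" using f' by blast
      fix \<theta> assume "\<theta> \<in> extn X Y"
      then show "\<gamma> X (pushforward X f' \<theta>) = \<gamma> X (pushforward X f \<theta>)" using f' that(4) by metis
    qed
  qed (use that in blast)
  have \<phi>ex: "\<phi> X Y \<psi> \<in> mor Y (T X) \<and> (\<forall>\<theta>\<in>extn X Y. \<psi> \<theta> = \<gamma> X (pushforward X (\<phi> X Y \<psi>) \<theta>))"
    if o: "X \<in> Ob \<C>" "Y \<in> Ob \<C>" and p: "\<psi> \<in> carrier (dual (Ext \<E> X Y))" for X Y \<psi>
  proof -
    obtain f where f: "f \<in> mor Y (T X)" "\<psi> = (\<lambda>\<theta>\<in>extn X Y. \<gamma> X (pushforward X f \<theta>))"
      using serre_pair_push_surj[OF pair[OF o(1)] o(2) p] by blast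
    have v: "\<psi> \<theta> = \<gamma> X (pushforward X f \<theta>)" if "\<theta> \<in> extn X Y" for \<theta>
      using fun_cong[OF f(2), of \<theta>] that by simp
    then show ?thesis using \<phi>eq[OF o f(1)] f(1) by simp
  qed
  have \<phi>iso: "linear_iso k (dual (Ext \<E> X Y)) (Hom \<C> Y (T X)) (\<phi> X Y)" if X: "X \<in> Ob \<C>" and Y: "Y \<in> Ob \<C>" for X Y
  proof -
    note TX = TO[OF X]
    interpret H: module k "Hom \<C> Y (T X)" by (rule hom_module[OF Y TX])
    have l: "linear_map k (Hom \<C> Y (T X)) J (\<lambda>t. \<gamma> X (pushforward X t \<theta>))"
      if "\<theta> \<in> extn X Y" for \<theta>
      by (rule linear_map_comp[OF Emap_linear(3)[OF X X Y TX id[OF X] that] \<gamma>l[OF X]])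
    have lin: "linear_map k (dual (Ext \<E> X Y)) (Hom \<C> Y (T X)) (\<phi> X Y)"
      unfolding linear_map_def
    proof (intro conjI ballI)
      show "\<phi> X Y \<in> carrier (dual (Ext \<E> X Y)) \<rightarrow> mor Y (T X)" using \<phi>ex[OF X Y] by blast
      fix \<psi> \<psi>' assume p: "\<psi> \<in> carrier (dual (Ext \<E> X Y))" "\<psi>' \<in> carrier (dual (Ext \<E> X Y))"
      show "\<phi> X Y (\<psi> \<oplus>\<^bsub>dual (Ext \<E> X Y)\<^esub> \<psi>') = \<phi> X Y \<psi> \<oplus>\<^bsub>Hom \<C> Y (T X)\<^esub> \<phi> X Y \<psi>'"
        using \<phi>ex[OF X Y p(1)] \<phi>ex[OF X Y p(2)] linear_mapD(2)[OF l]
        by (intro \<phi>eq[OF X Y]) (auto simp: dual_simps(3))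
    next
      fix r \<psi> assume p: "r \<in> carrier k" "\<psi> \<in> carrier (dual (Ext \<E> X Y))"
      show "\<phi> X Y (r \<odot>\<^bsub>dual (Ext \<E> X Y)\<^esub> \<psi>) = r \<odot>\<^bsub>Hom \<C> Y (T X)\<^esub> \<phi> X Y \<psi>"
        using \<phi>ex[OF X Y p(2)] p(1) linear_mapD(3)[OF l]
        by (intro \<phi>eq[OF X Y]) (auto simp: dual_simps(4))
    qed
    have "bij_betw (\<phi> X Y) (carrier (dual (Ext \<E> X Y))) (mor Y (T X))"
    proof (rule bij_betw_imageI)
      show "inj_on (\<phi> X Y) (carrier (dual (Ext \<E> X Y)))"
      proof (rule inj_onI)
        fix \<psi> \<psi>' assume p: "\<psi> \<in> carrier (dual (Ext \<E> X Y))" "\<psi>' \<in> carrier (dual (Ext \<E> X Y))" "\<phi> X Y \<psi> = \<phi> X Y \<psi>'"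
        show "\<psi> = \<psi>'"
          by (rule dual_eqI[OF p(1,2)]) (use \<phi>ex[OF X Y p(1)] \<phi>ex[OF X Y p(2)] p(3) in simp)
      qed
      show "\<phi> X Y ` carrier (dual (Ext \<E> X Y)) = mor Y (T X)"
      proof (intro equalityI subsetI)
        fix f assume f: "f \<in> mor Y (T X)"
        define \<psi> where "\<psi> = (\<lambda>\<theta>\<in>extn X Y. \<gamma> X (pushforward X f \<theta>))"
        have "\<psi> \<in> carrier (dual (Ext \<E> X Y))"
          unfolding \<psi>_def
          by (rule dual_restrict[OF ext_module[OF X Y] linear_map_comp[OF Emap_linear(2)[OF X X Y TX id[OF X] f] \<gamma>l[OF X]]])
        moreover have "\<phi> X Y \<psi> = f" by (rule \<phi>eq[OF X Y f]) (simp add: \<psi>_def)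
        ultimately show "f \<in> \<phi> X Y ` carrier (dual (Ext \<E> X Y))" by blast
      qed (use \<phi>ex[OF X Y] in blast)
    qed
    then show ?thesis using lin by (simp add: linear_iso_def)
  qed
  have nat: "\<phi> X' Y' (\<lambda>\<delta>\<in>extn X' Y'. \<psi> (Emap \<E> x y \<delta>)) = \<tau>m x \<cdot> \<phi> X Y \<psi> \<cdot> y"
    if X: "X \<in> Ob \<C>" and X': "X' \<in> Ob \<C>" and Y: "Y \<in> Ob \<C>" and Y': "Y' \<in> Ob \<C>"
      and x: "x \<in> mor X X'" and y: "y \<in> mor Y' Y" and p: "\<psi> \<in> carrier (dual (Ext \<E> X Y))" for X X' Y Y' x y \<psi>
  proof -
    note TX = TO[OF X] and TX' = TO[OF X'] and tx = \<tau>mor[OF X X' x]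
    define f where "f = \<phi> X Y \<psi>"
    have f: "f \<in> mor Y (T X)" and fv: "\<And>\<theta>. \<theta> \<in> extn X Y \<Longrightarrow> \<psi> \<theta> = \<gamma> X (pushforward X f \<theta>)"
      using \<phi>ex[OF X Y p] by (auto simp: f_def)
    have fy: "f \<cdot> y \<in> mor Y' (T X)" by (rule comp_closed[OF Y' Y TX y f])
    have as: "\<tau>m x \<cdot> f \<cdot> y = \<tau>m x \<cdot> (f \<cdot> y)" using comp_assoc[OF Y' Y TX TX' y f tx] by simp
    have "\<phi> X' Y' (\<lambda>\<delta>\<in>extn X' Y'. \<psi> (Emap \<E> x y \<delta>)) = \<tau>m x \<cdot> (f \<cdot> y)"
    proof (rule \<phi>eq[OF X' Y' comp_closed[OF Y' TX TX' fy tx]])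
      fix \<delta> assume d: "\<delta> \<in> extn X' Y'"
      have c1: "pushforward X' (f \<cdot> y) \<delta> \<in> extn X' (T X)"
        by (rule Emap_closed[OF X' X' Y' TX id[OF X'] fy d])
      have c2: "Emap \<E> x y \<delta> \<in> extn X Y" by (rule Emap_closed[OF X' X Y' Y x y d])
      have "\<gamma> X' (Emap \<E> (ident \<C> X') (\<tau>m x \<cdot> (f \<cdot> y)) \<delta>) =
          \<gamma> X' (pushforward X' (\<tau>m x) (pushforward X' (f \<cdot> y) \<delta>))"
        using Emap_push_push[OF X' Y' TX TX' fy tx d] by simp
      also have "\<dots> = \<gamma> X (pullback x (T X) (pushforward X' (f \<cdot> y) \<delta>))"
        by (rule \<tau>val[OF X X' x c1])
      also have "\<dots> = \<gamma> X (Emap \<E> x (f \<cdot> y) \<delta>)"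
        using Emap_push_pull(2)[OF X' X Y' TX fy x d] by simp
      also have "\<dots> = \<gamma> X (pushforward X f (Emap \<E> x y \<delta>))"
        using Emap_comp[OF X' X X Y' Y TX x id[OF X] y f d] ident_right[OF X X' x] by simp
      also have "\<dots> = \<psi> (Emap \<E> x y \<delta>)" using fv[OF c2] by simp
      finally show "(\<lambda>\<delta>\<in>extn X' Y'. \<psi> (Emap \<E> x y \<delta>)) \<delta> =
          \<gamma> X' (Emap \<E> (ident \<C> X') (\<tau>m x \<cdot> (f \<cdot> y)) \<delta>)" using d by simp
    qed
    then show ?thesis using as by (simp add: f_def)
  qed
  show ?thesis
    unfolding has_serre_duality_def
    using ae \<tau>lin \<phi>iso nat by (intro exI[of _ T] exI[of _ \<tau>m] exI[of _ \<phi>] conjI ballI) auto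
qed

end

section \<open>Krull-Schmidt categories\<close>

context preadditive_category
begin

lemma direct_sum_decomposition:
  assumes "direct_sum m A X i p"
  shows "decomposition m A X i p"
proof -
  have X: "X \<in> Ob \<C>" and j: "\<forall>j<m. A j \<in> Ob \<C> \<and> i j \<in> mor (A j) X \<and> p j \<in> mor X (A j)"
    and e: "\<forall>j<m. \<forall>l<m. p j \<cdot> i l = (if j = l then ident \<C> (A j) else \<zero>\<^bsub>Hom \<C> (A l) (A j)\<^esub>)"
    and s: "(\<Oplus>\<^bsub>Hom \<C> X X\<^esub>j\<in>{..<m}. i j \<cdot> p j) = ident \<C> X"
    using assms unfolding direct_sum_def by blast+
  interpret XX: abelian_group "Hom \<C> X X" by (rule hom_group[OF X X])
  have ip: "i l \<cdot> p l \<in> mor X X" if "l < m" for l using comp_closed[OF X _ X] j that by blast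
  have "ident \<C> X \<in> K" if K: "K \<subseteq> mor X X" "\<zero>\<^bsub>Hom \<C> X X\<^esub> \<in> K"
    "\<forall>x\<in>K. \<forall>y\<in>K. x \<oplus>\<^bsub>Hom \<C> X X\<^esub> y \<in> K" "\<forall>j<m. i j \<cdot> p j \<in> K" for K
  proof -
    have "(\<Oplus>\<^bsub>Hom \<C> X X\<^esub>j\<in>{..<l}. i j \<cdot> p j) \<in> K" if "l \<le> m" for l
      using that
    proof (induct l)
      case (Suc l)
      have "(\<Oplus>\<^bsub>Hom \<C> X X\<^esub>j\<in>{..<Suc l}. i j \<cdot> p j) =
          i l \<cdot> p l \<oplus>\<^bsub>Hom \<C> X X\<^esub> (\<Oplus>\<^bsub>Hom \<C> X X\<^esub>j\<in>{..<l}. i j \<cdot> p j)"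
        unfolding lessThan_Suc using ip Suc by (intro XX.finsum_insert) auto
      then show ?case using K Suc by auto
    qed (use K in simp)
    from this[of m] show ?thesis using s by simp
  qed
  then show ?thesis unfolding decomposition_def using X j e by blast
qed

lemma local_ring_local_object:
  assumes A: "A \<in> Ob \<C>" and l: "local_ring (End_ring A)"
  shows "local_object A"
proof -
  have U: "f \<in> Units (End_ring A) \<longleftrightarrow> iso_mor A A f" if "f \<in> mor A A" for f
    using that by (auto simp: Units_def End_ring_def iso_mor_def)
  show ?thesis
    using A l add_mor[OF A A] unfolding local_object_def local_ring_def
    by (auto simp: U) (auto simp: End_ring_def U[unfolded End_ring_def])
qed

lemma krull_schmidt_decomposition:
  assumes "krull_schmidt" "X \<in> Ob \<C>"
  shows "\<exists>m A i p. decomposition m A X i p \<and> (\<forall>j<m. local_object (A j))"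
proof -
  obtain m A i p where d: "direct_sum m A X i p" "\<forall>j<m. local_ring (End_ring (A j))"
    using assms unfolding krull_schmidt_def by blast
  then have "\<forall>j<m. A j \<in> Ob \<C>" by (simp add: direct_sum_def)
  then show ?thesis using direct_sum_decomposition[OF d(1)] local_ring_local_object d(2) by blast
qed

lemma homotopy_equivalent_refl:
  assumes X: "complex_between n A C X"
  shows "homotopy_equivalent n A C X X"
proof -
  have O: "obj X i \<in> Ob \<C>" if "i \<le> n + 1" for i using X that by (simp add: complex_between_def complex_def)
  have d: "diff X i \<in> mor (obj X i) (obj X (i + 1))" if "i \<le> n" for i
    using X that by (simp add: complex_between_def complex_def)
  have c: "ident \<C> (obj X i) \<cdot> ident \<C> (obj X i) = ident \<C> (obj X i)" if "i \<le> n + 1" for i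
    using ident_left[OF O O ident_closed[OF O]] that by simp
  have f: "fixed_ends_map n A C X X (\<lambda>i. ident \<C> (obj X i))"
    using X O d ident_closed ident_left[OF O O d] ident_right[OF O O d]
    unfolding fixed_ends_map_def chain_map_def complex_between_def by simp
  have z: "ident \<C> (obj X i) \<ominus>\<^bsub>Hom \<C> (obj X i) (obj X i)\<^esub> ident \<C> (obj X i) = \<zero>\<^bsub>Hom \<C> (obj X i) (obj X i)\<^esub>"
    if "i \<le> n + 1" for i
    using abelian_group.r_neg[OF hom_group[OF O[OF that] O[OF that]] ident_closed[OF O[OF that]]]
    by (simp add: a_minus_def)
  have h: "homotopic n X X (\<lambda>i. ident \<C> (obj X i) \<cdot> ident \<C> (obj X i)) (\<lambda>i. ident \<C> (obj X i))"
    unfolding homotopic_def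
  proof (intro exI[of _ "\<lambda>i. \<zero>\<^bsub>Hom \<C> (obj X i) (obj X (i - 1))\<^esub>"] conjI ballI)
    fix i assume "i \<in> {1..n + 1}"
    then show "\<zero>\<^bsub>Hom \<C> (obj X i) (obj X (i - 1))\<^esub> \<in> mor (obj X i) (obj X (i - 1))"
      using O by (intro zero_mor) auto
  next
    show "ident \<C> (obj X 0) \<cdot> ident \<C> (obj X 0) \<ominus>\<^bsub>Hom \<C> (obj X 0) (obj X 0)\<^esub> ident \<C> (obj X 0) =
      \<zero>\<^bsub>Hom \<C> (obj X 1) (obj X (1 - 1))\<^esub> \<cdot> diff X 0"
      using c[of 0] z[of 0] comp_zero_left[OF O O O d, of 0 0] by simp
  next
    fix i assume i: "i \<in> {1..n}"
    have "\<zero>\<^bsub>Hom \<C> (obj X (i + 1)) (obj X i)\<^esub> \<cdot> diff X i = \<zero>\<^bsub>Hom \<C> (obj X i) (obj X i)\<^esub>"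
      using comp_zero_left[OF O O O d, of i i] i by simp
    moreover have "diff X (i - 1) \<cdot> \<zero>\<^bsub>Hom \<C> (obj X i) (obj X (i - 1))\<^esub> = \<zero>\<^bsub>Hom \<C> (obj X i) (obj X i)\<^esub>"
      using i d[of "i - 1"] by (intro comp_zero_right O) auto
    moreover have "\<zero>\<^bsub>Hom \<C> (obj X i) (obj X i)\<^esub> \<oplus>\<^bsub>Hom \<C> (obj X i) (obj X i)\<^esub> \<zero>\<^bsub>Hom \<C> (obj X i) (obj X i)\<^esub>
        = \<zero>\<^bsub>Hom \<C> (obj X i) (obj X i)\<^esub>"
      using abelian_monoid.l_zero[OF abelian_group.axioms(1)[OF hom_group[OF O O]] zero_mor[OF O O]] i by simp
    ultimately show "ident \<C> (obj X i) \<cdot> ident \<C> (obj X i) \<ominus>\<^bsub>Hom \<C> (obj X i) (obj X i)\<^esub> ident \<C> (obj X i) =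
      diff X (i - 1) \<cdot> \<zero>\<^bsub>Hom \<C> (obj X i) (obj X (i - 1))\<^esub> \<oplus>\<^bsub>Hom \<C> (obj X i) (obj X i)\<^esub>
      \<zero>\<^bsub>Hom \<C> (obj X (i + 1)) (obj X (i + 1 - 1))\<^esub> \<cdot> diff X i"
      using c[of i] z[of i] i by simp
  next
    show "ident \<C> (obj X (n + 1)) \<cdot> ident \<C> (obj X (n + 1)) \<ominus>\<^bsub>Hom \<C> (obj X (n + 1)) (obj X (n + 1))\<^esub>
      ident \<C> (obj X (n + 1)) = diff X n \<cdot> \<zero>\<^bsub>Hom \<C> (obj X (n + 1)) (obj X (n + 1 - 1))\<^esub>"
      using c[of "n + 1"] z[of "n + 1"] comp_zero_right[OF O O O d[of n], of "n + 1"] by simp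
  qed
  show ?thesis unfolding homotopy_equivalent_def using f h by blast
qed

end

section \<open>n-exangulated categories\<close>

lemma (in exact_realization) distinguished_exists:
  assumes "C \<in> Ob \<C>" "A \<in> Ob \<C>" "\<delta> \<in> carrier (Ext \<E> C A)"
  shows "\<exists>X. distinguished X \<delta> \<and> obj X 0 = A \<and> obj X (n + 1) = C \<and> X \<in> \<ss> C A \<delta>"
proof -
  obtain X where X: "complex_between n A C X" "\<ss> C A \<delta> = homotopy_class n A C X"
    using realization_class[OF assms] by blast
  then have "X \<in> \<ss> C A \<delta>" using homotopy_equivalent_refl by (simp add: homotopy_class_def)
  then show ?thesis using X assms by (auto simp: distinguished_def complex_between_def)
qed

locale linear_n_exangulated = n_exangulated \<C> \<E> \<ss> n + serre_setting k J \<C> \<E>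
  for k :: "'k ring" and J :: "('k, 'j) module"
    and \<C> :: "('o, 'm, 'k) module_cat" (structure)
    and \<E> :: "('o, 'm, 'e, 'k) module_bifunctor"
    and \<ss> :: "'o \<Rightarrow> 'o \<Rightarrow> 'e \<Rightarrow> ('o, 'm) cpx set" and n :: nat +
  assumes n_pos: "n \<ge> 1"
begin

lemma distinguishedD:
  assumes "distinguished Z \<delta>"
  shows "obj Z 0 \<in> Ob \<C>" "obj Z 1 \<in> Ob \<C>" "obj Z n \<in> Ob \<C>" "obj Z (n + 1) \<in> Ob \<C>"
    and "\<delta> \<in> extn (obj Z (n + 1)) (obj Z 0)"
    and "diff Z 0 \<in> mor (obj Z 0) (obj Z 1)" "diff Z n \<in> mor (obj Z n) (obj Z (n + 1))"
    and "\<And>L g. \<lbrakk>L \<in> Ob \<C>; g \<in> mor L (obj Z (n + 1))\<rbrakk> \<Longrightarrow>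
      pullback g (obj Z 0) \<delta> = zero_ext L (obj Z 0) \<longleftrightarrow> (\<exists>t\<in>mor L (obj Z n). g = diff Z n \<cdot> t)"
    and "\<And>L f. \<lbrakk>L \<in> Ob \<C>; f \<in> mor (obj Z 0) L\<rbrakk> \<Longrightarrow>
      pushforward (obj Z (n + 1)) f \<delta> = (zero_ext (obj Z (n + 1)) L) \<longleftrightarrow> (\<exists>t\<in>mor (obj Z 1) L. f = t \<cdot> diff Z 0)"
proof -
  have o: "obj Z 0 \<in> Ob \<C>" "obj Z (n + 1) \<in> Ob \<C>" and d: "\<delta> \<in> extn (obj Z (n + 1)) (obj Z 0)"
    and s: "Z \<in> \<ss> (obj Z (n + 1)) (obj Z 0) \<delta>"
    using assms by (auto simp: distinguished_def)
  have e: "exangle n Z \<delta>" by (rule R1[OF o(2,1) d s])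
  then have c: "complex n Z" by (simp add: exangle_def)
  show "obj Z 0 \<in> Ob \<C>" "obj Z (n + 1) \<in> Ob \<C>" "\<delta> \<in> extn (obj Z (n + 1)) (obj Z 0)"
    by (rule o d)+
  show "obj Z 1 \<in> Ob \<C>" "obj Z n \<in> Ob \<C>" "diff Z 0 \<in> mor (obj Z 0) (obj Z 1)"
    "diff Z n \<in> mor (obj Z n) (obj Z (n + 1))"
    using c unfolding complex_def by (auto dest: spec[of _ 0])
  show "pullback g (obj Z 0) \<delta> = zero_ext L (obj Z 0) \<longleftrightarrow> (\<exists>t\<in>mor L (obj Z n). g = diff Z n \<cdot> t)"
    if "L \<in> Ob \<C>" "g \<in> mor L (obj Z (n + 1))" for L g
  proof -
    have "{f \<in> mor L (obj Z (n+1)). pull f (obj Z 0) \<delta> = zero_ext L (obj Z 0)}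
         = (\<lambda>g. diff Z n \<cdot> g) ` mor L (obj Z n)"
      using e[unfolded exangle_def, THEN conjunct2, THEN conjunct2, THEN conjunct2, THEN conjunct2,
          THEN conjunct1, THEN bspec, OF that(1), THEN conjunct2] .
    then show ?thesis using that(2) unfolding pull_def by blast
  qed
  show "pushforward (obj Z (n + 1)) f \<delta> = (zero_ext (obj Z (n + 1)) L) \<longleftrightarrow> (\<exists>t\<in>mor (obj Z 1) L. f = t \<cdot> diff Z 0)"
    if "L \<in> Ob \<C>" "f \<in> mor (obj Z 0) L" for L f
  proof -
    have "{f \<in> mor (obj Z 0) L. push (obj Z (n+1)) f \<delta> = \<zero>\<^bsub>Ext \<E> (obj Z (n+1)) L\<^esub>}
         = (\<lambda>g. g \<cdot> diff Z 0) ` mor (obj Z 1) L"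
      using e[unfolded exangle_def, THEN conjunct2, THEN conjunct2, THEN conjunct2, THEN conjunct2,
          THEN conjunct2, THEN bspec, OF that(1), THEN conjunct2] .
    then show ?thesis using that(2) unfolding push_def by blast
  qed
qed

text \<open>Let \<open>z : A \<rightarrow> B\<close> be the inflation of a complex that realizes \<open>\<delta>\<close>. It annihilates \<open>\<delta>\<close>, hence \<open>\<theta>\<close> and
  \<open>\<omega> = (\<delta>, \<theta>) \<in> \<E>(Y \<oplus> X, A)\<close>. Let \<open>W\<close> realize \<open>\<omega>\<close>. The mapping cone of \<open>EA2\<close> for the injection
  \<open>Y \<rightarrow> Y \<oplus> X\<close>, which pulls \<open>\<omega>\<close> back to \<open>\<delta>\<close>, carries the extension \<open>z\<^sub>* \<omega> = 0\<close>, so its deflation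
  \<open>Y \<oplus> W\<^sub>n \<rightarrow> Y \<oplus> X\<close> has a section. Restricted to \<open>X\<close>, the section writes the injection \<open>X \<rightarrow> Y \<oplus> X\<close> as a
  morphism that factors through \<open>Y\<close> by some \<open>g\<close>, plus a morphism that factors through the deflation of
  \<open>W\<close> and annihilates \<open>\<omega>\<close>. Pulling \<open>\<omega>\<close> back gives \<open>\<theta> = g\<^sup>* \<delta>\<close>.\<close>

lemma pull_exactness:
  assumes A: "A \<in> Ob \<C>" and Y: "Y \<in> Ob \<C>" and X: "X \<in> Ob \<C>"
    and \<delta>: "\<delta> \<in> extn Y A" and \<theta>: "\<theta> \<in> extn X A"
    and van: "\<forall>L\<in>Ob \<C>. \<forall>f\<in>mor A L. pushforward Y f \<delta> = zero_ext Y L \<longrightarrow>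
      pushforward X f \<theta> = zero_ext X L"
  shows "\<exists>g\<in>mor X Y. \<theta> = pullback g A \<delta>"
proof -
  note id = ident_closed
  obtain Z where Z: "distinguished Z \<delta>" "obj Z 0 = A" "obj Z (n + 1) = Y" "Z \<in> \<ss> Y A \<delta>"
    using distinguished_exists[OF Y A \<delta>] by blast
  obtain B where Z1: "obj Z 1 = B" by blast
  note Zd = distinguishedD[OF Z(1), unfolded Z(2,3) Z1]
  let ?z = "diff Z 0"
  note B = Zd(2) and z = Zd(6)
  have z\<delta>: "pushforward Y ?z \<delta> = zero_ext Y B"
    using Zd(9)[OF B z] ident_left[OF A B z] id[OF B] by metis
  then have z\<theta>: "pushforward X ?z \<theta> = zero_ext X B" using van B z by blast
  obtain S i1 i2 p1 p2 where b: "biproduct Y X S i1 i2 p1 p2" using biproduct_exists[OF Y X] by auto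
  have S: "S \<in> Ob \<C>" and i: "i1 \<in> mor Y S" "i2 \<in> mor X S" and p: "p1 \<in> mor S Y" "p2 \<in> mor S X"
    and e: "p1 \<cdot> i1 = ident \<C> Y" "p2 \<cdot> i2 = ident \<C> X" "p1 \<cdot> i2 = zero_hom X Y" "p2 \<cdot> i1 = zero_hom Y X"
    using b by (auto simp: biproduct_def)
  interpret SA: module k "Ext \<E> S A" by (rule ext_module[OF S A])
  interpret SB: module k "Ext \<E> S B" by (rule ext_module[OF S B])
  interpret YA: module k "Ext \<E> Y A" by (rule ext_module[OF Y A])
  interpret XA: module k "Ext \<E> X A" by (rule ext_module[OF X A])
  define \<omega>1 where "\<omega>1 = pullback p1 A \<delta>"
  define \<omega>2 where "\<omega>2 = pullback p2 A \<theta>"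
  define \<omega> where "\<omega> = \<omega>1 \<oplus>\<^bsub>Ext \<E> S A\<^esub> \<omega>2"
  have w: "\<omega>1 \<in> extn S A" "\<omega>2 \<in> extn S A"
    unfolding \<omega>1_def \<omega>2_def
    by (rule Emap_closed[OF Y S A A p(1) id[OF A] \<delta>], rule Emap_closed[OF X S A A p(2) id[OF A] \<theta>])
  then have wc: "\<omega> \<in> extn S A" by (simp add: \<omega>_def)
  have i1w: "pullback i1 A \<omega> = \<delta>"
    using Emap_add[OF S Y A A i(1) id[OF A] w] Emap_pull_pull[OF A Y S Y p(1) i(1) \<delta>]
      Emap_pull_pull[OF A X S Y p(2) i(1) \<theta>] e Emap_ident[OF Y A \<delta>] Emap_zero(1)[OF Y X A A \<theta> id[OF A]] \<delta>
    by (simp add: \<omega>_def \<omega>1_def \<omega>2_def)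
  have i2w: "pullback i2 A \<omega> = \<theta>"
    using Emap_add[OF S X A A i(2) id[OF A] w] Emap_pull_pull[OF A Y S X p(1) i(2) \<delta>]
      Emap_pull_pull[OF A X S X p(2) i(2) \<theta>] e Emap_ident[OF X A \<theta>] Emap_zero(1)[OF X Y A A \<delta> id[OF A]] \<theta>
    by (simp add: \<omega>_def \<omega>1_def \<omega>2_def)
  have zw: "pushforward S ?z \<omega> = zero_ext S B"
  proof -
    have "pushforward S ?z \<omega>1 = pullback p1 B (pushforward Y ?z \<delta>)"
      using Emap_push_pull[OF Y S A B z p(1) \<delta>] by (simp add: \<omega>1_def)
    moreover have "pushforward S ?z \<omega>2 = pullback p2 B (pushforward X ?z \<theta>)"
      using Emap_push_pull[OF X S A B z p(2) \<theta>] by (simp add: \<omega>2_def)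
    ultimately show ?thesis
      using Emap_add[OF S S A B id[OF S] z w] z\<delta> z\<theta> Emap_zero(2)[OF S Y B B p(1) id[OF B]]
        Emap_zero(2)[OF S X B B p(2) id[OF B]] by (simp add: \<omega>_def)
  qed
  obtain W where W: "distinguished W \<omega>" "obj W 0 = A" "obj W (n + 1) = S" "W \<in> \<ss> S A \<omega>"
    using distinguished_exists[OF S A wc] by blast
  note Wd = distinguishedD[OF W(1), unfolded W(2,3)]
  have "Z \<in> \<ss> Y A (pull i1 A \<omega>)" using Z(4) i1w by (simp add: pull_def)
  then obtain f M where f: "f (n + 1) = i1" and M: "mapping_cone n Z W f M" "distinguished M (push S ?z \<omega>)"
    using EA2[OF A Y S wc i(1) _ W(4)] by blast
  have M0: "obj M 0 = B" "obj M (n + 1) = S" using M(1) W(3) Z1 by (auto simp: mapping_cone_def)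
  have dM: "distinguished M (zero_ext S B)" using M(2) zw by (simp add: push_def)
  note Md = distinguishedD[OF dM, unfolded M0]
  obtain q1 q2 where q: "q1 \<in> mor (obj M n) Y" "q2 \<in> mor (obj M n) (obj W n)"
    and dn: "diff M n = i1 \<cdot> q1 \<oplus>\<^bsub>Hom \<C> (obj M n) S\<^esub> diff W n \<cdot> q2"
  proof -
    have "n \<in> {1..n}" using n_pos by simp
    then show ?thesis
      using that M(1) Z(3) M0(2) f unfolding mapping_cone_def biproduct_def by metis
  qed
  obtain s where s: "s \<in> mor S (obj M n)" "ident \<C> S = diff M n \<cdot> s"
    using Md(8)[OF S id[OF S]] Emap_zero(2)[OF S S B B id[OF S] id[OF B]] by blast
  have si: "s \<cdot> i2 \<in> mor X (obj M n)" by (rule comp_closed[OF X S Md(3) i(2) s(1)])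
  define g where "g = q1 \<cdot> (s \<cdot> i2)"
  define h where "h = q2 \<cdot> (s \<cdot> i2)"
  have g: "g \<in> mor X Y" and h: "h \<in> mor X (obj W n)" unfolding g_def h_def
    by (rule comp_closed[OF X Md(3) Y si q(1)], rule comp_closed[OF X Md(3) Wd(3) si q(2)])
  have "i2 = diff M n \<cdot> s \<cdot> i2" using s(2) ident_left[OF X S i(2)] by simp
  also have "\<dots> = diff M n \<cdot> (s \<cdot> i2)" using comp_assoc[OF X S Md(3) S i(2) s(1) Md(7)] by simp
  also have "\<dots> = (i1 \<cdot> q1) \<cdot> (s \<cdot> i2) \<oplus>\<^bsub>Hom \<C> X S\<^esub> (diff W n \<cdot> q2) \<cdot> (s \<cdot> i2)"
    unfolding dn by (rule comp_add_left[OF X Md(3) S si comp_closed[OF Md(3) Y S q(1) i(1)]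
        comp_closed[OF Md(3) Wd(3) S q(2) Wd(7)]])
  also have "\<dots> = i1 \<cdot> g \<oplus>\<^bsub>Hom \<C> X S\<^esub> diff W n \<cdot> h"
    unfolding g_def h_def
    using comp_assoc[OF X Md(3) Y S si q(1) i(1)] comp_assoc[OF X Md(3) Wd(3) S si q(2) Wd(7)] by simp
  finally have i2: "i2 = i1 \<cdot> g \<oplus>\<^bsub>Hom \<C> X S\<^esub> diff W n \<cdot> h" .
  have "pullback (diff W n \<cdot> h) A \<omega> = zero_ext X A"
    using Wd(8)[OF X comp_closed[OF X Wd(3) S h Wd(7)]] h by blast
  moreover have "pullback (i1 \<cdot> g) A \<omega> = pullback g A \<delta>"
    using Emap_pull_pull[OF A S Y X i(1) g wc] i1w by simp
  moreover have "pullback i2 A \<omega> =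
      pullback (i1 \<cdot> g) A \<omega> \<oplus>\<^bsub>Ext \<E> X A\<^esub> pullback (diff W n \<cdot> h) A \<omega>"
    unfolding i2 by (rule Emap_add_first[OF S X A A comp_closed[OF X Y S g i(1)]
        comp_closed[OF X Wd(3) S h Wd(7)] id[OF A] wc])
  ultimately have "\<theta> = pullback g A \<delta>"
    using i2w Emap_closed[OF Y X A A g id[OF A] \<delta>] by simp
  then show ?thesis using g by blast
qed

text \<open>The dual argument: \<open>\<omega> = (\<delta>, \<theta>) \<in> \<E>(Y, A \<oplus> B)\<close> is annihilated by the deflation of a realization of \<open>\<delta>\<close>,
  and the mapping cocone for the projection \<open>A \<oplus> B \<rightarrow> A\<close> has a split inflation.\<close>

lemma push_exactness:
  assumes Y: "Y \<in> Ob \<C>" and A: "A \<in> Ob \<C>" and B: "B \<in> Ob \<C>"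
    and \<delta>: "\<delta> \<in> extn Y A" and \<theta>: "\<theta> \<in> extn Y B"
    and van: "\<forall>L\<in>Ob \<C>. \<forall>g\<in>mor L Y. pullback g A \<delta> = zero_ext L A \<longrightarrow>
      pullback g B \<theta> = zero_ext L B"
  shows "\<exists>f\<in>mor A B. \<theta> = pushforward Y f \<delta>"
proof -
  note id = ident_closed
  obtain Z where Z: "distinguished Z \<delta>" "obj Z 0 = A" "obj Z (n + 1) = Y" "Z \<in> \<ss> Y A \<delta>"
    using distinguished_exists[OF Y A \<delta>] by blast
  note Zd = distinguishedD[OF Z(1), unfolded Z(2,3)]
  let ?z = "diff Z n" and ?X = "obj Z n"
  note X = Zd(3) and z = Zd(7)
  have z\<delta>: "pullback ?z A \<delta> = zero_ext ?X A"
    using Zd(8)[OF X z] ident_right[OF X Y z] id[OF X] by metis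
  then have z\<theta>: "pullback ?z B \<theta> = zero_ext ?X B" using van X z by blast
  obtain S i1 i2 p1 p2 where b: "biproduct A B S i1 i2 p1 p2" using biproduct_exists[OF A B] by auto
  have S: "S \<in> Ob \<C>" and i: "i1 \<in> mor A S" "i2 \<in> mor B S" and p: "p1 \<in> mor S A" "p2 \<in> mor S B"
    and e: "p1 \<cdot> i1 = ident \<C> A" "p2 \<cdot> i2 = ident \<C> B" "p1 \<cdot> i2 = zero_hom B A" "p2 \<cdot> i1 = zero_hom A B"
    using b by (auto simp: biproduct_def)
  interpret YS: module k "Ext \<E> Y S" by (rule ext_module[OF Y S])
  interpret XS: module k "Ext \<E> ?X S" by (rule ext_module[OF X S])
  interpret YA: module k "Ext \<E> Y A" by (rule ext_module[OF Y A])
  interpret YB: module k "Ext \<E> Y B" by (rule ext_module[OF Y B])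
  define \<omega>1 where "\<omega>1 = pushforward Y i1 \<delta>"
  define \<omega>2 where "\<omega>2 = pushforward Y i2 \<theta>"
  define \<omega> where "\<omega> = \<omega>1 \<oplus>\<^bsub>Ext \<E> Y S\<^esub> \<omega>2"
  have w: "\<omega>1 \<in> extn Y S" "\<omega>2 \<in> extn Y S"
    unfolding \<omega>1_def \<omega>2_def
    by (rule Emap_closed[OF Y Y A S id[OF Y] i(1) \<delta>], rule Emap_closed[OF Y Y B S id[OF Y] i(2) \<theta>])
  then have wc: "\<omega> \<in> extn Y S" by (simp add: \<omega>_def)
  have p1w: "pushforward Y p1 \<omega> = \<delta>"
    using Emap_add[OF Y Y S A id[OF Y] p(1) w] Emap_push_push[OF Y A S A i(1) p(1) \<delta>]
      Emap_push_push[OF Y B S A i(2) p(1) \<theta>] e Emap_ident[OF Y A \<delta>] Emap_zero(3)[OF Y Y B A id[OF Y] \<theta>] \<delta>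
    by (simp add: \<omega>_def \<omega>1_def \<omega>2_def)
  have p2w: "pushforward Y p2 \<omega> = \<theta>"
    using Emap_add[OF Y Y S B id[OF Y] p(2) w] Emap_push_push[OF Y A S B i(1) p(2) \<delta>]
      Emap_push_push[OF Y B S B i(2) p(2) \<theta>] e Emap_ident[OF Y B \<theta>] Emap_zero(3)[OF Y Y A B id[OF Y] \<delta>] \<theta>
    by (simp add: \<omega>_def \<omega>1_def \<omega>2_def)
  have zw: "pullback ?z S \<omega> = zero_ext ?X S"
  proof -
    have "pullback ?z S \<omega>1 = pushforward ?X i1 (pullback ?z A \<delta>)"
      using Emap_push_pull[OF Y X A S i(1) z \<delta>] by (simp add: \<omega>1_def)
    moreover have "pullback ?z S \<omega>2 = pushforward ?X i2 (pullback ?z B \<theta>)"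
      using Emap_push_pull[OF Y X B S i(2) z \<theta>] by (simp add: \<omega>2_def)
    ultimately show ?thesis
      using Emap_add[OF Y X S S z id[OF S] w] z\<delta> z\<theta> Emap_zero(2)[OF X X A S id[OF X] i(1)]
        Emap_zero(2)[OF X X B S id[OF X] i(2)] by (simp add: \<omega>_def)
  qed
  obtain W where W: "distinguished W \<omega>" "obj W 0 = S" "obj W (n + 1) = Y" "W \<in> \<ss> Y S \<omega>"
    using distinguished_exists[OF Y S wc] by blast
  note Wd = distinguishedD[OF W(1), unfolded W(2,3)]
  have "Z \<in> \<ss> Y A (push Y p1 \<omega>)" using Z(4) p1w by (simp add: push_def)
  then obtain f N where f: "f 0 = p1" and N: "mapping_cocone n W Z f N" "distinguished N (pull ?z S \<omega>)"
    using EA2_op[OF S A Y wc p(1) W(4)] by blast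
  have N0: "obj N 0 = S" "obj N (n + 1) = ?X" using N(1) W(2) by (auto simp: mapping_cocone_def)
  have dN: "distinguished N (zero_ext ?X S)" using N(2) zw by (simp add: pull_def)
  note Nd = distinguishedD[OF dN, unfolded N0]
  obtain q1 q2 where q: "q1 \<in> mor A (obj N 1)" "q2 \<in> mor (obj W 1) (obj N 1)"
    and d0: "diff N 0 = q1 \<cdot> p1 \<oplus>\<^bsub>Hom \<C> S (obj N 1)\<^esub> q2 \<cdot> diff W 0"
  proof -
    have n1: "1 \<in> {1..n}" using n_pos by simp
    obtain j1 j2 r1 r2 where
      J: "\<forall>j\<in>{1..n}. biproduct (obj Z (j - 1)) (obj W j) (obj N j) (j1 j) (j2 j) (r1 j) (r2 j)"
      and D: "diff N 0 = j1 1 \<cdot> f 0 \<oplus>\<^bsub>Hom \<C> (obj N 0) (obj N 1)\<^esub> j2 1 \<cdot> diff W 0"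
      using N(1) unfolding mapping_cocone_def by blast
    have "biproduct A (obj W 1) (obj N 1) (j1 1) (j2 1) (r1 1) (r2 1)" using J n1 Z(2) by fastforce
    then show ?thesis using that[of "j1 1" "j2 1"] D f N0(1) by (simp add: biproduct_def)
  qed
  obtain s where s: "s \<in> mor (obj N 1) S" "ident \<C> S = s \<cdot> diff N 0"
    using Nd(9)[OF S id[OF S]] Emap_zero(2)[OF X X S S id[OF X] id[OF S]] by blast
  have ps: "p2 \<cdot> s \<in> mor (obj N 1) B" by (rule comp_closed[OF Nd(2) S B s(1) p(2)])
  define g where "g = p2 \<cdot> s \<cdot> q1"
  define h where "h = p2 \<cdot> s \<cdot> q2"
  have g: "g \<in> mor A B" and h: "h \<in> mor (obj W 1) B" unfolding g_def h_def
    by (rule comp_closed[OF A Nd(2) B q(1) ps], rule comp_closed[OF Wd(2) Nd(2) B q(2) ps])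
  have "p2 = p2 \<cdot> (s \<cdot> diff N 0)" using s(2) ident_right[OF S B p(2)] by simp
  also have "\<dots> = p2 \<cdot> s \<cdot> diff N 0" using comp_assoc[OF S Nd(2) S B Nd(6) s(1) p(2)] by simp
  also have "\<dots> = p2 \<cdot> s \<cdot> (q1 \<cdot> p1) \<oplus>\<^bsub>Hom \<C> S B\<^esub> p2 \<cdot> s \<cdot> (q2 \<cdot> diff W 0)"
    unfolding d0 by (rule comp_add_right[OF S Nd(2) B comp_closed[OF S A Nd(2) p(1) q(1)]
        comp_closed[OF S Wd(2) Nd(2) Wd(6) q(2)] ps])
  also have "\<dots> = g \<cdot> p1 \<oplus>\<^bsub>Hom \<C> S B\<^esub> h \<cdot> diff W 0"
    unfolding g_def h_def
    using comp_assoc[OF S A Nd(2) B p(1) q(1) ps] comp_assoc[OF S Wd(2) Nd(2) B Wd(6) q(2) ps] by simp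
  finally have p2: "p2 = g \<cdot> p1 \<oplus>\<^bsub>Hom \<C> S B\<^esub> h \<cdot> diff W 0" .
  have "pushforward Y (h \<cdot> diff W 0) \<omega> = zero_ext Y B"
    using Wd(9)[OF B comp_closed[OF S Wd(2) B Wd(6) h]] h by blast
  moreover have "pushforward Y (g \<cdot> p1) \<omega> = pushforward Y g \<delta>"
    using Emap_push_push[OF Y S A B p(1) g wc] p1w by simp
  moreover have "pushforward Y p2 \<omega> =
      pushforward Y (g \<cdot> p1) \<omega> \<oplus>\<^bsub>Ext \<E> Y B\<^esub> pushforward Y (h \<cdot> diff W 0) \<omega>"
    unfolding p2 by (rule Emap_add_second[OF Y Y S B id[OF Y] comp_closed[OF S A B p(1) g]
        comp_closed[OF S Wd(2) B Wd(6) h] wc])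
  ultimately have "\<theta> = pushforward Y g \<delta>"
    using p2w Emap_closed[OF Y Y A B id[OF Y] g \<delta>] by simp
  then show ?thesis using g by blast
qed

sublocale exact_serre_setting k J \<C> \<E>
  by unfold_locales (rule push_exactness pull_exactness; assumption)+

lemma deflation_right_determined:
  assumes Z: "distinguished Z \<delta>" and C: "C \<in> Ob \<C>"
  shows "right_determined C (obj Z n) (obj Z (n + 1)) (diff Z n) \<longleftrightarrow>
      right_determined_ext C (obj Z (n + 1)) (obj Z 0) \<delta>"
    and "(\<lambda>t. diff Z n \<cdot> t) ` mor C (obj Z n) =
      {h \<in> mor C (obj Z (n + 1)). pullback h (obj Z 0) \<delta> = zero_ext C (obj Z 0)}"
proof -
  note Zd = distinguishedD[OF Z]
  have "(\<exists>t\<in>mor L (obj Z n). g = diff Z n \<cdot> t) \<longleftrightarrow> pullback g (obj Z 0) \<delta> = zero_ext L (obj Z 0)"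
    "(\<forall>h\<in>mor C L. \<exists>t\<in>mor C (obj Z n). g \<cdot> h = diff Z n \<cdot> t) \<longleftrightarrow>
      (\<forall>h\<in>mor C L. pullback (g \<cdot> h) (obj Z 0) \<delta> = zero_ext C (obj Z 0))"
    if "L \<in> Ob \<C>" "g \<in> mor L (obj Z (n + 1))" for L g
    using Zd(8)[OF that] Zd(8)[OF C comp_closed[OF C that(1) Zd(4) _ that(2)]] by auto
  then show "right_determined C (obj Z n) (obj Z (n + 1)) (diff Z n) \<longleftrightarrow>
      right_determined_ext C (obj Z (n + 1)) (obj Z 0) \<delta>"
    unfolding right_determined_def right_determined_ext_def by simp
  show "(\<lambda>t. diff Z n \<cdot> t) ` mor C (obj Z n) =
      {h \<in> mor C (obj Z (n + 1)). pullback h (obj Z 0) \<delta> = zero_ext C (obj Z 0)}"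
    using Zd(8)[OF C] comp_closed[OF C Zd(3,4) _ Zd(7)] by blast
qed

lemma inflation_left_determined:
  assumes Z: "distinguished Z \<delta>" and C: "C \<in> Ob \<C>"
  shows "left_determined C (obj Z 0) (obj Z 1) (diff Z 0) \<longleftrightarrow>
      left_determined_ext C (obj Z 0) (obj Z (n + 1)) \<delta>"
    and "(\<lambda>t. t \<cdot> diff Z 0) ` mor (obj Z 1) C =
      {h \<in> mor (obj Z 0) C. pushforward (obj Z (n + 1)) h \<delta> = (zero_ext (obj Z (n + 1)) C)}"
proof -
  note Zd = distinguishedD[OF Z]
  have "(\<exists>t\<in>mor (obj Z 1) L. g = t \<cdot> diff Z 0) \<longleftrightarrow>
      pushforward (obj Z (n + 1)) g \<delta> = (zero_ext (obj Z (n + 1)) L)"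
    "(\<forall>h\<in>mor L C. \<exists>t\<in>mor (obj Z 1) C. h \<cdot> g = t \<cdot> diff Z 0) \<longleftrightarrow>
      (\<forall>h\<in>mor L C. pushforward (obj Z (n + 1)) (h \<cdot> g) \<delta> = (zero_ext (obj Z (n + 1)) C))"
    if "L \<in> Ob \<C>" "g \<in> mor (obj Z 0) L" for L g
    using Zd(9)[OF that] Zd(9)[OF C comp_closed[OF Zd(1) that(1) C that(2)]] by auto
  then show "left_determined C (obj Z 0) (obj Z 1) (diff Z 0) \<longleftrightarrow>
      left_determined_ext C (obj Z 0) (obj Z (n + 1)) \<delta>"
    unfolding left_determined_def left_determined_ext_def by simp
  show "(\<lambda>t. t \<cdot> diff Z 0) ` mor (obj Z 1) C =
      {h \<in> mor (obj Z 0) C. pushforward (obj Z (n + 1)) h \<delta> = (zero_ext (obj Z (n + 1)) C)}"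
    using Zd(9)[OF C] comp_closed[OF Zd(1,2) C Zd(6)] by blast
qed

lemma right_determined_deflations_iff: "has_right_determined_deflations \<longleftrightarrow> right_classified"
proof
  assume R: "has_right_determined_deflations"
  show "right_classified"
    unfolding right_classified_def
  proof (intro conjI ballI allI impI)
    fix Y A \<delta> assume o: "Y \<in> Ob \<C>" "A \<in> Ob \<C>" "\<delta> \<in> extn Y A"
    then obtain Z where Z: "distinguished Z \<delta>" "obj Z 0 = A" "obj Z (n + 1) = Y"
      using distinguished_exists by blast
    have "deflation (obj Z n) Y (diff Z n)" using Z unfolding deflation_def by blast
    then obtain C where "C \<in> Ob \<C>" "right_determined C (obj Z n) Y (diff Z n)"
      using R o(1) distinguishedD(3)[OF Z(1)]
      unfolding has_right_determined_deflations_def right_deflation_classified_def by blast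
    then show "\<exists>C\<in>Ob \<C>. right_determined_ext C Y A \<delta>"
      using deflation_right_determined(1)[OF Z(1)] Z(2,3) by blast
  next
    fix Y C H assume Y: "Y \<in> Ob \<C>" and C: "C \<in> Ob \<C>"
      and H: "subgroup H (add_monoid (Hom \<C> C Y)) \<and> (\<forall>h\<in>H. \<forall>e\<in>mor C C. h \<cdot> e \<in> H)"
    have "\<exists>X\<in>Ob \<C>. \<exists>\<alpha>. deflation X Y \<alpha> \<and> right_determined C X Y \<alpha> \<and> (\<lambda>t. \<alpha> \<cdot> t) ` mor C X = H"
      using R Y C H unfolding has_right_determined_deflations_def right_deflation_classified_def by blast
    then obtain Z \<delta> where Z: "distinguished Z \<delta>" "obj Z (n + 1) = Y"
      "right_determined C (obj Z n) Y (diff Z n)" "(\<lambda>t. diff Z n \<cdot> t) ` mor C (obj Z n) = H"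
      unfolding deflation_def by blast
    then show "\<exists>A\<in>Ob \<C>. \<exists>\<delta>\<in>extn Y A. right_determined_ext C Y A \<delta> \<and>
        {h \<in> mor C Y. pullback h A \<delta> = zero_ext C A} = H"
      using deflation_right_determined[OF Z(1) C] distinguishedD(1,5)[OF Z(1)] by auto
  qed
next
  assume R: "right_classified"
  show "has_right_determined_deflations"
    unfolding has_right_determined_deflations_def right_deflation_classified_def
  proof (intro conjI ballI allI impI)
    fix Y X \<alpha> assume "deflation X Y \<alpha>"
    then obtain Z \<delta> where Z: "distinguished Z \<delta>" "obj Z n = X" "obj Z (n + 1) = Y" "diff Z n = \<alpha>"
      unfolding deflation_def by blast
    then obtain C where "C \<in> Ob \<C>" "right_determined_ext C Y (obj Z 0) \<delta>"
      using R distinguishedD(1,4,5)[OF Z(1)] unfolding right_classified_def by blast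
    then show "\<exists>C\<in>Ob \<C>. right_determined C X Y \<alpha>"
      using deflation_right_determined(1)[OF Z(1)] Z(2-4) by blast
  next
    fix Y C H assume Y: "Y \<in> Ob \<C>" and C: "C \<in> Ob \<C>"
      and H: "subgroup H (add_monoid (Hom \<C> C Y)) \<and> (\<forall>h\<in>H. \<forall>e\<in>mor C C. h \<cdot> e \<in> H)"
    have "\<exists>A\<in>Ob \<C>. \<exists>\<delta>\<in>extn Y A. right_determined_ext C Y A \<delta> \<and>
        {h \<in> mor C Y. pullback h A \<delta> = zero_ext C A} = H"
      using R Y C H unfolding right_classified_def by blast
    then obtain A \<delta> where A: "A \<in> Ob \<C>" "\<delta> \<in> extn Y A" "right_determined_ext C Y A \<delta>"
      "{h \<in> mor C Y. pullback h A \<delta> = zero_ext C A} = H" by blast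
    then obtain Z where Z: "distinguished Z \<delta>" "obj Z 0 = A" "obj Z (n + 1) = Y"
      using distinguished_exists[OF Y] by blast
    have "deflation (obj Z n) Y (diff Z n)" using Z unfolding deflation_def by blast
    then show "\<exists>X\<in>Ob \<C>. \<exists>\<alpha>. deflation X Y \<alpha> \<and> right_determined C X Y \<alpha> \<and> (\<lambda>t. \<alpha> \<cdot> t) ` mor C X = H"
      using deflation_right_determined[OF Z(1) C] Z(2,3) A(3,4) distinguishedD(3)[OF Z(1)]
      by (intro bexI[of _ "obj Z n"] exI[of _ "diff Z n"]) auto
  qed
qed

lemma left_determined_inflations_iff: "has_left_determined_inflations \<longleftrightarrow> left_classified"
proof
  assume R: "has_left_determined_inflations"
  show "left_classified"
    unfolding left_classified_def
  proof (intro conjI ballI allI impI)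
    fix X D \<delta> assume o: "X \<in> Ob \<C>" "D \<in> Ob \<C>" "\<delta> \<in> extn D X"
    then obtain Z where Z: "distinguished Z \<delta>" "obj Z 0 = X" "obj Z (n + 1) = D"
      using distinguished_exists by blast
    have "inflation X (obj Z 1) (diff Z 0)" using Z unfolding inflation_def by blast
    then obtain C where "C \<in> Ob \<C>" "left_determined C X (obj Z 1) (diff Z 0)"
      using R o(1) distinguishedD(2)[OF Z(1)]
      unfolding has_left_determined_inflations_def left_inflation_classified_def by blast
    then show "\<exists>C\<in>Ob \<C>. left_determined_ext C X D \<delta>"
      using inflation_left_determined(1)[OF Z(1)] Z(2,3) by blast
  next
    fix X C H assume X: "X \<in> Ob \<C>" and C: "C \<in> Ob \<C>"
      and H: "subgroup H (add_monoid (Hom \<C> X C)) \<and> (\<forall>h\<in>H. \<forall>e\<in>mor C C. e \<cdot> h \<in> H)"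
    have "\<exists>Y\<in>Ob \<C>. \<exists>\<alpha>. inflation X Y \<alpha> \<and> left_determined C X Y \<alpha> \<and> (\<lambda>t. t \<cdot> \<alpha>) ` mor Y C = H"
      using R X C H unfolding has_left_determined_inflations_def left_inflation_classified_def by blast
    then obtain Z \<delta> where Z: "distinguished Z \<delta>" "obj Z 0 = X"
      "left_determined C X (obj Z 1) (diff Z 0)" "(\<lambda>t. t \<cdot> diff Z 0) ` mor (obj Z 1) C = H"
      unfolding inflation_def by blast
    then show "\<exists>D\<in>Ob \<C>. \<exists>\<delta>\<in>extn D X. left_determined_ext C X D \<delta> \<and>
        {h \<in> mor X C. pushforward D h \<delta> = zero_ext D C} = H"
      using inflation_left_determined[OF Z(1) C] distinguishedD(4,5)[OF Z(1)] by auto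
  qed
next
  assume R: "left_classified"
  show "has_left_determined_inflations"
    unfolding has_left_determined_inflations_def left_inflation_classified_def
  proof (intro conjI ballI allI impI)
    fix X Y \<alpha> assume "inflation X Y \<alpha>"
    then obtain Z \<delta> where Z: "distinguished Z \<delta>" "obj Z 0 = X" "obj Z 1 = Y" "diff Z 0 = \<alpha>"
      unfolding inflation_def by blast
    then obtain C where "C \<in> Ob \<C>" "left_determined_ext C X (obj Z (n + 1)) \<delta>"
      using R distinguishedD(1,4,5)[OF Z(1)] unfolding left_classified_def by blast
    then show "\<exists>C\<in>Ob \<C>. left_determined C X Y \<alpha>"
      using inflation_left_determined(1)[OF Z(1)] Z(2-4) by blast
  next
    fix X C H assume X: "X \<in> Ob \<C>" and C: "C \<in> Ob \<C>"
      and H: "subgroup H (add_monoid (Hom \<C> X C)) \<and> (\<forall>h\<in>H. \<forall>e\<in>mor C C. e \<cdot> h \<in> H)"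
    have "\<exists>D\<in>Ob \<C>. \<exists>\<delta>\<in>extn D X. left_determined_ext C X D \<delta> \<and>
        {h \<in> mor X C. pushforward D h \<delta> = zero_ext D C} = H"
      using R X C H unfolding left_classified_def by blast
    then obtain D \<delta> where D: "D \<in> Ob \<C>" "\<delta> \<in> extn D X" "left_determined_ext C X D \<delta>"
      "{h \<in> mor X C. pushforward D h \<delta> = zero_ext D C} = H" by blast
    then obtain Z where Z: "distinguished Z \<delta>" "obj Z 0 = X" "obj Z (n + 1) = D"
      using distinguished_exists[OF _ X] by blast
    have "inflation X (obj Z 1) (diff Z 0)" using Z unfolding inflation_def by blast
    then show "\<exists>Y\<in>Ob \<C>. \<exists>\<alpha>. inflation X Y \<alpha> \<and> left_determined C X Y \<alpha> \<and> (\<lambda>t. t \<cdot> \<alpha>) ` mor Y C = H"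
      using inflation_left_determined[OF Z(1) C] Z(2,3) D(3,4) distinguishedD(2)[OF Z(1)]
      by (intro bexI[of _ "obj Z 1"] exI[of _ "diff Z 0"]) auto
  qed
qed

end

theorem theorem1p2:
  fixes k :: "'k ring"
    and J :: "('k, 'j) module"
    and n :: nat
    and \<C> :: "('o, 'm, 'k) module_cat"
    and \<E> :: "('o, 'm, 'e, 'k) module_bifunctor"
    and \<ss> :: "'o \<Rightarrow> 'o \<Rightarrow> 'e \<Rightarrow> ('o, 'm) cpx set"
  assumes "cring k" and "artinian_ring k"
    and "minimal_injective_cogenerator k J"
    and "n \<ge> 1"
    and "n_exangulated \<C> \<E> \<ss> n"
    and "k_linear k \<C> \<E>"
    and "ext_finite k \<C> \<E>"
    and "preadditive_category.krull_schmidt \<C>"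
  shows "has_serre_duality k J \<C> \<E> \<longleftrightarrow>
    exact_realization.has_right_determined_deflations \<C> \<E> \<ss> n \<and>
    exact_realization.has_left_determined_inflations \<C> \<E> \<ss> n"
proof -
  interpret n_exangulated \<C> \<E> \<ss> n by fact
  interpret artinian_duality k J by (rule artinian_duality.intro) fact+
  interpret linear_n_exangulated k J \<C> \<E> \<ss> n
    by unfold_locales (use assms krull_schmidt_decomposition in auto)
  show ?thesis
    unfolding right_determined_deflations_iff left_determined_inflations_iff
    using serre_duality_has_serre_pairs has_serre_pairs_serre_duality classified_has_serre_pairs
      serre_pairs_right_classified serre_pairs_left_classified by blast
qed

end
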